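(* Let $\Gamma$ be a finitely generated group, let $\Gamma\curvearrowright(M,d)$ be an essentially free action by isometries on a compact Riemannian manifold, let $(t_k)$ be an increasing diverging sequence in $[1,\infty)$, and let $\Lambda$ be a group generated by a finite set $S'$. (i) If $\Lambda$ acts essentially freely by isometries on a compact Riemannian manifold $N$ and the sequence $\{(M,\delta^{t_k}_\Gamma)\}_k$ is uniformly coarsely equivalent to $\{(N,\delta^{s_k}_\Lambda)\}_k$ for some increasing diverging sequence $(s_k)$ in $[1,\infty)$, then $\Lambda\times\mathbb{Z}^{\dim(N)}$ is quasi-isometric to $\Gamma\times\mathbb{Z}^{\dim(M)}$. (ii) If there exists a sequence of finite index normal subgroups $\Lambda_k\vartriangleleft\Lambda$ with $\Lambda_{k+1}<\Lambda_k$ for all $k$ and $\bigcap_{k\in\mathbb{N}}\Lambda_k=\{1\}$, such that the sequence $\{\mathrm{Cay}(\Lambda/\Lambda_k,\pi_k(S'))\}_k$ of Cayley graphs of the quotients is uniformly coarsely equivalent to $\{(M,\delta^{t_k}_\Gamma)\}_k$ (where $\pi_k\colon\Lambda\to\Lambda/\Lambda_k$ is the quotient map), then $\Lambda$ is quasi-isometric to $\Gamma\times\mathbb{Z}^{\dim(M)}$.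
   Context: Finitely generated groups are equipped with word metrics; connected graphs are viewed as metric spaces on their vertex sets with the shortest path distance. Warped cone levels: let $\Gamma$ be a group with finite symmetric generating set $S$, acting on a compact Riemannian manifold $M$ with Riemannian distance $d$. For $t\ge1$, the $t$-level of the warped cone is $(M,\delta^t_\Gamma)$, where $\delta^t_\Gamma$ is the largest metric on $M$ satisfying $\delta^t_\Gamma(x,y)\le t\,d(x,y)$ for all $x,y\in M$ and $\delta^t_\Gamma(x,s\cdot x)\le 1$ for all $x\in M$, $s\in S$. Similarly for $\Lambda\curvearrowright N$ and $\delta^s_\Lambda$. An action is essentially free if the set of points with nontrivial stabilizer has measure zero (for the Riemannian volume). Two sequences $(X_k)$, $(Y_k)$ of metric spaces are uniformly coarsely equivalent if there are increasing unbounded functions $\rho_-,\rho_+\colon[0,\infty)\to[0,\infty)$, a constant $C>0$ and maps $f_k\colon X_k\to Y_k$ such that for every $k$: $\rho_-(d(x_1,x_2))\le d(f_k(x_1),f_k(x_2))\le\rho_+(d(x_1,x_2))$ for all $x_1,x_2\in X_k$, and every point of $Y_k$ is at distance at most $C$ from $f_k(X_k)$. Two metric spaces $X,Y$ are quasi-isometric if there are constants $L\ge1$, $A\ge0$ and a map $f\colon X\to Y$ with $\frac1L d(x_1,x_2)-A\le d(f(x_1),f(x_2))\le L\,d(x_1,x_2)+A$ for all $x_1,x_2\in X$ and with every point of $Y$ at distance at most $A$ from $f(X)$. *)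

theory Defs
  imports "HOL-Analysis.Analysis" "HOL-Algebra.Group_Action" "HOL-Algebra.Product_Groups"
begin

section \<open>Smooth functions on open subsets of n-dimensional Euclidean space\<close>

text \<open>
  The dimension is a natural number \<open>n\<close> (possibly \<open>0\<close>), and the model space is the library's
  \<^const>\<open>Euclidean_space\<close> \<open>n\<close>: sequences \<open>nat \<Rightarrow> real\<close> vanishing from index \<open>n\<close> on.
\<close>

definition partial_differentiable :: "nat \<Rightarrow> ((nat \<Rightarrow> real) \<Rightarrow> real) \<Rightarrow> (nat \<Rightarrow> real) \<Rightarrow> bool" where
  "partial_differentiable i f p \<longleftrightarrow> (\<lambda>s. f (p(i := s))) field_differentiable (at (p i))"

definition partial_deriv :: "nat \<Rightarrow> ((nat \<Rightarrow> real) \<Rightarrow> real) \<Rightarrow> (nat \<Rightarrow> real) \<Rightarrow> real" where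
  "partial_deriv i f p = deriv (\<lambda>s. f (p(i := s))) (p i)"

fun Ck_on :: "nat \<Rightarrow> nat \<Rightarrow> (nat \<Rightarrow> real) set \<Rightarrow> ((nat \<Rightarrow> real) \<Rightarrow> real) \<Rightarrow> bool" where
  "Ck_on n 0 W f \<longleftrightarrow> continuous_map (subtopology (Euclidean_space n) W) euclideanreal f"
| "Ck_on n (Suc k) W f \<longleftrightarrow>
     continuous_map (subtopology (Euclidean_space n) W) euclideanreal f \<and>
     (\<forall>i<n. (\<forall>p\<in>W. partial_differentiable i f p) \<and> Ck_on n k W (partial_deriv i f))"

definition smooth_on :: "nat \<Rightarrow> (nat \<Rightarrow> real) set \<Rightarrow> ((nat \<Rightarrow> real) \<Rightarrow> real) \<Rightarrow> bool" where
  "smooth_on n W f \<longleftrightarrow> (\<forall>k. Ck_on n k W f)"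

text \<open>
  Lebesgue measure on \<^const>\<open>Euclidean_space\<close> \<open>n\<close>: the \<open>n\<close>-fold product of \<^const>\<open>lborel\<close>,
  whose points are undefined from index \<open>n\<close> on, transported by filling up with zeros. For
  \<open>n = 0\<close> it is the unit mass at the origin.
\<close>

definition Euclidean_lebesgue :: "nat \<Rightarrow> (nat \<Rightarrow> real) measure" where
  "Euclidean_lebesgue n =
     distr (PiM {..<n} (\<lambda>_. lborel)) borel (\<lambda>q i. if i < n then q i else 0)"

definition nat_det :: "nat \<Rightarrow> (nat \<Rightarrow> nat \<Rightarrow> real) \<Rightarrow> real" where
  "nat_det n a = (\<Sum>\<sigma> | \<sigma> permutes {..<n}. of_int (sign \<sigma>) * (\<Prod>i<n. a i (\<sigma> i)))"


section \<open>Riemannian manifolds\<close>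

text \<open>
  A chart \<open>(U, \<phi>)\<close> consists of its domain and its coordinate map. The metric tensor is given by its
  coefficients: \<open>rm_metric M (U, \<phi>) x i j\<close> is \<open>g(\<partial>\<^sub>i, \<partial>\<^sub>j)\<close> at the point \<open>x \<in> U\<close>, where
  \<open>\<partial>\<^sub>i\<close> are the coordinate vector fields of the chart.
\<close>

type_synonym 'a chart = "'a set \<times> ('a \<Rightarrow> nat \<Rightarrow> real)"

record 'a riem_mfd =
  rm_top :: "'a topology"
  rm_dim :: nat
  rm_atlas :: "'a chart set"
  rm_metric :: "'a chart \<Rightarrow> 'a \<Rightarrow> nat \<Rightarrow> nat \<Rightarrow> real"

abbreviation rm_points :: "'a riem_mfd \<Rightarrow> 'a set" where
  "rm_points M \<equiv> topspace (rm_top M)"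

definition chart_in :: "'a topology \<Rightarrow> nat \<Rightarrow> 'a chart \<Rightarrow> bool" where
  "chart_in X n = (\<lambda>(U, \<phi>).
     openin X U \<and> openin (Euclidean_space n) (\<phi> ` U) \<and>
     homeomorphic_map (subtopology X U) (subtopology (Euclidean_space n) (\<phi> ` U)) \<phi>)"

definition transition :: "'a chart \<Rightarrow> 'a chart \<Rightarrow> nat \<Rightarrow> (nat \<Rightarrow> real) \<Rightarrow> real" where
  "transition = (\<lambda>(U, \<phi>) (V, \<psi>) k p. \<psi> (inv_into U \<phi> p) k)"

definition smooth_manifold :: "'a riem_mfd \<Rightarrow> bool" where
  "smooth_manifold M \<longleftrightarrow>
     rm_points M \<noteq> {} \<and> Hausdorff_space (rm_top M) \<and> second_countable (rm_top M) \<and>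
     (\<forall>c\<in>rm_atlas M. chart_in (rm_top M) (rm_dim M) c) \<and>
     (\<Union>(U, \<phi>)\<in>rm_atlas M. U) = rm_points M \<and>
     (\<forall>(U, \<phi>)\<in>rm_atlas M. \<forall>(V, \<psi>)\<in>rm_atlas M. \<forall>k<rm_dim M.
        smooth_on (rm_dim M) (\<phi> ` (U \<inter> V)) (transition (U, \<phi>) (V, \<psi>) k))"

definition riemannian_metric :: "'a riem_mfd \<Rightarrow> bool" where
  "riemannian_metric M \<longleftrightarrow>
     (let n = rm_dim M; g = rm_metric M in
     (\<forall>(U, \<phi>)\<in>rm_atlas M.
        (\<forall>i<n. \<forall>j<n. smooth_on n (\<phi> ` U) (\<lambda>p. g (U, \<phi>) (inv_into U \<phi> p) i j)) \<and>
        (\<forall>x\<in>U. (\<forall>i<n. \<forall>j<n. g (U, \<phi>) x i j = g (U, \<phi>) x j i) \<and>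
           (\<forall>v::nat \<Rightarrow> real. (\<exists>i<n. v i \<noteq> 0) \<longrightarrow>
              0 < (\<Sum>i<n. \<Sum>j<n. g (U, \<phi>) x i j * v i * v j)))) \<and>
     (\<forall>(U, \<phi>)\<in>rm_atlas M. \<forall>(V, \<psi>)\<in>rm_atlas M. \<forall>x\<in>U \<inter> V. \<forall>i<n. \<forall>j<n.
        g (U, \<phi>) x i j =
          (\<Sum>k<n. \<Sum>l<n. g (V, \<psi>) x k l *
             partial_deriv i (transition (U, \<phi>) (V, \<psi>) k) (\<phi> x) *
             partial_deriv j (transition (U, \<phi>) (V, \<psi>) l) (\<phi> x))))"

definition compact_riemannian_manifold :: "'a riem_mfd \<Rightarrow> bool" where
  "compact_riemannian_manifold M \<longleftrightarrow>
     smooth_manifold M \<and> riemannian_metric M \<and> compact_space (rm_top M)"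


subsection \<open>Riemannian distance\<close>

text \<open>
  Piecewise \<open>C\<^sup>1\<close> is meant as in the library's \<^const>\<open>piecewise_C1_differentiable_on\<close>: continuous,
  and \<open>C\<^sup>1\<close> off a finite set. The derivative may blow up at the exceptional points, but then the length
  below is still the length of the curve (possibly infinite), so the infimum is not affected.
\<close>

definition piecewise_C1_curve :: "'a riem_mfd \<Rightarrow> (real \<Rightarrow> 'a) \<Rightarrow> bool" where
  "piecewise_C1_curve M \<gamma> \<longleftrightarrow>
     pathin (rm_top M) \<gamma> \<and>
     (\<exists>F. finite F \<and> (\<forall>(U, \<phi>)\<in>rm_atlas M. \<forall>i<rm_dim M.
        (\<lambda>r. \<phi> (\<gamma> r) i) C1_differentiable_on {s \<in> {0..1} - F. \<gamma> s \<in> U}))"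

text \<open>The speed does not depend on the chart chosen around \<open>\<gamma> s\<close>.\<close>

definition speed :: "'a riem_mfd \<Rightarrow> (real \<Rightarrow> 'a) \<Rightarrow> real \<Rightarrow> real" where
  "speed M \<gamma> s =
     (let c = (SOME c. c \<in> rm_atlas M \<and> \<gamma> s \<in> fst c);
          v = (\<lambda>i. vector_derivative (\<lambda>r. snd c (\<gamma> r) i) (at s))
      in sqrt (\<Sum>i<rm_dim M. \<Sum>j<rm_dim M. rm_metric M c (\<gamma> s) i j * v i * v j))"

definition curve_length :: "'a riem_mfd \<Rightarrow> (real \<Rightarrow> 'a) \<Rightarrow> ennreal" where
  "curve_length M \<gamma> = (\<integral>\<^sup>+ s\<in>{0..1}. ennreal (speed M \<gamma> s) \<partial>lborel)"

text \<open>Points in different components are at distance \<open>\<infinity>\<close>.\<close>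

definition riemannian_dist :: "'a riem_mfd \<Rightarrow> 'a \<Rightarrow> 'a \<Rightarrow> ennreal" where
  "riemannian_dist M x y =
     (INF \<gamma>\<in>{\<gamma>. piecewise_C1_curve M \<gamma> \<and> \<gamma> 0 = x \<and> \<gamma> 1 = y}. curve_length M \<gamma>)"


subsection \<open>Riemannian volume\<close>

text \<open>
  The Riemannian volume is the unique Borel measure given in every chart by the density
  \<open>sqrt (det g\<^sub>i\<^sub>j)\<close> with respect to Lebesgue measure.
\<close>

definition riemannian_volume :: "'a riem_mfd \<Rightarrow> 'a measure \<Rightarrow> bool" where
  "riemannian_volume M \<mu> \<longleftrightarrow>
     space \<mu> = rm_points M \<and> sets \<mu> = sigma_sets (rm_points M) {U. openin (rm_top M) U} \<and>
     (\<forall>(U, \<phi>)\<in>rm_atlas M. \<forall>B\<in>sets \<mu>. B \<subseteq> U \<longrightarrow>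
        emeasure \<mu> B =
          (\<integral>\<^sup>+ p\<in>\<phi> ` B.
             ennreal (sqrt (nat_det (rm_dim M) (rm_metric M (U, \<phi>) (inv_into U \<phi> p))))
           \<partial>Euclidean_lebesgue (rm_dim M)))"


section \<open>Group actions and warped cones\<close>

definition isometric_action ::
    "('g, 'c) monoid_scheme \<Rightarrow> ('g \<Rightarrow> 'a \<Rightarrow> 'a) \<Rightarrow> 'a riem_mfd \<Rightarrow> bool" where
  "isometric_action G \<alpha> M \<longleftrightarrow>
     group_action G (rm_points M) \<alpha> \<and>
     (\<forall>g\<in>carrier G. \<forall>x\<in>rm_points M. \<forall>y\<in>rm_points M.
        riemannian_dist M (\<alpha> g x) (\<alpha> g y) = riemannian_dist M x y)"

text \<open>
  The volume is determined uniquely, so the quantifier over \<open>\<mu>\<close> only names it.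
\<close>

definition essentially_free ::
    "('g, 'c) monoid_scheme \<Rightarrow> ('g \<Rightarrow> 'a \<Rightarrow> 'a) \<Rightarrow> 'a riem_mfd \<Rightarrow> bool" where
  "essentially_free G \<alpha> M \<longleftrightarrow>
     (\<exists>\<mu>. riemannian_volume M \<mu> \<and>
        (\<exists>Z\<in>null_sets \<mu>. {x \<in> rm_points M. stabilizer G \<alpha> x \<noteq> {\<one>\<^bsub>G\<^esub>}} \<subseteq> Z))"

definition finite_generating_set :: "('g, 'c) monoid_scheme \<Rightarrow> 'g set \<Rightarrow> bool" where
  "finite_generating_set G S \<longleftrightarrow> finite S \<and> S \<subseteq> carrier G \<and> generate G S = carrier G"

definition symmetric_set :: "('g, 'c) monoid_scheme \<Rightarrow> 'g set \<Rightarrow> bool" where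
  "symmetric_set G S \<longleftrightarrow> (\<forall>s\<in>S. inv\<^bsub>G\<^esub> s \<in> S)"

text \<open>
  Word metrics, Cayley graphs and warped level metrics are the same for a generating set and for its
  symmetrization.
\<close>

definition symmetrization :: "('g, 'c) monoid_scheme \<Rightarrow> 'g set \<Rightarrow> 'g set" where
  "symmetrization G S = S \<union> m_inv G ` S"

definition warped_admissible ::
    "'g set \<Rightarrow> ('g \<Rightarrow> 'a \<Rightarrow> 'a) \<Rightarrow> 'a riem_mfd \<Rightarrow> real \<Rightarrow> ('a \<Rightarrow> 'a \<Rightarrow> real) \<Rightarrow> bool" where
  "warped_admissible S \<alpha> M t \<delta> \<longleftrightarrow>
     Metric_space (rm_points M) \<delta> \<and>
     (\<forall>x\<in>rm_points M. \<forall>y\<in>rm_points M. ennreal (\<delta> x y) \<le> ennreal t * riemannian_dist M x y) \<and>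
     (\<forall>x\<in>rm_points M. \<forall>s\<in>S. \<delta> x (\<alpha> s x) \<le> 1)"

text \<open>\<open>\<delta>\<close> is the largest admissible metric; on the points of \<open>M\<close> it is unique.\<close>

definition warped_level_metric ::
    "'g set \<Rightarrow> ('g \<Rightarrow> 'a \<Rightarrow> 'a) \<Rightarrow> 'a riem_mfd \<Rightarrow> real \<Rightarrow> ('a \<Rightarrow> 'a \<Rightarrow> real) \<Rightarrow> bool" where
  "warped_level_metric S \<alpha> M t \<delta> \<longleftrightarrow>
     warped_admissible S \<alpha> M t \<delta> \<and>
     (\<forall>\<delta>'. warped_admissible S \<alpha> M t \<delta>' \<longrightarrow>
        (\<forall>x\<in>rm_points M. \<forall>y\<in>rm_points M. \<delta>' x y \<le> \<delta> x y))"


section \<open>Coarse geometry\<close>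

definition control_function :: "(real \<Rightarrow> real) \<Rightarrow> bool" where
  "control_function \<rho> \<longleftrightarrow>
     (\<forall>r\<ge>0. 0 \<le> \<rho> r) \<and> mono_on {0..} \<rho> \<and> \<not> bdd_above (\<rho> ` {0..})"

definition uniformly_coarsely_equivalent ::
    "(nat \<Rightarrow> 'a set) \<Rightarrow> (nat \<Rightarrow> 'a \<Rightarrow> 'a \<Rightarrow> real) \<Rightarrow>
     (nat \<Rightarrow> 'b set) \<Rightarrow> (nat \<Rightarrow> 'b \<Rightarrow> 'b \<Rightarrow> real) \<Rightarrow> bool" where
  "uniformly_coarsely_equivalent X dX Y dY \<longleftrightarrow>
     (\<exists>\<rho>l \<rho>u C f. control_function \<rho>l \<and> control_function \<rho>u \<and> C > 0 \<and>
        (\<forall>k. f k \<in> X k \<rightarrow> Y k \<and>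
           (\<forall>x\<in>X k. \<forall>x'\<in>X k.
              \<rho>l (dX k x x') \<le> dY k (f k x) (f k x') \<and>
              dY k (f k x) (f k x') \<le> \<rho>u (dX k x x')) \<and>
           (\<forall>y\<in>Y k. \<exists>x\<in>X k. dY k y (f k x) \<le> C)))"

definition quasi_isometric ::
    "'a set \<Rightarrow> ('a \<Rightarrow> 'a \<Rightarrow> real) \<Rightarrow> 'b set \<Rightarrow> ('b \<Rightarrow> 'b \<Rightarrow> real) \<Rightarrow> bool" where
  "quasi_isometric X dX Y dY \<longleftrightarrow>
     (\<exists>L A f. L \<ge> 1 \<and> A \<ge> 0 \<and> f \<in> X \<rightarrow> Y \<and>
        (\<forall>x\<in>X. \<forall>x'\<in>X.
           1 / L * dX x x' - A \<le> dY (f x) (f x') \<and> dY (f x) (f x') \<le> L * dX x x' + A) \<and>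
        (\<forall>y\<in>Y. \<exists>x\<in>X. dY y (f x) \<le> A))"

definition word_length :: "('g, 'c) monoid_scheme \<Rightarrow> 'g set \<Rightarrow> 'g \<Rightarrow> nat" where
  "word_length G S g =
     (LEAST n. \<exists>w. length w = n \<and> set w \<subseteq> symmetrization G S \<and>
        foldr (\<lambda>a b. a \<otimes>\<^bsub>G\<^esub> b) w \<one>\<^bsub>G\<^esub> = g)"

definition word_metric :: "('g, 'c) monoid_scheme \<Rightarrow> 'g set \<Rightarrow> 'g \<Rightarrow> 'g \<Rightarrow> real" where
  "word_metric G S g h = real (word_length G S (inv\<^bsub>G\<^esub> g \<otimes>\<^bsub>G\<^esub> h))"

text \<open>
  Quasi-isometry of finitely generated groups: the word metrics depend on the generating sets only
  up to quasi-isometry, so all of them are required to be quasi-isometric.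
\<close>

definition quasi_isometric_groups ::
    "('g, 'c) monoid_scheme \<Rightarrow> ('h, 'd) monoid_scheme \<Rightarrow> bool" where
  "quasi_isometric_groups G H \<longleftrightarrow>
     (\<exists>S. finite_generating_set G S) \<and> (\<exists>T. finite_generating_set H T) \<and>
     (\<forall>S T. finite_generating_set G S \<longrightarrow> finite_generating_set H T \<longrightarrow>
        quasi_isometric (carrier G) (word_metric G S) (carrier H) (word_metric H T))"

definition Zn :: "nat \<Rightarrow> (nat \<Rightarrow> int) monoid" where
  "Zn n = product_group {..<n} (\<lambda>_. integer_group)"

text \<open>Edges of the (undirected) Cayley graph, whose vertex set is \<open>carrier G\<close>.\<close>

definition cayley_edges :: "('g, 'c) monoid_scheme \<Rightarrow> 'g set \<Rightarrow> ('g \<times> 'g) set" where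
  "cayley_edges G S =
     {(x, y). x \<in> carrier G \<and> y \<in> carrier G \<and> (\<exists>s\<in>S. y = x \<otimes>\<^bsub>G\<^esub> s \<or> x = y \<otimes>\<^bsub>G\<^esub> s)}"

definition graph_dist :: "('v \<times> 'v) set \<Rightarrow> 'v \<Rightarrow> 'v \<Rightarrow> real" where
  "graph_dist E x y = real (LEAST n. (x, y) \<in> E ^^ n)"

end

(*
At a point x with trivial stabilizer, rescaling by t makes a ball of fixed radius in the t-level of the
warped cone look like a ball in the product of the group with Z^n: every point of the ball is g y for a
short word g and a point y of a chart ball around x, and the metric is, up to constants, the word length
plus the rescaled coordinate distance as long as t d(g x, x) is large for all short g other than 1. The
finite quotients of a residually finite group look like the group itself around every point.

A uniform coarse equivalence between the levels therefore restricts to coarse equivalences between larger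
and larger balls of the two model groups, provided that a good point is mapped to a good point. Since the
balls are finite, a subsequence converges pointwise to a coarse equivalence of the model groups, and
coarse equivalences between word metrics are quasi-isometries.

Against quotient groups the good point in M can be prescribed, because Cayley graphs are homogeneous. For
two warped cones a good point is found by counting cells of side 1/t: there are about t^n of them, while
for every eps > 0 the bad points meet at most eps t^n cells eventually, because they shrink to a null set.
*)

theory Submission
  imports Defs "HOL-Library.Diagonal_Subsequence" "Jordan_Normal_Form.Determinant"
begin

section \<open>Word metrics\<close>

text \<open>Everything hinges on uniformity: the constant of a local model may depend on the charts
  and on the generating sets, but not on the radius, the level or the centre, whereas the threshold
  that makes a point good may depend on the radius. Only then do the maps between balls have control
  functions that survive the limit. Coarse surjectivity needs a further uniform bound, on how far
  away a preimage may lie; otherwise preimages could escape to infinity. A coarse equivalence says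
  nothing about volume, and neither the two dimensions nor the two level sequences are related in
  advance. Hence the image of a good point can be bad, and cells have to be counted in both
  directions in order to compare \<open>t k ^ n\<close> with \<open>s k ^ n'\<close>. Riemannian
  geometry enters only through finitely many bi-Lipschitz charts. Straight segments give the upper
  bound. A lower bound has to cope with curves that leave the chart, so it comes from test functions
  that vanish outside it.\<close>

lemma symmetrization_inv:
  assumes "group G" "S \<subseteq> carrier G" "s \<in> symmetrization G S"
  shows "inv\<^bsub>G\<^esub> s \<in> symmetrization G S"
  using assms by (auto simp: symmetrization_def subset_iff group.inv_inv)

lemma symmetrization_carrier:
  assumes "group G" "S \<subseteq> carrier G"
  shows "symmetrization G S \<subseteq> carrier G"
  using assms by (auto simp: symmetrization_def intro: group.inv_closed)

abbreviation word_prod :: "('g, 'c) monoid_scheme \<Rightarrow> 'g list \<Rightarrow> 'g" where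
  "word_prod G w \<equiv> foldr (\<lambda>a b. a \<otimes>\<^bsub>G\<^esub> b) w \<one>\<^bsub>G\<^esub>"

lemma word_prod_closed:
  assumes "group G" "set w \<subseteq> carrier G"
  shows "word_prod G w \<in> carrier G"
proof -
  interpret group G by fact
  show ?thesis using assms(2) by (induction w) auto
qed

lemma word_prod_append:
  assumes "group G" "set w \<subseteq> carrier G" "set v \<subseteq> carrier G"
  shows "word_prod G (w @ v) = word_prod G w \<otimes>\<^bsub>G\<^esub> word_prod G v"
proof -
  interpret group G by fact
  show ?thesis using assms(2)
  proof (induction w)
    case Nil then show ?case using word_prod_closed[OF assms(1,3)] by simp
  next
    case (Cons a w)
    then show ?case using word_prod_closed[OF assms(1,3)] word_prod_closed[OF assms(1), of w]
      by (simp add: m_assoc)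
  qed
qed

lemma word_prod_inv:
  assumes "group G" "set w \<subseteq> carrier G"
  shows "word_prod G (map (m_inv G) (rev w)) = inv\<^bsub>G\<^esub> (word_prod G w)"
proof -
  interpret group G by fact
  show ?thesis using assms(2)
  proof (induction w)
    case (Cons a w)
    then have "word_prod G (map (m_inv G) (rev w) @ [inv\<^bsub>G\<^esub> a])
       = word_prod G (map (m_inv G) (rev w)) \<otimes>\<^bsub>G\<^esub> word_prod G [inv\<^bsub>G\<^esub> a]"
      by (intro word_prod_append[OF assms(1)]) auto
    with Cons show ?case using word_prod_closed[OF assms(1), of w] by (simp add: inv_mult_group)
  qed auto
qed

lemma generate_word:
  assumes "group G" "S \<subseteq> carrier G" "g \<in> generate G S"
  shows "\<exists>w. set w \<subseteq> symmetrization G S \<and> word_prod G w = g"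
  using assms(3)
proof (induction rule: generate.induct)
  case one then show ?case by (intro exI[of _ "[]"]) auto
next
  case (incl h)
  then show ?case using assms(1,2) monoid.r_one[OF group.is_monoid[OF assms(1)]]
    by (intro exI[of _ "[h]"]) (auto simp: symmetrization_def)
next
  case (inv h)
  then show ?case using assms(1,2) monoid.r_one[OF group.is_monoid[OF assms(1)]] group.inv_closed[OF assms(1)]
    by (intro exI[of _ "[inv\<^bsub>G\<^esub> h]"]) (auto simp: symmetrization_def)
next
  case (eng h1 h2)
  then obtain w v where "set w \<subseteq> symmetrization G S" "word_prod G w = h1"
    "set v \<subseteq> symmetrization G S" "word_prod G v = h2" by blast
  then show ?case using symmetrization_carrier[OF assms(1,2)]
    by (intro exI[of _ "w @ v"], subst word_prod_append[OF assms(1)]) auto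
qed

locale fg_group = group G for G (structure) +
  fixes S
  assumes fgs: "finite_generating_set G S"
begin

abbreviation wl :: "'a \<Rightarrow> nat" where "wl \<equiv> word_length G S"
abbreviation wd :: "'a \<Rightarrow> 'a \<Rightarrow> real" where "wd \<equiv> word_metric G S"

lemma S_carrier: "S \<subseteq> carrier G"
  using fgs by (simp add: finite_generating_set_def)

lemma sym_carrier: "symmetrization G S \<subseteq> carrier G"
  using symmetrization_carrier[OF is_group S_carrier] .

lemma finite_sym: "finite (symmetrization G S)"
  using fgs by (simp add: finite_generating_set_def symmetrization_def)

lemma wl_word:
  assumes "g \<in> carrier G"
  obtains w where "length w = wl g" "set w \<subseteq> symmetrization G S" "word_prod G w = g"
proof -
  have "\<exists>w. set w \<subseteq> symmetrization G S \<and> word_prod G w = g"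
    using generate_word[OF is_group S_carrier] assms fgs by (auto simp: finite_generating_set_def)
  then have "\<exists>n w. length w = n \<and> set w \<subseteq> symmetrization G S \<and> word_prod G w = g" by blast
  from LeastI_ex[OF this] show ?thesis using that unfolding word_length_def by blast
qed

lemma wl_le: "set w \<subseteq> symmetrization G S \<Longrightarrow> wl (word_prod G w) \<le> length w"
  unfolding word_length_def by (rule Least_le) blast

lemma wl_one [simp]: "wl \<one> = 0"
  using wl_le[of "[]"] by simp

lemma wl_eq_0: "g \<in> carrier G \<Longrightarrow> wl g = 0 \<longleftrightarrow> g = \<one>"
  by (metis foldr_Nil id_apply length_0_conv wl_one wl_word)

lemma wl_mult: "g \<in> carrier G \<Longrightarrow> h \<in> carrier G \<Longrightarrow> wl (g \<otimes> h) \<le> wl g + wl h"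
proof -
  assume "g \<in> carrier G" "h \<in> carrier G"
  then obtain w v where *: "length w = wl g" "set w \<subseteq> symmetrization G S" "word_prod G w = g"
    "length v = wl h" "set v \<subseteq> symmetrization G S" "word_prod G v = h"
    using wl_word by metis
  then have "word_prod G (w @ v) = g \<otimes> h"
    using word_prod_append[OF is_group, of w v] sym_carrier by auto
  then show ?thesis using wl_le[of "w @ v"] * by simp
qed

lemma wl_inv_le: "g \<in> carrier G \<Longrightarrow> wl (inv g) \<le> wl g"
proof -
  assume g: "g \<in> carrier G"
  obtain w where w: "length w = wl g" "set w \<subseteq> symmetrization G S" "word_prod G w = g"
    by (rule wl_word[OF g])
  have "set (map (m_inv G) (rev w)) \<subseteq> symmetrization G S"
    using w(2) symmetrization_inv[OF is_group S_carrier] by auto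
  from wl_le[OF this] show ?thesis
    using w word_prod_inv[OF is_group, of w] sym_carrier by auto
qed

lemma wl_inv [simp]: "g \<in> carrier G \<Longrightarrow> wl (inv g) = wl g"
  by (metis antisym inv_closed inv_inv wl_inv_le)

lemma wl_gen: "s \<in> symmetrization G S \<Longrightarrow> wl s \<le> 1"
  using wl_le[of "[s]"] sym_carrier by auto

lemma finite_wl_ball: "finite {g \<in> carrier G. wl g \<le> n}"
proof (rule finite_subset)
  show "{g \<in> carrier G. wl g \<le> n} \<subseteq> word_prod G ` {w. set w \<subseteq> symmetrization G S \<and> length w \<le> n}"
    by clarsimp (metis (mono_tags, lifting) wl_word imageI mem_Collect_eq)
qed (intro finite_imageI finite_lists_length_le finite_sym)

text \<open>The bound propagates by subadditivity along a shortest word; applied to the length for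
  another generating set, it compares the two.\<close>

lemma wl_bound:
  assumes "l \<one> \<le> (0::real)" "\<And>g h. g \<in> carrier G \<Longrightarrow> h \<in> carrier G \<Longrightarrow> l (g \<otimes> h) \<le> l g + l h"
    "\<And>s. s \<in> symmetrization G S \<Longrightarrow> l s \<le> C" "g \<in> carrier G"
  shows "l g \<le> C * wl g"
proof -
  have *: "l (word_prod G w) \<le> C * length w" if "set w \<subseteq> symmetrization G S" for w
    using that
  proof (induction w)
    case (Cons a w)
    have "l (a \<otimes> word_prod G w) \<le> l a + l (word_prod G w)"
      using Cons sym_carrier by (intro assms(2) word_prod_closed[OF is_group]) auto
    also have "\<dots> \<le> C + C * length w" using Cons assms(3) by (intro add_mono) auto
    finally show ?case by (simp add: algebra_simps)
  qed (use assms in simp)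
  obtain w where "length w = wl g" "set w \<subseteq> symmetrization G S" "word_prod G w = g"
    by (rule wl_word[OF assms(4)])
  then show ?thesis using *[of w] by simp
qed

lemma wd_nonneg [simp]: "wd g h \<ge> 0" by (simp add: word_metric_def)
lemma wd_same [simp]: "g \<in> carrier G \<Longrightarrow> wd g g = 0" by (simp add: word_metric_def)

lemma wd_commute: "g \<in> carrier G \<Longrightarrow> h \<in> carrier G \<Longrightarrow> wd g h = wd h g"
  unfolding word_metric_def
  by (metis inv_closed inv_inv inv_mult_group m_closed wl_inv)

lemma wd_triangle:
  assumes "g \<in> carrier G" "h \<in> carrier G" "k \<in> carrier G"
  shows "wd g k \<le> wd g h + wd h k"
proof -
  have "inv g \<otimes> k = (inv g \<otimes> h) \<otimes> (inv h \<otimes> k)"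
    using assms by (metis inv_closed l_inv m_assoc m_closed r_inv r_one)
  then show ?thesis
    using wl_mult[of "inv g \<otimes> h" "inv h \<otimes> k"] assms by (simp add: word_metric_def flip: of_nat_add)
qed

lemma wd_one: "g \<in> carrier G \<Longrightarrow> wd \<one> g = wl g"
  by (simp add: word_metric_def)

lemma finite_wd_ball: "finite {h \<in> carrier G. wd \<one> h \<le> r}"
  by (rule finite_subset[OF _ finite_wl_ball[of "nat \<lfloor>r\<rfloor>"]]) (auto simp: wd_one le_nat_floor)

text \<open>A bound on steps of length 1 adds up along a word. This is where an arbitrary control
  function becomes a linear one. The target is kept general so that the lemma serves for a map and
  for its coarse inverse.\<close>

lemma wd_lipschitz:
  assumes tri: "\<And>x y z. x \<in> Y \<Longrightarrow> y \<in> Y \<Longrightarrow> z \<in> Y \<Longrightarrow> d x z \<le> d x y + (d y z :: real)"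
    and same: "\<And>x. x \<in> Y \<Longrightarrow> d x x \<le> 0"
    and f: "f \<in> carrier G \<rightarrow> Y"
    and step: "\<And>x y. x \<in> carrier G \<Longrightarrow> y \<in> carrier G \<Longrightarrow> wd x y \<le> 1 \<Longrightarrow> d (f x) (f y) \<le> B"
    and x: "x \<in> carrier G" and y: "y \<in> carrier G"
  shows "d (f x) (f y) \<le> B * wd x y"
proof -
  have *: "d (f x) (f (x \<otimes> word_prod G w)) \<le> B * length w"
    if "set w \<subseteq> symmetrization G S" "x \<in> carrier G" for w x
    using that
  proof (induction w arbitrary: x)
    case Nil then show ?case using f same by auto
  next
    case (Cons a w)
    have a: "a \<in> carrier G" "set w \<subseteq> carrier G" "word_prod G w \<in> carrier G"
      using Cons sym_carrier by (auto intro!: word_prod_closed[OF is_group])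
    have "wd x (x \<otimes> a) \<le> 1" using Cons a wl_gen by (simp add: word_metric_def flip: m_assoc)
    then have "d (f x) (f (x \<otimes> a)) \<le> B" using step Cons a by simp
    moreover have "d (f (x \<otimes> a)) (f ((x \<otimes> a) \<otimes> word_prod G w)) \<le> B * length w"
      using Cons a by simp
    moreover have "d (f x) (f (x \<otimes> (a \<otimes> word_prod G w))) \<le>
        d (f x) (f (x \<otimes> a)) + d (f (x \<otimes> a)) (f (x \<otimes> (a \<otimes> word_prod G w)))"
      using f a Cons(3) by (intro tri) auto
    ultimately show ?case using a Cons(3) by (simp add: m_assoc algebra_simps)
  qed
  obtain w where "length w = wl (inv x \<otimes> y)" "set w \<subseteq> symmetrization G S" "word_prod G w = inv x \<otimes> y"
    using wl_word[of "inv x \<otimes> y"] x y by blast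
  then show ?thesis using *[of w x] x y by (simp add: word_metric_def flip: m_assoc)
qed

end

text \<open>A map \<open>g\<close> choosing approximate preimages is a coarse inverse. Both
  \<open>f\<close> and \<open>g\<close> are controlled on steps of length 1, hence Lipschitz, and
  the lower bound for each of them is the Lipschitz bound for the other. Both directions are stated
  because \<open>quasi_isometric\<close> is not symmetric by definition.\<close>

lemma coarse_imp_quasi_isometric:
  assumes "fg_group G S" "fg_group H T"
    and f: "f \<in> carrier G \<rightarrow> carrier H"
    and up: "\<And>x y r. x \<in> carrier G \<Longrightarrow> y \<in> carrier G \<Longrightarrow> word_metric G S x y \<le> r \<Longrightarrow>
        word_metric H T (f x) (f y) \<le> \<sigma> r"
    and lo: "\<And>x y r. x \<in> carrier G \<Longrightarrow> y \<in> carrier G \<Longrightarrow> word_metric H T (f x) (f y) \<le> r \<Longrightarrow>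
        word_metric G S x y \<le> \<tau> r"
    and onto: "\<And>y. y \<in> carrier H \<Longrightarrow> \<exists>x\<in>carrier G. word_metric H T y (f x) \<le> A"
  shows "quasi_isometric (carrier G) (word_metric G S) (carrier H) (word_metric H T)"
    and "quasi_isometric (carrier H) (word_metric H T) (carrier G) (word_metric G S)"
proof -
  interpret G: fg_group G S by fact
  interpret H: fg_group H T by fact
  obtain g where g: "\<And>y. y \<in> carrier H \<Longrightarrow> g y \<in> carrier G \<and> H.wd y (f (g y)) \<le> A"
    using onto by metis
  have fc: "f x \<in> carrier H" if "x \<in> carrier G" for x using f that by auto
  have A0: "0 \<le> A" using g[OF H.one_closed] H.wd_nonneg[of "\<one>\<^bsub>H\<^esub>" "f (g \<one>\<^bsub>H\<^esub>)"] by linarith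
  define B where "B = max 1 (\<sigma> 1)"
  \<comment> \<open>If \<open>x\<close> and \<open>y\<close> are at distance at most 1, then
    \<open>f (g x)\<close> and \<open>f (g y)\<close> are at distance at most
    \<open>2 * A + 1\<close>, which explains the first \<open>\<tau>\<close>; the second bounds the
    displacement of \<open>g \<circ> f\<close>.\<close>
  define D where "D = max 1 (max (\<tau> (2 * A + 1)) (\<tau> A))"
  have fB: "H.wd (f x) (f y) \<le> B * G.wd x y" if "x \<in> carrier G" "y \<in> carrier G" for x y
    using G.wd_lipschitz[of "carrier H" H.wd f B x y] H.wd_triangle f that up[of _ _ 1] B_def
    by (metis H.wd_same max.coboundedI2 order.refl)
  have gD: "G.wd (g x) (g y) \<le> D * H.wd x y" if "x \<in> carrier H" "y \<in> carrier H" for x y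
  proof (rule H.wd_lipschitz[of "carrier G" G.wd g D x y, OF _ _ _ _ that])
    fix x y assume xy: "x \<in> carrier H" "y \<in> carrier H" "H.wd x y \<le> 1"
    note 1 = g[OF xy(1)] and 2 = g[OF xy(2)]
    have "H.wd (f (g x)) (f (g y)) \<le> H.wd (f (g x)) x + H.wd x (f (g y))"
      using 1 2 fc xy by (intro H.wd_triangle) auto
    also have "\<dots> \<le> H.wd (f (g x)) x + (H.wd x y + H.wd y (f (g y)))"
      using 1 2 fc xy by (intro add_left_mono H.wd_triangle) auto
    also have "\<dots> \<le> 2 * A + 1" using 1 2 xy fc H.wd_commute[of x "f (g x)"] by auto
    finally show "G.wd (g x) (g y) \<le> D" using lo[of "g x" "g y"] 1 2 unfolding D_def by fastforce
  qed (use g G.wd_triangle in auto)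
  have gf: "G.wd x (g (f x)) \<le> D" if "x \<in> carrier G" for x
    using lo[of x "g (f x)" A] g[OF fc[OF that]] that unfolding D_def by auto
  define K where "K = B * D"
  have BD: "B \<ge> 1" "D \<ge> 1" by (auto simp: B_def D_def)
  have K: "K \<ge> B" "K \<ge> D" "K \<ge> 1" 
    using BD mult_right_mono[of 1 B D] mult_left_mono[of 1 D B] unfolding K_def by linarith+
  have Glo: "G.wd x y \<le> 2 * D + D * H.wd (f x) (f y)" if "x \<in> carrier G" "y \<in> carrier G" for x y
  proof -
    have "G.wd x y \<le> G.wd x (g (f x)) + G.wd (g (f x)) y"
      using that g fc by (intro G.wd_triangle) auto
    also have "\<dots> \<le> G.wd x (g (f x)) + (G.wd (g (f x)) (g (f y)) + G.wd (g (f y)) y)"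
      using that g fc by (intro add_left_mono G.wd_triangle) auto
    finally show ?thesis using gf[OF that(1)] gf[OF that(2)] gD[OF fc fc, OF that]
        G.wd_commute[of y "g (f y)"] g fc that by fastforce
  qed
  have Hlo: "H.wd x y \<le> 2 * A + B * G.wd (g x) (g y)" if "x \<in> carrier H" "y \<in> carrier H" for x y
  proof -
    note 1 = g[OF that(1)] and 2 = g[OF that(2)]
    have "H.wd x y \<le> H.wd x (f (g x)) + H.wd (f (g x)) y"
      using that 1 2 fc by (intro H.wd_triangle) auto
    also have "\<dots> \<le> H.wd x (f (g x)) + (H.wd (f (g x)) (f (g y)) + H.wd (f (g y)) y)"
      using that 1 2 fc by (intro add_left_mono H.wd_triangle) auto
    finally show ?thesis using 1 2 fB[of "g x" "g y"]
        H.wd_commute[of y "f (g y)"] fc that by fastforce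
  qed
  define A' where "A' = 2 * A + 2 * D"
  have A': "A' \<ge> 0" "A' \<ge> 2 * A" "A' \<ge> 2 * D" using A0 BD by (auto simp: A'_def)
  \<comment> \<open>Brings \<open>a \<le> c + C * b\<close> into the form with factor
    \<open>1 / K\<close>; \<open>A' \<le> K * A'\<close> absorbs the additive constant.\<close>
  have div: "1 / K * a - A' \<le> b" if "a \<le> c + C * b" "C \<le> K" "0 \<le> b" "c \<le> A'" for a b c C :: real
  proof -
    have "C * b \<le> K * b" using that by (intro mult_right_mono) auto
    moreover have "A' \<le> K * A'" using mult_right_mono[OF K(3) A'(1)] by simp
    ultimately have "a \<le> K * (A' + b)" using that by (simp add: distrib_left)
    then show ?thesis using K by (simp add: field_simps)
  qed
  have mono: "b \<le> K * a + A'" if "b \<le> C * a" "C \<le> K" "0 \<le> a" for a b C :: real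
    using that mult_right_mono[OF that(2,3)] A' by linarith
  show "quasi_isometric (carrier G) G.wd (carrier H) H.wd"
    unfolding quasi_isometric_def
  proof (rule exI[of _ K], rule exI[of _ A'], rule exI[of _ f], intro conjI ballI)
    fix x y assume xy: "x \<in> carrier G" "y \<in> carrier G"
    show "1 / K * G.wd x y - A' \<le> H.wd (f x) (f y)"
      by (rule div[OF Glo[OF xy]]) (use K A' in auto)
    show "H.wd (f x) (f y) \<le> K * G.wd x y + A'"
      by (rule mono[OF fB[OF xy]]) (use K A' in auto)
  next
    fix y assume "y \<in> carrier H"
    then show "\<exists>x\<in>carrier G. H.wd y (f x) \<le> A'" using g A' A0 by (intro bexI[of _ "g y"]) force+
  qed (use K A' f in auto)
  show "quasi_isometric (carrier H) H.wd (carrier G) G.wd"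
    unfolding quasi_isometric_def
  proof (rule exI[of _ K], rule exI[of _ A'], rule exI[of _ g], intro conjI ballI)
    fix x y assume xy: "x \<in> carrier H" "y \<in> carrier H"
    show "1 / K * H.wd x y - A' \<le> G.wd (g x) (g y)"
      by (rule div[OF Hlo[OF xy]]) (use K A' in auto)
    show "G.wd (g x) (g y) \<le> K * H.wd x y + A'"
      by (rule mono[OF gD[OF xy]]) (use K A' in auto)
  next
    fix x assume x: "x \<in> carrier G"
    then show "\<exists>y\<in>carrier H. G.wd x (g y) \<le> A'" using gf A' BD fc by (intro bexI[of _ "f x"]) force+
  qed (use K A' g in auto)
qed

text \<open>Pigeonhole: at each point of \<open>Z\<close> finitely many values occur eventually, so
  one of them occurs infinitely often and a subsequence is constant there. A diagonal sequence
  handles all points of the countable set at once.\<close>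

lemma pointwise_limit_of_finite_valued:
  fixes h :: "nat \<Rightarrow> 'z \<Rightarrow> 'w"
  assumes "countable Z" "\<And>z. z \<in> Z \<Longrightarrow> finite (K z)"
    and "\<And>z. z \<in> Z \<Longrightarrow> eventually (\<lambda>k. h k z \<in> K z) sequentially"
  obtains s :: "nat \<Rightarrow> nat" and h' where "strict_mono s"
    "\<And>z. z \<in> Z \<Longrightarrow> eventually (\<lambda>k. h (s k) z = h' z) sequentially"
proof (cases "Z = {}")
  case True then show ?thesis using that[of id] by (auto simp: strict_mono_def)
next
  case False
  define e where "e = from_nat_into Z"
  have e: "range e = Z" using assms(1) False by (simp add: e_def range_from_nat_into)
  have eZ: "e n \<in> Z" for n using e by auto
  define P where "P n s \<longleftrightarrow> (\<exists>w. eventually (\<lambda>k. h (s k) (e n) = w) sequentially)" for n and s :: "nat \<Rightarrow> nat"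
  interpret subseqs P
  proof
    fix n and s :: "nat \<Rightarrow> nat" assume s: "strict_mono s"
    have "eventually (\<lambda>k. h (s k) (e n) \<in> K (e n)) sequentially"
      using eventually_subseq[OF s assms(3)[OF eZ]] .
    then obtain N where N: "\<And>k. k \<ge> N \<Longrightarrow> h (s k) (e n) \<in> K (e n)"
      unfolding eventually_sequentially by blast
    then have "finite ((\<lambda>k. h (s k) (e n)) ` {N..})"
      by (intro finite_subset[OF _ assms(2)[OF eZ[of n]]]) auto
    from pigeonhole_infinite[OF infinite_Ici this] obtain k0 where
      inf: "infinite {k \<in> {N..}. h (s k) (e n) = h (s k0) (e n)}" by blast
    let ?I = "{k \<in> {N..}. h (s k) (e n) = h (s k0) (e n)}"
    from infinite_enumerate[OF inf] obtain r :: "nat \<Rightarrow> nat" where r: "strict_mono r" "\<forall>k. r k \<in> ?I" by blast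
    then show "\<exists>r'. strict_mono r' \<and> P n (s \<circ> r')"
      unfolding P_def by (intro exI[of _ r]) auto
  qed
  \<comment> \<open>Passing to a further subsequence preserves \<open>P\<close>, so the diagonal
    sequence, which has a tail inside each stage, inherits it.\<close>
  have "P n (s \<circ> r)" if "strict_mono r" "P n s" for r s :: "nat \<Rightarrow> nat" and n
    using that unfolding P_def by (auto dest: eventually_subseq simp: o_def)
  then have *: "P n (diagseq \<circ> (+) (Suc n))" for n
    by (intro diagseq_holds) blast
  have "\<exists>w. eventually (\<lambda>k. h (diagseq (k + Suc n)) (e n) = w) sequentially" for n
  proof -
    have "diagseq \<circ> (+) (Suc n) = (\<lambda>k. diagseq (k + Suc n))"
      by (auto simp: fun_eq_iff add.commute)
    with *[of n] show ?thesis using P_def[of n "\<lambda>k. diagseq (k + Suc n)"] by metis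
  qed
  then have "\<exists>w. eventually (\<lambda>k. h (diagseq k) (e n) = w) sequentially" for n
    using eventually_sequentially_seg[of "\<lambda>k. h (diagseq k) (e n) = _" "Suc n"] by blast
  then obtain w where w: "\<And>n. eventually (\<lambda>k. h (diagseq k) (e n) = w n) sequentially"
    by metis
  show ?thesis
  proof (rule that[OF subseq_diagseq])
    fix z assume "z \<in> Z"
    then have "e (to_nat_on Z z) = z" using assms(1) by (simp add: e_def)
    then show "eventually (\<lambda>k. h (diagseq k) z = (w \<circ> to_nat_on Z) z) sequentially"
      using w[of "to_nat_on Z z"] by simp
  qed
qed

section \<open>Limits of locally defined coarse equivalences\<close>

text \<open>\<open>\<theta>\<close> bounds the length of an approximate preimage of \<open>y\<close>
  independently of \<open>n\<close>. The preimages for all large \<open>n\<close> therefore lie in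
  one finite ball, on which infinitely many of the maps agree with the limit, and surjectivity
  survives.\<close>

lemma coarse_limit:
  assumes "fg_group G S" "fg_group H T"
    and mono: "mono \<sigma>" "mono \<tau>"
    and ex: "\<And>n :: real. \<exists>h. h \<in> carrier G \<rightarrow> carrier H \<and> word_metric H T \<one>\<^bsub>H\<^esub> (h \<one>\<^bsub>G\<^esub>) \<le> A \<and>
      (\<forall>x\<in>carrier G. \<forall>y\<in>carrier G. real (word_length G S x) \<le> n \<longrightarrow> real (word_length G S y) \<le> n \<longrightarrow>
         word_metric H T (h x) (h y) \<le> \<sigma> (word_metric G S x y) \<and>
         word_metric G S x y \<le> \<tau> (word_metric H T (h x) (h y))) \<and>
      (\<forall>y\<in>carrier H. \<theta> (word_length H T y) \<le> n \<longrightarrow>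
         (\<exists>x\<in>carrier G. real (word_length G S x) \<le> \<theta> (word_length H T y) \<and> word_metric H T y (h x) \<le> A))"
  shows "quasi_isometric (carrier G) (word_metric G S) (carrier H) (word_metric H T)"
    and "quasi_isometric (carrier H) (word_metric H T) (carrier G) (word_metric G S)"
proof -
  interpret G: fg_group G S by fact
  interpret H: fg_group H T by fact
  define P where "P n h \<longleftrightarrow> h \<in> carrier G \<rightarrow> carrier H \<and> H.wd \<one>\<^bsub>H\<^esub> (h \<one>\<^bsub>G\<^esub>) \<le> A \<and>
      (\<forall>x\<in>carrier G. \<forall>y\<in>carrier G. real (G.wl x) \<le> n \<longrightarrow> real (G.wl y) \<le> n \<longrightarrow>
         H.wd (h x) (h y) \<le> \<sigma> (G.wd x y) \<and> G.wd x y \<le> \<tau> (H.wd (h x) (h y))) \<and>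
      (\<forall>y\<in>carrier H. \<theta> (H.wl y) \<le> n \<longrightarrow>
         (\<exists>x\<in>carrier G. real (G.wl x) \<le> \<theta> (H.wl y) \<and> H.wd y (h x) \<le> A))" for n :: real and h
  have "\<forall>n :: nat. \<exists>h. P (real n) h" using ex unfolding P_def by blast
  from choice[OF this] obtain h where hP: "\<And>n :: nat. P (real n) (h n)" by blast
  note h = hP[unfolded P_def, THEN conjunct1] hP[unfolded P_def, THEN conjunct2, THEN conjunct1]
  have h3: "H.wd (h n x) (h n y) \<le> \<sigma> (G.wd x y) \<and> G.wd x y \<le> \<tau> (H.wd (h n x) (h n y))"
    if "x \<in> carrier G" "y \<in> carrier G" "G.wl x \<le> n" "G.wl y \<le> n" for n x y
    using hP[of n] that unfolding P_def by simp
  have h4: "\<exists>x\<in>carrier G. G.wl x \<le> \<theta> (H.wl y) \<and> H.wd y (h n x) \<le> A"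
    if "y \<in> carrier H" "\<theta> (H.wl y) \<le> n" for n y
    using hP[of n] that unfolding P_def by simp
  have cG: "countable (carrier G)"
  proof -
    have "carrier G = (\<Union>n. {g \<in> carrier G. G.wl g \<le> n})" by auto
    moreover have "countable (\<Union>n. {g \<in> carrier G. G.wl g \<le> n})"
      by (intro countable_UN[OF countableI_type] countable_finite[OF G.finite_wl_ball])
    ultimately show ?thesis by simp
  qed
  \<comment> \<open>The image of the unit stays within \<open>A\<close> of the unit and
    \<open>\<sigma>\<close> bounds the rest, so for large \<open>n\<close> all values at
    \<open>z\<close> lie in one ball; balls are finite.\<close>
  define K where "K z = {y \<in> carrier H. H.wd \<one>\<^bsub>H\<^esub> y \<le> A + \<sigma> (G.wd \<one>\<^bsub>G\<^esub> z)}" for z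
  have K: "\<forall>\<^sub>F n in sequentially. h n z \<in> K z" if "z \<in> carrier G" for z
  proof (rule eventually_sequentiallyI[of "G.wl z"])
    fix n assume n: "G.wl z \<le> n"
    have "H.wd \<one>\<^bsub>H\<^esub> (h n z) \<le> H.wd \<one>\<^bsub>H\<^esub> (h n \<one>\<^bsub>G\<^esub>) + H.wd (h n \<one>\<^bsub>G\<^esub>) (h n z)"
      using h(1)[of n] that by (intro H.wd_triangle) auto
    also have "\<dots> \<le> A + \<sigma> (G.wd \<one>\<^bsub>G\<^esub> z)" using h(2) h3[of "\<one>\<^bsub>G\<^esub>" z n] that n by (intro add_mono) auto
    finally show "h n z \<in> K z" using h(1)[of n] that by (auto simp: K_def)
  qed
  obtain s h' where s: "strict_mono s" and
    h': "\<And>z. z \<in> carrier G \<Longrightarrow> \<forall>\<^sub>F k in sequentially. h (s k) z = h' z"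
    using pointwise_limit_of_finite_valued[of "carrier G" K h, OF cG _ K] H.finite_wd_ball
    unfolding K_def by blast
  \<comment> \<open>Every property of \<open>h'\<close> involves finitely many points and is read
    off from a single late map that agrees with \<open>h'\<close> there.\<close>
  have *: "\<exists>n\<ge>N. \<forall>z\<in>F. h n z = h' z" if "finite F" "F \<subseteq> carrier G" for F and N :: nat
  proof -
    have "\<forall>\<^sub>F k in sequentially. (\<forall>z\<in>F. h (s k) z = h' z) \<and> k \<ge> N"
      using that h' by (intro eventually_conj eventually_ball_finite eventually_ge_at_top) auto
    then obtain k where "\<forall>z\<in>F. h (s k) z = h' z" "k \<ge> N"
      using eventually_happens by fastforce
    then show ?thesis using seq_suble[OF s, of k] by (intro exI[of _ "s k"]) auto
  qed
  have h'c: "h' z \<in> carrier H" if "z \<in> carrier G" for z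
    using *[of "{z}"] that h(1) by (auto simp: Pi_iff) (metis)
  have two: "H.wd (h' x) (h' y) \<le> \<sigma> (G.wd x y) \<and> G.wd x y \<le> \<tau> (H.wd (h' x) (h' y))"
    if "x \<in> carrier G" "y \<in> carrier G" for x y
  proof -
    obtain n where n: "n \<ge> max (G.wl x) (G.wl y)" "\<forall>z\<in>{x, y}. h n z = h' z"
      using *[of "{x, y}"] \<open>x \<in> carrier G\<close> \<open>y \<in> carrier G\<close> by blast
    then show ?thesis using h3[of x y n] that by auto
  qed
  have onto: "\<exists>x\<in>carrier G. H.wd y (h' x) \<le> A" if y: "y \<in> carrier H" for y
  proof -
    \<comment> \<open>All candidates for a preimage of \<open>y\<close>, whatever \<open>n\<close>
      is.\<close>
    let ?F = "{x \<in> carrier G. G.wd \<one>\<^bsub>G\<^esub> x \<le> \<theta> (H.wl y)}"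
    obtain n where n: "n \<ge> nat \<lceil>\<theta> (H.wl y)\<rceil>" "\<forall>z\<in>?F. h n z = h' z"
      using *[OF G.finite_wd_ball] by blast
    then obtain x where "x \<in> carrier G" "G.wl x \<le> \<theta> (H.wl y)" "H.wd y (h n x) \<le> A"
      using h4[OF y, of n] by (metis nat_ceiling_le_eq)
    then show ?thesis using n by (intro bexI[of _ x]) (auto simp: G.wd_one)
  qed
  have 1: "h' \<in> carrier G \<rightarrow> carrier H" using h'c by auto
  have 2: "H.wd (h' x) (h' y) \<le> \<sigma> r" if "x \<in> carrier G" "y \<in> carrier G" "G.wd x y \<le> r" for x y r
    using two[OF that(1,2)] monoD[OF mono(1) that(3)] by linarith
  have 3: "G.wd x y \<le> \<tau> r" if "x \<in> carrier G" "y \<in> carrier G" "H.wd (h' x) (h' y) \<le> r" for x y r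
    using two[OF that(1,2)] monoD[OF mono(2) that(3)] by linarith
  show "quasi_isometric (carrier G) G.wd (carrier H) H.wd" "quasi_isometric (carrier H) H.wd (carrier G) G.wd"
    by (rule coarse_imp_quasi_isometric[OF assms(1,2), of h' \<sigma> \<tau> A]; use 1 2 3 onto in blast)+
qed

text \<open>
  \<open>\<psi>\<close> maps the word ball of radius \<open>r\<close> quasi-isometrically to \<open>X\<close>, with a constant \<open>A\<close> that does not depend
  on \<open>r\<close>, and its image is coarsely dense in the ball around \<open>p\<close> whose radius is \<open>r\<close> up to the constant \<open>A\<close>.
\<close>

definition local_model ::
    "('g, 'c) monoid_scheme \<Rightarrow> 'g set \<Rightarrow> real \<Rightarrow> real \<Rightarrow> 'x set \<Rightarrow> ('x \<Rightarrow> 'x \<Rightarrow> real) \<Rightarrow> 'x \<Rightarrow> ('g \<Rightarrow> 'x) \<Rightarrow> bool" where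
  "local_model G S A r X d p \<psi> \<longleftrightarrow>
     (\<forall>g\<in>carrier G. real (word_length G S g) \<le> r \<longrightarrow> \<psi> g \<in> X) \<and> d p (\<psi> \<one>\<^bsub>G\<^esub>) \<le> A \<and>
     (\<forall>g\<in>carrier G. \<forall>h\<in>carrier G. real (word_length G S g) \<le> r \<longrightarrow> real (word_length G S h) \<le> r \<longrightarrow>
        d (\<psi> g) (\<psi> h) \<le> A * word_metric G S g h + A \<and> word_metric G S g h \<le> A * d (\<psi> g) (\<psi> h) + A) \<and>
     (\<forall>x\<in>X. A * d p x + A \<le> r \<longrightarrow>
        (\<exists>g\<in>carrier G. real (word_length G S g) \<le> r \<and> d x (\<psi> g) \<le> A))"

lemma local_modelD:
  assumes "local_model G S A r X d p \<psi>"
  shows "\<And>g. g \<in> carrier G \<Longrightarrow> real (word_length G S g) \<le> r \<Longrightarrow> \<psi> g \<in> X" "d p (\<psi> \<one>\<^bsub>G\<^esub>) \<le> A"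
    "\<And>g h. g \<in> carrier G \<Longrightarrow> h \<in> carrier G \<Longrightarrow> real (word_length G S g) \<le> r \<Longrightarrow> real (word_length G S h) \<le> r \<Longrightarrow>
        d (\<psi> g) (\<psi> h) \<le> A * word_metric G S g h + A"
    "\<And>g h. g \<in> carrier G \<Longrightarrow> h \<in> carrier G \<Longrightarrow> real (word_length G S g) \<le> r \<Longrightarrow> real (word_length G S h) \<le> r \<Longrightarrow>
        word_metric G S g h \<le> A * d (\<psi> g) (\<psi> h) + A"
    "\<And>x. x \<in> X \<Longrightarrow> A * d p x + A \<le> r \<Longrightarrow>
        \<exists>g\<in>carrier G. real (word_length G S g) \<le> r \<and> d x (\<psi> g) \<le> A"
  using assms unfolding local_model_def by auto

text \<open>Up to the error \<open>A\<close>, the map between the model groups is \<open>f\<close>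
  read through the two models: go from \<open>G\<close> to \<open>X\<close> by
  \<open>\<psi>\<close>, apply \<open>f\<close>, and pick an element of \<open>H\<close> whose image
  under \<open>\<phi>\<close> is near. All bounds depend only on \<open>A\<close> and the control
  functions, so \<open>coarse_limit\<close> applies as the radius grows.\<close>

lemma quasi_isometric_of_local_models:
  fixes \<rho>l \<rho>u :: "real \<Rightarrow> real"
  assumes "fg_group G S" "fg_group H T" and A: "A \<ge> 1"
    and \<rho>: "control_function \<rho>l" "control_function \<rho>u"
    and loc: "\<And>r. r \<ge> 0 \<Longrightarrow> \<exists>(X :: 'x set) dX (Y :: 'y set) dY f p \<psi> \<phi>. Metric_space X dX \<and> Metric_space Y dY \<and> f \<in> X \<rightarrow> Y \<and>
       p \<in> X \<and>
       local_model G S A r X dX p \<psi> \<and> local_model H T A r Y dY (f p) \<phi> \<and>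
       (\<forall>x\<in>X. \<forall>x'\<in>X. \<rho>l (dX x x') \<le> dY (f x) (f x') \<and> dY (f x) (f x') \<le> \<rho>u (dX x x')) \<and>
       (\<forall>y\<in>Y. \<exists>x\<in>X. dY y (f x) \<le> A)"
  shows "quasi_isometric (carrier G) (word_metric G S) (carrier H) (word_metric H T)"
    and "quasi_isometric (carrier H) (word_metric H T) (carrier G) (word_metric G S)"
proof -
  interpret G: fg_group G S by fact
  interpret H: fg_group H T by fact
  \<comment> \<open>Extended to negative arguments so as to be monotone on all reals, as
    \<open>coarse_limit\<close> asks of the controls.\<close>
  define u where "u r = \<rho>u (max 0 r)" for r
  have u: "mono u" "\<And>r. u r \<ge> 0" "\<And>r. r \<ge> 0 \<Longrightarrow> u r = \<rho>u r"
    using \<rho>(2) unfolding u_def control_function_def mono_on_def by (auto intro!: monoI)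
  \<comment> \<open>A generalized inverse of \<open>\<rho>l\<close>: unboundedness makes the set
    nonempty, and \<open>\<rho>l d \<le> r\<close> implies \<open>d \<le> v r\<close>.\<close>
  define v where "v r = Inf {b. b \<ge> 0 \<and> \<rho>l b > r} + 1" for r
  have ne: "{b. b \<ge> 0 \<and> \<rho>l b > r} \<noteq> {}" for r
    using \<rho>(1) unfolding control_function_def bdd_above_def by (simp add: not_le not_less Bex_def)
  have bdd: "bdd_below {b. b \<ge> 0 \<and> \<rho>l b > r}" for r by (rule bdd_belowI[of _ 0]) auto
  have v_mono: "mono v"
    unfolding v_def by (intro monoI add_right_mono cInf_superset_mono ne bdd) auto
  have v: "d \<le> v r" if "\<rho>l d \<le> r" "0 \<le> d" for d r
  proof (rule ccontr)
    assume "\<not> d \<le> v r"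
    then have "Inf {b. b \<ge> 0 \<and> \<rho>l b > r} < d" unfolding v_def by linarith
    then obtain b where "b \<ge> 0" "\<rho>l b > r" "b < d" using cInf_lessD[OF ne] by blast
    then have "\<rho>l b \<le> \<rho>l d" using \<rho>(1) that unfolding control_function_def mono_on_def by auto
    then show False using \<open>\<rho>l b > r\<close> that by linarith
  qed
  have v0: "v r \<ge> 0" for r
    unfolding v_def using cInf_greatest[OF ne[of r], of 0] by auto
  have Am: "A * a \<le> A * b" if "a \<le> b" for a b using that A by (intro mult_left_mono) auto
  have Age: "a \<le> A * a" if "a \<ge> 0" for a using mult_right_mono[OF A that] by simp
  \<comment> \<open>Accounts for two approximations by \<open>A\<close> and for \<open>f\<close>
    moving a pair at distance \<open>A\<close> to distance at most \<open>u A\<close>. It bounds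
    both the displacement of the unit and the defect of surjectivity.\<close>
  define B where "B = A * (2 * A + u A) + A"
  define \<sigma> where "\<sigma> r = A * (2 * A + u (A * r + A)) + A" for r
  define \<tau> where "\<tau> r = A * v (2 * A + A * r + A) + A" for r
  define \<theta> where "\<theta> r = A * (3 * A + v (3 * A + A * r + A)) + A" for r
  have m: "mono \<sigma>" "mono \<tau>"
    unfolding \<sigma>_def \<tau>_def
    by (intro monoI add_right_mono add_left_mono Am monoD[OF u(1)] monoD[OF v_mono]; simp)+
  have "quasi_isometric (carrier G) G.wd (carrier H) H.wd \<and> quasi_isometric (carrier H) H.wd (carrier G) G.wd"
  proof -
    \<comment> \<open>Taking the maximum with \<open>H.wl y\<close> guarantees that \<open>y\<close>
      itself lies in the ball on which the model of \<open>H\<close> is valid.\<close>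
    have "\<exists>h. h \<in> carrier G \<rightarrow> carrier H \<and> H.wd \<one>\<^bsub>H\<^esub> (h \<one>\<^bsub>G\<^esub>) \<le> B \<and>
      (\<forall>x\<in>carrier G. \<forall>y\<in>carrier G. real (G.wl x) \<le> n \<longrightarrow> real (G.wl y) \<le> n \<longrightarrow>
         H.wd (h x) (h y) \<le> \<sigma> (G.wd x y) \<and> G.wd x y \<le> \<tau> (H.wd (h x) (h y))) \<and>
      (\<forall>y\<in>carrier H. max (H.wl y) (\<theta> (H.wl y)) \<le> n \<longrightarrow>
         (\<exists>x\<in>carrier G. real (G.wl x) \<le> max (H.wl y) (\<theta> (H.wl y)) \<and> H.wd y (h x) \<le> B))" for n
    proof -
      define N where "N = max 0 n"
      \<comment> \<open>Large enough for three purposes: the balls of radius \<open>N\<close> lie in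
        both model domains, \<open>\<phi>\<close> covers the \<open>f\<close>-images of the ball of
        \<open>G\<close>, and \<open>\<psi>\<close> covers the preimages of points coming from the
        ball of \<open>H\<close>.\<close>
      define R where "R = N + A * (A + u (A * N + 2 * A)) + A + (A * v (3 * A + A * N + A) + A)"
      have N0: "N \<ge> 0" "n \<le> N" by (auto simp: N_def)
      have "A * (A + u (A * N + 2 * A)) \<ge> 0" "A * v (3 * A + A * N + A) \<ge> 0"
        using A u v0 by auto
      then have R: "N \<le> R" "A * (A + u (A * N + 2 * A)) + A \<le> R" "A * v (3 * A + A * N + A) + A \<le> R"
        using A N0 unfolding R_def by auto
      from loc[OF order_trans[OF N0(1) R(1)]] obtain X :: "'x set" and dX and Y :: "'y set" and dY f p \<psi> \<phi>
        where *: "Metric_space X dX" "Metric_space Y dY" "f \<in> X \<rightarrow> Y" "p \<in> X"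
        and \<psi>: "local_model G S A R X dX p \<psi>" and \<phi>: "local_model H T A R Y dY (f p) \<phi>"
        and f': "\<forall>x\<in>X. \<forall>x'\<in>X. \<rho>l (dX x x') \<le> dY (f x) (f x') \<and> dY (f x) (f x') \<le> \<rho>u (dX x x')"
        and onto': "\<forall>y\<in>Y. \<exists>x\<in>X. dY y (f x) \<le> A"
        by (elim exE conjE) (rule that)
      have f: "\<rho>l (dX x x') \<le> dY (f x) (f x')" "dY (f x) (f x') \<le> \<rho>u (dX x x')"
        if "x \<in> X" "x' \<in> X" for x x' using f' that by auto
      have onto: "\<exists>x\<in>X. dY y (f x) \<le> A" if "y \<in> Y" for y using onto' that by blast
      interpret X: Metric_space X dX by fact
      interpret Y: Metric_space Y dY by fact
      note \<psi>D = local_modelD[OF \<psi>] and \<phi>D = local_modelD[OF \<phi>]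
      have fu: "dY (f x) (f x') \<le> u (dX x x')" if "x \<in> X" "x' \<in> X" for x x'
        using f(2)[OF that] u by simp
      have fv: "dX x x' \<le> v (dY (f x) (f x'))" if "x \<in> X" "x' \<in> X" for x x'
        using f(1)[OF that] v by simp
      have fX: "f x \<in> Y" if "x \<in> X" for x using * that by auto
      have \<psi>1: "\<psi> \<one>\<^bsub>G\<^esub> \<in> X" and \<phi>1: "\<phi> \<one>\<^bsub>H\<^esub> \<in> Y" using \<psi>D(1) \<phi>D(1) R N0 by auto
      have \<psi>X: "\<psi> x \<in> X" if "x \<in> carrier G" "G.wl x \<le> N" for x
        using \<psi>D(1)[OF that(1)] that R by linarith
      have "\<exists>w\<in>carrier H. H.wl w \<le> R \<and> dY (f (\<psi> x)) (\<phi> w) \<le> A" if x: "x \<in> carrier G" "G.wl x \<le> N" for x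
      proof (rule \<phi>D(5))
        have "dX p (\<psi> x) \<le> dX p (\<psi> \<one>\<^bsub>G\<^esub>) + dX (\<psi> \<one>\<^bsub>G\<^esub>) (\<psi> x)"
          using \<psi>1 \<psi>X[OF x] * by (intro X.triangle) auto
        also have "\<dots> \<le> A + (A * G.wd \<one>\<^bsub>G\<^esub> x + A)"
          using \<psi>D(2) \<psi>D(3)[of "\<one>\<^bsub>G\<^esub>" x] x R N0 by (intro add_mono) auto
        also have "\<dots> \<le> A * N + 2 * A" using Am[OF x(2)] x by (simp add: G.wd_one)
        finally have "dY (f p) (f (\<psi> x)) \<le> u (A * N + 2 * A)"
          using fu[of p "\<psi> x"] \<psi>X[OF x] * monoD[OF u(1)] by (meson order_trans)
        then have "A * dY (f p) (f (\<psi> x)) + A \<le> A * (A + u (A * N + 2 * A)) + A"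
          using A by (intro add_right_mono Am) auto
        then show "A * dY (f p) (f (\<psi> x)) + A \<le> R" using R by linarith
      qed (use fX \<psi>X x in auto)
      then obtain h where h: "\<And>x. x \<in> carrier G \<Longrightarrow> G.wl x \<le> N \<Longrightarrow> h x \<in> carrier H \<and> H.wl (h x) \<le> R \<and> dY (f (\<psi> x)) (\<phi> (h x)) \<le> A"
        by metis
      have h1: "H.wd \<one>\<^bsub>H\<^esub> (h \<one>\<^bsub>G\<^esub>) \<le> A * (2 * A + u A) + A"
      proof -
        note h1 = h[of "\<one>\<^bsub>G\<^esub>"]
        have "dY (\<phi> \<one>\<^bsub>H\<^esub>) (\<phi> (h \<one>\<^bsub>G\<^esub>)) \<le> dY (\<phi> \<one>\<^bsub>H\<^esub>) (f (\<psi> \<one>\<^bsub>G\<^esub>)) + dY (f (\<psi> \<one>\<^bsub>G\<^esub>)) (\<phi> (h \<one>\<^bsub>G\<^esub>))"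
          using h1 \<phi>1 \<psi>1 \<phi>D(1) fX N0 by (intro Y.triangle) auto
        also have "\<dots> \<le> (dY (\<phi> \<one>\<^bsub>H\<^esub>) (f p) + dY (f p) (f (\<psi> \<one>\<^bsub>G\<^esub>))) + A"
          using h1 \<phi>1 \<psi>1 \<phi>D(1) fX N0 * by (intro add_mono Y.triangle) auto
        also have "\<dots> \<le> (A + u A) + A"
          using \<phi>D(2) fu[of p "\<psi> \<one>\<^bsub>G\<^esub>"] \<psi>1 * monoD[OF u(1) \<psi>D(2)] by (intro add_mono) (auto simp: Y.commute)
        finally have "dY (\<phi> \<one>\<^bsub>H\<^esub>) (\<phi> (h \<one>\<^bsub>G\<^esub>)) \<le> 2 * A + u A" by simp
        from Am[OF this] show ?thesis using \<phi>D(4)[of "\<one>\<^bsub>H\<^esub>" "h \<one>\<^bsub>G\<^esub>"] h1 R N0 by auto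
      qed
      have \<phi>X: "\<phi> y \<in> Y" if "y \<in> carrier H" "H.wl y \<le> R" for y
        using \<phi>D(1) that by blast
      \<comment> \<open>Beyond radius \<open>N\<close> nothing is known about \<open>h\<close>; the
        unit is a default that keeps \<open>h'\<close> a map into the carrier.\<close>
      define h' where "h' x = (if real (G.wl x) \<le> N then h x else \<one>\<^bsub>H\<^esub>)" for x
      have h'h: "h' x = h x" if "G.wl x \<le> N" for x using that by (simp add: h'_def)
      have "h' \<in> carrier G \<rightarrow> carrier H" using h by (auto simp: h'_def)
      moreover have "H.wd \<one>\<^bsub>H\<^esub> (h' \<one>\<^bsub>G\<^esub>) \<le> B" using h1 N0 by (simp add: h'h B_def)
      moreover have "H.wd (h' x) (h' y) \<le> \<sigma> (G.wd x y) \<and> G.wd x y \<le> \<tau> (H.wd (h' x) (h' y))"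
        if x: "x \<in> carrier G" "G.wl x \<le> n" and y: "y \<in> carrier G" "G.wl y \<le> n" for x y
      proof -
        have xN: "G.wl x \<le> N" "G.wl y \<le> N" using x y N0 by auto
        note hx = h[OF x(1) xN(1)] and hy = h[OF y(1) xN(2)]
        note fx = fX[OF \<psi>X[OF x(1) xN(1)]] and fy = fX[OF \<psi>X[OF y(1) xN(2)]]
        note px = \<phi>X[of "h x"] and py = \<phi>X[of "h y"]
        have R': "G.wl x \<le> R" "G.wl y \<le> R" using xN R by linarith+
        have "dY (\<phi> (h x)) (\<phi> (h y)) \<le> dY (\<phi> (h x)) (f (\<psi> x)) + dY (f (\<psi> x)) (\<phi> (h y))"
          using hx hy px py fx fy by (intro Y.triangle) auto
        also have "\<dots> \<le> dY (\<phi> (h x)) (f (\<psi> x)) + (dY (f (\<psi> x)) (f (\<psi> y)) + dY (f (\<psi> y)) (\<phi> (h y)))"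
          using hx hy px py fx fy by (intro add_left_mono Y.triangle) auto
        also have "\<dots> \<le> A + (u (dX (\<psi> x) (\<psi> y)) + A)"
          using hx hy fu[OF \<psi>X[OF x(1) xN(1)] \<psi>X[OF y(1) xN(2)]] by (intro add_mono) (auto simp: Y.commute)
        also have "\<dots> \<le> A + (u (A * G.wd x y + A) + A)"
          using \<psi>D(3)[OF x(1) y(1) R'] by (intro add_mono monoD[OF u(1)]) auto
        finally have "dY (\<phi> (h x)) (\<phi> (h y)) \<le> 2 * A + u (A * G.wd x y + A)" by simp
        from Am[OF this] have 1: "H.wd (h x) (h y) \<le> \<sigma> (G.wd x y)"
          using \<phi>D(4)[of "h x" "h y"] hx hy by (auto simp: \<sigma>_def)
        have "dY (f (\<psi> x)) (f (\<psi> y)) \<le> dY (f (\<psi> x)) (\<phi> (h x)) + dY (\<phi> (h x)) (f (\<psi> y))"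
          using hx hy px py fx fy by (intro Y.triangle) auto
        also have "\<dots> \<le> dY (f (\<psi> x)) (\<phi> (h x)) + (dY (\<phi> (h x)) (\<phi> (h y)) + dY (\<phi> (h y)) (f (\<psi> y)))"
          using hx hy px py fx fy by (intro add_left_mono Y.triangle) auto
        also have "\<dots> \<le> A + ((A * H.wd (h x) (h y) + A) + A)"
          using hx hy \<phi>D(3)[of "h x" "h y"] by (intro add_mono) (auto simp: Y.commute)
        finally have "dY (f (\<psi> x)) (f (\<psi> y)) \<le> 2 * A + A * H.wd (h x) (h y) + A" by simp
        then have "dX (\<psi> x) (\<psi> y) \<le> v (2 * A + A * H.wd (h x) (h y) + A)"
          using fv[OF \<psi>X[OF x(1) xN(1)] \<psi>X[OF y(1) xN(2)]] monoD[OF v_mono] by (meson order_trans)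
        from Am[OF this] have "G.wd x y \<le> \<tau> (H.wd (h x) (h y))"
          using \<psi>D(4)[OF x(1) y(1) R'] by (auto simp: \<tau>_def)
        with 1 show ?thesis using xN by (simp add: h'h)
      qed
      moreover have "\<exists>x\<in>carrier G. real (G.wl x) \<le> max (H.wl y) (\<theta> (H.wl y)) \<and> H.wd y (h' x) \<le> B"
        if y: "y \<in> carrier H" "max (H.wl y) (\<theta> (H.wl y)) \<le> n" for y
      proof -
        have yN: "H.wl y \<le> N" "H.wl y \<le> R" using y N0 R by linarith+
        note py = \<phi>X[OF y(1) yN(2)]
        obtain x where x: "x \<in> X" "dY (\<phi> y) (f x) \<le> A" using onto py by blast
        have "dY (f p) (f x) \<le> dY (f p) (\<phi> \<one>\<^bsub>H\<^esub>) + dY (\<phi> \<one>\<^bsub>H\<^esub>) (f x)"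
          using \<phi>1 fX x * by (intro Y.triangle) auto
        also have "\<dots> \<le> dY (f p) (\<phi> \<one>\<^bsub>H\<^esub>) + (dY (\<phi> \<one>\<^bsub>H\<^esub>) (\<phi> y) + dY (\<phi> y) (f x))"
          using \<phi>1 fX x * py by (intro add_left_mono Y.triangle) auto
        also have "\<dots> \<le> A + ((A * H.wl y + A) + A)"
          using \<phi>D(2) \<phi>D(3)[of "\<one>\<^bsub>H\<^esub>" y] x y yN R N0 by (intro add_mono) (auto simp: H.wd_one)
        finally have "dY (f p) (f x) \<le> 3 * A + A * H.wl y + A" using A by simp
        then have px: "dX p x \<le> v (3 * A + A * H.wl y + A)"
          using fv[OF _ x(1), of p] * monoD[OF v_mono] by (meson order_trans)
        also have "\<dots> \<le> v (3 * A + A * N + A)"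
          using Am[OF yN(1)] by (intro monoD[OF v_mono]) auto
        finally have "A * dX p x + A \<le> R" using Am R by (smt (verit))
        then obtain g where g: "g \<in> carrier G" "G.wl g \<le> R" "dX x (\<psi> g) \<le> A"
          using \<psi>D(5)[OF x(1)] by blast
        note pg = \<psi>D(1)[OF g(1,2)]
        have "dX (\<psi> \<one>\<^bsub>G\<^esub>) (\<psi> g) \<le> dX (\<psi> \<one>\<^bsub>G\<^esub>) p + dX p (\<psi> g)"
          using \<psi>1 pg * by (intro X.triangle) auto
        also have "\<dots> \<le> dX (\<psi> \<one>\<^bsub>G\<^esub>) p + (dX p x + dX x (\<psi> g))"
          using \<psi>1 pg * x by (intro add_left_mono X.triangle) auto
        also have "\<dots> \<le> A + (v (3 * A + A * H.wl y + A) + A)"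
          using \<psi>D(2) px g by (intro add_mono) (auto simp: X.commute)
        also have "\<dots> \<le> 3 * A + v (3 * A + A * H.wl y + A)" using A by simp
        finally have "G.wl g \<le> \<theta> (H.wl y)"
          using \<psi>D(4)[of "\<one>\<^bsub>G\<^esub>" g] g R N0 Am unfolding \<theta>_def by (smt (verit) G.one_closed G.wd_one G.wl_one of_nat_0)
        then have gN: "G.wl g \<le> max (H.wl y) (\<theta> (H.wl y))" "G.wl g \<le> N" using y N0 by linarith+
        note hg = h[OF g(1) gN(2)]
        have "dY (\<phi> y) (\<phi> (h g)) \<le> dY (\<phi> y) (f x) + dY (f x) (\<phi> (h g))"
          using py x fX hg \<phi>X by (intro Y.triangle) auto
        also have "\<dots> \<le> dY (\<phi> y) (f x) + (dY (f x) (f (\<psi> g)) + dY (f (\<psi> g)) (\<phi> (h g)))"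
          using py x fX hg \<phi>X pg by (intro add_left_mono Y.triangle) auto
        also have "\<dots> \<le> A + (u A + A)"
          using x hg fu[OF x(1) pg] monoD[OF u(1) g(3)] by (intro add_mono) auto
        finally have "dY (\<phi> y) (\<phi> (h g)) \<le> 2 * A + u A" by simp
        from Am[OF this] have "H.wd y (h g) \<le> B"
          using \<phi>D(4)[of y "h g"] hg y yN unfolding B_def by auto
        then show ?thesis using g gN by (intro bexI[of _ g]) (auto simp: h'h)
      qed
      ultimately show ?thesis by blast
    qed
    from coarse_limit[OF assms(1,2) m, of B "\<lambda>n. max n (\<theta> n)", OF this]
    show ?thesis by blast
  qed
  then show "quasi_isometric (carrier G) G.wd (carrier H) H.wd" "quasi_isometric (carrier H) H.wd (carrier G) G.wd"
    by blast+
qed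

section \<open>Products with free abelian groups\<close>

lemma carrier_Zn: "carrier (Zn n) = ({..<n} \<rightarrow>\<^sub>E UNIV)"
  by (simp add: Zn_def)

lemma one_Zn: "\<one>\<^bsub>Zn n\<^esub> = (\<lambda>i\<in>{..<n}. 0)"
  by (simp add: Zn_def)

lemma mult_Zn: "v \<otimes>\<^bsub>Zn n\<^esub> w = (\<lambda>i\<in>{..<n}. v i + w i)"
  by (simp add: Zn_def)

lemma group_Zn: "group (Zn n)"
  by (simp add: Zn_def)

lemma inv_Zn: "v \<in> carrier (Zn n) \<Longrightarrow> inv\<^bsub>Zn n\<^esub> v = (\<lambda>i\<in>{..<n}. - v i)"
  unfolding Zn_def by (subst inv_product_group) auto

definition Zn_basis :: "nat \<Rightarrow> nat \<Rightarrow> int \<Rightarrow> nat \<Rightarrow> int" where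
  "Zn_basis n i k = (\<lambda>j\<in>{..<n}. if j = i then k else 0)"

text \<open>Partial sums of the expansion of \<open>v\<close> in the standard basis; they drive the
  induction in \<open>word_Zn\<close>.\<close>

definition Zn_trunc :: "nat \<Rightarrow> nat \<Rightarrow> (nat \<Rightarrow> int) \<Rightarrow> nat \<Rightarrow> int" where
  "Zn_trunc n m v = (\<lambda>j\<in>{..<n}. if j < m then v j else 0)"

definition prod_gens :: "('g, 'c) monoid_scheme \<Rightarrow> 'g set \<Rightarrow> nat \<Rightarrow> ('g \<times> (nat \<Rightarrow> int)) set" where
  "prod_gens G S n = (\<lambda>s. (s, \<one>\<^bsub>Zn n\<^esub>)) ` S \<union> (\<lambda>i. (\<one>\<^bsub>G\<^esub>, Zn_basis n i 1)) ` {..<n}"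

text \<open>An explicit stand-in for the word lengths of the product: it is comparable to each of
  them, and on the abelian factor it is the l1 norm, which compares easily with coordinate
  distances.\<close>

definition prod_length :: "('g, 'c) monoid_scheme \<Rightarrow> 'g set \<Rightarrow> nat \<Rightarrow> 'g \<times> (nat \<Rightarrow> int) \<Rightarrow> nat" where
  "prod_length G S n x = word_length G S (fst x) + (\<Sum>i<n. nat \<bar>snd x i\<bar>)"

context fg_group
begin

abbreviation GZ where "GZ n \<equiv> G \<times>\<times> Zn n"

lemma group_GZ: "group (GZ n)"
  using DirProd_group[OF is_group group_Zn] .

lemma mult_GZ: "x \<otimes>\<^bsub>GZ n\<^esub> y = (fst x \<otimes> fst y, snd x \<otimes>\<^bsub>Zn n\<^esub> snd y)"
  by (cases x; cases y) simp

lemma inv_GZ: "x \<in> carrier (GZ n) \<Longrightarrow> inv\<^bsub>GZ n\<^esub> x = (inv (fst x), inv\<^bsub>Zn n\<^esub> (snd x))"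
  by (cases x) (simp add: inv_DirProd[OF is_group group_Zn])

lemma prod_gens_carrier: "prod_gens G S n \<subseteq> carrier (GZ n)"
  using S_carrier by (auto simp: prod_gens_def carrier_Zn one_Zn Zn_basis_def split: if_splits)

lemma prod_gens_sym:
  "s \<in> symmetrization G S \<Longrightarrow> (s, \<one>\<^bsub>Zn n\<^esub>) \<in> symmetrization (GZ n) (prod_gens G S n)"
proof -
  have "(inv s, \<one>\<^bsub>Zn n\<^esub>) \<in> m_inv (GZ n) ` prod_gens G S n" if "s \<in> S" for s
    using that S_carrier inv_DirProd[OF is_group group_Zn, of s "\<one>\<^bsub>Zn n\<^esub>" n] monoid.inv_one[OF group.is_monoid[OF group_Zn], of n]
    by (intro image_eqI[of _ _ "(s, \<one>\<^bsub>Zn n\<^esub>)"])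
      (auto simp: prod_gens_def carrier_Zn one_Zn group.is_monoid[OF group_Zn])
  then show "s \<in> symmetrization G S \<Longrightarrow> (s, \<one>\<^bsub>Zn n\<^esub>) \<in> symmetrization (GZ n) (prod_gens G S n)"
    by (auto simp: symmetrization_def prod_gens_def)
qed

lemma Zn_basis_sym:
  assumes "i < n" "k = 1 \<or> k = -1"
  shows "(\<one>, Zn_basis n i k) \<in> symmetrization (GZ n) (prod_gens G S n)"
  using assms(2)
proof
  assume "k = 1" then show ?thesis using assms by (auto simp: symmetrization_def prod_gens_def)
next
  assume k: "k = -1"
  have "inv\<^bsub>GZ n\<^esub> (\<one>, Zn_basis n i 1) = (\<one>, Zn_basis n i k)"
    by (subst inv_GZ) (auto simp: carrier_Zn Zn_basis_def inv_Zn k intro!: restrict_ext)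
  then show ?thesis using assms(1) by (force simp: symmetrization_def prod_gens_def)
qed

lemma word_Zn_basis:
  assumes "i < n" "k = 1 \<or> k = -1"
  shows "word_prod (GZ n) (replicate m (\<one>, Zn_basis n i k)) = (\<one>, Zn_basis n i (int m * k))"
  using assms
  by (induction m) (auto simp: one_Zn mult_Zn Zn_basis_def algebra_simps intro!: restrict_ext)

text \<open>Coordinates are built one at a time, each by appending
  \<open>nat \<bar>v m\<bar>\<close> copies of a basis vector with the sign of
  \<open>v m\<close>.\<close>

lemma word_Zn:
  assumes "v \<in> carrier (Zn n)" "m \<le> n"
  shows "\<exists>w. set w \<subseteq> symmetrization (GZ n) (prod_gens G S n) \<and>
     word_prod (GZ n) w = (\<one>, Zn_trunc n m v) \<and> length w = (\<Sum>i<m. nat \<bar>v i\<bar>)"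
  using assms(2)
proof (induction m)
  case 0
  show ?case by (intro exI[of _ "[]"]) (auto simp: one_Zn Zn_trunc_def)
next
  case (Suc m)
  then obtain w where w: "set w \<subseteq> symmetrization (GZ n) (prod_gens G S n)"
     "word_prod (GZ n) w = (\<one>, Zn_trunc n m v)" "length w = (\<Sum>i<m. nat \<bar>v i\<bar>)" by auto
  define k :: int where "k = (if v m < 0 then -1 else 1)"
  have k: "k = 1 \<or> k = -1" "int (nat \<bar>v m\<bar>) * k = v m" by (auto simp: k_def)
  let ?u = "replicate (nat \<bar>v m\<bar>) (\<one>, Zn_basis n m k)"
  have u: "set ?u \<subseteq> symmetrization (GZ n) (prod_gens G S n)"
    using Zn_basis_sym[of m n k] Suc k by auto
  have "word_prod (GZ n) (w @ ?u) = (\<one>, Zn_trunc n m v) \<otimes>\<^bsub>GZ n\<^esub> (\<one>, Zn_basis n m (v m))"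
  proof -
    have "set w \<subseteq> carrier (GZ n)" "set ?u \<subseteq> carrier (GZ n)"
      using w(1) u symmetrization_carrier[OF group_GZ prod_gens_carrier] by blast+
    moreover have "word_prod (GZ n) ?u = (\<one>, Zn_basis n m (v m))"
      using word_Zn_basis[OF _ k(1), of m n "nat \<bar>v m\<bar>"] Suc.prems unfolding k(2) by simp
    ultimately show ?thesis using word_prod_append[OF group_GZ, of w n ?u] w(2) by simp
  qed
  also have "\<dots> = (\<one>, Zn_trunc n (Suc m) v)"
    by (auto simp: mult_Zn Zn_trunc_def Zn_basis_def less_Suc_eq intro!: restrict_ext)
  finally show ?case using w u by (intro exI[of _ "w @ ?u"]) auto
qed

lemma word_GZ:
  assumes "x \<in> carrier (GZ n)"
  shows "\<exists>w. set w \<subseteq> symmetrization (GZ n) (prod_gens G S n) \<and>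
     word_prod (GZ n) w = x \<and> length w = prod_length G S n x"
proof -
  obtain g v where x: "x = (g, v)" "g \<in> carrier G" "v \<in> carrier (Zn n)" using assms by auto
  obtain w where w: "length w = wl g" "set w \<subseteq> symmetrization G S" "word_prod G w = g"
    by (rule wl_word[OF x(2)])
  let ?w = "map (\<lambda>s. (s, \<one>\<^bsub>Zn n\<^esub>)) w"
  have 1: "word_prod (GZ n) (map (\<lambda>s. (s, \<one>\<^bsub>Zn n\<^esub>)) u) = (word_prod G u, \<one>\<^bsub>Zn n\<^esub>)" for u
    by (induction u) (auto simp: one_Zn mult_Zn intro!: restrict_ext)
  have sub: "set ?w \<subseteq> symmetrization (GZ n) (prod_gens G S n)" using w prod_gens_sym by auto
  obtain u where u: "set u \<subseteq> symmetrization (GZ n) (prod_gens G S n)"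
     "word_prod (GZ n) u = (\<one>, Zn_trunc n n v)" "length u = (\<Sum>i<n. nat \<bar>v i\<bar>)"
    using word_Zn[OF x(3), of n] by auto
  have v: "Zn_trunc n n v = v" using x(3) by (force simp: Zn_trunc_def carrier_Zn PiE_def extensional_def)
  have "word_prod (GZ n) (?w @ u) = (g, \<one>\<^bsub>Zn n\<^esub>) \<otimes>\<^bsub>GZ n\<^esub> (\<one>, v)"
  proof -
    have "set ?w \<subseteq> carrier (GZ n)" "set u \<subseteq> carrier (GZ n)"
      using sub u(1) symmetrization_carrier[OF group_GZ prod_gens_carrier] by blast+
    from word_prod_append[OF group_GZ this] show ?thesis by (simp only: u(2) 1 w(3) v)
  qed
  also have "\<dots> = x" using x monoid.l_one[OF group.is_monoid[OF group_Zn] x(3)] by simp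
  finally show ?thesis using sub u w x
    by (intro exI[of _ "?w @ u"]) (auto simp: prod_length_def)
qed

lemma prod_gens_generate: "finite_generating_set (GZ n) (prod_gens G S n)"
proof -
  interpret P: group "GZ n" by (rule group_GZ)
  have sg: "symmetrization (GZ n) (prod_gens G S n) \<subseteq> generate (GZ n) (prod_gens G S n)"
    by (auto simp: symmetrization_def intro: generate.intros)
  have "word_prod (GZ n) w \<in> generate (GZ n) (prod_gens G S n)"
    if "set w \<subseteq> symmetrization (GZ n) (prod_gens G S n)" for w
    using that
  proof (induction w)
    case Nil then show ?case using generate.one[of "GZ n"] by simp
  next
    case (Cons a w)
    then show ?case using generate.eng[of a "GZ n" _ "word_prod (GZ n) w"] sg by (auto simp del: mult_DirProd)
  qed
  then have "carrier (GZ n) \<subseteq> generate (GZ n) (prod_gens G S n)" using word_GZ by blast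
  then show ?thesis
    using P.generate_incl[OF prod_gens_carrier] prod_gens_carrier fgs
    by (auto simp: finite_generating_set_def prod_gens_def)
qed

lemma prod_length_mult:
  assumes "x \<in> carrier (GZ n)" "y \<in> carrier (GZ n)"
  shows "prod_length G S n (x \<otimes>\<^bsub>GZ n\<^esub> y) \<le> prod_length G S n x + prod_length G S n y"
proof -
  have "(\<Sum>i<n. nat \<bar>snd (x \<otimes>\<^bsub>GZ n\<^esub> y) i\<bar>) \<le> (\<Sum>i<n. nat \<bar>snd x i\<bar> + nat \<bar>snd y i\<bar>)"
    by (intro sum_mono) (auto simp: mult_GZ mult_Zn)
  moreover have "wl (fst x \<otimes> fst y) \<le> wl (fst x) + wl (fst y)"
    using assms by (intro wl_mult) auto
  ultimately show ?thesis by (simp add: prod_length_def mult_GZ sum.distrib)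
qed

text \<open>\<open>wl_bound\<close> is used twice: for the length of \<open>T\<close> along words in
  \<open>prod_gens\<close>, and for \<open>prod_length\<close> along words in \<open>T\<close>. In
  the first case \<open>word_GZ\<close> bounds the length of the word by
  \<open>prod_length\<close>.\<close>

lemma word_length_GZ:
  assumes "finite_generating_set (GZ n) T"
  obtains C :: real where "C \<ge> 1"
    "\<And>x. x \<in> carrier (GZ n) \<Longrightarrow> real (word_length (GZ n) T x) \<le> C * prod_length G S n x"
    "\<And>x. x \<in> carrier (GZ n) \<Longrightarrow> real (prod_length G S n x) \<le> C * word_length (GZ n) T x"
proof -
  interpret P: group "GZ n" by (rule group_GZ)
  interpret T: fg_group "GZ n" T by unfold_locales fact
  interpret T0: fg_group "GZ n" "prod_gens G S n" by unfold_locales (rule prod_gens_generate)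
  \<comment> \<open>Inserting 1 keeps the set nonempty and the constant at least 1.\<close>
  define C1 where "C1 = Max (insert 1 ((\<lambda>x. real (T.wl x)) ` symmetrization (GZ n) (prod_gens G S n)))"
  define C2 where "C2 = Max (insert 1 ((\<lambda>x. real (prod_length G S n x)) ` symmetrization (GZ n) T))"
  have 1: "real (T.wl x) \<le> C1 * T0.wl x" if "x \<in> carrier (GZ n)" for x
    by (rule T0.wl_bound[of "\<lambda>x. real (T.wl x)"])
      (use that T.wl_mult T0.finite_sym in \<open>auto simp: C1_def simp del: DirProd_def mult_DirProd one_DirProd simp flip: of_nat_add intro!: Max_ge\<close>)
  have 2: "real (prod_length G S n x) \<le> C2 * T.wl x" if "x \<in> carrier (GZ n)" for x
    by (rule T.wl_bound[of "\<lambda>x. real (prod_length G S n x)"])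
      (use that prod_length_mult T.finite_sym in \<open>auto simp: C2_def prod_length_def[of G S n "(\<one>, \<lambda>i\<in>{..<n}. 0)"] one_Zn simp del: mult_DirProd simp flip: of_nat_add intro!: Max_ge\<close>)
  have 3: "T0.wl x \<le> prod_length G S n x" if x: "x \<in> carrier (GZ n)" for x
    using word_GZ[OF x] T0.wl_le by metis
  have C: "C1 \<ge> 1" "C2 \<ge> 1"
    unfolding C1_def C2_def using T0.finite_sym T.finite_sym by (auto intro: Max_ge)
  show ?thesis
  proof (rule that[of "max C1 C2"])
    fix x assume x: "x \<in> carrier (GZ n)"
    have "real (T.wl x) \<le> C1 * T0.wl x" by (rule 1[OF x])
    also have "\<dots> \<le> max C1 C2 * real (prod_length G S n x)"
      using 3[OF x] C by (intro mult_mono) auto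
    finally show "real (T.wl x) \<le> max C1 C2 * real (prod_length G S n x)" .
    have "C2 * real (T.wl x) \<le> max C1 C2 * real (T.wl x)" by (intro mult_right_mono) auto
    with 2[OF x] show "real (prod_length G S n x) \<le> max C1 C2 * real (T.wl x)" by linarith
  qed (use C in auto)
qed

end

section \<open>Warped metrics over bi-Lipschitz atlases\<close>

definition cdist :: "nat \<Rightarrow> (nat \<Rightarrow> real) \<Rightarrow> (nat \<Rightarrow> real) \<Rightarrow> real" where
  "cdist n u v = L2_set (\<lambda>i. u i - v i) {..<n}"

text \<open>The points are required to vanish from index \<open>n\<close> on because
  \<open>cdist\<close> does not see those coordinates; this makes it a genuine metric on the
  ball.\<close>

definition coord_ball :: "nat \<Rightarrow> (nat \<Rightarrow> real) \<Rightarrow> real \<Rightarrow> (nat \<Rightarrow> real) set" where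
  "coord_ball n p r = {v. (\<forall>i\<ge>n. v i = 0) \<and> cdist n p v \<le> r}"

lemma cdist_nonneg [simp]: "0 \<le> cdist n u v"
  by (simp add: cdist_def L2_set_nonneg)

lemma cdist_same [simp]: "cdist n u u = 0"
  by (simp add: cdist_def L2_set_def)

lemma cdist_commute: "cdist n u v = cdist n v u"
  unfolding cdist_def L2_set_def by (simp add: power2_commute)

lemma cdist_triangle: "cdist n u w \<le> cdist n u v + cdist n v w"
  using L2_set_triangle_ineq[of "\<lambda>i. u i - v i" "\<lambda>i. v i - w i" "{..<n}"] by (simp add: cdist_def)

lemma cdist_coord: "i < n \<Longrightarrow> \<bar>u i - v i\<bar> \<le> cdist n u v"
  unfolding cdist_def using member_le_L2_set[of "{..<n}" i "\<lambda>i. \<bar>u i - v i\<bar>"]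
  by (simp add: L2_set_def)

lemma cdist_le_sum: "cdist n u v \<le> (\<Sum>i<n. \<bar>u i - v i\<bar>)"
  unfolding cdist_def by (rule L2_set_le_sum_abs)

lemma sum_le_cdist: "(\<Sum>i<n. \<bar>u i - v i\<bar>) \<le> n * cdist n u v"
  using sum_bounded_above[of "{..<n}" "\<lambda>i. \<bar>u i - v i\<bar>" "cdist n u v"] cdist_coord by simp

lemma cdist_eq_0D: "cdist n u v = 0 \<Longrightarrow> i < n \<Longrightarrow> u i = v i"
  using cdist_coord[of i n u v] by simp

text \<open>
  The Riemannian distance is only bounded from below through test functions: \<open>lip_dist\<close> is a
  pseudometric below \<open>d\<close> for every \<open>d\<close>, so that the metric axioms for \<^const>\<open>riemannian_dist\<close> are not
  needed. The bound \<open>1\<close> on the test functions keeps it finite across components.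
\<close>

definition lip_class :: "'a set \<Rightarrow> ('a \<Rightarrow> 'a \<Rightarrow> ennreal) \<Rightarrow> ('a \<Rightarrow> real) set" where
  "lip_class X d = {u. (\<forall>x\<in>X. \<bar>u x\<bar> \<le> 1) \<and> (\<forall>x\<in>X. \<forall>y\<in>X. ennreal \<bar>u x - u y\<bar> \<le> d x y)}"

definition lip_dist :: "'a set \<Rightarrow> ('a \<Rightarrow> 'a \<Rightarrow> ennreal) \<Rightarrow> 'a \<Rightarrow> 'a \<Rightarrow> real" where
  "lip_dist X d x y = (SUP u\<in>lip_class X d. \<bar>u x - u y\<bar>)"

lemma lip_class_0: "(\<lambda>_. 0) \<in> lip_class X d"
  by (simp add: lip_class_def)

lemma lip_dist_bdd:
  assumes "x \<in> X" "y \<in> X"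
  shows "bdd_above ((\<lambda>u. \<bar>u x - u y\<bar>) ` lip_class X d)"
proof (rule bdd_aboveI2)
  fix u assume "u \<in> lip_class X d"
  then have "\<bar>u x\<bar> \<le> 1" "\<bar>u y\<bar> \<le> 1" using assms by (auto simp: lip_class_def)
  then show "\<bar>u x - u y\<bar> \<le> 2" by linarith
qed

lemma lip_dist_ge:
  "x \<in> X \<Longrightarrow> y \<in> X \<Longrightarrow> u \<in> lip_class X d \<Longrightarrow> \<bar>u x - u y\<bar> \<le> lip_dist X d x y"
  unfolding lip_dist_def by (rule cSUP_upper[OF _ lip_dist_bdd])

lemma lip_dist_leI:
  assumes "\<And>u. u \<in> lip_class X d \<Longrightarrow> \<bar>u x - u y\<bar> \<le> b"
  shows "lip_dist X d x y \<le> b"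
  unfolding lip_dist_def using lip_class_0 by (intro cSUP_least assms) blast+

lemma lip_dist_nonneg: "x \<in> X \<Longrightarrow> y \<in> X \<Longrightarrow> 0 \<le> lip_dist X d x y"
  using lip_dist_ge[OF _ _ lip_class_0, of x X y d] by simp

lemma lip_dist_same [simp]: "lip_dist X d x x = 0"
proof -
  have "(\<lambda>u. \<bar>u x - u x\<bar>) ` lip_class X d = {0 :: real}" using lip_class_0[of X d] by auto
  then show ?thesis unfolding lip_dist_def by simp
qed

lemma lip_dist_commute: "lip_dist X d x y = lip_dist X d y x"
  by (simp add: lip_dist_def abs_minus_commute)

lemma lip_dist_triangle:
  assumes "x \<in> X" "y \<in> X" "z \<in> X"
  shows "lip_dist X d x z \<le> lip_dist X d x y + lip_dist X d y z"
proof (rule lip_dist_leI)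
  fix u assume u: "u \<in> lip_class X d"
  show "\<bar>u x - u z\<bar> \<le> lip_dist X d x y + lip_dist X d y z"
    using lip_dist_ge[OF assms(1,2) u] lip_dist_ge[OF assms(2,3) u] by linarith
qed

lemma lip_dist_le:
  assumes "x \<in> X" "y \<in> X"
  shows "ennreal (lip_dist X d x y) \<le> d x y"
proof (cases "d x y")
  case (real b)
  have "lip_dist X d x y \<le> b"
  proof (rule lip_dist_leI)
    fix u assume "u \<in> lip_class X d"
    then have "ennreal \<bar>u x - u y\<bar> \<le> ennreal b" using assms real unfolding lip_class_def by force
    then show "\<bar>u x - u y\<bar> \<le> b" using real by simp
  qed
  then show ?thesis using real by (simp add: ennreal_leI)
qed simp

lemma lip_dist_le_real:
  assumes "x \<in> X" "y \<in> X" "d x y \<le> ennreal b" "0 \<le> b"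
  shows "lip_dist X d x y \<le> b"
proof -
  have "ennreal (lip_dist X d x y) \<le> ennreal b"
    using lip_dist_le[OF assms(1,2)] assms(3) by (rule order_trans)
  then show ?thesis using assms(4) by simp
qed

text \<open>Composition with an isometric self-map preserves the class of test functions.\<close>

lemma lip_dist_contract:
  assumes f: "f \<in> X \<rightarrow> X" and d: "\<And>x y. x \<in> X \<Longrightarrow> y \<in> X \<Longrightarrow> d (f x) (f y) = d x y" and x: "x \<in> X" "y \<in> X"
  shows "lip_dist X d (f x) (f y) \<le> lip_dist X d x y"
proof (rule lip_dist_leI)
  fix u assume u: "u \<in> lip_class X d"
  have "u \<circ> f \<in> lip_class X d"
  proof -
    have "ennreal \<bar>u (f a) - u (f b)\<bar> \<le> d a b" if "a \<in> X" "b \<in> X" for a b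
    proof -
      have "f a \<in> X" "f b \<in> X" using f that by auto
      then have "ennreal \<bar>u (f a) - u (f b)\<bar> \<le> d (f a) (f b)" using u by (auto simp: lip_class_def)
      then show ?thesis using d[OF that] by simp
    qed
    then show ?thesis using u f by (auto simp: lip_class_def Pi_iff)
  qed
  from lip_dist_ge[OF x this] show "\<bar>u (f x) - u (f y)\<bar> \<le> lip_dist X d x y" by simp
qed

text \<open>All that is kept of a compact Riemannian manifold: finitely many parametrized balls
  whose concentric halves cover. Upper bounds are for \<open>d\<close>, lower bounds for
  \<open>lip_dist\<close>, which is the smaller of the two. \<open>capture\<close> is the global
  condition: \<open>lip_ge\<close> compares points of one chart, and \<open>capture\<close> keeps
  points outside the double ball away from the inner one.\<close>

locale bilip_atlas =
  fixes X :: "'x set" and d :: "'x \<Rightarrow> 'x \<Rightarrow> ennreal" and n :: nat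
    and J :: "'j set" and p :: "'j \<Rightarrow> nat \<Rightarrow> real" and r :: "'j \<Rightarrow> real" and \<psi> :: "'j \<Rightarrow> (nat \<Rightarrow> real) \<Rightarrow> 'x"
    and L :: real
  assumes X_ne: "X \<noteq> {}" and finite_J: "finite J" and L1: "L \<ge> 1"
    and r_pos: "j \<in> J \<Longrightarrow> r j > 0"
    and p_supp: "j \<in> J \<Longrightarrow> i \<ge> n \<Longrightarrow> p j i = 0"
    and psi_X: "j \<in> J \<Longrightarrow> v \<in> coord_ball n (p j) (2 * r j) \<Longrightarrow> \<psi> j v \<in> X"
    and cover: "x \<in> X \<Longrightarrow> \<exists>j\<in>J. \<exists>v\<in>coord_ball n (p j) (r j). x = \<psi> j v"
    and d_le: "j \<in> J \<Longrightarrow> u \<in> coord_ball n (p j) (2 * r j) \<Longrightarrow> v \<in> coord_ball n (p j) (2 * r j) \<Longrightarrow>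
       d (\<psi> j u) (\<psi> j v) \<le> ennreal (L * cdist n u v)"
    and lip_ge: "j \<in> J \<Longrightarrow> u \<in> coord_ball n (p j) (2 * r j) \<Longrightarrow> v \<in> coord_ball n (p j) (2 * r j) \<Longrightarrow>
       cdist n u v \<le> L * lip_dist X d (\<psi> j u) (\<psi> j v)"
    and capture: "j \<in> J \<Longrightarrow> u \<in> coord_ball n (p j) (r j) \<Longrightarrow> y \<in> X \<Longrightarrow> L * lip_dist X d (\<psi> j u) y < r j \<Longrightarrow>
       \<exists>v\<in>coord_ball n (p j) (2 * r j). y = \<psi> j v"
begin

abbreviation D where "D \<equiv> lip_dist X d"

lemma r0: obtains r0 where "r0 > 0" "\<And>j. j \<in> J \<Longrightarrow> r0 \<le> r j"
proof (rule that[of "Min (insert 1 (r ` J))"])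
  show "0 < Min (insert 1 (r ` J))" using finite_J r_pos by (subst Min_gr_iff) auto
qed (use finite_J in auto)

lemma D_le:
  assumes "j \<in> J" "u \<in> coord_ball n (p j) (2 * r j)" "v \<in> coord_ball n (p j) (2 * r j)"
  shows "D (\<psi> j u) (\<psi> j v) \<le> L * cdist n u v"
  using assms L1 by (intro lip_dist_le_real psi_X d_le) auto

lemma coord_ball_mono: "v \<in> coord_ball n q s \<Longrightarrow> s \<le> s' \<Longrightarrow> v \<in> coord_ball n q s'"
  by (auto simp: coord_ball_def)

lemma coord_ball_double: "j \<in> J \<Longrightarrow> v \<in> coord_ball n (p j) (r j) \<Longrightarrow> v \<in> coord_ball n (p j) (2 * r j)"
  using r_pos[of j] coord_ball_mono[of v "p j" "r j" "2 * r j"] by linarith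

text \<open>\<open>capture\<close> puts both points into one chart, where \<open>lip_ge\<close>
  separates them.\<close>

lemma D_eq_0: "x \<in> X \<Longrightarrow> y \<in> X \<Longrightarrow> D x y = 0 \<Longrightarrow> x = y"
proof -
  assume x: "x \<in> X" and y: "y \<in> X" and 0: "D x y = 0"
  obtain j u where j: "j \<in> J" "u \<in> coord_ball n (p j) (r j)" "x = \<psi> j u" using cover[OF x] by blast
  obtain v where v: "v \<in> coord_ball n (p j) (2 * r j)" "y = \<psi> j v"
    using capture[OF j(1,2) y] 0 j r_pos[of j] by auto
  have "cdist n u v = 0" using lip_ge[OF j(1) coord_ball_double[OF j(1,2)] v(1)] 0 j v by (intro antisym) auto
  then have "u i = v i" for i using cdist_eq_0D[of n u v i] v(1) j(2) by (cases "i < n") (auto simp: coord_ball_def)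
  then have "u = v" by auto
  then show "x = y" using j v by simp
qed

end

section \<open>Isometric actions and the warped level metric\<close>

locale bilip_action = bilip_atlas X d n J p r \<psi> L + fg_group G S
  for X :: "'x set" and d n and J :: "'j set" and p r \<psi> L and G :: "('g, 'c) monoid_scheme" (structure) and S +
  fixes \<alpha> :: "'g \<Rightarrow> 'x \<Rightarrow> 'x"
  assumes act: "group_action G X \<alpha>" and sym: "symmetric_set G S"
    and d_inv: "g \<in> carrier G \<Longrightarrow> x \<in> X \<Longrightarrow> y \<in> X \<Longrightarrow> d (\<alpha> g x) (\<alpha> g y) = d x y"
begin

lemma act_X: "g \<in> carrier G \<Longrightarrow> x \<in> X \<Longrightarrow> \<alpha> g x \<in> X"
  using group_action.element_image[OF act] by blast

lemma act_one: "x \<in> X \<Longrightarrow> \<alpha> \<one> x = x"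
  using group_action.id_eq_one[OF act] by (metis restrict_apply')

lemma act_mult: "g \<in> carrier G \<Longrightarrow> h \<in> carrier G \<Longrightarrow> x \<in> X \<Longrightarrow> \<alpha> (g \<otimes> h) x = \<alpha> g (\<alpha> h x)"
  using group_action.composition_rule[OF act] by blast

lemma act_inv: "g \<in> carrier G \<Longrightarrow> x \<in> X \<Longrightarrow> \<alpha> (inv g) (\<alpha> g x) = x"
  using act_mult[of "inv g" g x] act_one by simp

lemma act_inv': "g \<in> carrier G \<Longrightarrow> x \<in> X \<Longrightarrow> \<alpha> g (\<alpha> (inv g) x) = x"
  using act_mult[of g "inv g" x] act_one by simp

lemma D_inv:
  assumes "g \<in> carrier G" "x \<in> X" "y \<in> X"
  shows "D (\<alpha> g x) (\<alpha> g y) = D x y"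
proof (rule antisym)
  have c: "D (\<alpha> h x) (\<alpha> h y) \<le> D x y" if "h \<in> carrier G" "x \<in> X" "y \<in> X" for h x y
    using that act_X d_inv by (intro lip_dist_contract) auto
  show "D (\<alpha> g x) (\<alpha> g y) \<le> D x y" using c assms by blast
  show "D x y \<le> D (\<alpha> g x) (\<alpha> g y)"
    using c[of "inv g" "\<alpha> g x" "\<alpha> g y"] assms act_X act_inv by simp
qed

lemma D_shift: "g \<in> carrier G \<Longrightarrow> x \<in> X \<Longrightarrow> y \<in> X \<Longrightarrow> D (\<alpha> g x) y = D x (\<alpha> (inv g) y)"
  using D_inv[of "inv g" "\<alpha> g x" y] act_X act_inv by simp

lemma sym_S: "symmetrization G S = S"
  using sym by (auto simp: symmetric_set_def symmetrization_def)

text \<open>Abstract version of \<open>warped_admissible\<close>, with \<open>X\<close> and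
  \<open>d\<close> in place of a manifold; \<open>warped\<close> likewise abstracts
  \<open>warped_level_metric\<close>.\<close>

definition admissible :: "real \<Rightarrow> ('x \<Rightarrow> 'x \<Rightarrow> real) \<Rightarrow> bool" where
  "admissible t \<delta> \<longleftrightarrow> Metric_space X \<delta> \<and> (\<forall>x\<in>X. \<forall>y\<in>X. ennreal (\<delta> x y) \<le> ennreal t * d x y) \<and>
     (\<forall>x\<in>X. \<forall>s\<in>S. \<delta> x (\<alpha> s x) \<le> 1)"

definition warped :: "real \<Rightarrow> ('x \<Rightarrow> 'x \<Rightarrow> real) \<Rightarrow> bool" where
  "warped t \<delta> \<longleftrightarrow> admissible t \<delta> \<and> (\<forall>\<delta>'. admissible t \<delta>' \<longrightarrow> (\<forall>x\<in>X. \<forall>y\<in>X. \<delta>' x y \<le> \<delta> x y))"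

lemma warped_metric: "warped t \<delta> \<Longrightarrow> Metric_space X \<delta>"
  by (simp add: warped_def admissible_def)

text \<open>A chain from \<open>x\<close> to \<open>\<alpha> g x\<close> applies the letters of a
  shortest word one after another, each at cost at most 1; a single jump at cost
  \<open>t * b\<close> follows.\<close>

lemma warped_le:
  fixes \<delta> :: "'x \<Rightarrow> 'x \<Rightarrow> real" and t b :: real
  assumes w: "warped t \<delta>" and t: "t \<ge> 0" and g: "g \<in> carrier G" and x: "x \<in> X" and y: "y \<in> X"
    and b: "d (\<alpha> g x) y \<le> ennreal b" "b \<ge> 0"
  shows "\<delta> x y \<le> wl g + t * b"
proof -
  have adm: "admissible t \<delta>" using w by (simp add: warped_def)
  interpret M: Metric_space X \<delta> using warped_metric[OF w] .
  have *: "\<delta> x (\<alpha> (word_prod G w) x) \<le> length w" if "set w \<subseteq> S" for w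
    using that
  proof (induction w)
    case Nil then show ?case using act_one[OF x] M.zero[OF x x] by simp
  next
    case (Cons a w)
    have c: "a \<in> carrier G" "word_prod G w \<in> carrier G"
      using Cons S_carrier word_prod_closed[OF is_group, of w] by auto
    have "\<delta> x (\<alpha> (a \<otimes> word_prod G w) x) \<le> \<delta> x (\<alpha> (word_prod G w) x) + \<delta> (\<alpha> (word_prod G w) x) (\<alpha> a (\<alpha> (word_prod G w) x))"
      using c x act_X act_mult by (simp add: M.triangle)
    also have "\<dots> \<le> real (length w) + 1"
      using Cons adm c act_X[OF c(2) x] unfolding admissible_def by (intro add_mono) auto
    finally show ?case by simp
  qed
  obtain w where "length w = wl g" "set w \<subseteq> S" "word_prod G w = g"
    using wl_word[OF g] sym_S by metis
  then have 1: "\<delta> x (\<alpha> g x) \<le> wl g" using *[of w] by simp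
  have "ennreal (\<delta> (\<alpha> g x) y) \<le> ennreal t * d (\<alpha> g x) y"
    using adm g x y act_X unfolding admissible_def by blast
  also have "\<dots> \<le> ennreal t * ennreal b" using b by (intro mult_left_mono) auto
  also have "\<dots> = ennreal (t * b)" using t b by (simp add: ennreal_mult)
  finally have "\<delta> (\<alpha> g x) y \<le> t * b" using t b by simp
  moreover have "\<delta> x y \<le> \<delta> x (\<alpha> g x) + \<delta> (\<alpha> g x) y" using g x y act_X by (simp add: M.triangle)
  ultimately show ?thesis using 1 by linarith
qed

text \<open>The infimum of \<open>wl g + t * D (\<alpha> g x) y\<close> over \<open>g\<close> is itself admissible, since the action is isometric.\<close>

lemma warped_ge:
  fixes \<delta> :: "'x \<Rightarrow> 'x \<Rightarrow> real" and t :: real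
  assumes w: "warped t \<delta>" and t: "t > 0" and x: "x \<in> X" and y: "y \<in> X"
  shows "\<exists>g\<in>carrier G. wl g + t * D (\<alpha> g x) y \<le> \<delta> x y + 1"
proof -
  define f where "f x y g = real (wl g) + t * D (\<alpha> g x) y" for x y g
  \<comment> \<open>The value 0 off \<open>X\<close> is chosen because the metric axioms ask for
    nonnegativity and symmetry on the whole type.\<close>
  define \<delta>' where "\<delta>' x y = (if x \<in> X \<and> y \<in> X then INF g\<in>carrier G. f x y g else 0)" for x y
  have f0: "f x y g \<ge> 0" if "x \<in> X" "y \<in> X" "g \<in> carrier G" for x y g
    using that t lip_dist_nonneg[of "\<alpha> g x" X y d] act_X by (auto simp: f_def)
  have bdd: "bdd_below (f x y ` carrier G)" if "x \<in> X" "y \<in> X" for x y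
    using f0[OF that] by (intro bdd_belowI2) auto
  have low: "\<delta>' x y \<le> f x y g" if "x \<in> X" "y \<in> X" "g \<in> carrier G" for x y g
    unfolding \<delta>'_def using that bdd by (auto intro!: cINF_lower)
  have great: "b \<le> \<delta>' x y" if "x \<in> X" "y \<in> X" "\<And>g. g \<in> carrier G \<Longrightarrow> b \<le> f x y g" for x y b
    unfolding \<delta>'_def using that by (auto intro!: cINF_greatest)
  have approx: "\<exists>g\<in>carrier G. f x y g < \<delta>' x y + e" if "x \<in> X" "y \<in> X" "e > 0" for x y e
    using great[of x y "\<delta>' x y + e"] that by (meson less_add_same_cancel1 not_le)
  have nonneg: "0 \<le> \<delta>' x y" if "x \<in> X" "y \<in> X" for x y
    using f0[OF that] that by (intro great)
  have comm: "\<delta>' x y \<le> \<delta>' y x" if xy: "x \<in> X" "y \<in> X" for x y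
  proof (rule great[OF xy(2,1)])
    fix g assume g: "g \<in> carrier G"
    have "f x y (inv g) = f y x g"
      using g xy D_shift[of "inv g" x y] by (simp add: f_def lip_dist_commute[of X d x])
    then show "\<delta>' x y \<le> f y x g" using low[OF xy inv_closed[OF g]] by simp
  qed
  have tri: "\<delta>' x z \<le> \<delta>' x y + \<delta>' y z" if xyz: "x \<in> X" "y \<in> X" "z \<in> X" for x y z
  proof (rule field_le_epsilon)
    fix e :: real assume e: "e > 0"
    obtain g h where g: "g \<in> carrier G" "f x y g < \<delta>' x y + e / 2"
      and h: "h \<in> carrier G" "f y z h < \<delta>' y z + e / 2"
      using approx[OF xyz(1,2), of "e / 2"] approx[OF xyz(2,3), of "e / 2"] e by auto
    \<comment> \<open>Performing \<open>g\<close> and then \<open>h\<close> leads from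
      \<open>x\<close> towards \<open>z\<close>; as \<open>\<alpha> h\<close> is isometric, the
      first error is carried over without growing.\<close>
    have "D (\<alpha> (h \<otimes> g) x) z \<le> D (\<alpha> h (\<alpha> g x)) (\<alpha> h y) + D (\<alpha> h y) z"
      using g h xyz act_X act_mult by (simp add: lip_dist_triangle)
    also have "\<dots> = D (\<alpha> g x) y + D (\<alpha> h y) z" using g h xyz act_X by (simp add: D_inv)
    finally have "t * D (\<alpha> (h \<otimes> g) x) z \<le> t * D (\<alpha> g x) y + t * D (\<alpha> h y) z"
      using t by (simp flip: distrib_left)
    moreover have "real (wl (h \<otimes> g)) \<le> wl h + wl g" using wl_mult[OF h(1) g(1)] by (simp flip: of_nat_add)
    ultimately have "f x z (h \<otimes> g) \<le> f x y g + f y z h" unfolding f_def by linarith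
    then show "\<delta>' x z \<le> \<delta>' x y + \<delta>' y z + e"
      using low[OF xyz(1,3) m_closed[OF h(1) g(1)]] g h by linarith
  qed
  have le: "\<delta>' x y \<le> t * D x y" if "x \<in> X" "y \<in> X" for x y
    using low[OF that one_closed] act_one[OF that(1)] by (simp add: f_def)
  have zero: "x = y" if xy: "x \<in> X" "y \<in> X" and 0: "\<delta>' x y = 0" for x y
  proof -
    have "D x y \<le> 0 + e" if e: "e > 0" for e
    proof -
      \<comment> \<open>A value below 1 leaves room only for the unit, whose cost is
        \<open>t * D x y\<close>.\<close>
      obtain g where g: "g \<in> carrier G" "f x y g < \<delta>' x y + min 1 (t * e)"
        using approx[OF xy, of "min 1 (t * e)"] e t by auto
      then have "real (wl g) < 1" using t 0 lip_dist_nonneg[of "\<alpha> g x" X y d] act_X xy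
        unfolding f_def by (smt (verit) mult_nonneg_nonneg)
      then have "g = \<one>" using wl_eq_0[OF g(1)] by simp
      then have "t * D x y < t * e" using g 0 act_one xy by (simp add: f_def)
      then show ?thesis using t by simp
    qed
    then have "D x y \<le> 0" by (rule field_le_epsilon)
    then show ?thesis using D_eq_0[OF xy] lip_dist_nonneg[OF xy, of d] by linarith
  qed
  have "Metric_space X \<delta>'"
  proof
    show "0 \<le> \<delta>' x y" for x y using nonneg by (auto simp: \<delta>'_def)
    show "\<delta>' x y = \<delta>' y x" for x y
    proof (cases "x \<in> X \<and> y \<in> X")
      case True then show ?thesis using comm[of x y] comm[of y x] by auto
    qed (auto simp: \<delta>'_def)
    show "\<delta>' x y = 0 \<longleftrightarrow> x = y" if "x \<in> X" "y \<in> X" for x y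
      using zero[OF that] le[OF that] nonneg[OF that] by auto
  qed (use tri in auto)
  moreover have "ennreal (\<delta>' x y) \<le> ennreal t * d x y" if "x \<in> X" "y \<in> X" for x y
  proof -
    have "ennreal (\<delta>' x y) \<le> ennreal (t * D x y)" using le[OF that] by (intro ennreal_leI)
    also have "\<dots> = ennreal t * ennreal (D x y)" using t lip_dist_nonneg[OF that] by (simp add: ennreal_mult)
    also have "\<dots> \<le> ennreal t * d x y" using lip_dist_le[OF that] by (intro mult_left_mono) auto
    finally show ?thesis .
  qed
  moreover have "\<delta>' x (\<alpha> s x) \<le> 1" if "x \<in> X" "s \<in> S" for x s
  proof -
    have "s \<in> carrier G" "real (wl s) \<le> 1" using that S_carrier wl_gen[of s] sym_S by auto
    then show ?thesis using low[of x "\<alpha> s x" s] that act_X by (simp add: f_def)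
  qed
  ultimately have "admissible t \<delta>'" by (simp add: admissible_def)
  then have "\<delta>' x y \<le> \<delta> x y" using w x y by (simp add: warped_def)
  \<comment> \<open>The infimum need not be attained, whence the slack 1.\<close>
  then show ?thesis using approx[OF x y, of 1] unfolding f_def by force
qed

text \<open>One parameter governs both length and rescaled displacement, which makes the condition
  monotone in \<open>R\<close>; the thresholds of two models can then be merged by a
  maximum.\<close>

definition good :: "real \<Rightarrow> real \<Rightarrow> 'x \<Rightarrow> bool" where
  "good t R x \<longleftrightarrow> (\<forall>g\<in>carrier G. g \<noteq> \<one> \<longrightarrow> real (wl g) \<le> R \<longrightarrow> t * D (\<alpha> g x) x > R)"

lemma good_mono: "good t R x \<Longrightarrow> R' \<le> R \<Longrightarrow> good t R' x"
  unfolding good_def by fastforce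

text \<open>
  Around a good point \<open>x = \<psi> j u\<close> the model map is \<open>(g, v) \<mapsto> g\<^sup>-\<^sup>1 \<cdot> \<psi> j (u + v / t)\<close>; goodness excludes
  that the infimum in the warped metric is attained by an element other than the obvious one.
\<close>

lemma local_model_good:
  assumes T: "finite_generating_set (GZ n) T"
  shows "\<exists>A::real. A \<ge> 1 \<and> (\<forall>s::real. \<exists>R::real. \<forall>t::real. t \<ge> R \<longrightarrow> (\<forall>(\<delta> :: 'x \<Rightarrow> 'x \<Rightarrow> real) x. x \<in> X \<longrightarrow> warped t \<delta> \<longrightarrow> good t R x \<longrightarrow>
     (\<exists>\<phi>. local_model (GZ n) T A s X \<delta> x \<phi>)))"
proof -
  interpret P: fg_group "GZ n" T by (intro fg_group.intro fg_group_axioms.intro group_GZ T)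
  obtain C where C1: "C \<ge> 1"
    and C: "\<And>x. x \<in> carrier (GZ n) \<Longrightarrow> real (P.wl x) \<le> C * real (prod_length G S n x)"
    "\<And>x. x \<in> carrier (GZ n) \<Longrightarrow> real (prod_length G S n x) \<le> C * real (P.wl x)"
    using word_length_GZ[OF T] by metis
  obtain r0 where r0: "r0 > 0" "\<And>j. j \<in> J \<Longrightarrow> r0 \<le> r j" using r0 by blast
  \<comment> \<open>\<open>C\<close> compares word length with \<open>prod_length\<close>,
    \<open>L\<close> is the distortion of the charts, \<open>n + 1\<close> counts the coordinates
    together with the group part, and 2 pays for rounding to the lattice.\<close>
  define A where "A = 2 * C * L * (n + 1)"
  have CL: "C * L \<ge> 1" using C1 L1 mult_mono[of 1 C 1 L] by simp
  have A1: "A \<ge> 1" unfolding A_def using mult_mono[of 1 "2 * C * L" 1 "real (n + 1)"] CL by simp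
  show ?thesis
  proof (rule exI[of _ A], intro conjI A1 allI)
    fix s :: real
    \<comment> \<open>Bounds \<open>prod_length\<close> on the ball of radius \<open>s\<close>; the
      maximum covers negative \<open>s\<close>.\<close>
    define s1 where "s1 = C * max 0 s"
    have s1: "s1 \<ge> 0" using C1 by (simp add: s1_def)
    \<comment> \<open>\<open>4 * s1\<close> bounds the length of the element \<open>?k\<close> below
      and \<open>2 * s1 + 2 * L * s1\<close> the rescaled displacement it would cause;
      \<open>s1 / r0\<close> keeps the lattice points in the double ball, and the remaining quotient
      makes \<open>capture\<close> applicable.\<close>
    define R where "R = 4 * s1 + 2 * s1 + 2 * L * s1 + s1 / r0 + (L * max 0 s + 1) / r0 + 1"
    have nn: "0 \<le> L * s1" "0 \<le> s1 / r0" "0 \<le> (L * max 0 s + 1) / r0" using s1 L1 r0 by auto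
    have R: "4 * s1 \<le> R" "2 * s1 + 2 * L * s1 \<le> R" "s1 / r0 < R" "(L * max 0 s + 1) / r0 \<le> R" "R \<ge> 1"
      unfolding R_def using s1 nn by auto
    show "\<exists>R::real. \<forall>t::real. t \<ge> R \<longrightarrow> (\<forall>(\<delta> :: 'x \<Rightarrow> 'x \<Rightarrow> real) x. x \<in> X \<longrightarrow> warped t \<delta> \<longrightarrow> good t R x \<longrightarrow>
       (\<exists>\<phi>. local_model (GZ n) T A s X \<delta> x \<phi>))"
    proof (intro exI[of _ R] allI impI)
      fix t :: real and \<delta> :: "'x \<Rightarrow> 'x \<Rightarrow> real" and x assume t: "R \<le> t" and x: "x \<in> X" and w: "warped t \<delta>" and good: "good t R x"
      have t0: "t > 0" using t R by linarith
      interpret M: Metric_space X \<delta> using warped_metric[OF w] .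
      obtain j u where j: "j \<in> J" and u: "u \<in> coord_ball n (p j) (r j)" and xu: "x = \<psi> j u"
        using cover[OF x] by blast
      \<comment> \<open>The lattice of mesh \<open>1 / t\<close> based at the coordinates
        \<open>u\<close> of \<open>x\<close>.\<close>
      define q where "q v i = (if i < n then u i + real_of_int (v i) / t else 0)" for v :: "nat \<Rightarrow> int" and i
      have qd: "cdist n (q v) (q v') \<le> (\<Sum>i<n. \<bar>real_of_int (v i) - v' i\<bar>) / t" for v v'
      proof -
        have "cdist n (q v) (q v') \<le> (\<Sum>i<n. \<bar>q v i - q v' i\<bar>)" by (rule cdist_le_sum)
        also have "\<dots> = (\<Sum>i<n. \<bar>real_of_int (v i) - v' i\<bar> / t)"
          using t0 by (intro sum.cong) (auto simp: q_def diff_divide_distrib[symmetric])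
        finally show ?thesis by (simp add: sum_divide_distrib)
      qed
      have qd': "(\<Sum>i<n. \<bar>real_of_int (v i) - v' i\<bar>) \<le> n * (t * cdist n (q v) (q v'))" for v v'
      proof -
        have "(\<Sum>i<n. \<bar>real_of_int (v i) - v' i\<bar>) = t * (\<Sum>i<n. \<bar>q v i - q v' i\<bar>)"
          unfolding sum_distrib_left using t0
          by (intro sum.cong) (auto simp: q_def diff_divide_distrib[symmetric])
        also have "\<dots> \<le> t * (n * cdist n (q v) (q v'))" using t0 sum_le_cdist by (intro mult_left_mono) auto
        finally show ?thesis by (simp add: mult_ac)
      qed
      have uq: "u = q (\<lambda>_. 0)" using u by (auto simp: q_def coord_ball_def fun_eq_iff)
      have uqd: "cdist n u (q v) \<le> (\<Sum>i<n. real (nat \<bar>v i\<bar>)) / t" for v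
        using qd[of "\<lambda>_. 0" v] by (simp add: uq[symmetric])
      have qball: "q v \<in> coord_ball n (p j) (2 * r j)" if "(\<Sum>i<n. real (nat \<bar>v i\<bar>)) \<le> s1" for v
      proof -
        have "cdist n u (q v) \<le> s1 / t" using uqd[of v] that t0 by (meson divide_right_mono less_imp_le order_trans)
        also have "\<dots> \<le> r0" proof -
          have "s1 / r0 \<le> t" using R t by linarith
          then show ?thesis using t0 r0 by (simp add: pos_divide_le_eq mult.commute)
        qed
        finally have "cdist n (p j) (q v) \<le> r j + r j"
          using cdist_triangle[of n "p j" "q v" u] u r0(2)[OF j] by (simp add: coord_ball_def)
        then show ?thesis by (simp add: coord_ball_def q_def)
      qed
      define \<phi> where "\<phi> z = \<alpha> (inv (fst z)) (\<psi> j (q (snd z)))" for z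
      have len: "real (prod_length G S n z) \<le> s1" if "z \<in> carrier (GZ n)" "real (P.wl z) \<le> s" for z
      proof -
        have "real (prod_length G S n z) \<le> C * real (P.wl z)" by (rule C(2)[OF that(1)])
        also have "\<dots> \<le> C * max 0 s" using that C1 by (intro mult_left_mono) auto
        finally show ?thesis by (simp add: s1_def)
      qed
      have zq: "q (snd z) \<in> coord_ball n (p j) (2 * r j)" "real (wl (fst z)) \<le> s1" "cdist n u (q (snd z)) \<le> s1 / t"
        if "z \<in> carrier (GZ n)" "real (P.wl z) \<le> s" for z
      proof -
        have "real (wl (fst z)) + (\<Sum>i<n. real (nat \<bar>snd z i\<bar>)) \<le> s1"
          using len[OF that] by (simp add: prod_length_def)
        have 1: "(\<Sum>i<n. real (nat \<bar>snd z i\<bar>)) \<le> s1" "real (wl (fst z)) \<le> s1"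
        proof -
          have "0 \<le> (\<Sum>i<n. real (nat \<bar>snd z i\<bar>))" by (intro sum_nonneg) auto
          then show "(\<Sum>i<n. real (nat \<bar>snd z i\<bar>)) \<le> s1" "real (wl (fst z)) \<le> s1"
            using \<open>real (wl (fst z)) + (\<Sum>i<n. real (nat \<bar>snd z i\<bar>)) \<le> s1\<close> by linarith+
        qed
        from qball[OF 1(1)] 1(2) show "q (snd z) \<in> coord_ball n (p j) (2 * r j)" "real (wl (fst z)) \<le> s1" by auto
        show "cdist n u (q (snd z)) \<le> s1 / t"
          using uqd[of "snd z"] 1(1) t0 by (meson divide_right_mono less_imp_le order_trans)
      qed
      have u2: "u \<in> coord_ball n (p j) (2 * r j)" using coord_ball_double[OF j u] .
      have phiX: "\<phi> z \<in> X" if "z \<in> carrier (GZ n)" "real (P.wl z) \<le> s" for z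
        using zq[OF that] that psi_X[OF j] act_X by (auto simp: \<phi>_def)
      have diff: "prod_length G S n (inv\<^bsub>GZ n\<^esub> z \<otimes>\<^bsub>GZ n\<^esub> z') = 
          wl (inv (fst z) \<otimes> fst z') + (\<Sum>i<n. nat \<bar>snd z i - snd z' i\<bar>)"
        if "z \<in> carrier (GZ n)" "z' \<in> carrier (GZ n)" for z z'
        using that by (auto simp: prod_length_def inv_GZ mult_GZ mult_Zn inv_Zn abs_minus_commute intro!: sum.cong)
      have up: "\<delta> (\<phi> z) (\<phi> z') \<le> A * P.wd z z' + A"
        if z: "z \<in> carrier (GZ n)" "real (P.wl z) \<le> s" and z': "z' \<in> carrier (GZ n)" "real (P.wl z') \<le> s" for z z'
      proof -
        \<comment> \<open>\<open>?g\<close> cancels the group part of \<open>z\<close> and installs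
          that of \<open>z'\<close>, so that only a jump inside the chart remains.\<close>
        let ?g = "inv (fst z') \<otimes> fst z"
        have g: "?g \<in> carrier G" "fst z \<in> carrier G" "fst z' \<in> carrier G" using z z' by auto
        have "\<alpha> ?g (\<phi> z) = \<alpha> (inv (fst z')) (\<psi> j (q (snd z)))"
          using g psi_X[OF j zq(1)[OF z]] act_X act_inv' by (simp add: \<phi>_def act_mult)
        then have "d (\<alpha> ?g (\<phi> z)) (\<phi> z') = d (\<psi> j (q (snd z))) (\<psi> j (q (snd z')))"
          using g psi_X[OF j zq(1)[OF z]] psi_X[OF j zq(1)[OF z']] by (simp add: \<phi>_def d_inv)
        also have "\<dots> \<le> ennreal (L * cdist n (q (snd z)) (q (snd z')))"
          by (rule d_le[OF j zq(1)[OF z] zq(1)[OF z']])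
        finally have "\<delta> (\<phi> z) (\<phi> z') \<le> wl ?g + t * (L * cdist n (q (snd z)) (q (snd z')))"
          using t0 L1 g phiX[OF z] phiX[OF z'] by (intro warped_le[OF w]) auto
        also have "wl ?g = wl (inv (fst z) \<otimes> fst z')"
          using g wl_inv[of ?g] by (simp add: inv_mult_group)
        also have "t * (L * cdist n (q (snd z)) (q (snd z'))) \<le> L * (\<Sum>i<n. \<bar>real_of_int (snd z i) - snd z' i\<bar>)"
        proof -
          have "t * cdist n (q (snd z)) (q (snd z')) \<le> (\<Sum>i<n. \<bar>real_of_int (snd z i) - snd z' i\<bar>)"
            using qd[of "snd z" "snd z'"] t0 by (simp add: field_simps)
          then show ?thesis using L1 by (simp add: mult.left_commute)
        qed
        also have "real (wl (inv (fst z) \<otimes> fst z')) + L * (\<Sum>i<n. \<bar>real_of_int (snd z i) - snd z' i\<bar>)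
           \<le> L * real (prod_length G S n (inv\<^bsub>GZ n\<^esub> z \<otimes>\<^bsub>GZ n\<^esub> z'))"
          using L1 mult_right_mono[OF L1, of "real (wl (inv (fst z) \<otimes> fst z'))"]
          by (simp add: diff[OF z(1) z'(1)] distrib_left)
        also have "\<dots> \<le> L * (C * P.wd z z')"
          using L1 C(2)[of "inv\<^bsub>GZ n\<^esub> z \<otimes>\<^bsub>GZ n\<^esub> z'"] z z'
          unfolding word_metric_def by (intro mult_left_mono C(2) P.m_closed P.inv_closed) auto
        also have "\<dots> \<le> A * P.wd z z'"
        proof -
          have "L * C \<le> A"
            using CL mult_left_mono[of 1 "2 * (real n + 1)" "C * L"] by (simp add: A_def algebra_simps)
          then show ?thesis
            using mult_right_mono[of "L * C" A "P.wd z z'"] by (simp add: mult.assoc)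
        qed
        finally show ?thesis using A1 by simp
      qed
      have lo: "P.wd z z' \<le> A * \<delta> (\<phi> z) (\<phi> z') + A"
        if z: "z \<in> carrier (GZ n)" "real (P.wl z) \<le> s" and z': "z' \<in> carrier (GZ n)" "real (P.wl z') \<le> s" for z z'
      proof -
        let ?e = "\<delta> (\<phi> z) (\<phi> z') + 1"
        let ?l = "real (prod_length G S n (inv\<^bsub>GZ n\<^esub> z \<otimes>\<^bsub>GZ n\<^esub> z'))"
        have g: "fst z \<in> carrier G" "fst z' \<in> carrier G" using z z' by auto
        note pX = psi_X[OF j zq(1)[OF z]] and pX' = psi_X[OF j zq(1)[OF z']]
        have "?l \<le> L * (real n + 1) * ?e"
        \<comment> \<open>For large warped distance the crude bound \<open>?l \<le> 2 * s1\<close>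
          on the ball suffices; otherwise the element that nearly realizes the distance is
          short.\<close>
        proof (cases "?e \<ge> 2 * s1")
          case True
          have "real (prod_length G S n (inv\<^bsub>GZ n\<^esub> z)) = real (prod_length G S n z)"
            using z by (cases z) (auto simp: prod_length_def inv_GZ[of z n] inv_Zn inv_DirProd[OF is_group group_Zn])
          then have "?l \<le> s1 + s1"
            using prod_length_mult[of "inv\<^bsub>GZ n\<^esub> z" n z'] len[OF z] len[OF z'] z z' P.inv_closed[OF z(1)] by linarith
          then have "?l \<le> ?e" using True by linarith
          also have "?e \<le> L * (real n + 1) * ?e"
            using L1 mult_mono[of 1 L 1 "real n + 1"] mult_right_mono[of 1 "L * (real n + 1)" ?e] by simp
          finally show ?thesis .
        next
          case False
          obtain h where h: "h \<in> carrier G" and hl: "wl h + t * D (\<alpha> h (\<phi> z)) (\<phi> z') \<le> ?e"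
            using warped_ge[OF w t0 phiX[OF z] phiX[OF z']] by blast
          \<comment> \<open>Undoing the group parts of \<open>z\<close> and \<open>z'\<close> turns
            the near-optimal \<open>h\<close> into an element that moves one chart point near
            \<open>x\<close> close to another.\<close>
          let ?k = "fst z' \<otimes> h \<otimes> inv (fst z)"
          have k: "?k \<in> carrier G" using g h by auto
          have "D (\<alpha> h (\<phi> z)) (\<phi> z') = D (\<alpha> (fst z') (\<alpha> h (\<phi> z))) (\<psi> j (q (snd z')))"
            using g h pX' phiX[OF z] D_shift[of "fst z'" "\<alpha> h (\<phi> z)" "\<psi> j (q (snd z'))"] act_X by (simp add: \<phi>_def)
          also have "\<alpha> (fst z') (\<alpha> h (\<phi> z)) = \<alpha> ?k (\<psi> j (q (snd z)))"
            using g h pX act_X by (simp add: \<phi>_def act_mult)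
          finally have hk: "wl h + t * D (\<alpha> ?k (\<psi> j (q (snd z)))) (\<psi> j (q (snd z'))) \<le> ?e" using hl by simp
          have Dnn: "t * D (\<alpha> ?k (\<psi> j (q (snd z)))) (\<psi> j (q (snd z'))) \<ge> 0"
            using t0 k pX pX' act_X by (auto intro!: mult_nonneg_nonneg lip_dist_nonneg)
          \<comment> \<open>A nontrivial \<open>?k\<close> would have length at most
            \<open>R\<close> and displace \<open>x\<close> by at most \<open>R\<close> after
            rescaling, against goodness. So \<open>h\<close> is the expected element and only chart
            coordinates are left to compare.\<close>
          have "?k = \<one>"
          proof (rule ccontr)
            assume k1: "?k \<noteq> \<one>"
            have "wl ?k \<le> wl (fst z' \<otimes> h) + wl (inv (fst z))" using g h by (intro wl_mult) auto
            also have "\<dots> \<le> wl (fst z') + wl h + wl (fst z)" using g h wl_mult[of "fst z'" h] by simp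
            finally have "real (wl ?k) \<le> real (wl (fst z')) + wl h + wl (fst z)" by (simp flip: of_nat_add)
            also have "\<dots> \<le> 4 * s1" using zq(2)[OF z] zq(2)[OF z'] hk Dnn False by linarith
            finally have "real (wl ?k) \<le> R" using R by linarith
            then have gd: "t * D (\<alpha> ?k x) x > R" using good k k1 unfolding good_def by blast
            have "D (\<alpha> ?k x) x \<le> D (\<alpha> ?k x) (\<alpha> ?k (\<psi> j (q (snd z)))) + D (\<alpha> ?k (\<psi> j (q (snd z)))) x"
              using k x pX act_X by (intro lip_dist_triangle) auto
            also have "\<dots> \<le> D (\<alpha> ?k x) (\<alpha> ?k (\<psi> j (q (snd z)))) +
               (D (\<alpha> ?k (\<psi> j (q (snd z)))) (\<psi> j (q (snd z'))) + D (\<psi> j (q (snd z'))) x)"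
              using k x pX pX' act_X by (intro add_left_mono lip_dist_triangle) auto
            also have "D (\<alpha> ?k x) (\<alpha> ?k (\<psi> j (q (snd z)))) = D x (\<psi> j (q (snd z)))"
              using k x pX by (simp add: D_inv)
            also have "\<dots> \<le> L * (s1 / t)"
              using D_le[OF j u2 zq(1)[OF z]] zq(3)[OF z] L1 unfolding xu by (meson mult_left_mono order_trans zero_le_one)
            also have "D (\<psi> j (q (snd z'))) x \<le> L * (s1 / t)"
              using D_le[OF j u2 zq(1)[OF z']] zq(3)[OF z'] L1 unfolding xu lip_dist_commute[of X d _ "\<psi> j u"]
              by (meson mult_left_mono order_trans zero_le_one)
            finally have "D (\<alpha> ?k x) x \<le> L * (s1 / t) + (D (\<alpha> ?k (\<psi> j (q (snd z)))) (\<psi> j (q (snd z'))) + L * (s1 / t))"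
              by simp
            then have "t * D (\<alpha> ?k x) x \<le> t * (L * (s1 / t) + (D (\<alpha> ?k (\<psi> j (q (snd z)))) (\<psi> j (q (snd z'))) + L * (s1 / t)))"
              using t0 by (intro mult_left_mono) auto
            also have "\<dots> = 2 * L * s1 + t * D (\<alpha> ?k (\<psi> j (q (snd z)))) (\<psi> j (q (snd z')))"
              using t0 by (simp add: field_simps)
            also have "\<dots> \<le> R" using hk False R by linarith
            finally show False using gd by simp
          qed
          then have hz: "h = inv (fst z') \<otimes> fst z"
          proof -
            have "fst z' \<otimes> h = (fst z' \<otimes> h \<otimes> inv (fst z)) \<otimes> fst z"
              using g h by (simp add: m_assoc)
            also have "\<dots> = fst z" using \<open>?k = \<one>\<close> g by simp
            finally have "inv (fst z') \<otimes> fst z = inv (fst z') \<otimes> (fst z' \<otimes> h)" by simp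
            also have "\<dots> = h" using g h by (simp flip: m_assoc)
            finally show ?thesis by simp
          qed
          have "wl h = wl (inv (fst z) \<otimes> fst z')"
            using g wl_inv[of h] h hz by (simp add: inv_mult_group)
          moreover have "(\<Sum>i<n. \<bar>real_of_int (snd z i) - snd z' i\<bar>) \<le> n * L * (t * D (\<psi> j (q (snd z))) (\<psi> j (q (snd z'))))"
          proof -
            have "t * cdist n (q (snd z)) (q (snd z')) \<le> t * (L * D (\<psi> j (q (snd z))) (\<psi> j (q (snd z'))))"
              using t0 lip_ge[OF j zq(1)[OF z] zq(1)[OF z']] by (intro mult_left_mono) auto
            from mult_left_mono[OF this, of "real n"]
            have "n * (t * cdist n (q (snd z)) (q (snd z'))) \<le> n * (t * (L * D (\<psi> j (q (snd z))) (\<psi> j (q (snd z')))))"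
              by simp
            then show ?thesis using qd'[of "snd z" "snd z'"] by (simp add: mult_ac)
          qed
          ultimately have "?l \<le> wl h + n * L * (t * D (\<psi> j (q (snd z))) (\<psi> j (q (snd z'))))"
            using diff[OF z(1) z'(1)] by simp
          also have "\<dots> \<le> L * (n + 1) * wl h + L * (n + 1) * (t * D (\<psi> j (q (snd z))) (\<psi> j (q (snd z'))))"
          proof (intro add_mono mult_right_mono)
            show "real (wl h) \<le> L * (n + 1) * wl h"
              using L1 mult_mono[of 1 L 1 "real n + 1"] mult_right_mono[of 1 "L * (real n + 1)" "real (wl h)"] by (simp add: add.commute)
            show "0 \<le> t * D (\<psi> j (q (snd z))) (\<psi> j (q (snd z')))" by (intro mult_nonneg_nonneg lip_dist_nonneg pX pX') (use t0 in auto)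
          qed (use L1 in \<open>auto simp: algebra_simps\<close>)
          also have "\<dots> \<le> L * (n + 1) * ?e"
          proof -
            have "wl h + t * D (\<psi> j (q (snd z))) (\<psi> j (q (snd z'))) \<le> ?e"
              using hk pX \<open>?k = \<one>\<close> act_one by simp
            from mult_left_mono[OF this, of "L * (real n + 1)"] show ?thesis
              using L1 by (simp add: distrib_left add.commute)
          qed
          finally show ?thesis by (simp add: add.commute)
        qed
        then have "C * ?l \<le> C * (L * (real n + 1) * ?e)" using C1 by (intro mult_left_mono) auto
        moreover have "P.wd z z' \<le> C * ?l"
          unfolding word_metric_def using z z' by (intro C P.m_closed P.inv_closed)
        moreover have "C * (L * (real n + 1) * ?e) \<le> A * ?e"
          unfolding A_def mult.assoc[symmetric] using C1 L1 by (intro mult_right_mono) auto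
        ultimately show ?thesis by (simp add: distrib_left)
      qed
      have onto: "\<exists>z\<in>carrier (GZ n). real (P.wl z) \<le> s \<and> \<delta> y (\<phi> z) \<le> A"
        if y: "y \<in> X" and ys: "A * \<delta> x y + A \<le> s" for y
      proof -
        define e where "e = \<delta> x y + 1"
        have e1: "e \<ge> 1" and es: "A * e \<le> s" using ys by (auto simp: e_def distrib_left)
        obtain h where h: "h \<in> carrier G" and he: "wl h + t * D (\<alpha> h x) y \<le> e"
          using warped_ge[OF w t0 x y] unfolding e_def by blast
        \<comment> \<open>\<open>y\<close> is pulled back by \<open>h\<close> into the neighbourhood
          of \<open>x\<close>, where \<open>capture\<close> provides coordinates.\<close>
        let ?y = "\<alpha> (inv h) y"
        have yX: "?y \<in> X" using h y act_X by auto
        have te: "t * D x ?y \<le> e" using he D_shift[OF h x y] by simp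
        have e_s: "e \<le> max 0 s" 
        proof -
          have "1 * e \<le> A * e" using A1 e1 by (intro mult_right_mono) auto
          then show ?thesis using es by (simp add: le_max_iff_disj)
        qed
        have "t * (L * D x ?y) \<le> L * e"
          using mult_left_mono[OF te, of L] L1 by (simp add: mult.left_commute)
        also have "\<dots> < L * max 0 s + 1" using mult_left_mono[OF e_s, of L] L1 by linarith
        also have "\<dots> \<le> t * r0" proof -
          have "(L * max 0 s + 1) / r0 \<le> t" using R t by linarith
          then show ?thesis using r0 by (simp add: pos_divide_le_eq mult.commute)
        qed
        finally have "L * D x ?y < r0" using t0 by simp
        then have "L * D x ?y < r j" using r0(2)[OF j] by linarith
        then obtain v where v: "v \<in> coord_ball n (p j) (2 * r j)" "?y = \<psi> j v"
          using capture[OF j u yX] xu by blast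
        have "cdist n u v \<le> L * D x ?y" using lip_ge[OF j u2 v(1)] v xu by simp
        then have uv: "t * cdist n u v \<le> L * e"
          using mult_left_mono[of "cdist n u v" "L * D x ?y" t] \<open>t * (L * D x ?y) \<le> L * e\<close> t0 by linarith
        \<comment> \<open>Rounding down to the lattice costs at most \<open>1 / t\<close> per
          coordinate, hence a bounded amount in the warped metric.\<close>
        define m where "m = (\<lambda>i\<in>{..<n}. \<lfloor>t * (v i - u i)\<rfloor>)"
        have m: "m \<in> carrier (Zn n)" by (simp add: m_def carrier_Zn)
        let ?z = "(inv h, m)"
        have z: "?z \<in> carrier (GZ n)" using h m by auto
        have mi: "real (nat \<bar>m i\<bar>) \<le> L * e + 1" if "i < n" for i
        proof -
          have "\<bar>t * (v i - u i)\<bar> \<le> t * cdist n u v"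
            using mult_left_mono[OF cdist_coord[OF that, of u v], of t] t0 by (simp add: abs_mult abs_minus_commute)
          then have "\<bar>real_of_int \<lfloor>t * (v i - u i)\<rfloor>\<bar> \<le> L * e + 1" using uv by linarith
          then show ?thesis using that by (simp add: m_def)
        qed
        have "real (prod_length G S n ?z) \<le> e + n * (L * e + 1)"
        proof -
          have "(\<Sum>i<n. real (nat \<bar>m i\<bar>)) \<le> n * (L * e + 1)"
            using sum_bounded_above[of "{..<n}" "\<lambda>i. real (nat \<bar>m i\<bar>)" "L * e + 1"] mi by simp
          moreover have "real (wl h) \<le> e"
          proof -
            have "0 \<le> t * D (\<alpha> h x) y" using t0 act_X[OF h x] y by (intro mult_nonneg_nonneg lip_dist_nonneg) auto
            then show ?thesis using he by linarith
          qed
          ultimately show ?thesis using h by (simp add: prod_length_def)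
        qed
        also have "\<dots> \<le> 2 * L * (n + 1) * e"
        proof -
          have "1 \<le> L * e" using L1 e1 mult_mono[of 1 L 1 e] by simp
          then have "n * (L * e + 1) \<le> n * (2 * (L * e))" by (intro mult_left_mono) auto
          moreover have "e \<le> 2 * (L * e)" using \<open>1 \<le> L * e\<close> L1 e1 mult_right_mono[OF L1, of e] by simp
          ultimately show ?thesis by (simp add: algebra_simps)
        qed
        finally have "C * real (prod_length G S n ?z) \<le> C * (2 * L * (n + 1) * e)"
          using C1 by (intro mult_left_mono) auto
        then have zs: "real (P.wl ?z) \<le> s"
          using C(1)[OF z] es by (simp add: A_def mult_ac)
        have vq: "cdist n v (q m) \<le> n / t"
        proof -
          have "cdist n v (q m) \<le> (\<Sum>i<n. \<bar>v i - q m i\<bar>)" by (rule cdist_le_sum)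
          also have "\<dots> \<le> of_nat (card {..<n}) * (1 / t)"
          proof (rule sum_bounded_above)
            fix i assume i: "i \<in> {..<n}"
            have "v i - q m i = (t * (v i - u i) - \<lfloor>t * (v i - u i)\<rfloor>) / t"
              using t0 i by (simp add: q_def m_def field_simps)
            moreover have "\<bar>t * (v i - u i) - \<lfloor>t * (v i - u i)\<rfloor>\<bar> \<le> 1" by linarith
            ultimately show "\<bar>v i - q m i\<bar> \<le> 1 / t" using t0 by (simp add: divide_right_mono)
          qed
          finally show ?thesis by simp
        qed
        have qm: "q m \<in> coord_ball n (p j) (2 * r j)" using zq(1)[OF z zs] by simp
        have "d (\<alpha> \<one> y) (\<phi> ?z) = d ?y (\<psi> j (q m))"
          using h y yX psi_X[OF j qm] d_inv[of "inv h" y "\<alpha> h (\<psi> j (q m))"] act_X act_inv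
          by (simp add: act_one \<phi>_def)
        also have "\<dots> \<le> ennreal (L * cdist n v (q m))" using d_le[OF j v(1) qm] v by simp
        finally have "\<delta> y (\<phi> ?z) \<le> wl \<one> + t * (L * cdist n v (q m))"
          using t0 L1 y phiX[OF z zs] by (intro warped_le[OF w]) auto
        also have "\<dots> \<le> L * n"
        proof -
          have "t * cdist n v (q m) \<le> n" using vq t0 by (simp add: pos_le_divide_eq mult.commute)
          from mult_left_mono[OF this, of L] show ?thesis using L1 by (simp add: mult.left_commute)
        qed
        also have "\<dots> \<le> A"
        proof -
          have "1 * (L * n) \<le> (2 * C) * (L * (n + 1))" using C1 L1 by (intro mult_mono) auto
          then show ?thesis by (simp add: A_def mult_ac)
        qed
        finally show ?thesis using z zs by blast
      qed
      have "\<phi> \<one>\<^bsub>GZ n\<^esub> = x"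
      proof -
        have "q (\<lambda>i\<in>{..<n}. 0) = u" unfolding uq by (auto simp: q_def fun_eq_iff)
        then show ?thesis using x by (simp add: \<phi>_def one_Zn act_one xu)
      qed
      then have "\<delta> x (\<phi> \<one>\<^bsub>GZ n\<^esub>) \<le> A" using A1 M.zero[OF x x] by simp
      then have "local_model (GZ n) T A s X \<delta> x \<phi>"
        unfolding local_model_def using phiX up lo onto by blast
      then show "\<exists>\<phi>. local_model (GZ n) T A s X \<delta> x \<phi>" by (rule exI[of _ \<phi>])
    qed
  qed
qed

end

section \<open>Grid cells in Euclidean space\<close>

text \<open>Half-open, so that cells with different indices are disjoint. A cell sees the first
  \<open>n\<close> entries of its index, which is why index sets are taken to consist of extensional
  functions.\<close>

definition grid_cell :: "nat \<Rightarrow> real \<Rightarrow> (nat \<Rightarrow> int) \<Rightarrow> (nat \<Rightarrow> real) set" where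
  "grid_cell n t z = {v. (\<forall>i\<ge>n. v i = 0) \<and> (\<forall>i<n. \<lfloor>t * v i\<rfloor> = z i)}"

definition coord_box :: "nat \<Rightarrow> (nat \<Rightarrow> real set) \<Rightarrow> (nat \<Rightarrow> real) set" where
  "coord_box n A = {v. (\<forall>i\<ge>n. v i = 0) \<and> (\<forall>i<n. v i \<in> A i)}"

lemma coord_measurable: "(\<lambda>v :: nat \<Rightarrow> real. v i) \<in> borel_measurable borel"
  by (intro borel_measurable_continuous_onI continuous_on_product_coordinates)

lemma extend_zero_measurable:
  "(\<lambda>q (i :: nat). if i < n then q i else 0) \<in> borel_measurable (PiM {..<n} (\<lambda>_. lborel :: real measure))"
proof (rule measurable_coordinatewise_then_product)
  show "(\<lambda>q. if i < n then q i else 0) \<in> borel_measurable (PiM {..<n} (\<lambda>_. lborel :: real measure))" for i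
    using measurable_component_singleton[of i "{..<n}" "\<lambda>_. lborel :: real measure"] by (cases "i < n") auto
qed

lemma sets_Euclidean_lebesgue [simp]: "sets (Euclidean_lebesgue n) = sets borel"
  by (simp add: Euclidean_lebesgue_def)

lemma space_Euclidean_lebesgue [simp]: "space (Euclidean_lebesgue n) = UNIV"
  by (simp add: Euclidean_lebesgue_def)

lemma coord_box_borel:
  assumes "\<And>i. i < n \<Longrightarrow> A i \<in> sets borel"
  shows "coord_box n A \<in> sets borel"
proof -
  have "coord_box n A = (\<Inter>i. (\<lambda>v :: nat \<Rightarrow> real. v i) -` (if i < n then A i else {0}) \<inter> space borel)"
    (is "_ = ?R")
  proof (intro Set.set_eqI iffI)
    fix v assume v: "v \<in> ?R"
    have "v i \<in> (if i < n then A i else {0})" for i using v by blast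
    from this show "v \<in> coord_box n A" unfolding coord_box_def
      by (smt (verit) leD mem_Collect_eq singletonD)
  qed (auto simp: coord_box_def)
  also have "\<dots> \<in> sets borel"
    using assms by (intro sets.countable_INT'' measurable_sets[OF coord_measurable]) auto
  finally show ?thesis .
qed

lemma emeasure_coord_box:
  assumes "\<And>i. i < n \<Longrightarrow> A i \<in> sets borel"
  shows "emeasure (Euclidean_lebesgue n) (coord_box n A) = (\<Prod>i<n. emeasure lborel (A i))"
proof -
  interpret product_sigma_finite "\<lambda>_ :: nat. lborel :: real measure" by standard
  have "emeasure (Euclidean_lebesgue n) (coord_box n A) =
      emeasure (PiM {..<n} (\<lambda>_. lborel :: real measure))
        ((\<lambda>q i. if i < n then q i else 0) -` coord_box n A \<inter> space (PiM {..<n} (\<lambda>_. lborel :: real measure)))"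
    unfolding Euclidean_lebesgue_def
    by (intro emeasure_distr extend_zero_measurable coord_box_borel assms)
  also have "(\<lambda>q i. if i < n then q i else 0) -` coord_box n A \<inter> space (PiM {..<n} (\<lambda>_. lborel :: real measure))
     = (\<Pi>\<^sub>E i\<in>{..<n}. A i)"
    by (auto simp: coord_box_def space_PiM PiE_iff)
  also have "emeasure (PiM {..<n} (\<lambda>_. lborel :: real measure)) \<dots> = (\<Prod>i<n. emeasure lborel (A i))"
    using assms by (intro emeasure_PiM) auto
  finally show ?thesis .
qed

lemma grid_cell_box:
  assumes "t > 0"
  shows "grid_cell n t z = coord_box n (\<lambda>i. {z i / t ..< (z i + 1) / t})"
proof -
  have "\<lfloor>t * x\<rfloor> = k \<longleftrightarrow> x \<in> {k / t ..< (k + 1) / t}" for x :: real and k :: int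
    using assms by (auto simp: floor_eq_iff field_simps)
  then show ?thesis by (simp add: grid_cell_def coord_box_def)
qed

lemma grid_cell_borel: "t > 0 \<Longrightarrow> grid_cell n t z \<in> sets borel"
  by (simp add: grid_cell_box coord_box_borel)

lemma emeasure_grid_cell:
  assumes "t > 0"
  shows "emeasure (Euclidean_lebesgue n) (grid_cell n t z) = ennreal ((1 / t) ^ n)"
proof -
  have "emeasure lborel {z i / t ..< (z i + 1) / t} = ennreal (1 / t)" for i
    using assms by (subst emeasure_lborel_Ico) (auto simp: divide_right_mono diff_divide_distrib[symmetric])
  then show ?thesis using assms
    by (simp add: grid_cell_box emeasure_coord_box ennreal_power)
qed

text \<open>Disjoint cells of equal volume are packed into \<open>E\<close>; distinct extensional
  indices differ in some coordinate below \<open>n\<close>.\<close>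

lemma card_grid_cells_le:
  assumes t: "t > 0" and E: "E \<in> sets borel" and Z: "finite Z" "Z \<subseteq> ({..<n} \<rightarrow>\<^sub>E UNIV)"
    and sub: "\<And>z. z \<in> Z \<Longrightarrow> grid_cell n t z \<subseteq> E"
  shows "ennreal (real (card Z) * (1 / t) ^ n) \<le> emeasure (Euclidean_lebesgue n) E"
proof -
  have disj: "disjoint_family_on (grid_cell n t) Z"
  proof (unfold disjoint_family_on_def, intro ballI impI)
    fix z z' assume z: "z \<in> Z" "z' \<in> Z" "z \<noteq> z'"
    then have "z \<in> {..<n} \<rightarrow>\<^sub>E UNIV" "z' \<in> {..<n} \<rightarrow>\<^sub>E UNIV" using Z(2) by auto
    with z(3) have "\<exists>i<n. z i \<noteq> z' i" using PiE_ext[of z "{..<n}" "\<lambda>_. UNIV" z'] by auto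
    then obtain i where "i < n" "z i \<noteq> z' i" by blast
    then show "grid_cell n t z \<inter> grid_cell n t z' = {}" by (auto simp: grid_cell_def)
  qed
  have "ennreal (real (card Z) * (1 / t) ^ n) = (\<Sum>z\<in>Z. emeasure (Euclidean_lebesgue n) (grid_cell n t z))"
    using t by (simp add: emeasure_grid_cell ennreal_mult ennreal_of_nat_eq_real_of_nat)
  also have "\<dots> = emeasure (Euclidean_lebesgue n) (\<Union>z\<in>Z. grid_cell n t z)"
    using t Z disj by (intro sum_emeasure) (auto simp: grid_cell_borel)
  also have "\<dots> \<le> emeasure (Euclidean_lebesgue n) E"
    using sub E by (intro emeasure_mono) auto
  finally show ?thesis .
qed

lemma continuous_on_cdist: "continuous_on A (\<lambda>v. cdist n p v)"
  unfolding cdist_def L2_set_def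
  by (intro continuous_intros continuous_on_subset[OF continuous_on_product_coordinates]) auto

lemma closed_coord_ball: "closed (coord_ball n p r)"
proof -
  have "coord_ball n p r = (\<Inter>i\<in>{n..}. {v. v i = 0}) \<inter> {v. cdist n p v \<le> r}"
    by (auto simp: coord_ball_def)
  also have "closed \<dots>"
    by (intro closed_Int closed_INT ballI closed_Collect_eq closed_Collect_le continuous_on_cdist
        continuous_on_product_coordinates continuous_on_const)
  finally show ?thesis .
qed

lemma emeasure_coord_ball_finite: "emeasure (Euclidean_lebesgue n) (coord_ball n p r) < \<infinity>"
proof -
  have "coord_ball n p r \<subseteq> coord_box n (\<lambda>i. {p i - r .. p i + r})"
  proof
    fix v assume v: "v \<in> coord_ball n p r"
    then have "\<bar>p i - v i\<bar> \<le> r" if "i < n" for i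
      using cdist_coord[OF that, of p v] by (simp add: coord_ball_def)
    then show "v \<in> coord_box n (\<lambda>i. {p i - r .. p i + r})"
      using v by (fastforce simp: coord_ball_def coord_box_def abs_le_iff)
  qed
  then have "emeasure (Euclidean_lebesgue n) (coord_ball n p r) \<le>
      emeasure (Euclidean_lebesgue n) (coord_box n (\<lambda>i. {p i - r .. p i + r}))"
    by (intro emeasure_mono) (auto intro: coord_box_borel)
  also have "\<dots> < \<infinity>" by (subst emeasure_coord_box) (auto simp: less_top[symmetric] ennreal_prod_eq_top emeasure_lborel_Icc_eq)
  finally show ?thesis .
qed

lemma emeasure_coord_ball_pos:
  assumes "r > 0" "\<And>i. i \<ge> n \<Longrightarrow> p i = 0"
  shows "emeasure (Euclidean_lebesgue n) (coord_ball n p r) > 0"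
proof -
  \<comment> \<open>All points of a cube of half side \<open>e\<close> are within
    \<open>n * e < r\<close> of its centre; \<open>n + 1\<close> also covers dimension 0.\<close>
  define e where "e = r / (real n + 1)"
  have e: "e > 0" using assms by (simp add: e_def)
  have "coord_box n (\<lambda>i. {p i - e .. p i + e}) \<subseteq> coord_ball n p r"
  proof
    fix v assume v: "v \<in> coord_box n (\<lambda>i. {p i - e .. p i + e})"
    have "cdist n p v \<le> (\<Sum>i<n. \<bar>p i - v i\<bar>)" by (rule cdist_le_sum)
    also have "\<dots> \<le> of_nat (card {..<n}) * e"
      using v by (intro sum_bounded_above) (fastforce simp: coord_box_def abs_le_iff)
    also have "\<dots> \<le> r" using assms by (simp add: e_def field_simps)
    finally show "v \<in> coord_ball n p r" using v by (simp add: coord_ball_def coord_box_def)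
  qed
  then have "emeasure (Euclidean_lebesgue n) (coord_box n (\<lambda>i. {p i - e .. p i + e})) \<le>
      emeasure (Euclidean_lebesgue n) (coord_ball n p r)"
    using closed_coord_ball by (intro emeasure_mono) auto
  moreover have "emeasure (Euclidean_lebesgue n) (coord_box n (\<lambda>i. {p i - e .. p i + e})) = ennreal ((2 * e) ^ n)"
    using e by (subst emeasure_coord_box) (auto simp: ennreal_power)
  moreover have "ennreal ((2 * e) ^ n) > 0" using e by simp
  ultimately show ?thesis by order
qed

section \<open>Counting cells and good points\<close>

lemma card_le_fibres:
  assumes "finite P" "f ` Q \<subseteq> P" "finite Q" "\<And>y. card {x \<in> Q. f x = y} \<le> K"
  shows "card Q \<le> K * card P"
proof -
  have "card Q = card (\<Union>y\<in>P. {x \<in> Q. f x = y})"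
    using assms(2) by (intro arg_cong[of _ _ card]) auto
  also have "\<dots> \<le> (\<Sum>y\<in>P. card {x \<in> Q. f x = y})" by (rule card_UN_le[OF assms(1)])
  also have "\<dots> \<le> (\<Sum>y\<in>P. K)" by (intro sum_mono assms)
  finally show ?thesis by (simp add: mult.commute)
qed

section \<open>Displacement of points by group elements\<close>

context bilip_action
begin

abbreviation B2 where "B2 j \<equiv> coord_ball n (p j) (2 * r j)"

text \<open>An isometry moves two points by amounts that differ by at most twice their distance;
  \<open>L\<close> translates this into coordinates.\<close>

lemma displacement_lipschitz:
  assumes j: "j \<in> J" and g: "g \<in> carrier G" and v: "v \<in> B2 j" and w: "w \<in> B2 j"
  shows "D (\<alpha> g (\<psi> j v)) (\<psi> j v) \<le> D (\<alpha> g (\<psi> j w)) (\<psi> j w) + 2 * L * cdist n v w"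
proof -
  note X = psi_X[OF j v] psi_X[OF j w]
  have "D (\<alpha> g (\<psi> j v)) (\<psi> j v) \<le> D (\<alpha> g (\<psi> j v)) (\<alpha> g (\<psi> j w)) + D (\<alpha> g (\<psi> j w)) (\<psi> j v)"
    using X g act_X by (intro lip_dist_triangle) auto
  also have "\<dots> \<le> D (\<alpha> g (\<psi> j v)) (\<alpha> g (\<psi> j w)) + (D (\<alpha> g (\<psi> j w)) (\<psi> j w) + D (\<psi> j w) (\<psi> j v))"
    using X g act_X by (intro add_left_mono lip_dist_triangle) auto
  also have "D (\<alpha> g (\<psi> j v)) (\<alpha> g (\<psi> j w)) = D (\<psi> j v) (\<psi> j w)" using X g D_inv by blast
  finally show ?thesis using D_le[OF j v w] lip_dist_commute[of X d "\<psi> j w" "\<psi> j v"] by linarith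
qed

text \<open>Sublevel sets of the displacement of \<open>g\<close>, pulled back to a chart. They are
  closed and shrink to the fixed points as \<open>e\<close> tends to 0.\<close>

definition slow :: "'j \<Rightarrow> 'g \<Rightarrow> real \<Rightarrow> (nat \<Rightarrow> real) set" where
  "slow j g e = {v \<in> B2 j. D (\<alpha> g (\<psi> j v)) (\<psi> j v) \<le> e}"

lemma slow_0:
  assumes j: "j \<in> J" and g: "g \<in> carrier G"
  shows "slow j g 0 = {v \<in> B2 j. \<alpha> g (\<psi> j v) = \<psi> j v}"
proof -
  have "D (\<alpha> g (\<psi> j v)) (\<psi> j v) \<le> 0 \<longleftrightarrow> \<alpha> g (\<psi> j v) = \<psi> j v" if v: "v \<in> B2 j" for v
  proof -
    note X = psi_X[OF j v]
    show ?thesis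
      using D_eq_0[OF act_X[OF g X] X] lip_dist_nonneg[OF act_X[OF g X] X, of d] by fastforce
  qed
  then show ?thesis by (auto simp: slow_def)
qed

lemma closed_slow:
  assumes j: "j \<in> J" and g: "g \<in> carrier G"
  shows "closed (slow j g e)"
proof -
  have "continuous_on (B2 j) (\<lambda>v. D (\<alpha> g (\<psi> j v)) (\<psi> j v))"
    unfolding continuous_on_def
  proof
    fix v assume v: "v \<in> B2 j"
    have "((\<lambda>w. 2 * L * cdist n v w) \<longlongrightarrow> 2 * L * cdist n v v) (at v within B2 j)"
      using continuous_on_cdist[of "B2 j" n v] v unfolding continuous_on_def
      by (intro tendsto_mult_left) blast
    then have "((\<lambda>w. 2 * L * cdist n v w) \<longlongrightarrow> 0) (at v within B2 j)" by simp
    moreover have "\<forall>\<^sub>F w in at v within B2 j.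
        norm (D (\<alpha> g (\<psi> j w)) (\<psi> j w) - D (\<alpha> g (\<psi> j v)) (\<psi> j v)) \<le> 2 * L * cdist n v w"
      using displacement_lipschitz[OF j g v] displacement_lipschitz[OF j g _ v]
      by (auto simp: eventually_at_filter cdist_commute[of n v] abs_le_iff algebra_simps intro!: always_eventually)
    ultimately have "((\<lambda>w. D (\<alpha> g (\<psi> j w)) (\<psi> j w) - D (\<alpha> g (\<psi> j v)) (\<psi> j v)) \<longlongrightarrow> 0) (at v within B2 j)"
      by (rule Lim_null_comparison[rotated])
    then show "((\<lambda>w. D (\<alpha> g (\<psi> j w)) (\<psi> j w)) \<longlongrightarrow> D (\<alpha> g (\<psi> j v)) (\<psi> j v)) (at v within B2 j)"
      by (rule LIM_zero_cancel)
  qed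
  then have "closed (B2 j \<inter> (\<lambda>v. D (\<alpha> g (\<psi> j v)) (\<psi> j v)) -` {..e})"
    using closed_coord_ball by (intro continuous_closed_preimage) auto
  moreover have "B2 j \<inter> (\<lambda>v. D (\<alpha> g (\<psi> j v)) (\<psi> j v)) -` {..e} = slow j g e"
    by (auto simp: slow_def)
  ultimately show ?thesis by simp
qed

end

text \<open>Essential freeness read in coordinates: Lebesgue measure on the charts replaces the
  Riemannian volume.\<close>

locale bilip_ess_free = bilip_action X d n J p r \<psi> L G S \<alpha>
  for X :: "'x set" and d n and J :: "'j set" and p r \<psi> L and G :: "('g, 'c) monoid_scheme" (structure) and S
    and \<alpha> :: "'g \<Rightarrow> 'x \<Rightarrow> 'x" +
  assumes null_fix: "j \<in> J \<Longrightarrow> g \<in> carrier G \<Longrightarrow> g \<noteq> \<one> \<Longrightarrow>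
    emeasure (Euclidean_lebesgue n) {v \<in> coord_ball n (p j) (2 * r j). \<alpha> g (\<psi> j v) = \<psi> j v} = 0"
begin

text \<open>The charts overlap, so one chart and one coordinate vector are selected for each point;
  this makes \<open>key\<close> a function of the point.\<close>

definition chart_of :: "'x \<Rightarrow> 'j \<times> (nat \<Rightarrow> real)" where
  "chart_of x = (SOME q. fst q \<in> J \<and> snd q \<in> coord_ball n (p (fst q)) (r (fst q)) \<and> x = \<psi> (fst q) (snd q))"

text \<open>Points with the same key lie in a common coordinate cell of side \<open>1 / t\<close> of a chosen chart.\<close>

definition key :: "real \<Rightarrow> 'x \<Rightarrow> 'j \<times> (nat \<Rightarrow> int)" where
  "key t x = (fst (chart_of x), \<lambda>i\<in>{..<n}. \<lfloor>t * snd (chart_of x) i\<rfloor>)"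

lemma chart_of:
  assumes "x \<in> X"
  shows "fst (chart_of x) \<in> J" "snd (chart_of x) \<in> coord_ball n (p (fst (chart_of x))) (r (fst (chart_of x)))"
    "\<psi> (fst (chart_of x)) (snd (chart_of x)) = x"
proof -
  have "\<exists>q. fst q \<in> J \<and> snd q \<in> coord_ball n (p (fst q)) (r (fst q)) \<and> x = \<psi> (fst q) (snd q)"
    using cover[OF assms] by auto
  from someI_ex[OF this] show "fst (chart_of x) \<in> J"
    "snd (chart_of x) \<in> coord_ball n (p (fst (chart_of x))) (r (fst (chart_of x)))"
    "\<psi> (fst (chart_of x)) (snd (chart_of x)) = x" unfolding chart_of_def by metis+
qed

lemma cell_close:
  assumes "v \<in> grid_cell n t z" "w \<in> grid_cell n t z" "t > 0"
  shows "cdist n v w \<le> n / t"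
proof -
  have "cdist n v w \<le> (\<Sum>i<n. \<bar>v i - w i\<bar>)" by (rule cdist_le_sum)
  also have "\<dots> \<le> of_nat (card {..<n}) * (1 / t)"
  proof (rule sum_bounded_above)
    fix i assume "i \<in> {..<n}"
    then have "\<lfloor>t * v i\<rfloor> = \<lfloor>t * w i\<rfloor>" using assms by (auto simp: grid_cell_def)
    then have "\<bar>t * v i - t * w i\<bar> \<le> 1" by linarith
    then have "t * \<bar>v i - w i\<bar> \<le> 1" using assms(3) by (simp add: abs_mult flip: right_diff_distrib)
    then show "\<bar>v i - w i\<bar> \<le> 1 / t" using assms(3) by (simp add: field_simps)
  qed
  finally show ?thesis by simp
qed

lemma chart_cell:
  assumes "x \<in> X"
  shows "snd (chart_of x) \<in> grid_cell n t (snd (key t x))"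
  using chart_of(2)[OF assms] by (auto simp: key_def grid_cell_def coord_ball_def)

text \<open>The side \<open>1 / t\<close> of the cells cancels the factor \<open>t\<close> of the
  level, which makes the bound independent of the level.\<close>

lemma key_close:
  assumes w: "warped t \<delta>" and t: "t > 0" and x: "x \<in> X" and y: "y \<in> X" and k: "key t x = key t y"
  shows "\<delta> x y \<le> L * n"
proof -
  let ?j = "fst (chart_of x)" and ?v = "snd (chart_of x)" and ?w = "snd (chart_of y)"
  have jj: "fst (chart_of y) = ?j" using k by (simp add: key_def)
  have c: "cdist n ?v ?w \<le> n / t"
    using cell_close[OF chart_cell[OF x] _ t, of ?w] chart_cell[OF y, of t] k by simp
  have "d (\<psi> ?j ?v) (\<psi> ?j ?w) \<le> ennreal (L * cdist n ?v ?w)"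
    using chart_of[OF x] chart_of[OF y] jj by (intro d_le coord_ball_double) auto
  then have "d (\<alpha> \<one> x) y \<le> ennreal (L * cdist n ?v ?w)"
    using chart_of(3)[OF x] chart_of(3)[OF y] jj act_one[OF x] by simp
  then have "\<delta> x y \<le> wl \<one> + t * (L * cdist n ?v ?w)"
    using t L1 by (intro warped_le[OF w _ _ x y]) auto
  also have "\<dots> \<le> L * n"
  proof -
    have "t * cdist n ?v ?w \<le> n" using c t by (simp add: pos_le_divide_eq mult.commute)
    from mult_left_mono[OF this, of L] show ?thesis using L1 by (simp add: mult.left_commute)
  qed
  finally show ?thesis .
qed

text \<open>Every cell met by \<open>Q\<close> lies entirely in \<open>E j\<close>, so volume bounds
  the number of cells in each chart; summation over the charts gives the factor
  \<open>card J\<close>.\<close>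

lemma keys_bound:
  assumes E: "\<And>j. j \<in> J \<Longrightarrow> E j \<in> sets borel" and \<eta>: "\<eta> \<ge> 0"
    "\<And>j. j \<in> J \<Longrightarrow> emeasure (Euclidean_lebesgue n) (E j) \<le> ennreal \<eta>"
    and t: "t > 0" and Q: "Q \<subseteq> X"
    and near: "\<And>x w. x \<in> Q \<Longrightarrow> w \<in> grid_cell n t (snd (key t x)) \<Longrightarrow> w \<in> E (fst (chart_of x))"
  shows "finite (key t ` Q)" "real (card (key t ` Q)) \<le> real (card J) * \<eta> * t ^ n"
proof -
  define Z where "Z j = snd ` (key t ` {x \<in> Q. fst (chart_of x) = j})" for j
  have Zs: "Z j \<subseteq> ({..<n} \<rightarrow>\<^sub>E UNIV)" for j
  proof
    fix z assume "z \<in> Z j"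
    then obtain x where "z = snd (key t x)" unfolding Z_def by blast
    then show "z \<in> {..<n} \<rightarrow>\<^sub>E UNIV" by (simp add: key_def PiE_def)
  qed
  \<comment> \<open>Stated for finite subsets because the same bound is what then proves
    \<open>Z j\<close> finite.\<close>
  have fin: "card F \<le> \<eta> * t ^ n" if "F \<subseteq> Z j" "finite F" "j \<in> J" for F j
  proof -
    note FZ = that(1)
    have "ennreal (real (card F) * (1 / t) ^ n) \<le> emeasure (Euclidean_lebesgue n) (E j)"
    proof (rule card_grid_cells_le[OF t E[OF that(3)] that(2)])
      show "F \<subseteq> ({..<n} \<rightarrow>\<^sub>E UNIV)" using that Zs by blast
      fix z assume "z \<in> F"
      then obtain x where "x \<in> Q" "fst (chart_of x) = j" "z = snd (key t x)"
        using FZ unfolding Z_def by blast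
      then show "grid_cell n t z \<subseteq> E j" using near by blast
    qed
    also have "\<dots> \<le> ennreal \<eta>" by (rule \<eta>(2)[OF that(3)])
    finally have "real (card F) * (1 / t) ^ n \<le> \<eta>" using \<eta>(1) by simp
    then show ?thesis using t by (simp add: field_simps)
  qed
  have finZ: "finite (Z j)" if "j \<in> J" for j
  proof (rule ccontr)
    assume "infinite (Z j)"
    then obtain F where "F \<subseteq> Z j" "finite F" "card F = nat \<lceil>\<eta> * t ^ n\<rceil> + 1"
      using infinite_arbitrarily_large by metis
    with fin[OF this(1,2) that] show False by linarith
  qed
  have sub: "key t ` Q \<subseteq> (SIGMA j:J. Z j)"
  proof
    fix k assume "k \<in> key t ` Q"
    then obtain x where x: "x \<in> Q" "k = key t x" by blast
    have "snd k \<in> Z (fst (chart_of x))" unfolding Z_def x(2) using x(1) by blast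
    moreover have "fst k = fst (chart_of x)" by (simp add: x key_def)
    moreover have "fst (chart_of x) \<in> J" using chart_of(1) x Q by blast
    ultimately show "k \<in> (SIGMA j:J. Z j)" by (cases k) auto
  qed
  have finS: "finite (SIGMA j:J. Z j)" using finite_J finZ by blast
  show "finite (key t ` Q)" by (rule finite_subset[OF sub finS])
  have "card (key t ` Q) \<le> card (SIGMA j:J. Z j)" by (rule card_mono[OF finS sub])
  also have "card (SIGMA j:J. Z j) = (\<Sum>j\<in>J. card (Z j))" using finite_J finZ by simp
  finally have "real (card (key t ` Q)) \<le> (\<Sum>j\<in>J. real (card (Z j)))" by (simp flip: of_nat_sum)
  also have "\<dots> \<le> of_nat (card J) * (\<eta> * t ^ n)"
    using fin finZ by (intro sum_bounded_above) auto
  finally show "real (card (key t ` Q)) \<le> real (card J) * \<eta> * t ^ n" by (simp add: mult.assoc)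
qed

lemma near_double:
  assumes "x \<in> X" "w \<in> grid_cell n t (snd (key t x))" "t > 0" "real n / t \<le> r0" "\<And>j. j \<in> J \<Longrightarrow> r0 \<le> r j"
  shows "w \<in> B2 (fst (chart_of x))" "cdist n (snd (chart_of x)) w \<le> n / t"
proof -
  show c: "cdist n (snd (chart_of x)) w \<le> n / t"
    using cell_close[OF chart_cell[OF assms(1)] assms(2,3)] .
  have "cdist n (p (fst (chart_of x))) w \<le> r (fst (chart_of x)) + n / t"
    using cdist_triangle[of n "p (fst (chart_of x))" w "snd (chart_of x)"] c chart_of(2)[OF assms(1)]
    by (simp add: coord_ball_def)
  also have "\<dots> \<le> 2 * r (fst (chart_of x))" using assms(4,5) chart_of(1)[OF assms(1)] by fastforce
  finally show "w \<in> B2 (fst (chart_of x))" using assms(2) by (simp add: coord_ball_def grid_cell_def)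
qed

text \<open>\<open>keys_bound\<close> with the double balls as containers: once \<open>n / t\<close>
  is below all radii, a cell that meets an inner ball stays in the double ball.\<close>

lemma keys_all:
  obtains C t0 :: real where "C > 0" "t0 > 0" "\<And>t. t \<ge> t0 \<Longrightarrow> finite (key t ` X) \<and> real (card (key t ` X)) \<le> C * t ^ n"
proof -
  obtain r0 where r0: "r0 > 0" "\<And>j. j \<in> J \<Longrightarrow> r0 \<le> r j" using r0 by blast
  define \<eta> where "\<eta> = (\<Sum>j\<in>J. measure (Euclidean_lebesgue n) (B2 j))"
  have \<eta>: "emeasure (Euclidean_lebesgue n) (B2 j) \<le> ennreal \<eta>" if "j \<in> J" for j
  proof -
    have "emeasure (Euclidean_lebesgue n) (B2 j) = ennreal (measure (Euclidean_lebesgue n) (B2 j))"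
      using emeasure_coord_ball_finite[of n "p j" "2 * r j"] by (intro emeasure_eq_ennreal_measure) auto
    also have "\<dots> \<le> ennreal \<eta>" unfolding \<eta>_def
      using finite_J that by (intro ennreal_leI member_le_sum) auto
    finally show ?thesis .
  qed
  have \<eta>0: "\<eta> \<ge> 0" by (simp add: \<eta>_def sum_nonneg)
  show ?thesis
  proof (rule that[of "real (card J) * \<eta> + 1" "real n / r0 + 1"])
    show "0 < real (card J) * \<eta> + 1" "0 < n / r0 + 1"
      using \<eta>0 r0(1) by (auto intro!: add_nonneg_pos)
    fix t :: real assume "real n / r0 + 1 \<le> t"
    moreover have "0 \<le> real n / r0" using r0(1) by simp
    ultimately have t: "real n / r0 \<le> t" "t > 0" by linarith+
    have nt: "real n / t \<le> r0" using t r0 by (simp add: field_simps)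
    have *: "finite (key t ` X)" "real (card (key t ` X)) \<le> real (card J) * \<eta> * t ^ n"
      using keys_bound[of B2 \<eta> t X] \<eta> \<eta>0 t closed_coord_ball near_double(1)[OF _ _ t(2) nt r0(2)] by auto
    moreover have "real (card J) * \<eta> * t ^ n \<le> (real (card J) * \<eta> + 1) * t ^ n" using t by (intro mult_right_mono) auto
    ultimately show "finite (key t ` X) \<and> real (card (key t ` X)) \<le> (real (card J) * \<eta> + 1) * t ^ n" by linarith
  qed
qed

text \<open>Continuity of the measure from above, as balls have finite measure; the intersection is
  the fixed point set, which is null.\<close>

lemma slow_measure_tendsto:
  assumes j: "j \<in> J" and g: "g \<in> carrier G" "g \<noteq> \<one>"
  shows "(\<lambda>i. emeasure (Euclidean_lebesgue n) (slow j g (1 / Suc i))) \<longlonglongrightarrow> 0"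
proof -
  have "(\<lambda>i. emeasure (Euclidean_lebesgue n) (slow j g (1 / Suc i))) \<longlonglongrightarrow>
      emeasure (Euclidean_lebesgue n) (\<Inter>i. slow j g (1 / Suc i))"
  proof (rule Lim_emeasure_decseq)
    show "range (\<lambda>i. slow j g (1 / Suc i)) \<subseteq> sets (Euclidean_lebesgue n)"
      using closed_slow[OF j g(1)] by auto
    have "1 / real (Suc m) \<le> 1 / real (Suc k)" if "k \<le> m" for k m
      using that by (intro divide_left_mono) auto
    then show "decseq (\<lambda>i. slow j g (1 / Suc i))"
      unfolding decseq_def slow_def by (force intro: order_trans)
    fix i
    have "emeasure (Euclidean_lebesgue n) (slow j g (1 / Suc i)) \<le> emeasure (Euclidean_lebesgue n) (B2 j)"
      using closed_coord_ball by (intro emeasure_mono) (auto simp: slow_def)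
    then show "emeasure (Euclidean_lebesgue n) (slow j g (1 / Suc i)) \<noteq> \<infinity>"
      using emeasure_coord_ball_finite[of n "p j" "2 * r j"] by (auto simp: top_unique)
  qed
  moreover have "(\<Inter>i. slow j g (1 / Suc i)) = {v \<in> B2 j. \<alpha> g (\<psi> j v) = \<psi> j v}"
  proof (intro Set.set_eqI iffI)
    fix v assume v: "v \<in> (\<Inter>i. slow j g (1 / Suc i))"
    then have vB: "v \<in> B2 j" and le: "\<And>i. D (\<alpha> g (\<psi> j v)) (\<psi> j v) \<le> 1 / Suc i" by (auto simp: slow_def)
    note X = psi_X[OF j vB]
    have "D (\<alpha> g (\<psi> j v)) (\<psi> j v) \<le> 0"
      using le by (metis (no_types, lifting) inverse_eq_divide linorder_not_le order_less_le_trans reals_Archimedean order.irrefl)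
    then have "\<alpha> g (\<psi> j v) = \<psi> j v"
      using X act_X[OF g(1) X] lip_dist_nonneg[of "\<alpha> g (\<psi> j v)" X "\<psi> j v" d] by (intro D_eq_0) auto
    with vB show "v \<in> {v \<in> B2 j. \<alpha> g (\<psi> j v) = \<psi> j v}" by simp
  qed (auto simp: slow_def)
  ultimately show ?thesis using null_fix[OF j g] by simp
qed

lemma finite_real_wl_ball: "finite {g \<in> carrier G. real (wl g) \<le> R}"
  by (rule finite_subset[OF _ finite_wl_ball[of "nat \<lfloor>R\<rfloor>"]]) (auto simp: le_nat_floor)

lemma short_finite: "finite {g \<in> carrier G. g \<noteq> \<one> \<and> real (wl g) \<le> R}"
  by (rule finite_subset[OF _ finite_real_wl_ball[of R]]) auto

text \<open>A bad point is moved by at most \<open>R / t\<close> by some short nontrivial element.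
  By \<open>displacement_lipschitz\<close> its whole cell is moved by at most
  \<open>(R + 2 * L * n) / t\<close>, so for large \<open>t\<close> the cell lies in a union of
  finitely many slow sets of small measure.\<close>

lemma bad_keys:
  assumes \<eta>: "\<eta> > 0"
  obtains t0 :: real where "t0 > 0" "\<And>t. t \<ge> t0 \<Longrightarrow> finite (key t ` {x \<in> X. \<not> good t R x}) \<and>
     real (card (key t ` {x \<in> X. \<not> good t R x})) \<le> \<eta> * t ^ n"
proof -
  obtain r0 where r0: "r0 > 0" "\<And>j. j \<in> J \<Longrightarrow> r0 \<le> r j" using r0 by blast
  let ?F = "{g \<in> carrier G. g \<noteq> \<one> \<and> real (wl g) \<le> R}"
  \<comment> \<open>\<open>keys_bound\<close> multiplies the measure by \<open>card J\<close>; the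
    division compensates for it.\<close>
  define \<eta>' where "\<eta>' = \<eta> / (real (card J) + 1)"
  have \<eta>': "\<eta>' > 0" "real (card J) * \<eta>' \<le> \<eta>" using \<eta> by (auto simp: \<eta>'_def field_simps)
  have "\<forall>\<^sub>F i in sequentially. (\<Sum>g\<in>?F. emeasure (Euclidean_lebesgue n) (slow j g (1 / Suc i))) < ennreal \<eta>'"
    if j: "j \<in> J" for j
  proof -
    have "(\<lambda>i. \<Sum>g\<in>?F. emeasure (Euclidean_lebesgue n) (slow j g (1 / Suc i))) \<longlonglongrightarrow> (\<Sum>g\<in>?F. 0)"
      by (intro tendsto_sum slow_measure_tendsto j) auto
    then show ?thesis using \<eta>' by (intro order_tendstoD(2)) auto
  qed
  then have "\<forall>\<^sub>F i in sequentially. \<forall>j\<in>J. (\<Sum>g\<in>?F. emeasure (Euclidean_lebesgue n) (slow j g (1 / Suc i))) < ennreal \<eta>'"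
    using finite_J by (intro eventually_ball_finite) auto
  then obtain i where i: "\<And>j. j \<in> J \<Longrightarrow> (\<Sum>g\<in>?F. emeasure (Euclidean_lebesgue n) (slow j g (1 / Suc i))) < ennreal \<eta>'"
    using eventually_happens by fastforce
  define e where "e = 1 / real (Suc i)"
  have e: "e > 0" by (simp add: e_def)
  define E where "E j = (\<Union>g\<in>?F. slow j g e)" for j
  have E: "E j \<in> sets borel" if "j \<in> J" for j
    unfolding E_def using closed_slow[OF that] short_finite by (intro sets.finite_UN) auto
  have Em: "emeasure (Euclidean_lebesgue n) (E j) \<le> ennreal \<eta>'" if "j \<in> J" for j
  proof -
    have "emeasure (Euclidean_lebesgue n) (E j) \<le> (\<Sum>g\<in>?F. emeasure (Euclidean_lebesgue n) (slow j g e))"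
      unfolding E_def using closed_slow[OF that] short_finite by (intro emeasure_subadditive_finite) auto
    then show ?thesis using i[OF that] unfolding e_def by simp
  qed
  show ?thesis
  \<comment> \<open>The first summand keeps the cells in the double balls, the second makes
    \<open>(R + 2 * L * n) / t \<le> e\<close>.\<close>
  proof (rule that[of "real n / r0 + (\<bar>R\<bar> + 2 * L * n) / e + 1"])
    have nn: "real n / r0 \<ge> 0" "(\<bar>R\<bar> + 2 * L * n) / e \<ge> 0" using r0 e L1 by auto
    then show "0 < n / r0 + (\<bar>R\<bar> + 2 * L * n) / e + 1" by linarith
    fix t :: real assume "real n / r0 + (\<bar>R\<bar> + 2 * L * n) / e + 1 \<le> t"
    then have t: "real n / r0 \<le> t" "(\<bar>R\<bar> + 2 * L * n) / e \<le> t" "t > 0" using nn by linarith+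
    have nt: "real n / t \<le> r0" using t r0 by (simp add: field_simps)
    have et: "(R + 2 * L * n) / t \<le> e"
    proof -
      have "R + 2 * L * n \<le> e * t" using t(2) e by (simp add: pos_divide_le_eq mult.commute)
      then show ?thesis using t by (simp add: pos_divide_le_eq)
    qed
    have near: "w \<in> E (fst (chart_of x))"
      if x: "x \<in> {x \<in> X. \<not> good t R x}" and w: "w \<in> grid_cell n t (snd (key t x))" for x w
    proof -
      let ?j = "fst (chart_of x)" and ?v = "snd (chart_of x)"
      have xX: "x \<in> X" using x by simp
      note nd = near_double[OF xX w t(3) nt r0(2)]
      obtain g where g: "g \<in> ?F" "t * D (\<alpha> g x) x \<le> R" using x unfolding good_def by (auto simp: not_less)
      have "D (\<alpha> g (\<psi> ?j w)) (\<psi> ?j w) \<le> D (\<alpha> g (\<psi> ?j ?v)) (\<psi> ?j ?v) + 2 * L * cdist n w ?v"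
        using displacement_lipschitz[OF chart_of(1)[OF xX] _ nd(1) coord_ball_double[OF chart_of(1)[OF xX] chart_of(2)[OF xX]], of g] g(1) by simp
      also have "\<dots> \<le> R / t + 2 * L * (n / t)"
      proof (intro add_mono mult_left_mono)
        show "D (\<alpha> g (\<psi> ?j ?v)) (\<psi> ?j ?v) \<le> R / t"
          using g(2) t(3) chart_of(3)[OF xX] by (simp add: pos_le_divide_eq mult.commute)
        show "cdist n w ?v \<le> n / t" using nd(2) by (simp add: cdist_commute)
      qed (use L1 in auto)
      also have "\<dots> \<le> e" using et by (simp add: add_divide_distrib)
      finally show ?thesis using g(1) nd(1) unfolding E_def slow_def by blast
    qed
    have *: "finite (key t ` {x \<in> X. \<not> good t R x})"
       "real (card (key t ` {x \<in> X. \<not> good t R x})) \<le> real (card J) * \<eta>' * t ^ n"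
      using keys_bound[of E \<eta>' t "{x \<in> X. \<not> good t R x}", OF E _ Em t(3) _ near] \<eta>' by auto
    moreover have "real (card J) * \<eta>' * t ^ n \<le> \<eta> * t ^ n" using t \<eta>' by (intro mult_right_mono) auto
    ultimately show "finite (key t ` {x \<in> X. \<not> good t R x}) \<and> real (card (key t ` {x \<in> X. \<not> good t R x})) \<le> \<eta> * t ^ n"
      by linarith
  qed
qed

lemma J_ne: "J \<noteq> {}" using X_ne cover by blast

text \<open>Finitely many null sets cannot cover a ball, so some point is fixed by no short
  nontrivial element. Displacement is continuous, hence bounded below near that point, and the
  factor \<open>t\<close> eventually lifts it above \<open>R\<close>. The ball does not depend on
  \<open>t\<close>.\<close>

lemma good_ball:
  obtains j v0 and \<rho> t0 :: real where "j \<in> J" "\<rho> > 0" "v0 \<in> coord_ball n (p j) (2 * r j)" "coord_ball n v0 \<rho> \<subseteq> B2 j" "t0 > 0"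
    "\<And>t x. t \<ge> t0 \<Longrightarrow> x \<in> \<psi> j ` coord_ball n v0 \<rho> \<Longrightarrow> good t R x"
proof -
  let ?F = "{g \<in> carrier G. g \<noteq> \<one> \<and> real (wl g) \<le> R}"
  obtain j where j: "j \<in> J" using J_ne by blast
  have "\<exists>v0\<in>coord_ball n (p j) (r j). \<forall>g\<in>?F. \<alpha> g (\<psi> j v0) \<noteq> \<psi> j v0"
  proof (rule ccontr)
    assume "\<not> ?thesis"
    then have sub: "coord_ball n (p j) (r j) \<subseteq> (\<Union>g\<in>?F. slow j g 0)"
      using coord_ball_double[OF j] by (fastforce simp: slow_def)
    have s0: "slow j g 0 = {v \<in> B2 j. \<alpha> g (\<psi> j v) = \<psi> j v}" if "g \<in> ?F" for g
      using slow_0[OF j] that by blast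
    have "emeasure (Euclidean_lebesgue n) (coord_ball n (p j) (r j)) \<le> emeasure (Euclidean_lebesgue n) (\<Union>g\<in>?F. slow j g 0)"
      using closed_slow[OF j] short_finite by (intro emeasure_mono sub) (auto intro!: borel_closed closed_UN)
    also have "\<dots> \<le> (\<Sum>g\<in>?F. emeasure (Euclidean_lebesgue n) (slow j g 0))"
      using closed_slow[OF j] short_finite by (intro emeasure_subadditive_finite) auto
    also have "\<dots> = 0" using null_fix[OF j] s0 by (intro sum.neutral) auto
    finally show False using emeasure_coord_ball_pos[of "r j" n "p j"] r_pos[OF j] p_supp[OF j] by simp
  qed
  then obtain v0 where v0: "v0 \<in> coord_ball n (p j) (r j)" "\<And>g. g \<in> ?F \<Longrightarrow> \<alpha> g (\<psi> j v0) \<noteq> \<psi> j v0" by blast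
  have v2: "v0 \<in> B2 j" using coord_ball_double[OF j v0(1)] .
  define e where "e = Min (insert 1 ((\<lambda>g. D (\<alpha> g (\<psi> j v0)) (\<psi> j v0)) ` ?F))"
  have De: "D (\<alpha> g (\<psi> j v0)) (\<psi> j v0) \<ge> e" if "g \<in> ?F" for g
    unfolding e_def using short_finite[of R] that by (intro Min_le) auto
  have e: "e > 0"
  proof -
    have "D (\<alpha> g (\<psi> j v0)) (\<psi> j v0) > 0" if "g \<in> ?F" for g
    proof -
      have "\<alpha> g (\<psi> j v0) \<in> X" "\<psi> j v0 \<in> X" using that act_X psi_X[OF j v2] by auto
      then show ?thesis using D_eq_0[of "\<alpha> g (\<psi> j v0)" "\<psi> j v0"] v0(2)[OF that]
          lip_dist_nonneg[of "\<alpha> g (\<psi> j v0)" X "\<psi> j v0" d] by fastforce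
    qed
    then show ?thesis unfolding e_def using short_finite[of R] by (subst Min_gr_iff) auto
  qed
  \<comment> \<open>By \<open>displacement_lipschitz\<close> the displacement drops by at most
    \<open>e / 2\<close> within radius \<open>e / (4 * L)\<close>; the bound \<open>r j\<close>
    keeps the ball inside the double ball.\<close>
  define \<rho> where "\<rho> = min (r j) (e / (4 * L))"
  have \<rho>: "\<rho> > 0" "\<rho> \<le> r j" "2 * L * \<rho> \<le> e / 2"
  proof -
    show "\<rho> > 0" "\<rho> \<le> r j" using e L1 r_pos[OF j] by (auto simp: \<rho>_def)
    have "2 * L * \<rho> \<le> 2 * L * (e / (4 * L))" using L1 by (intro mult_left_mono) (auto simp: \<rho>_def)
    then show "2 * L * \<rho> \<le> e / 2" using L1 by simp
  qed
  have sub: "coord_ball n v0 \<rho> \<subseteq> B2 j"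
  proof
    fix v assume v: "v \<in> coord_ball n v0 \<rho>"
    have "cdist n (p j) v \<le> r j + \<rho>"
      using cdist_triangle[of n "p j" v v0] v v0(1) by (simp add: coord_ball_def)
    then show "v \<in> B2 j" using v \<rho>(2) by (simp add: coord_ball_def)
  qed
  show ?thesis
  proof (rule that[OF j \<rho>(1) v2 sub])
    show "2 * \<bar>R\<bar> / e + 1 > 0" using e by (simp add: add_nonneg_pos)
    fix t x assume t: "t \<ge> 2 * \<bar>R\<bar> / e + 1" and "x \<in> \<psi> j ` coord_ball n v0 \<rho>"
    then obtain v where v: "v \<in> coord_ball n v0 \<rho>" "x = \<psi> j v" by blast
    show "good t R x"
      unfolding good_def
    proof (intro ballI impI)
      fix g assume g: "g \<in> carrier G" "g \<noteq> \<one>" "real (wl g) \<le> R"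
      have "D (\<alpha> g (\<psi> j v0)) (\<psi> j v0) \<le> D (\<alpha> g x) x + 2 * L * cdist n v0 v"
        unfolding v(2) using sub v g by (intro displacement_lipschitz[OF j _ v2]) auto
      also have "\<dots> \<le> D (\<alpha> g x) x + 2 * L * \<rho>" using v L1 by (simp add: coord_ball_def)
      finally have "e / 2 \<le> D (\<alpha> g x) x" using De[of g] g \<rho>(3) by simp
      then have "t * (e / 2) \<le> t * D (\<alpha> g x) x" 
      proof (rule mult_left_mono)
        have "0 \<le> 2 * \<bar>R\<bar> / e" using e by simp
        then show "0 \<le> t" using t by linarith
      qed
      moreover have "R < t * (e / 2)"
      proof -
        have "2 * \<bar>R\<bar> / e < t" using t by linarith
        then have "2 * \<bar>R\<bar> < t * e" using e by (simp add: pos_divide_less_eq)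
        then show ?thesis by linarith
      qed
      ultimately show "R < t * D (\<alpha> g x) x" by linarith
    qed
  qed
qed

text \<open>The points form a lattice of mesh of order \<open>1 / t\<close> in a fixed coordinate
  ball, so their number is at least of order \<open>t ^ n\<close>; \<open>lip_ge\<close> makes them
  separated.\<close>

lemma packing:
  assumes j: "j \<in> J" and v0: "v0 \<in> B2 j" and \<rho>: "\<rho> > 0" "coord_ball n v0 \<rho> \<subseteq> B2 j" and b: "b \<ge> 0" and t: "t > 0"
  shows "\<exists>Q. finite Q \<and> Q \<subseteq> \<psi> j ` coord_ball n v0 \<rho> \<and> (\<rho> / ((L * b + 1) * (real n + 1)) * t) ^ n \<le> real (card Q) \<and>
    (\<forall>x\<in>Q. \<forall>y\<in>Q. x \<noteq> y \<longrightarrow> D x y > b / t)"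
proof -
  \<comment> \<open>The summand 1 makes the separation strict, since
    \<open>L * b < s\<close>.\<close>
  define s where "s = L * b + 1"
  have s: "s > 0" using L1 b by (simp add: s_def add_nonneg_pos)
  \<comment> \<open>The number of points per axis: the largest index \<open>K - 1\<close> stays
    within \<open>\<rho> / (n + 1)\<close> of the centre, while counting 0 as well gives the lower
    bound for \<open>K\<close>.\<close>
  define K where "K = nat \<lfloor>\<rho> * t / (s * (real n + 1))\<rfloor> + 1"
  have K: "\<rho> * t / (s * (real n + 1)) \<le> K" by (simp add: K_def) linarith
  have K': "real K - 1 \<le> \<rho> * t / (s * (real n + 1))"
    using \<rho> t s by (simp add: K_def)
  define q where "q z i = (if i < n then v0 i + s * real (z i) / t else 0)" for z :: "nat \<Rightarrow> nat" and i
  let ?P = "{..<n} \<rightarrow>\<^sub>E {..<K}"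
  have qb: "q z \<in> coord_ball n v0 \<rho>" if z: "z \<in> ?P" for z
  proof -
    have "cdist n v0 (q z) \<le> (\<Sum>i<n. \<bar>v0 i - q z i\<bar>)" by (rule cdist_le_sum)
    also have "\<dots> \<le> of_nat (card {..<n}) * (\<rho> / (real n + 1))"
    proof (rule sum_bounded_above)
      fix i assume i: "i \<in> {..<n}"
      have "real (z i) \<le> real K - 1" proof -
        have "z i < K" using z i by auto
        then show ?thesis by linarith
      qed
      then have "real (z i) \<le> \<rho> * t / (s * (real n + 1))" using K' by linarith
      then have "s / t * real (z i) \<le> s / t * (\<rho> * t / (s * (real n + 1)))"
        using s t by (intro mult_left_mono) auto
      then have "s * real (z i) / t \<le> \<rho> / (real n + 1)" using s t by simp
      then show "\<bar>v0 i - q z i\<bar> \<le> \<rho> / (real n + 1)" using i s t by (simp add: q_def)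
    qed
    also have "\<dots> \<le> \<rho>" using \<rho> by (simp add: field_simps)
    finally show ?thesis by (simp add: coord_ball_def q_def)
  qed
  have sep: "D (\<psi> j (q z)) (\<psi> j (q z')) > b / t" if z: "z \<in> ?P" "z' \<in> ?P" "z \<noteq> z'" for z z'
  proof -
    obtain i where i: "i < n" "z i \<noteq> z' i" using z PiE_ext[of z "{..<n}" "\<lambda>_. {..<K}" z'] by blast
    then have "1 \<le> \<bar>real (z i) - real (z' i)\<bar>" by linarith
    then have "s / t * 1 \<le> s / t * \<bar>real (z i) - real (z' i)\<bar>" using s t by (intro mult_left_mono) auto
    also have "\<dots> = \<bar>q z i - q z' i\<bar>"
    proof -
      have "q z i - q z' i = s / t * (real (z i) - real (z' i))" using i t by (simp add: q_def field_simps)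
      then show ?thesis using s t by (simp add: abs_mult)
    qed
    also have "\<dots> \<le> cdist n (q z) (q z')" by (rule cdist_coord[OF i(1)])
    also have "\<dots> \<le> L * D (\<psi> j (q z)) (\<psi> j (q z'))" using qb z \<rho>(2) by (intro lip_ge[OF j]) auto
    finally have "s / t \<le> L * D (\<psi> j (q z)) (\<psi> j (q z'))" by simp
    moreover have "L * (b / t) < s / t" using t by (simp add: s_def divide_strict_right_mono)
    ultimately have "L * (b / t) < L * D (\<psi> j (q z)) (\<psi> j (q z'))" by linarith
    then show ?thesis by (rule mult_left_less_imp_less) (use L1 in auto)
  qed
  have bt: "b / t \<ge> 0" using b t by simp
  have inj: "inj_on (\<lambda>z. \<psi> j (q z)) ?P"
  proof (rule inj_onI, rule ccontr)
    fix z z' assume "z \<in> ?P" "z' \<in> ?P" "\<psi> j (q z) = \<psi> j (q z')" "z \<noteq> z'"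
    then show False using sep[of z z'] bt by simp
  qed
  show ?thesis
  proof (intro exI[of _ "(\<lambda>z. \<psi> j (q z)) ` ?P"] conjI)
    show "finite ((\<lambda>z. \<psi> j (q z)) ` ?P)" by (intro finite_imageI finite_PiE) auto
    show "(\<lambda>z. \<psi> j (q z)) ` ?P \<subseteq> \<psi> j ` coord_ball n v0 \<rho>" using qb by blast
    have "card ((\<lambda>z. \<psi> j (q z)) ` ?P) = K ^ n" using inj by (simp add: card_image card_PiE)
    moreover have "(\<rho> / (s * (real n + 1)) * t) ^ n \<le> real K ^ n"
      using K \<rho> s t by (intro power_mono) auto
    ultimately show "(\<rho> / ((L * b + 1) * (real n + 1)) * t) ^ n \<le> real (card ((\<lambda>z. \<psi> j (q z)) ` ?P))"
      unfolding s_def by simp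
    show "\<forall>x\<in>(\<lambda>z. \<psi> j (q z)) ` ?P. \<forall>y\<in>(\<lambda>z. \<psi> j (q z)) ` ?P. x \<noteq> y \<longrightarrow> D x y > b / t"
      using sep by blast
  qed
qed

text \<open>From a fixed point of \<open>Q'\<close>, each point of \<open>Q'\<close> is reached by
  an element of length at most \<open>B + 1\<close> up to an error of \<open>(B + 1) / t\<close>.
  Two points sharing the element would be closer than the separation permits, so \<open>Q'\<close>
  injects into a ball of the group.\<close>

lemma multiplicity:
  assumes w: "warped t \<delta>" and t: "t > 0" and Q: "finite Q" "Q \<subseteq> X"
    and sep: "\<And>x y. x \<in> Q \<Longrightarrow> y \<in> Q \<Longrightarrow> x \<noteq> y \<Longrightarrow> D x y > 2 * (B + 1) / t"
    and y0: "\<And>y y'. y \<in> Q' \<Longrightarrow> y' \<in> Q' \<Longrightarrow> \<delta> y y' \<le> B" and Q': "Q' \<subseteq> Q"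
  shows "card Q' \<le> card {g \<in> carrier G. real (wl g) \<le> B + 1}"
proof (cases "Q' = {}")
  case False
  then obtain x where x: "x \<in> Q'" by blast
  have xX: "x \<in> X" using x Q Q' by blast
  have "\<exists>g\<in>carrier G. wl g + t * D (\<alpha> g x) y \<le> B + 1" if "y \<in> Q'" for y
  proof -
    have "y \<in> X" using that Q Q' by blast
    then show ?thesis using warped_ge[OF w t xX, of y] y0[OF x that] by force
  qed
  then obtain f where f: "\<And>y. y \<in> Q' \<Longrightarrow> f y \<in> carrier G \<and> wl (f y) + t * D (\<alpha> (f y) x) y \<le> B + 1" by metis
  have nn: "t * D (\<alpha> (f y) x) y \<ge> 0" if "y \<in> Q'" for y
  proof -
    have "y \<in> X" using that Q Q' by blast
    then show ?thesis using f[OF that] t act_X xX by (intro mult_nonneg_nonneg lip_dist_nonneg) auto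
  qed
  have "inj_on f Q'"
  proof (rule inj_onI, rule ccontr)
    fix y y' assume y: "y \<in> Q'" "y' \<in> Q'" "f y = f y'" "y \<noteq> y'"
    have X: "y \<in> X" "y' \<in> X" "\<alpha> (f y) x \<in> X" using y Q Q' f act_X xX by auto
    have "D y y' \<le> D y (\<alpha> (f y) x) + D (\<alpha> (f y) x) y'" using X by (intro lip_dist_triangle)
    then have "D y y' \<le> D (\<alpha> (f y) x) y + D (\<alpha> (f y) x) y'" by (simp add: lip_dist_commute[of X d y])
    then have "t * D y y' \<le> t * D (\<alpha> (f y) x) y + t * D (\<alpha> (f y) x) y'"
      using mult_left_mono[OF \<open>D y y' \<le> D (\<alpha> (f y) x) y + D (\<alpha> (f y) x) y'\<close>, of t] t by (simp add: distrib_left)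
    also have "\<dots> \<le> 2 * (B + 1)" using f[OF y(1)] f[OF y(2)] y(3) by simp
    finally have "D y y' \<le> 2 * (B + 1) / t" using t by (simp add: pos_le_divide_eq mult.commute)
    then show False using sep[of y y'] y Q' by force
  qed
  moreover have "f ` Q' \<subseteq> {g \<in> carrier G. real (wl g) \<le> B + 1}" using f nn by fastforce
  moreover have "finite {g \<in> carrier G. real (wl g) \<le> B + 1}"
    by (rule finite_real_wl_ball)
  ultimately show ?thesis by (metis card_inj_on_le)
qed simp

end

section \<open>Calculus in coordinates\<close>

lemma nat_det_eq_det:
  "nat_det n a = Determinant.det (Matrix.mat n n (\<lambda>(i, j). a i j))"
proof -
  have "(\<Prod>i<n. a i (\<sigma> i)) = (\<Prod>i = 0..<n. Matrix.mat n n (\<lambda>(i, j). a i j) $$ (i, \<sigma> i))"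
    if "\<sigma> permutes {..<n}" for \<sigma>
  proof (rule prod.cong[OF lessThan_atLeast0])
    fix i assume i: "i \<in> {0..<n}"
    then have "\<sigma> i < n" using permutes_in_image[OF that, of i] by simp
    then show "a i (\<sigma> i) = Matrix.mat n n (\<lambda>(i, j). a i j) $$ (i, \<sigma> i)" using i by simp
  qed
  then show ?thesis
    unfolding nat_det_def Determinant.det_def
    by (simp add: lessThan_atLeast0)
qed

text \<open>The segment from the identity matrix to \<open>a\<close> has positive definite quadratic
  forms throughout, hence avoids determinant 0; the intermediate value theorem fixes the
  sign.\<close>

lemma nat_det_pos:
  fixes a :: "nat \<Rightarrow> nat \<Rightarrow> real"
  assumes pd: "\<And>v :: nat \<Rightarrow> real. \<exists>i<n. v i \<noteq> 0 \<Longrightarrow> 0 < (\<Sum>i<n. \<Sum>j<n. a i j * v i * v j)"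
  shows "nat_det n a > 0"
proof -
  define b where "b s i j = (1 - s) * (if i = j then 1 else 0) + s * a i j" for s :: real and i j :: nat
  have ne: "nat_det n (b s) \<noteq> 0" if s: "0 \<le> s" "s \<le> 1" for s
  proof
    let ?B = "Matrix.mat n n (\<lambda>(i, j). b s i j)"
    assume "nat_det n (b s) = 0"
    then obtain v where v: "v \<in> carrier_vec n" "v \<noteq> 0\<^sub>v n" "?B *\<^sub>v v = 0\<^sub>v n"
      using det_0_iff_vec_prod_zero_field[of ?B n] by (auto simp: nat_det_eq_det)
    define w where "w i = v $ i" for i
    have w: "\<exists>i<n. w i \<noteq> 0"
    proof (rule ccontr)
      assume "\<not> ?thesis"
      then have "v = 0\<^sub>v n" using v(1) by (intro eq_vecI) (auto simp: w_def)
      then show False using v by simp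
    qed
    have 0: "(\<Sum>j<n. b s i j * w j) = 0" if i: "i < n" for i
    proof -
      have "(?B *\<^sub>v v) $ i = 0" using v(3) i by simp
      then show ?thesis using i v(1) by (simp add: scalar_prod_def w_def lessThan_atLeast0)
    qed
    have "(\<Sum>i<n. \<Sum>j<n. b s i j * w i * w j) = (\<Sum>i<n. w i * (\<Sum>j<n. b s i j * w j))"
      by (simp add: sum_distrib_left mult_ac)
    also have "\<dots> = 0" using 0 by simp
    also have "(\<Sum>i<n. \<Sum>j<n. b s i j * w i * w j) =
       (1 - s) * (\<Sum>i<n. (w i)\<^sup>2) + s * (\<Sum>i<n. \<Sum>j<n. a i j * w i * w j)"
    proof -
      have "(\<Sum>j<n. (1 - s) * (if i = j then 1 else 0) * w i * w j) = (1 - s) * (w i)\<^sup>2" if "i < n" for i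
      proof -
        have "(\<Sum>j<n. (1 - s) * (if i = j then 1 else 0) * w i * w j) = (\<Sum>j<n. if i = j then (1 - s) * (w i)\<^sup>2 else 0)"
          by (intro sum.cong) (auto simp: power2_eq_square)
        then show ?thesis using that by simp
      qed
      then have "(\<Sum>i<n. \<Sum>j<n. (1 - s) * (if i = j then 1 else 0) * w i * w j) = (1 - s) * (\<Sum>i<n. (w i)\<^sup>2)"
        by (simp add: sum_distrib_left)
      moreover have "(\<Sum>i<n. \<Sum>j<n. b s i j * w i * w j) =
          (\<Sum>i<n. \<Sum>j<n. (1 - s) * (if i = j then 1 else 0) * w i * w j + s * (a i j * w i * w j))"
        by (intro sum.cong refl) (simp add: b_def algebra_simps)
      ultimately show ?thesis by (simp only: sum.distrib sum_distrib_left)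
    qed
    finally have "(1 - s) * (\<Sum>i<n. (w i)\<^sup>2) + s * (\<Sum>i<n. \<Sum>j<n. a i j * w i * w j) = 0" .
    moreover have "(\<Sum>i<n. \<Sum>j<n. a i j * w i * w j) > 0" using pd[OF w] .
    moreover have "(\<Sum>i<n. (w i)\<^sup>2) > 0"
      using w by (metis (no_types, lifting) finite_lessThan lessThan_iff sum_pos2 zero_le_power2 zero_less_power2)
    ultimately show False using s
      by (smt (verit) mult_nonneg_nonneg mult_pos_pos)
  qed
  have cont: "continuous_on {0..1} (\<lambda>s. nat_det n (b s))"
    unfolding nat_det_def b_def by (intro continuous_intros)
  have b0: "nat_det n (b 0) = 1"
  proof -
    have "Matrix.mat n n (\<lambda>(i, j). b 0 i j) = 1\<^sub>m n" by (auto simp: b_def)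
    then show ?thesis by (simp add: nat_det_eq_det)
  qed
  have "b 1 = a" by (intro ext) (simp add: b_def)
  then have b1: "nat_det n (b 1) = nat_det n a" by simp
  show ?thesis
  proof (rule ccontr)
    assume "\<not> ?thesis"
    then have "\<exists>s\<ge>0. s \<le> 1 \<and> nat_det n (b s) = 0"
      using cont b0 b1 by (intro IVT2') auto
    then show False using ne by blast
  qed
qed

section \<open>Topology and differential calculus in \<open>Euclidean_space n\<close>\<close>

lemma Euclidean_space_eq: "Euclidean_space n = top_of_set {x. \<forall>i\<ge>n. x i = 0}"
  by (simp add: Euclidean_space_def euclidean_product_topology)

lemma continuous_map_Euclidean_subtopology:
  assumes "W \<subseteq> {x. \<forall>i\<ge>n. x i = 0}"
  shows "continuous_map (subtopology (Euclidean_space n) W) euclidean f \<longleftrightarrow> continuous_on W f"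
  using assms by (simp add: Euclidean_space_eq subtopology_subtopology Int_absorb1)

text \<open>A product neighbourhood restricts each coordinate separately: the first \<open>n\<close>
  are handled by a common radius, and from \<open>n\<close> on the points of the ball agree with
  \<open>p\<close>.\<close>

lemma openin_Euclidean_ball:
  assumes "openin (Euclidean_space n) W" "p \<in> W"
  obtains \<rho> where "\<rho> > 0" "coord_ball n p \<rho> \<subseteq> W"
proof -
  obtain U where U: "openin (powertop_real UNIV) U" "W = U \<inter> {x. \<forall>i\<ge>n. x i = 0}"
    using assms(1) unfolding Euclidean_space_def openin_subtopology by blast
  from product_topology_open_contains_basis[OF U(1), of p] obtain X where
    X: "p \<in> (\<Pi>\<^sub>E i\<in>UNIV. X i)" "\<And>i. open (X i)" "(\<Pi>\<^sub>E i\<in>UNIV. X i) \<subseteq> U" using assms U by auto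
  have "\<exists>e>0. \<forall>y. \<bar>p i - y\<bar> \<le> e \<longrightarrow> y \<in> X i" for i
  proof -
    have "p i \<in> X i" using X(1) by auto
    then obtain e where "e > 0" "cball (p i) e \<subseteq> X i" using X(2) open_contains_cball by metis
    then show ?thesis by (intro exI[of _ e]) (auto simp: dist_real_def subset_iff)
  qed
  then obtain e where e: "\<And>i. e i > 0" "\<And>i y. \<bar>p i - y\<bar> \<le> e i \<Longrightarrow> y \<in> X i" by metis
  define \<rho> where "\<rho> = Min (insert 1 (e ` {..<n}))"
  have \<rho>: "\<rho> > 0" "\<And>i. i < n \<Longrightarrow> \<rho> \<le> e i"
    unfolding \<rho>_def using e by (auto simp: Min_gr_iff)
  have p0: "p i = 0" if "i \<ge> n" for i using assms(2) U(2) that by auto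
  show ?thesis
  proof (rule that[OF \<rho>(1)], rule subsetI)
    fix v assume v: "v \<in> coord_ball n p \<rho>"
    have "v i \<in> X i" for i
    proof (cases "i < n")
      case True
      have "\<bar>p i - v i\<bar> \<le> e i" using cdist_coord[OF True, of p v] v \<rho>(2)[OF True] by (simp add: coord_ball_def)
      then show ?thesis by (rule e(2))
    next
      case False
      then have "v i = p i" using v p0 by (simp add: coord_ball_def)
      then show ?thesis using X(1) by auto
    qed
    then show "v \<in> W" using X(3) U(2) v by (auto simp: coord_ball_def PiE_def)
  qed
qed

text \<open>It is a closed subset of a product of compact intervals.\<close>

lemma compact_coord_ball: "compact (coord_ball n p r)"
proof -
  have "compactin (product_topology (\<lambda>i::nat. euclideanreal) UNIV) (\<Pi>\<^sub>E i\<in>UNIV. {- \<bar>p i\<bar> - \<bar>r\<bar> .. \<bar>p i\<bar> + \<bar>r\<bar>})"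
    unfolding compactin_PiE by (auto simp: compactin_euclidean_iff)
  then have "compact (\<Pi>\<^sub>E i\<in>UNIV. {- \<bar>p i\<bar> - \<bar>r\<bar> .. \<bar>p i\<bar> + \<bar>r\<bar>})"
    unfolding euclidean_product_topology compactin_euclidean_iff .
  moreover have "coord_ball n p r \<subseteq> (\<Pi>\<^sub>E i\<in>UNIV. {- \<bar>p i\<bar> - \<bar>r\<bar> .. \<bar>p i\<bar> + \<bar>r\<bar>})"
  proof
    fix v assume v: "v \<in> coord_ball n p r"
    have "v i \<in> {- \<bar>p i\<bar> - \<bar>r\<bar> .. \<bar>p i\<bar> + \<bar>r\<bar>}" for i
    proof (cases "i < n")
      case True
      then show ?thesis using cdist_coord[OF True, of p v] v by (auto simp: coord_ball_def)
    qed (use v in \<open>auto simp: coord_ball_def\<close>)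
    then show "v \<in> (\<Pi>\<^sub>E i\<in>UNIV. {- \<bar>p i\<bar> - \<bar>r\<bar> .. \<bar>p i\<bar> + \<bar>r\<bar>})" by auto
  qed
  ultimately show ?thesis
    using compact_Int_closed[OF _ closed_coord_ball] by (metis Int_absorb1)
qed

text \<open>The bound \<open>w\<close> need not be measurable, and \<open>h'\<close> may blow up at the exceptional points.\<close>

lemma ftc_le_nn_integral:
  fixes h :: "real \<Rightarrow> real" and w :: "real \<Rightarrow> real"
  assumes cont: "continuous_on {0..1} h" and F: "finite F"
    and der: "\<And>s. s \<in> {0<..<1} - F \<Longrightarrow> (h has_real_derivative h' s) (at s)"
    and le: "\<And>s. s \<in> {0<..<1} - F \<Longrightarrow> \<bar>h' s\<bar> \<le> w s"
  shows "ennreal \<bar>h 1 - h 0\<bar> \<le> (\<integral>\<^sup>+ s\<in>{0..1}. ennreal (w s) \<partial>lborel)"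
proof -
  let ?A = "{0<..<1} - F"
  \<comment> \<open>The derivative, set to 0 at the exceptional points and outside the interval, as
    a function on the whole line.\<close>
  define k where "k s = indicator ?A s * h' s" for s :: real
  have hi: "(h' has_integral (h 1 - h 0)) {0..1}"
    using der by (intro fundamental_theorem_of_calculus_interior_strong[OF F _ _ cont])
      (auto simp: has_real_derivative_iff_has_vector_derivative)
  have ki: "(k has_integral (h 1 - h 0)) UNIV"
  proof -
    have "(k has_integral (h 1 - h 0)) {0..1}"
      by (rule has_integral_spike_finite[OF _ _ hi, of "F \<union> {0, 1}"]) (use F in \<open>auto simp: k_def indicator_def\<close>)
    then show ?thesis
      by (rule has_integral_on_superset) (auto simp: k_def indicator_def)
  qed
  \<comment> \<open>A continuous extension of \<open>h\<close> to the line. Its difference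
    quotients, cut off by the indicator, are Borel and converge to \<open>k\<close>, which yields
    the measurability of \<open>k\<close>.\<close>
  define c where "c s = h (max 0 (min 1 s))" for s
  have c_cont: "continuous_on UNIV c"
    unfolding c_def by (intro continuous_on_compose2[OF cont] continuous_intros) auto
  have k_meas: "k \<in> borel_measurable borel"
  proof (rule borel_measurable_LIMSEQ_real)
    show "(\<lambda>s. indicator ?A s * ((c (s + 1 / Suc i) - c s) / (1 / Suc i))) \<in> borel_measurable borel" for i
    proof -
      have "?A \<in> sets borel" using F by (intro sets.Diff) (auto intro: finite_imp_closed borel_closed)
      moreover have "(\<lambda>s. (c (s + 1 / Suc i) - c s) / (1 / Suc i)) \<in> borel_measurable borel"
        using c_cont by (intro borel_measurable_continuous_onI continuous_intros continuous_on_compose2[OF c_cont]) auto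
      ultimately show ?thesis by (intro borel_measurable_times borel_measurable_indicator)
    qed
    fix s :: real
    show "(\<lambda>i. indicator ?A s * ((c (s + 1 / Suc i) - c s) / (1 / Suc i))) \<longlonglongrightarrow> k s"
    proof (cases "s \<in> ?A")
      case True
      have "eventually (\<lambda>r. c r = h r) (nhds s)"
      proof (rule eventually_nhds_in_open[THEN eventually_mono, of "{0<..<1}"])
        show "s \<in> {0<..<1}" using True by simp
      qed (auto simp: c_def)
      then have "(c has_real_derivative h' s) (at s)"
        using der[OF True] by (subst DERIV_cong_ev[OF refl _ refl, of _ h]) auto
      then have "((\<lambda>e. (c (s + e) - c s) / e) \<longlongrightarrow> h' s) (at 0)" by (simp add: DERIV_def)
      moreover have "filterlim (\<lambda>i. 1 / real (Suc i)) (at 0) sequentially"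
        using LIMSEQ_Suc[OF lim_1_over_n] by (intro filterlim_atI) auto
      ultimately have "(\<lambda>i. (c (s + 1 / Suc i) - c s) / (1 / Suc i)) \<longlonglongrightarrow> h' s"
        by (rule filterlim_compose)
      then show ?thesis using True by (simp add: k_def)
    qed (simp add: k_def)
  qed
  have kw: "(\<integral>\<^sup>+ s. ennreal \<bar>k s\<bar> \<partial>lborel) \<le> (\<integral>\<^sup>+ s\<in>{0..1}. ennreal (w s) \<partial>lborel)"
  proof (rule nn_integral_mono)
    fix s :: real
    show "ennreal \<bar>k s\<bar> \<le> ennreal (w s) * indicator {0..1} s"
      using le[of s] by (cases "s \<in> ?A") (auto simp: k_def intro!: ennreal_leI)
  qed
  show ?thesis
  \<comment> \<open>With infinite integral the bound is trivial. Otherwise \<open>k\<close> is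
    Lebesgue integrable, and its integral agrees with the gauge integral from the fundamental
    theorem.\<close>
  proof (cases "(\<integral>\<^sup>+ s. ennreal \<bar>k s\<bar> \<partial>lborel) = \<infinity>")
    case True then show ?thesis using kw by (simp add: top_unique)
  next
    case False
    then have int: "integrable lborel k"
      using k_meas by (intro integrableI_bounded) (auto simp: less_top)
    then have "h 1 - h 0 = integral\<^sup>L lborel k"
      using has_integral_unique[OF ki has_integral_integral_lborel] by blast
    then have "ennreal \<bar>h 1 - h 0\<bar> \<le> (\<integral>\<^sup>+ s. ennreal \<bar>k s\<bar> \<partial>lborel)"
      using integral_norm_bound_ennreal[OF int] by simp
    then show ?thesis using kw by (rule order_trans)
  qed
qed

text \<open>Continuous partial derivatives imply total differentiability: go from \<open>p\<close>
  to \<open>q\<close> parallel to the coordinate axes and apply the mean value inequality on each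
  edge, where the partial derivative differs from that at \<open>p\<close> by at most
  \<open>e\<close>.\<close>

lemma C1_remainder:
  assumes W: "openin (Euclidean_space n) W" and f: "Ck_on n (Suc 0) W f" and p: "p \<in> W" and e: "e > 0"
  obtains \<delta> where "\<delta> > 0" "coord_ball n p \<delta> \<subseteq> W"
    "\<And>q. q \<in> coord_ball n p \<delta> \<Longrightarrow>
       \<bar>f q - f p - (\<Sum>i<n. partial_deriv i f p * (q i - p i))\<bar> \<le> e * (\<Sum>i<n. \<bar>q i - p i\<bar>)"
proof -
  have W0: "W \<subseteq> {x. \<forall>i\<ge>n. x i = 0}" using openin_subset[OF W] by (simp add: topspace_Euclidean_space)
  have pd: "partial_differentiable i f z" if "i < n" "z \<in> W" for i z using f that by simp
  have cont: "continuous_on W (partial_deriv i f)" if "i < n" for i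
    using f that by (simp add: continuous_map_Euclidean_subtopology[OF W0])
  have nbhd: "\<exists>\<delta>>0. \<forall>z\<in>coord_ball n p \<delta>. z \<in> W \<and> \<bar>partial_deriv i f z - partial_deriv i f p\<bar> \<le> e" if "i < n" for i
  proof -
    let ?V = "{z \<in> W. partial_deriv i f z \<in> ball (partial_deriv i f p) e}"
    have "openin (subtopology (Euclidean_space n) W) ?V"
    proof -
      have "continuous_map (subtopology (Euclidean_space n) W) euclideanreal (partial_deriv i f)"
        using f that by simp
      from openin_continuous_map_preimage[OF this, of "ball (partial_deriv i f p) e"]
      show ?thesis using W0 by (simp add: topspace_Euclidean_space Int_absorb1)
    qed
    then have "openin (Euclidean_space n) ?V" using W by (rule openin_trans_full)
    moreover have "p \<in> ?V" using p e by simp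
    ultimately obtain \<delta> where "\<delta> > 0" "coord_ball n p \<delta> \<subseteq> ?V" by (rule openin_Euclidean_ball)
    then show ?thesis by (intro exI[of _ \<delta>]) (auto simp: dist_real_def abs_minus_commute subset_iff intro: less_imp_le)
  qed
  then obtain d where d: "\<And>i. i < n \<Longrightarrow> d i > 0"
    "\<And>i z. i < n \<Longrightarrow> z \<in> coord_ball n p (d i) \<Longrightarrow> z \<in> W \<and> \<bar>partial_deriv i f z - partial_deriv i f p\<bar> \<le> e" by metis
  obtain d0 where d0: "d0 > 0" "coord_ball n p d0 \<subseteq> W" using openin_Euclidean_ball[OF W p] .
  define \<delta> where "\<delta> = Min (insert d0 (d ` {..<n}))"
  have \<delta>: "\<delta> > 0" "\<delta> \<le> d0" "\<And>i. i < n \<Longrightarrow> \<delta> \<le> d i"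
    unfolding \<delta>_def using d d0 by (auto simp: Min_gr_iff)
  have \<delta>W: "coord_ball n p \<delta> \<subseteq> W" using d0 \<delta> by (auto simp: coord_ball_def subset_iff)
  show ?thesis
  proof (rule that[OF \<delta>(1) \<delta>W])
    fix q assume q: "q \<in> coord_ball n p \<delta>"
    \<comment> \<open>The corners of the path: the first \<open>k\<close> coordinates are already
      those of \<open>q\<close>.\<close>
    define z where "z k i = (if i < k then q i else p i)" for k i :: nat
    have inball: "(z k)(k := s) \<in> coord_ball n p \<delta>" if k: "k < n" and s: "s \<in> closed_segment (p k) (q k)" for k s
    proof -
      have "\<bar>p k - s\<bar> \<le> \<bar>p k - q k\<bar>" using s by (auto simp: closed_segment_eq_real_ivl split: if_splits)
      then have "cdist n p ((z k)(k := s)) \<le> cdist n p q"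
        unfolding cdist_def L2_set_def
        by (intro real_sqrt_le_mono sum_mono) (auto simp: z_def abs_le_square_iff[symmetric])
      then show ?thesis using q k W0 p by (auto simp: coord_ball_def z_def)
    qed
    have step: "\<bar>f (z (Suc k)) - f (z k) - partial_deriv k f p * (q k - p k)\<bar> \<le> e * \<bar>q k - p k\<bar>" if k: "k < n" for k
    proof -
      define h where "h s = f ((z k)(k := s)) - partial_deriv k f p * s" for s
      have der: "(h has_real_derivative (partial_deriv k f ((z k)(k := s)) - partial_deriv k f p))
          (at s within closed_segment (p k) (q k))" if s: "s \<in> closed_segment (p k) (q k)" for s
      proof -
        have "(z k)(k := s) \<in> W" using inball[OF k s] \<delta>W by blast
        then have "(\<lambda>s'. f ((z k)(k := s, k := s'))) field_differentiable at s"
          using pd[OF k] unfolding partial_differentiable_def by fastforce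
        then have "((\<lambda>s'. f ((z k)(k := s, k := s'))) has_real_derivative partial_deriv k f ((z k)(k := s))) (at s)"
          unfolding partial_deriv_def using field_differentiable_derivI by fastforce
        then have 1: "((\<lambda>s'. f ((z k)(k := s'))) has_real_derivative partial_deriv k f ((z k)(k := s))) (at s)"
          by simp
        have 2: "((\<lambda>s. partial_deriv k f p * s) has_real_derivative partial_deriv k f p) (at s)"
          by (auto intro!: derivative_eq_intros)
        show ?thesis unfolding h_def
          by (rule has_field_derivative_at_within[OF DERIV_diff[OF 1 2]])
      qed
      have "\<bar>partial_deriv k f ((z k)(k := s)) - partial_deriv k f p\<bar> \<le> e" if "s \<in> closed_segment (p k) (q k)" for s
        using inball[OF k that] d(2)[OF k] \<delta>(3)[OF k] by (auto simp: coord_ball_def)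
      then have "norm (h (q k) - h (p k)) \<le> e * norm (q k - p k)"
        using der by (intro field_differentiable_bound[OF convex_closed_segment]) auto
      moreover have "(z k)(k := q k) = z (Suc k)" "(z k)(k := p k) = z k"
        by (auto simp: z_def fun_eq_iff less_Suc_eq)
      ultimately show ?thesis by (simp add: h_def algebra_simps)
    qed
    have z0: "z 0 = p" and zn: "z n = q"
      using q W0 p by (auto simp: z_def fun_eq_iff coord_ball_def)
    have "f q - f p = (\<Sum>k<n. f (z (Suc k)) - f (z k))"
      using sum_lessThan_telescope[of "\<lambda>k. f (z k)" n] by (simp add: z0 zn)
    then have "f q - f p - (\<Sum>i<n. partial_deriv i f p * (q i - p i)) =
       (\<Sum>k<n. f (z (Suc k)) - f (z k) - partial_deriv k f p * (q k - p k))" by (simp add: sum_subtractf)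
    also have "\<bar>\<dots>\<bar> \<le> (\<Sum>k<n. e * \<bar>q k - p k\<bar>)" using step by (intro order_trans[OF sum_abs] sum_mono) simp
    finally show "\<bar>f q - f p - (\<Sum>i<n. partial_deriv i f p * (q i - p i))\<bar> \<le> e * (\<Sum>i<n. \<bar>q i - p i\<bar>)"
      by (simp add: sum_distrib_left)
  qed
qed

lemma curve_eventually_in_ball:
  assumes v: "\<And>i. i < n \<Longrightarrow> ((\<lambda>r. c r i) has_real_derivative v i) (at s)"
    and ev: "\<forall>\<^sub>F r in at s. \<forall>i\<ge>n. c r i = 0" and \<delta>: "\<delta> > 0"
  shows "\<forall>\<^sub>F r in at s. c r \<in> coord_ball n (c s) \<delta>"
proof -
  have "((\<lambda>r. \<Sum>i<n. \<bar>c s i - c r i\<bar>) \<longlongrightarrow> (\<Sum>i<n. \<bar>c s i - c s i\<bar>)) (at s)"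
    using DERIV_isCont[OF v] by (intro tendsto_intros) (auto simp: isCont_def)
  then have "\<forall>\<^sub>F r in at s. (\<Sum>i<n. \<bar>c s i - c r i\<bar>) < \<delta>" using \<delta> by (intro order_tendstoD(2)) auto
  then show ?thesis using ev
  proof eventually_elim
    case (elim r)
    have "cdist n (c s) (c r) \<le> (\<Sum>i<n. \<bar>c s i - c r i\<bar>)" by (rule cdist_le_sum)
    then show ?case using elim by (simp add: coord_ball_def)
  qed
qed

text \<open>Differentiability of the curve at the single point \<open>s\<close> suffices: its
  difference quotients are then bounded near \<open>s\<close>, and the remainder from
  \<open>C1_remainder\<close> is small relative to \<open>r - s\<close>.\<close>

lemma C1_chain_rule:
  assumes W: "openin (Euclidean_space n) W" and f: "Ck_on n (Suc 0) W f" and p: "c s \<in> W"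
    and v: "\<And>i. i < n \<Longrightarrow> ((\<lambda>r. c r i) has_real_derivative v i) (at s)"
    and ev: "\<forall>\<^sub>F r in at s. \<forall>i\<ge>n. c r i = 0"
  shows "((\<lambda>r. f (c r)) has_real_derivative (\<Sum>i<n. partial_deriv i f (c s) * v i)) (at s)"
proof -
  let ?a = "\<lambda>i. partial_deriv i f (c s)" and ?q = "\<lambda>i r. (c r i - c s i) / (r - s)"
  have q: "(?q i \<longlongrightarrow> v i) (at s)" if "i < n" for i
    using v[OF that] by (simp add: has_field_derivative_iff)
  have main: "((\<lambda>r. \<Sum>i<n. ?a i * ?q i r) \<longlongrightarrow> (\<Sum>i<n. ?a i * v i)) (at s)"
    using q by (intro tendsto_intros) auto
  have bnd: "((\<lambda>r. \<Sum>i<n. \<bar>?q i r\<bar>) \<longlongrightarrow> (\<Sum>i<n. \<bar>v i\<bar>)) (at s)"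
    using q by (intro tendsto_intros) auto
  \<comment> \<open>The 1 turns the limit into a strict bound near \<open>s\<close> and keeps
    \<open>V\<close> positive for the division.\<close>
  define V where "V = (\<Sum>i<n. \<bar>v i\<bar>) + 1"
  have V: "V > 0" by (simp add: V_def add_nonneg_pos sum_nonneg)
  have bV: "\<forall>\<^sub>F r in at s. (\<Sum>i<n. \<bar>?q i r\<bar>) < V" using bnd by (rule order_tendstoD(2)) (simp add: V_def)
  have "((\<lambda>r. (f (c r) - f (c s)) / (r - s) - (\<Sum>i<n. ?a i * ?q i r)) \<longlongrightarrow> 0) (at s)"
  proof (rule tendstoI)
    fix e :: real assume e: "e > 0"
    obtain \<delta> where \<delta>: "\<delta> > 0" "coord_ball n (c s) \<delta> \<subseteq> W" and
      rem: "\<And>q. q \<in> coord_ball n (c s) \<delta> \<Longrightarrow>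
       \<bar>f q - f (c s) - (\<Sum>i<n. ?a i * (q i - c s i))\<bar> \<le> (e / V) * (\<Sum>i<n. \<bar>q i - c s i\<bar>)"
      by (rule C1_remainder[OF W f p divide_pos_pos[OF e V]], rule that)
    have inb: "\<forall>\<^sub>F r in at s. c r \<in> coord_ball n (c s) \<delta>"
      by (rule curve_eventually_in_ball[OF _ ev \<delta>(1)]) (use v in auto)
    show "\<forall>\<^sub>F r in at s. dist ((f (c r) - f (c s)) / (r - s) - (\<Sum>i<n. ?a i * ?q i r)) 0 < e"
      using inb bV eventually_neq_at_within[of s s]
    proof eventually_elim
      case (elim r)
      have rs: "\<bar>r - s\<bar> > 0" using elim by simp
      have "(f (c r) - f (c s)) / (r - s) - (\<Sum>i<n. ?a i * ?q i r) =
         (f (c r) - f (c s) - (\<Sum>i<n. ?a i * (c r i - c s i))) / (r - s)"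
      proof -
        have "(\<Sum>i<n. ?a i * ?q i r) = (\<Sum>i<n. ?a i * (c r i - c s i)) / (r - s)"
          by (simp add: sum_divide_distrib)
        then show ?thesis by (simp only: diff_divide_distrib)
      qed
      also have "\<bar>\<dots>\<bar> \<le> (e / V) * (\<Sum>i<n. \<bar>c r i - c s i\<bar>) / \<bar>r - s\<bar>"
        using divide_right_mono[OF rem[OF elim(1)] abs_ge_zero[of "r - s"]] by (simp only: abs_divide)
      also have "\<dots> = (e / V) * (\<Sum>i<n. \<bar>?q i r\<bar>)"
        by (simp add: abs_divide sum_divide_distrib sum_distrib_left)
      also have "\<dots> < (e / V) * V" using elim e V by (intro mult_strict_left_mono) auto
      finally show ?case using V by simp
    qed
  qed
  from tendsto_add[OF this main] show ?thesis by (simp add: has_field_derivative_iff)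
qed

section \<open>Riemannian manifolds in charts\<close>

text \<open>Squaring smooths the kink of the positive part at 0; this is why \<open>bump\<close> is
  a square.\<close>

lemma max0_square_deriv: "((\<lambda>x :: real. (max 0 x)\<^sup>2) has_real_derivative 2 * max 0 x) (at x)"
proof (cases x "0 :: real" rule: linorder_cases)
  case less
  have "\<forall>\<^sub>F y in nhds x. (max 0 y)\<^sup>2 = 0"
    using eventually_nhds_in_open[of "{..<0}" x] less by (auto elim!: eventually_mono)
  then show ?thesis using less DERIV_cong_ev[OF refl, of "\<lambda>x. (max 0 x)\<^sup>2" "\<lambda>_. 0" x 0] by simp
next
  case greater
  have "\<forall>\<^sub>F y in nhds x. (max 0 y)\<^sup>2 = y\<^sup>2"
    using eventually_nhds_in_open[of "{0<..}" x] greater by (auto elim!: eventually_mono)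
  moreover have "((\<lambda>y. y\<^sup>2) has_real_derivative 2 * x) (at x)" by (auto intro!: derivative_eq_intros)
  ultimately show ?thesis using greater DERIV_cong_ev[OF refl, of "\<lambda>x. (max 0 x)\<^sup>2" "\<lambda>y. y\<^sup>2" x "2 * x"] by simp
next
  case equal
  have "((\<lambda>h :: real. (max 0 h)\<^sup>2 / h) \<longlongrightarrow> 0) (at 0)"
  proof (rule Lim_null_comparison)
    show "\<forall>\<^sub>F h in at 0. norm ((max 0 h)\<^sup>2 / h) \<le> \<bar>h\<bar>"
      by (rule always_eventually) (auto simp: max_def power2_eq_square)
    show "((\<lambda>h :: real. \<bar>h\<bar>) \<longlongrightarrow> 0) (at 0)" by (intro tendsto_rabs_zero tendsto_ident_at)
  qed
  then show ?thesis using equal by (simp add: DERIV_def)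
qed

text \<open>
  A compactly supported test function only has to be \<open>C\<^sup>1\<close> along curves. Multiplying \<open>bump\<close> by a coordinate
  centred at \<open>w\<close> gives a function that vanishes at \<open>w\<close> and separates it linearly from its neighbours.
\<close>

definition bump :: "nat \<Rightarrow> (nat \<Rightarrow> real) \<Rightarrow> real \<Rightarrow> (nat \<Rightarrow> real) \<Rightarrow> real" where
  "bump n q R z = (max 0 (R\<^sup>2 - (cdist n q z)\<^sup>2))\<^sup>2"

lemma cdist_square: "(cdist n q z)\<^sup>2 = (\<Sum>i<n. (q i - z i)\<^sup>2)"
  unfolding cdist_def L2_set_def by (intro real_sqrt_pow2 sum_nonneg) auto

lemma bump_outside: "R \<ge> 0 \<Longrightarrow> cdist n q z \<ge> R \<Longrightarrow> bump n q R z = 0"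
  using power_mono[of R "cdist n q z" 2] by (simp add: bump_def)

lemma bump_le: "bump n q R z \<le> R ^ 4" "bump n q R z \<ge> 0"
proof -
  have "(max 0 (R\<^sup>2 - (cdist n q z)\<^sup>2))\<^sup>2 \<le> (R\<^sup>2)\<^sup>2" by (intro power_mono) auto
  then show "bump n q R z \<le> R ^ 4" by (simp add: bump_def)
qed (simp add: bump_def)

lemma bump_ge:
  assumes "cdist n q z \<le> \<rho>" "\<rho> \<le> R"
  shows "bump n q R z \<ge> (R\<^sup>2 - \<rho>\<^sup>2)\<^sup>2"
proof -
  have "(cdist n q z)\<^sup>2 \<le> \<rho>\<^sup>2" using assms by (intro power_mono) auto
  moreover have "\<rho>\<^sup>2 \<le> R\<^sup>2" using assms order_trans[OF cdist_nonneg assms(1)] by (intro power_mono) auto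
  ultimately show ?thesis unfolding bump_def by (intro power_mono) auto
qed

lemma continuous_on_bump: "continuous_on A (bump n q R)"
  unfolding bump_def by (intro continuous_intros continuous_on_cdist)

text \<open>Covers both test functions of \<open>local_chart\<close>: \<open>e = 0\<close>,
  \<open>f = 1\<close> gives the bump times a centred coordinate, and \<open>e = 1\<close>,
  \<open>f = 0\<close> gives the bump itself. In the latter case \<open>j\<close> may be out of
  range, so that dimension 0 is included. The coefficient arises from
  \<open>\<bar>?N'\<bar> \<le> 2 * (R * ?V)\<close>, from \<open>R^2\<close> as a bound for
  \<open>max 0 (?N s)\<close> and from \<open>R ^ 4\<close> as a bound for the bump.\<close>

lemma bump_deriv:
  assumes R: "R > 0" and z: "cdist n q (z s) \<le> R"
    and v: "\<And>i. i < n \<Longrightarrow> ((\<lambda>r. z r i) has_real_derivative v i) (at s)"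
    and w: "cdist n q w \<le> R" and j: "j < n \<or> f = 0"
  shows "\<exists>D. ((\<lambda>r. bump n q R (z r) * (e + f * (z r j - w j))) has_real_derivative D) (at s) \<and>
     \<bar>D\<bar> \<le> (4 * R ^ 3 * (\<bar>e\<bar> + 2 * R * \<bar>f\<bar>) + R ^ 4 * \<bar>f\<bar>) * L2_set v {..<n}"
proof -
  let ?N = "\<lambda>r. R\<^sup>2 - (\<Sum>i<n. (q i - z r i)\<^sup>2)"
  let ?N' = "\<Sum>i<n. 2 * (q i - z s i) * v i"
  let ?V = "L2_set v {..<n}"
  define vj where "vj = (if j < n then v j else 0)"
  have dN: "(?N has_real_derivative ?N') (at s)"
  proof -
    have "((\<lambda>r. \<Sum>i<n. (q i - z r i)\<^sup>2) has_real_derivative (\<Sum>i<n. - (2 * (q i - z s i) * v i))) (at s)"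
      using v by (intro DERIV_sum) (auto intro!: derivative_eq_intros)
    from DERIV_diff[OF DERIV_const[of "R\<^sup>2"] this] show ?thesis by (simp add: sum_negf)
  qed
  have dB: "((\<lambda>r. bump n q R (z r)) has_real_derivative 2 * max 0 (?N s) * ?N') (at s)"
    unfolding bump_def cdist_square using DERIV_chain2[OF max0_square_deriv dN] .
  have dq: "((\<lambda>r. e + f * (z r j - w j)) has_real_derivative f * vj) (at s)"
  proof (cases "f = 0")
    case False
    then have "j < n" using j by simp
    then show ?thesis using v[of j] by (auto simp: vj_def intro!: derivative_eq_intros)
  qed simp
  let ?D = "2 * max 0 (?N s) * ?N' * (e + f * (z s j - w j)) + bump n q R (z s) * (f * vj)"
  have "((\<lambda>r. bump n q R (z r) * (e + f * (z r j - w j))) has_real_derivative ?D) (at s)"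
    using DERIV_mult[OF dB dq] by (simp add: algebra_simps)
  moreover have "\<bar>?D\<bar> \<le> (4 * R ^ 3 * (\<bar>e\<bar> + 2 * R * \<bar>f\<bar>) + R ^ 4 * \<bar>f\<bar>) * ?V"
  proof -
    have V: "?V \<ge> 0" by (rule L2_set_nonneg)
    have "(\<Sum>i<n. (q i - z s i) * v i) \<le> (\<Sum>i<n. \<bar>q i - z s i\<bar> * \<bar>v i\<bar>)"
      "- (\<Sum>i<n. (q i - z s i) * v i) \<le> (\<Sum>i<n. \<bar>q i - z s i\<bar> * \<bar>v i\<bar>)"
      unfolding sum_negf[symmetric] by (intro sum_mono; simp add: abs_mult[symmetric])+
    then have "\<bar>\<Sum>i<n. (q i - z s i) * v i\<bar> \<le> (\<Sum>i<n. \<bar>q i - z s i\<bar> * \<bar>v i\<bar>)" by linarith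
    also have "\<dots> \<le> cdist n q (z s) * ?V" unfolding cdist_def by (rule L2_set_mult_ineq)
    also have "\<dots> \<le> R * ?V" using z V by (intro mult_right_mono)
    finally have "\<bar>\<Sum>i<n. (q i - z s i) * v i\<bar> \<le> R * ?V" .
    moreover have "?N' = 2 * (\<Sum>i<n. (q i - z s i) * v i)" by (simp only: sum_distrib_left mult.assoc)
    ultimately have N': "\<bar>?N'\<bar> \<le> 2 * (R * ?V)" by simp
    have M: "\<bar>2 * max 0 (?N s)\<bar> \<le> 2 * R\<^sup>2" using sum_nonneg[of "{..<n}" "\<lambda>i. (q i - z s i)\<^sup>2"] by auto
    have Q: "\<bar>e + f * (z s j - w j)\<bar> \<le> \<bar>e\<bar> + 2 * R * \<bar>f\<bar>"
    proof (cases "f = 0")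
      case False
      then have jn: "j < n" using j by simp
      have "\<bar>z s j - w j\<bar> \<le> 2 * R"
        using cdist_coord[OF jn, of q "z s"] cdist_coord[OF jn, of q w] z w by linarith
      then have "\<bar>f\<bar> * \<bar>z s j - w j\<bar> \<le> \<bar>f\<bar> * (2 * R)" by (intro mult_left_mono) auto
      then show ?thesis using abs_triangle_ineq[of e "f * (z s j - w j)"] by (simp add: abs_mult mult_ac)
    qed simp
    have J: "\<bar>vj\<bar> \<le> ?V" using V member_le_L2_set[of "{..<n}" j "\<lambda>i. \<bar>v i\<bar>"] by (auto simp: vj_def L2_set_def)
    have "\<bar>2 * max 0 (?N s) * ?N' * (e + f * (z s j - w j))\<bar> \<le> (2 * R\<^sup>2) * (2 * (R * ?V)) * (\<bar>e\<bar> + 2 * R * \<bar>f\<bar>)"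
      unfolding abs_mult[of "_ * _"] abs_mult[of "2 * max 0 (?N s)"]
      using R V by (intro mult_mono M N' Q) auto
    moreover have "\<bar>bump n q R (z s) * (f * vj)\<bar> \<le> R ^ 4 * (\<bar>f\<bar> * ?V)"
      unfolding abs_mult using bump_le[of n q R "z s"] J R by (intro mult_mono) auto
    ultimately have "\<bar>?D\<bar> \<le> (2 * R\<^sup>2) * (2 * (R * ?V)) * (\<bar>e\<bar> + 2 * R * \<bar>f\<bar>) + R ^ 4 * (\<bar>f\<bar> * ?V)" by linarith
    also have "\<dots> = (4 * R ^ 3 * (\<bar>e\<bar> + 2 * R * \<bar>f\<bar>) + R ^ 4 * \<bar>f\<bar>) * ?V"
      by (simp add: algebra_simps power2_eq_square power3_eq_cube)
    finally show ?thesis .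
  qed
  ultimately show ?thesis by blast
qed

lemma quadratic_form_pullback:
  fixes G a :: "nat \<Rightarrow> nat \<Rightarrow> real"
  shows "(\<Sum>k<m. \<Sum>l<m. G k l * (\<Sum>i<m. a k i * v i) * (\<Sum>j<m. a l j * v j)) =
     (\<Sum>i<m. \<Sum>j<m. (\<Sum>k<m. \<Sum>l<m. G k l * a k i * a l j) * v i * v j)"
proof -
  have "(\<Sum>k<m. \<Sum>l<m. G k l * (\<Sum>i<m. a k i * v i) * (\<Sum>j<m. a l j * v j)) =
     (\<Sum>k<m. \<Sum>l<m. \<Sum>i<m. \<Sum>j<m. G k l * a k i * a l j * v i * v j)"
    by (simp add: sum_distrib_left sum_distrib_right sum_product mult_ac)
  also have "\<dots> = (\<Sum>k<m. \<Sum>i<m. \<Sum>l<m. \<Sum>j<m. G k l * a k i * a l j * v i * v j)"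
    by (intro sum.cong refl sum.swap)
  also have "\<dots> = (\<Sum>i<m. \<Sum>k<m. \<Sum>l<m. \<Sum>j<m. G k l * a k i * a l j * v i * v j)"
    by (rule sum.swap)
  also have "\<dots> = (\<Sum>i<m. \<Sum>k<m. \<Sum>j<m. \<Sum>l<m. G k l * a k i * a l j * v i * v j)"
    by (intro sum.cong refl sum.swap)
  also have "\<dots> = (\<Sum>i<m. \<Sum>j<m. \<Sum>k<m. \<Sum>l<m. G k l * a k i * a l j * v i * v j)"
    by (intro sum.cong refl sum.swap)
  finally show ?thesis by (simp add: sum_distrib_right)
qed

section \<open>Charts, transition maps and the speed of curves\<close>

locale riem =
  fixes M :: "'a riem_mfd"
  assumes crm: "compact_riemannian_manifold M"
begin

abbreviation n where "n \<equiv> rm_dim M"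
abbreviation X where "X \<equiv> rm_points M"
abbreviation T where "T \<equiv> rm_top M"
abbreviation d where "d \<equiv> riemannian_dist M"

lemma Hausdorff: "Hausdorff_space T" and compact: "compact_space T" and nonempty: "X \<noteq> {}"
  and atlas_cover: "(\<Union>(U, \<phi>)\<in>rm_atlas M. U) = X"
  using crm by (auto simp: compact_riemannian_manifold_def smooth_manifold_def)

lemma chart:
  assumes "(U, \<phi>) \<in> rm_atlas M"
  shows "openin T U" "openin (Euclidean_space n) (\<phi> ` U)"
    "homeomorphic_map (subtopology T U) (subtopology (Euclidean_space n) (\<phi> ` U)) \<phi>"
proof -
  have "\<forall>c\<in>rm_atlas M. chart_in T n c"
    using crm by (simp add: compact_riemannian_manifold_def smooth_manifold_def)
  then have "chart_in T n (U, \<phi>)" using assms by blast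
  then show "openin T U" "openin (Euclidean_space n) (\<phi> ` U)"
    "homeomorphic_map (subtopology T U) (subtopology (Euclidean_space n) (\<phi> ` U)) \<phi>"
    by (auto simp: chart_in_def)
qed

lemma chart_facts:
  assumes c: "(U, \<phi>) \<in> rm_atlas M"
  shows "U \<subseteq> X" "\<phi> ` U \<subseteq> {x. \<forall>i\<ge>n. x i = 0}" "inj_on \<phi> U"
    "continuous_map (subtopology T U) euclidean \<phi>"
    "continuous_map (top_of_set (\<phi> ` U)) T (inv_into U \<phi>)"
proof -
  show U: "U \<subseteq> X" using openin_subset[OF chart(1)[OF c]] .
  show E: "\<phi> ` U \<subseteq> {x. \<forall>i\<ge>n. x i = 0}"
    using openin_subset[OF chart(2)[OF c]] by (simp add: topspace_Euclidean_space)
  have eq: "subtopology (Euclidean_space n) (\<phi> ` U) = top_of_set (\<phi> ` U)"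
    using E by (simp add: Euclidean_space_eq subtopology_subtopology Int_absorb1)
  have tU: "topspace (subtopology T U) = U" using U by (simp add: Int_absorb1)
  note h = chart(3)[OF c, unfolded eq]
  show inj: "inj_on \<phi> U" using homeomorphic_imp_injective_map[OF h] tU by simp
  show "continuous_map (subtopology T U) euclidean \<phi>"
    using homeomorphic_imp_continuous_map[OF h] continuous_map_into_fulltopology by blast
  obtain g where g: "homeomorphic_maps (subtopology T U) (top_of_set (\<phi> ` U)) \<phi> g"
    using h homeomorphic_map_maps by blast
  have "continuous_map (top_of_set (\<phi> ` U)) T g"
    using g continuous_map_into_fulltopology unfolding homeomorphic_maps_def by blast
  then show "continuous_map (top_of_set (\<phi> ` U)) T (inv_into U \<phi>)"
  proof (rule continuous_map_eq)
    fix z assume "z \<in> topspace (top_of_set (\<phi> ` U))"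
    then obtain y where y: "y \<in> U" "z = \<phi> y" by auto
    have "g (\<phi> y) = y" using g y tU unfolding homeomorphic_maps_def by blast
    then show "g z = inv_into U \<phi> z" using y inj by simp
  qed
qed

lemma overlap:
  assumes c: "(U, \<phi>) \<in> rm_atlas M" and c': "(V, \<theta>) \<in> rm_atlas M"
  shows "openin (Euclidean_space n) (\<phi> ` (U \<inter> V))"
    "\<And>k. k < n \<Longrightarrow> Ck_on n (Suc 0) (\<phi> ` (U \<inter> V)) (transition (U, \<phi>) (V, \<theta>) k)"
proof -
  have "{z \<in> \<phi> ` U. inv_into U \<phi> z \<in> V} = \<phi> ` (U \<inter> V)"
    using chart_facts(3)[OF c] by (auto simp: inv_into_f_f)
  moreover have "openin (top_of_set (\<phi> ` U)) {z \<in> topspace (top_of_set (\<phi> ` U)). inv_into U \<phi> z \<in> V}"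
    by (rule openin_continuous_map_preimage[OF chart_facts(5)[OF c] chart(1)[OF c']])
  ultimately have "openin (top_of_set (\<phi> ` U)) (\<phi> ` (U \<inter> V))" by simp
  moreover have "subtopology (Euclidean_space n) (\<phi> ` U) = top_of_set (\<phi> ` U)"
    using chart_facts(2)[OF c] by (simp add: Euclidean_space_eq subtopology_subtopology Int_absorb1)
  ultimately show "openin (Euclidean_space n) (\<phi> ` (U \<inter> V))"
    using chart(2)[OF c] by (metis openin_trans_full)
  have "\<forall>(U, \<phi>)\<in>rm_atlas M. \<forall>(V, \<psi>)\<in>rm_atlas M. \<forall>k<n.
        smooth_on n (\<phi> ` (U \<inter> V)) (transition (U, \<phi>) (V, \<psi>) k)"
    using crm by (simp add: compact_riemannian_manifold_def smooth_manifold_def)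
  then show "Ck_on n (Suc 0) (\<phi> ` (U \<inter> V)) (transition (U, \<phi>) (V, \<theta>) k)" if "k < n" for k
    using c c' that unfolding smooth_on_def by fast
qed

lemma transition_eq:
  assumes "(U, \<phi>) \<in> rm_atlas M" "y \<in> U"
  shows "transition (U, \<phi>) (V, \<theta>) k (\<phi> y) = \<theta> y k"
  using chart_facts(3)[OF assms(1)] assms(2) by (simp add: transition_def)

definition qform :: "'a chart \<Rightarrow> 'a \<Rightarrow> (nat \<Rightarrow> real) \<Rightarrow> real" where
  "qform c x v = (\<Sum>i<n. \<Sum>j<n. rm_metric M c x i j * v i * v j)"

lemma metric_facts:
  assumes c: "(U, \<phi>) \<in> rm_atlas M"
  shows "\<And>i j. i < n \<Longrightarrow> j < n \<Longrightarrow> continuous_on (\<phi> ` U) (\<lambda>z. rm_metric M (U, \<phi>) (inv_into U \<phi> z) i j)"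
    "\<And>x v. x \<in> U \<Longrightarrow> \<exists>i<n. v i \<noteq> 0 \<Longrightarrow> 0 < qform (U, \<phi>) x v"
    "\<And>V \<theta> x i j. (V, \<theta>) \<in> rm_atlas M \<Longrightarrow> x \<in> U \<inter> V \<Longrightarrow> i < n \<Longrightarrow> j < n \<Longrightarrow>
      rm_metric M (U, \<phi>) x i j = (\<Sum>k<n. \<Sum>l<n. rm_metric M (V, \<theta>) x k l *
             partial_deriv i (transition (U, \<phi>) (V, \<theta>) k) (\<phi> x) *
             partial_deriv j (transition (U, \<phi>) (V, \<theta>) l) (\<phi> x))"
proof -
  have r: "riemannian_metric M" using crm by (simp add: compact_riemannian_manifold_def)
  have A: "\<forall>(U, \<phi>)\<in>rm_atlas M.
        (\<forall>i<n. \<forall>j<n. smooth_on n (\<phi> ` U) (\<lambda>p. rm_metric M (U, \<phi>) (inv_into U \<phi> p) i j)) \<and>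
        (\<forall>x\<in>U. (\<forall>i<n. \<forall>j<n. rm_metric M (U, \<phi>) x i j = rm_metric M (U, \<phi>) x j i) \<and>
           (\<forall>v::nat \<Rightarrow> real. (\<exists>i<n. v i \<noteq> 0) \<longrightarrow>
              0 < (\<Sum>i<n. \<Sum>j<n. rm_metric M (U, \<phi>) x i j * v i * v j)))"
    using r[unfolded riemannian_metric_def Let_def] by (rule conjunct1)
  have B: "\<forall>(U, \<phi>)\<in>rm_atlas M. \<forall>(V, \<psi>)\<in>rm_atlas M. \<forall>x\<in>U \<inter> V. \<forall>i<n. \<forall>j<n.
        rm_metric M (U, \<phi>) x i j =
          (\<Sum>k<n. \<Sum>l<n. rm_metric M (V, \<psi>) x k l *
             partial_deriv i (transition (U, \<phi>) (V, \<psi>) k) (\<phi> x) *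
             partial_deriv j (transition (U, \<phi>) (V, \<psi>) l) (\<phi> x))"
    using r[unfolded riemannian_metric_def Let_def] by (rule conjunct2)
  note A' = bspec[OF A c, unfolded prod.case]
  show "continuous_on (\<phi> ` U) (\<lambda>z. rm_metric M (U, \<phi>) (inv_into U \<phi> z) i j)" if "i < n" "j < n" for i j
  proof -
    have "smooth_on n (\<phi> ` U) (\<lambda>p. rm_metric M (U, \<phi>) (inv_into U \<phi> p) i j)" using A' that by blast
    then have "Ck_on n 0 (\<phi> ` U) (\<lambda>p. rm_metric M (U, \<phi>) (inv_into U \<phi> p) i j)"
      unfolding smooth_on_def by blast
    then show ?thesis by (simp add: continuous_map_Euclidean_subtopology[OF chart_facts(2)[OF c]])
  qed
  show "0 < qform (U, \<phi>) x v" if "x \<in> U" "\<exists>i<n. v i \<noteq> 0" for x v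
    using A' that unfolding qform_def by blast
  show "rm_metric M (U, \<phi>) x i j = (\<Sum>k<n. \<Sum>l<n. rm_metric M (V, \<theta>) x k l *
             partial_deriv i (transition (U, \<phi>) (V, \<theta>) k) (\<phi> x) *
             partial_deriv j (transition (U, \<phi>) (V, \<theta>) l) (\<phi> x))"
    if "(V, \<theta>) \<in> rm_atlas M" "x \<in> U \<inter> V" "i < n" "j < n" for V \<theta> x i j
    using bspec[OF bspec[OF B c, unfolded prod.case] that(1), unfolded prod.case] that by blast
qed

lemma path_eventually:
  assumes "pathin T \<gamma>" "s \<in> {0<..<1}" "openin T W" "\<gamma> s \<in> W"
  shows "\<forall>\<^sub>F r in at s. \<gamma> r \<in> W"
proof -
  have "continuous_map (top_of_set {0..1}) T \<gamma>" using assms(1) by (simp add: pathin_def)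
  from openin_continuous_map_preimage[OF this assms(3)]
  obtain O' where O': "open O'" "{r \<in> {0..1}. \<gamma> r \<in> W} = {0..1} \<inter> O'"
    by (auto simp: openin_open)
  have "s \<in> {r \<in> {0..1}. \<gamma> r \<in> W}" using assms(2,4) by simp
  then have "s \<in> {0..1} \<inter> O'" unfolding O'(2) .
  then have "\<forall>\<^sub>F r in at s. r \<in> O' \<inter> {0<..<1}"
    using O'(1) assms(2) by (intro eventually_at_in_open') auto
  then show ?thesis
  proof eventually_elim
    case (elim r)
    then have "r \<in> {0..1} \<inter> O'" by auto
    then show ?case using O'(2) by blast
  qed
qed

lemma curve_deriv_transition:
  assumes c: "(U, \<phi>) \<in> rm_atlas M" and c': "(V, \<theta>) \<in> rm_atlas M" and s: "\<gamma> s \<in> U \<inter> V"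
    and ev: "\<forall>\<^sub>F r in at s. \<gamma> r \<in> U \<inter> V"
    and v: "\<And>i. i < n \<Longrightarrow> ((\<lambda>r. \<phi> (\<gamma> r) i) has_real_derivative v i) (at s)" and k: "k < n"
  shows "((\<lambda>r. \<theta> (\<gamma> r) k) has_real_derivative
     (\<Sum>i<n. partial_deriv i (transition (U, \<phi>) (V, \<theta>) k) (\<phi> (\<gamma> s)) * v i)) (at s)"
proof -
  have ev0: "\<forall>\<^sub>F r in at s. \<forall>i\<ge>n. \<phi> (\<gamma> r) i = 0"
    using ev by eventually_elim (use chart_facts(2)[OF c] in auto)
  have "((\<lambda>r. transition (U, \<phi>) (V, \<theta>) k (\<phi> (\<gamma> r))) has_real_derivative
     (\<Sum>i<n. partial_deriv i (transition (U, \<phi>) (V, \<theta>) k) (\<phi> (\<gamma> s)) * v i)) (at s)"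
    using C1_chain_rule[OF overlap(1)[OF c c'] overlap(2)[OF c c' k], of "\<lambda>r. \<phi> (\<gamma> r)" s v] s v ev0 by blast
  moreover have "\<forall>\<^sub>F r in nhds s. transition (U, \<phi>) (V, \<theta>) k (\<phi> (\<gamma> r)) = \<theta> (\<gamma> r) k"
    unfolding eventually_nhds_conv_at
    using ev s transition_eq[OF c] by (auto elim!: eventually_mono)
  ultimately show ?thesis by (subst DERIV_cong_ev[OF refl, symmetric]) auto
qed

text \<open>\<open>speed\<close> is evaluated in a chart picked by choice. The chain rule carries
  the coordinate velocity to that chart and the transformation law of the metric carries the
  quadratic form back, so any chart around the point may be used.\<close>

lemma speed_chart:
  assumes c: "(U, \<phi>) \<in> rm_atlas M" and s: "\<gamma> s \<in> U"
    and ev: "\<And>W. openin T W \<Longrightarrow> \<gamma> s \<in> W \<Longrightarrow> \<forall>\<^sub>F r in at s. \<gamma> r \<in> W"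
    and v: "\<And>i. i < n \<Longrightarrow> ((\<lambda>r. \<phi> (\<gamma> r) i) has_real_derivative v i) (at s)"
  shows "speed M \<gamma> s = sqrt (qform (U, \<phi>) (\<gamma> s) v)"
proof -
  define c0 where "c0 = (SOME c. c \<in> rm_atlas M \<and> \<gamma> s \<in> fst c)"
  have "\<exists>c. c \<in> rm_atlas M \<and> \<gamma> s \<in> fst c" using c s by (intro exI[of _ "(U, \<phi>)"]) auto
  from someI_ex[OF this] have c0: "c0 \<in> rm_atlas M" "\<gamma> s \<in> fst c0" unfolding c0_def by auto
  obtain V \<theta> where V: "c0 = (V, \<theta>)" by (cases c0)
  have c': "(V, \<theta>) \<in> rm_atlas M" "\<gamma> s \<in> V" using c0 V by auto
  define a where "a k i = partial_deriv i (transition (U, \<phi>) (V, \<theta>) k) (\<phi> (\<gamma> s))" for k i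
  have sUV: "\<gamma> s \<in> U \<inter> V" using s c' by blast
  have evUV: "\<forall>\<^sub>F r in at s. \<gamma> r \<in> U \<inter> V"
    using chart(1)[OF c] chart(1)[OF c'(1)] sUV by (intro ev openin_Int)
  have vd: "vector_derivative (\<lambda>r. \<theta> (\<gamma> r) k) (at s) = (\<Sum>i<n. a k i * v i)" if "k < n" for k
    unfolding a_def
    using curve_deriv_transition[OF c c'(1) sUV evUV v that]
    by (intro vector_derivative_at) (simp add: has_real_derivative_iff_has_vector_derivative)
  have "speed M \<gamma> s = sqrt (\<Sum>k<n. \<Sum>l<n. rm_metric M (V, \<theta>) (\<gamma> s) k l *
      vector_derivative (\<lambda>r. \<theta> (\<gamma> r) k) (at s) * vector_derivative (\<lambda>r. \<theta> (\<gamma> r) l) (at s))"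
    unfolding speed_def Let_def c0_def[symmetric] V by simp
  also have "(\<Sum>k<n. \<Sum>l<n. rm_metric M (V, \<theta>) (\<gamma> s) k l *
      vector_derivative (\<lambda>r. \<theta> (\<gamma> r) k) (at s) * vector_derivative (\<lambda>r. \<theta> (\<gamma> r) l) (at s)) =
     (\<Sum>k<n. \<Sum>l<n. rm_metric M (V, \<theta>) (\<gamma> s) k l * (\<Sum>i<n. a k i * v i) * (\<Sum>j<n. a l j * v j))"
    using vd by (intro sum.cong refl) auto
  also have "\<dots> = (\<Sum>i<n. \<Sum>j<n. (\<Sum>k<n. \<Sum>l<n. rm_metric M (V, \<theta>) (\<gamma> s) k l * a k i * a l j) * v i * v j)"
    by (rule quadratic_form_pullback)
  also have "\<dots> = qform (U, \<phi>) (\<gamma> s) v"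
    unfolding qform_def using metric_facts(3)[OF c c'(1) sUV] by (intro sum.cong refl) (auto simp: a_def)
  finally show ?thesis .
qed

end

lemma L2_set_scale: "L2_set (\<lambda>i. c * v i) A = \<bar>c\<bar> * L2_set v A"
proof -
  have "(\<Sum>i\<in>A. (c * v i)\<^sup>2) = c\<^sup>2 * (\<Sum>i\<in>A. (v i)\<^sup>2)"
    by (simp add: power_mult_distrib sum_distrib_left)
  then show ?thesis by (simp add: L2_set_def real_sqrt_mult)
qed

lemma cdist_0: "cdist n (\<lambda>_. 0) v = L2_set v {..<n}"
  by (simp add: cdist_def L2_set_def)

lemma compact_unit_sphere:
  fixes n :: nat
  shows "compact {v :: nat \<Rightarrow> real. (\<forall>i\<ge>n. v i = 0) \<and> L2_set v {..<n} = 1}"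
proof -
  have "{v. (\<forall>i\<ge>n. v i = 0) \<and> L2_set v {..<n} = 1} = coord_ball n (\<lambda>_. 0) 1 \<inter> {v. cdist n (\<lambda>_. 0) v = 1}"
    by (auto simp: coord_ball_def cdist_0)
  moreover have "closed {v. cdist n (\<lambda>_. 0) v = 1}"
    by (intro closed_Collect_eq continuous_on_cdist continuous_on_const)
  ultimately show ?thesis using compact_Int_closed[OF compact_coord_ball] by metis
qed

lemma coord_ball_convex:
  assumes "u \<in> coord_ball n q R" "w \<in> coord_ball n q R" "0 \<le> s" "s \<le> 1"
  shows "(\<lambda>i. u i + s * (w i - u i)) \<in> coord_ball n q R"
proof -
  have "cdist n q (\<lambda>i. u i + s * (w i - u i)) = L2_set (\<lambda>i. (1 - s) * (q i - u i) + s * (q i - w i)) {..<n}"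
    unfolding cdist_def by (intro L2_set_cong) (auto simp: algebra_simps)
  also have "\<dots> \<le> L2_set (\<lambda>i. (1 - s) * (q i - u i)) {..<n} + L2_set (\<lambda>i. s * (q i - w i)) {..<n}"
    by (rule L2_set_triangle_ineq)
  also have "\<dots> = (1 - s) * cdist n q u + s * cdist n q w"
    using assms by (simp add: L2_set_scale cdist_def)
  also have "\<dots> \<le> (1 - s) * R + s * R"
    using assms by (intro add_mono mult_left_mono) (auto simp: coord_ball_def)
  also have "\<dots> = R" by (simp add: algebra_simps)
  finally show ?thesis using assms by (simp add: coord_ball_def)
qed

section \<open>Riemannian distance against coordinate distance\<close>

context riem
begin

lemma qform_scale: "qform c x (\<lambda>i. s * v i) = s\<^sup>2 * qform c x v"
  by (simp add: qform_def sum_distrib_left power2_eq_square mult_ac)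

lemma qform_cong: "(\<And>i. i < n \<Longrightarrow> v i = w i) \<Longrightarrow> qform c x v = qform c x w"
  unfolding qform_def by (intro sum.cong refl) auto

text \<open>By homogeneity it suffices to bound the quadratic form on the product of the ball and
  the unit sphere, which is compact.\<close>

lemma metric_bounds:
  assumes c: "(U, \<phi>) \<in> rm_atlas M" and K: "coord_ball n q R \<subseteq> \<phi> ` U"
  obtains a b where "a > 0" "b > 0"
    "\<And>z v. z \<in> coord_ball n q R \<Longrightarrow> a * L2_set v {..<n} \<le> sqrt (qform (U, \<phi>) (inv_into U \<phi> z) v)"
    "\<And>z v. z \<in> coord_ball n q R \<Longrightarrow> sqrt (qform (U, \<phi>) (inv_into U \<phi> z) v) \<le> b * L2_set v {..<n}"
proof -
  let ?S = "{v :: nat \<Rightarrow> real. (\<forall>i\<ge>n. v i = 0) \<and> L2_set v {..<n} = 1}"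
  let ?K = "coord_ball n q R"
  let ?Q = "\<lambda>z v. qform (U, \<phi>) (inv_into U \<phi> z) v"
  have coord: "continuous_on A (\<lambda>p :: (nat \<Rightarrow> real) \<times> (nat \<Rightarrow> real). snd p i)" for A i
    by (rule continuous_on_compose2[OF continuous_on_product_coordinates[of i] continuous_on_snd[OF continuous_on_id]]) auto
  have cont: "continuous_on (?K \<times> ?S) (\<lambda>p. ?Q (fst p) (snd p))"
    unfolding qform_def
    using K by (intro continuous_on_sum continuous_on_mult coord)
      (rule continuous_on_compose2[OF metric_facts(1)[OF c] continuous_on_fst[OF continuous_on_id]]; auto)
  have cpt: "compact (?K \<times> ?S)" by (intro compact_Times compact_coord_ball compact_unit_sphere)
  have pos: "0 < ?Q z v" if "z \<in> ?K" "v \<in> ?S" for z v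
  proof -
    have "\<exists>i<n. v i \<noteq> 0"
    proof (rule ccontr)
      assume "\<not> ?thesis"
      then have "L2_set v {..<n} = 0" by (simp add: L2_set_def)
      then show False using that by simp
    qed
    moreover have "inv_into U \<phi> z \<in> U" using that K by (auto intro: inv_into_into)
    ultimately show ?thesis using metric_facts(2)[OF c] by blast
  qed
  have "\<exists>m M'. 0 < m \<and> 0 < M' \<and> (\<forall>z\<in>?K. \<forall>v\<in>?S. m \<le> ?Q z v \<and> ?Q z v \<le> M')"
  proof (cases "?K \<times> ?S = {}")
    \<comment> \<open>This includes dimension 0, where the unit sphere is empty.\<close>
    case True
    then show ?thesis by (intro exI[of _ 1]) auto
  next
    case False
    obtain p0 where p0: "p0 \<in> ?K \<times> ?S" "\<And>p. p \<in> ?K \<times> ?S \<Longrightarrow> ?Q (fst p0) (snd p0) \<le> ?Q (fst p) (snd p)"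
      using continuous_attains_inf[OF cpt False cont] by blast
    obtain p1 where p1: "p1 \<in> ?K \<times> ?S" "\<And>p. p \<in> ?K \<times> ?S \<Longrightarrow> ?Q (fst p) (snd p) \<le> ?Q (fst p1) (snd p1)"
      using continuous_attains_sup[OF cpt False cont] by blast
    have "0 < ?Q (fst p0) (snd p0)" "0 < ?Q (fst p1) (snd p1)"
      using pos[of "fst p0" "snd p0"] pos[of "fst p1" "snd p1"] p0(1) p1(1) by (auto simp: mem_Times_iff)
    moreover have "?Q (fst p0) (snd p0) \<le> ?Q z v \<and> ?Q z v \<le> ?Q (fst p1) (snd p1)" if "z \<in> ?K" "v \<in> ?S" for z v
      using p0(2)[of "(z, v)"] p1(2)[of "(z, v)"] that by simp
    ultimately show ?thesis by blast
  qed
  then obtain m M' where m: "0 < m" "0 < M'" "\<And>z v. z \<in> ?K \<Longrightarrow> v \<in> ?S \<Longrightarrow> m \<le> ?Q z v"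
    "\<And>z v. z \<in> ?K \<Longrightarrow> v \<in> ?S \<Longrightarrow> ?Q z v \<le> M'" by blast
  have both: "m * (L2_set v {..<n})\<^sup>2 \<le> ?Q z v \<and> ?Q z v \<le> M' * (L2_set v {..<n})\<^sup>2" if z: "z \<in> ?K" for z v
  proof (cases "L2_set v {..<n} = 0")
    case True
    then have "v i = 0" if "i < n" for i using that by (simp add: L2_set_eq_0_iff)
    then have "?Q z v = 0" by (simp add: qform_def)
    then show ?thesis using True by simp
  next
    case False
    let ?l = "L2_set v {..<n}"
    have l: "?l > 0" using False L2_set_nonneg[of v "{..<n}"] by linarith
    define w where "w i = (if i < n then (1 / ?l) * v i else 0)" for i
    have "L2_set w {..<n} = L2_set (\<lambda>i. (1 / ?l) * v i) {..<n}" by (intro L2_set_cong) (auto simp: w_def)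
    also have "\<dots> = 1" unfolding L2_set_scale using l by simp
    finally have w: "w \<in> ?S" by (simp add: w_def)
    have "?Q z v = ?Q z (\<lambda>i. ?l * w i)" using l by (intro qform_cong) (auto simp: w_def)
    also have "\<dots> = ?l\<^sup>2 * ?Q z w" by (rule qform_scale)
    finally have "?Q z v = ?l\<^sup>2 * ?Q z w" .
    then show ?thesis using mult_left_mono[OF m(3)[OF z w], of "?l\<^sup>2"] mult_left_mono[OF m(4)[OF z w], of "?l\<^sup>2"]
      by (simp add: mult.commute)
  qed
  show ?thesis
  proof (rule that[of "sqrt m" "sqrt M'"])
    fix z v assume z: "z \<in> ?K"
    have "sqrt (m * (L2_set v {..<n})\<^sup>2) \<le> sqrt (?Q z v)" "sqrt (?Q z v) \<le> sqrt (M' * (L2_set v {..<n})\<^sup>2)"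
      using both[OF z, of v] by (auto intro: real_sqrt_le_mono)
    then show "sqrt m * L2_set v {..<n} \<le> sqrt (?Q z v)" "sqrt (?Q z v) \<le> sqrt M' * L2_set v {..<n}"
      by (auto simp: real_sqrt_mult L2_set_nonneg)
  qed (use m in auto)
qed

text \<open>The straight segment in coordinates stays in the ball by convexity, and
  \<open>ub\<close> bounds its speed.\<close>

lemma dist_le_in_chart:
  assumes c: "(U, \<phi>) \<in> rm_atlas M" and K: "coord_ball n q R \<subseteq> \<phi> ` U" and b: "b > 0"
    and ub: "\<And>z v. z \<in> coord_ball n q R \<Longrightarrow> sqrt (qform (U, \<phi>) (inv_into U \<phi> z) v) \<le> b * L2_set v {..<n}"
    and u: "u \<in> coord_ball n q R" and w: "w \<in> coord_ball n q R"
  shows "d (inv_into U \<phi> u) (inv_into U \<phi> w) \<le> ennreal (b * cdist n u w)"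
proof -
  let ?psi = "inv_into U \<phi>"
  define l where "l s i = u i + s * (w i - u i)" for s :: real and i :: nat
  define \<gamma> where "\<gamma> s = ?psi (l s)" for s
  have lK: "l s \<in> coord_ball n q R" if "s \<in> {0..1}" for s
    using coord_ball_convex[OF u w, of s] that by (simp add: l_def[abs_def])
  have lc: "continuous_on A l" for A
    unfolding l_def by (intro continuous_on_coordinatewise_then_product continuous_intros)
  have \<phi>\<gamma>: "\<phi> (\<gamma> s) = l s" and \<gamma>U: "\<gamma> s \<in> U" if "s \<in> {0..1}" for s
    using lK[OF that] K by (auto simp: \<gamma>_def f_inv_into_f inv_into_into subset_iff)
  have path: "pathin T \<gamma>"
  proof -
    have "continuous_map (top_of_set {0..1}) (top_of_set (\<phi> ` U)) l"
      using lc lK K by (auto simp: continuous_map_in_subtopology)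
    from continuous_map_compose[OF this chart_facts(5)[OF c]]
    show ?thesis by (simp add: pathin_def \<gamma>_def[abs_def] o_def)
  qed
  have vl: "((\<lambda>r. l r i) has_real_derivative (w i - u i)) (at s)" for i s
    unfolding l_def by (auto intro!: derivative_eq_intros)
  have v\<gamma>: "((\<lambda>r. \<phi> (\<gamma> r) i) has_real_derivative (w i - u i)) (at s)" if s: "s \<in> {0<..<1}" for i s
  proof -
    have "\<forall>\<^sub>F r in nhds s. r \<in> {0<..<1}" using s by (intro eventually_nhds_in_open) auto
    then have "\<forall>\<^sub>F r in nhds s. \<phi> (\<gamma> r) i = l r i" by eventually_elim (use \<phi>\<gamma> in auto)
    then show ?thesis using vl by (subst DERIV_cong_ev[OF refl _ refl]) auto
  qed
  \<comment> \<open>Coordinates have to be C1 in every chart of the atlas, not only in the one where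
    the segment is straight. The endpoints go into the exceptional set because two-sided derivatives
    are available only between them.\<close>
  have C1: "(\<lambda>r. \<theta> (\<gamma> r) k) C1_differentiable_on {s \<in> {0..1} - {0, 1}. \<gamma> s \<in> V}"
    if c': "(V, \<theta>) \<in> rm_atlas M" and k: "k < n" for V \<theta> k
  proof -
    let ?P = "\<lambda>i. partial_deriv i (transition (U, \<phi>) (V, \<theta>) k)"
    let ?D = "\<lambda>s. \<Sum>i<n. ?P i (l s) * (w i - u i)"
    let ?A = "{s \<in> {0..1} - {0, 1}. \<gamma> s \<in> V}"
    have 1: "((\<lambda>r. \<theta> (\<gamma> r) k) has_vector_derivative ?D s) (at s)" if s: "s \<in> ?A" for s
    proof -
      have s01: "s \<in> {0<..<1}" "s \<in> {0..1}" using s by auto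
      have sUV: "\<gamma> s \<in> U \<inter> V" using \<gamma>U[OF s01(2)] s by auto
      have "\<forall>\<^sub>F r in at s. \<gamma> r \<in> U \<inter> V"
        using path_eventually[OF path s01(1) openin_Int[OF chart(1)[OF c] chart(1)[OF c']] sUV] .
      from curve_deriv_transition[OF c c' sUV this v\<gamma>[OF s01(1)] k] show ?thesis
        by (simp add: \<phi>\<gamma>[OF s01(2)] has_real_derivative_iff_has_vector_derivative)
    qed
    have 2: "continuous_on ?A ?D"
    proof (intro continuous_on_sum continuous_on_mult continuous_on_const)
      fix i assume i: "i \<in> {..<n}"
      have W0: "\<phi> ` (U \<inter> V) \<subseteq> {x. \<forall>i\<ge>n. x i = 0}" using chart_facts(2)[OF c] by auto
      have "continuous_on (\<phi> ` (U \<inter> V)) (?P i)"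
        using overlap(2)[OF c c' k] i by (simp add: continuous_map_Euclidean_subtopology[OF W0])
      moreover have "l ` ?A \<subseteq> \<phi> ` (U \<inter> V)"
      proof
        fix z assume "z \<in> l ` ?A"
        then obtain s where s: "s \<in> ?A" "z = l s" by blast
        then have "z = \<phi> (\<gamma> s)" "\<gamma> s \<in> U \<inter> V" using \<phi>\<gamma>[of s] \<gamma>U[of s] by auto
        then show "z \<in> \<phi> ` (U \<inter> V)" by blast
      qed
      ultimately show "continuous_on ?A (\<lambda>s. ?P i (l s))" by (rule continuous_on_compose2[OF _ lc])
    qed
    show ?thesis unfolding C1_differentiable_on_def
      by (rule exI[of _ ?D], intro conjI ballI 1 2)
  qed
  have pw: "piecewise_C1_curve M \<gamma>"
    unfolding piecewise_C1_curve_def using path C1 by (intro conjI exI[of _ "{0, 1}"]) auto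
  have sp: "speed M \<gamma> s \<le> b * cdist n u w" if s: "s \<in> {0<..<1}" for s
  proof -
    have s01: "s \<in> {0..1}" using s by auto
    have "speed M \<gamma> s = sqrt (qform (U, \<phi>) (\<gamma> s) (\<lambda>i. w i - u i))"
      using path_eventually[OF path s] v\<gamma>[OF s] by (intro speed_chart[where \<gamma> = \<gamma> and s = s, OF c \<gamma>U[OF s01]]) auto
    also have "\<dots> \<le> b * L2_set (\<lambda>i. w i - u i) {..<n}" unfolding \<gamma>_def by (rule ub[OF lK[OF s01]])
    also have "\<dots> = b * cdist n u w" using cdist_commute[of n u w] by (simp add: cdist_def)
    finally show ?thesis .
  qed
  have "curve_length M \<gamma> \<le> (\<integral>\<^sup>+ s\<in>{0..1::real}. ennreal (b * cdist n u w) \<partial>lborel)"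
  proof -
    have "AE s in lborel. s \<notin> {0, 1 :: real}"
      by (intro AE_not_in finite_imp_null_set_lborel) auto
    then have "AE s in lborel. ennreal (speed M \<gamma> s) * indicator {0..1} s \<le> ennreal (b * cdist n u w) * indicator {0..1} s"
    proof eventually_elim
      case (elim s)
      then show ?case using sp[of s] by (cases "s \<in> {0..1}") (auto intro!: ennreal_leI)
    qed
    from nn_integral_mono_AE[OF this] show ?thesis unfolding curve_length_def .
  qed
  also have "\<dots> = ennreal (b * cdist n u w)" by (simp add: nn_integral_cmult_indicator)
  finally have len: "curve_length M \<gamma> \<le> ennreal (b * cdist n u w)" .
  have "l 0 = u" "l 1 = w" by (auto simp: l_def fun_eq_iff)
  then have "\<gamma> 0 = ?psi u" "\<gamma> 1 = ?psi w" by (simp_all add: \<gamma>_def)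
  then have "d (?psi u) (?psi w) \<le> curve_length M \<gamma>"
    unfolding riemannian_dist_def using pw by (intro INF_lower) auto
  then show ?thesis using len by (rule order_trans)
qed

text \<open>The image is compact, and compact sets in a Hausdorff space are closed.\<close>

lemma closedin_chart_image:
  assumes c: "(U, \<phi>) \<in> rm_atlas M" and E: "compact E" "E \<subseteq> \<phi> ` U"
  shows "closedin T (inv_into U \<phi> ` E)"
proof -
  have "compactin (top_of_set (\<phi> ` U)) E" using E by (simp add: compactin_subtopology)
  from image_compactin[OF this chart_facts(5)[OF c]] show ?thesis
    by (rule compactin_imp_closedin[OF Hausdorff])
qed

text \<open>Along any curve the extended function is locally constant while the curve is off the
  support, and elsewhere it changes at most at the rate of the speed. Integration bounds the
  difference of its values by the length, even if the curve leaves the chart.\<close>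

lemma test_function_lip:
  assumes c: "(U, \<phi>) \<in> rm_atlas M" and K: "coord_ball n q R \<subseteq> \<phi> ` U"
    and lb: "\<And>z v. z \<in> coord_ball n q R \<Longrightarrow> a * L2_set v {..<n} \<le> sqrt (qform (U, \<phi>) (inv_into U \<phi> z) v)"
    and B: "continuous_on UNIV B" and B0: "\<And>z. z \<in> \<phi> ` U \<Longrightarrow> z \<notin> coord_ball n q R \<Longrightarrow> B z = 0"
    and B1: "\<And>z. z \<in> coord_ball n q R \<Longrightarrow> \<bar>B z\<bar> \<le> 1"
    and der: "\<And>z v s. z s \<in> coord_ball n q R \<Longrightarrow> (\<And>i. i < n \<Longrightarrow> ((\<lambda>r. z r i) has_real_derivative v i) (at s)) \<Longrightarrow>
       \<exists>D. ((\<lambda>r. B (z r)) has_real_derivative D) (at s) \<and> \<bar>D\<bar> \<le> a * L2_set v {..<n}"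
  shows "(\<lambda>y. if y \<in> U then B (\<phi> y) else 0) \<in> lip_class X d"
proof -
  let ?K = "inv_into U \<phi> ` coord_ball n q R"
  define u where "u y = (if y \<in> U then B (\<phi> y) else 0)" for y
  have KU: "?K \<subseteq> U" using K by (auto intro: inv_into_into)
  \<comment> \<open>The complement of \<open>?K\<close> is therefore open and covers the manifold
    together with the chart domain; the function is pasted over these two sets.\<close>
  have clK: "closedin T ?K" by (rule closedin_chart_image[OF c compact_coord_ball K])
  have C: "openin T (X - ?K)" using clK by blast
  have inK: "y \<in> ?K \<longleftrightarrow> \<phi> y \<in> coord_ball n q R" if "y \<in> U" for y
  proof
    assume "y \<in> ?K"
    then obtain z where "z \<in> coord_ball n q R" "y = inv_into U \<phi> z" by blast
    then show "\<phi> y \<in> coord_ball n q R" using K f_inv_into_f[of z \<phi> U] by auto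
  next
    assume "\<phi> y \<in> coord_ball n q R"
    moreover have "y = inv_into U \<phi> (\<phi> y)" using that chart_facts(3)[OF c] by simp
    ultimately show "y \<in> ?K" by blast
  qed
  have u0: "u y = 0" if "y \<in> X - ?K" for y
    using that inK[of y] B0[of "\<phi> y"] by (auto simp: u_def)
  have uc: "continuous_map T euclideanreal u"
  proof (rule pasting_lemma[where I = "{True, False}" and T = "\<lambda>b. if b then U else X - ?K"
        and f = "\<lambda>b. if b then B \<circ> \<phi> else (\<lambda>_. 0)"])
    fix b :: bool
    show "openin T (if b then U else X - ?K)" using chart(1)[OF c] C by simp
    have "continuous_map (subtopology T U) euclideanreal (B \<circ> \<phi>)"
      using B by (intro continuous_map_compose[OF chart_facts(4)[OF c]]) simp
    then show "continuous_map (subtopology T (if b then U else X - ?K)) euclideanreal (if b then B \<circ> \<phi> else (\<lambda>_. 0))"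
      by auto
  next
    fix b b' :: bool and x
    assume "b \<in> {True, False}" "b' \<in> {True, False}" "x \<in> topspace T \<inter> (if b then U else X - ?K) \<inter> (if b' then U else X - ?K)"
    then show "(if b then B \<circ> \<phi> else (\<lambda>_. 0)) x = (if b' then B \<circ> \<phi> else (\<lambda>_. 0)) x"
      using u0[of x] by (auto simp: u_def split: if_splits)
  next
    fix x assume x: "x \<in> topspace T"
    show "\<exists>b. b \<in> {True, False} \<and> x \<in> (if b then U else X - ?K) \<and> u x = (if b then B \<circ> \<phi> else (\<lambda>_. 0)) x"
    proof (cases "x \<in> U")
      case True then show ?thesis by (intro exI[of _ True]) (simp add: u_def)
    next
      case False then show ?thesis using KU x by (intro exI[of _ False]) (auto simp: u_def)
    qed
  qed
  have u1: "\<bar>u y\<bar> \<le> 1" if "y \<in> X" for y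
  proof (cases "y \<in> ?K")
    case True
    then have "y \<in> U" using KU by blast
    then show ?thesis using B1 inK True by (simp add: u_def)
  qed (use u0 that in auto)
  have lip: "ennreal \<bar>u x - u y\<bar> \<le> d x y" for x y
    unfolding riemannian_dist_def
  proof (rule INF_greatest)
    fix \<gamma> assume "\<gamma> \<in> {\<gamma>. piecewise_C1_curve M \<gamma> \<and> \<gamma> 0 = x \<and> \<gamma> 1 = y}"
    then have pw: "piecewise_C1_curve M \<gamma>" and g01: "\<gamma> 0 = x" "\<gamma> 1 = y" by auto
    then obtain F where path: "pathin T \<gamma>" and F: "finite F" and
      C1: "\<And>i. i < n \<Longrightarrow> (\<lambda>r. \<phi> (\<gamma> r) i) C1_differentiable_on {s \<in> {0..1} - F. \<gamma> s \<in> U}"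
      using c unfolding piecewise_C1_curve_def by fast
    define h where "h s = u (\<gamma> s)" for s
    have hc: "continuous_on {0..1} h"
    proof -
      have "continuous_map (top_of_set {0..1}) euclideanreal (u \<circ> \<gamma>)"
        using path uc unfolding pathin_def by (rule continuous_map_compose)
      then show ?thesis by (simp add: h_def[abs_def] o_def)
    qed
    have \<gamma>X: "\<gamma> s \<in> X" if "s \<in> {0..1}" for s
      using path that unfolding pathin_def continuous_map_def by auto
    \<comment> \<open>At a point of \<open>?K\<close> the derivative is computed in the chart;
      elsewhere the function vanishes along the curve near \<open>s\<close>. The maximum with 0
      settles the second case whatever the sign of \<open>speed\<close>, and it does not change the
      integral in \<open>ennreal\<close>.\<close>
    have hd: "\<exists>D. (h has_real_derivative D) (at s) \<and> \<bar>D\<bar> \<le> max 0 (speed M \<gamma> s)" if s: "s \<in> {0<..<1} - F" for s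
    proof (cases "\<gamma> s \<in> ?K")
      case True
      have s01: "s \<in> {0<..<1}" using s by simp
      have sU: "\<gamma> s \<in> U" using True KU by blast
      have "\<exists>D. ((\<lambda>r. \<phi> (\<gamma> r) i) has_vector_derivative D) (at s)" if "i < n" for i
      proof -
        have sA: "s \<in> {s \<in> {0..1} - F. \<gamma> s \<in> U}" using s sU by auto
        from C1[OF that] obtain D where
          "\<forall>x\<in>{s \<in> {0..1} - F. \<gamma> s \<in> U}. ((\<lambda>r. \<phi> (\<gamma> r) i) has_vector_derivative D x) (at x)"
          unfolding C1_differentiable_on_def by blast
        from bspec[OF this sA] show ?thesis by blast
      qed
      then obtain v where v: "\<And>i. i < n \<Longrightarrow> ((\<lambda>r. \<phi> (\<gamma> r) i) has_real_derivative v i) (at s)"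
        unfolding has_real_derivative_iff_has_vector_derivative by metis
      have zK: "\<phi> (\<gamma> s) \<in> coord_ball n q R" using True inK sU by blast
      obtain D where D: "((\<lambda>r. B (\<phi> (\<gamma> r))) has_real_derivative D) (at s)" "\<bar>D\<bar> \<le> a * L2_set v {..<n}"
        using der[of "\<lambda>r. \<phi> (\<gamma> r)" s v] zK v by blast
      have "\<forall>\<^sub>F r in at s. \<gamma> r \<in> U" by (rule path_eventually[OF path s01 chart(1)[OF c] sU])
      then have "\<forall>\<^sub>F r in nhds s. h r = B (\<phi> (\<gamma> r))"
        unfolding eventually_nhds_conv_at using sU by (auto simp: h_def u_def elim!: eventually_mono)
      then have "(h has_real_derivative D) (at s)" using D(1) by (subst DERIV_cong_ev[OF refl _ refl]) auto
      moreover have "speed M \<gamma> s = sqrt (qform (U, \<phi>) (\<gamma> s) v)"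
        using path_eventually[OF path s01] v by (intro speed_chart[where \<gamma> = \<gamma> and s = s, OF c sU]) auto
      moreover have "a * L2_set v {..<n} \<le> sqrt (qform (U, \<phi>) (\<gamma> s) v)"
        using lb[OF zK, of v] sU chart_facts(3)[OF c] by simp
      ultimately show ?thesis using D(2) by (intro exI[of _ D]) auto
    next
      case False
      have s01: "s \<in> {0<..<1}" "s \<in> {0..1}" using s by auto
      have sC: "\<gamma> s \<in> X - ?K" using False \<gamma>X[OF s01(2)] by simp
      have "\<forall>\<^sub>F r in at s. \<gamma> r \<in> X - ?K" by (rule path_eventually[OF path s01(1) C sC])
      then have "\<forall>\<^sub>F r in nhds s. h r = 0"
        unfolding eventually_nhds_conv_at using sC u0 by (auto simp: h_def elim!: eventually_mono)
      then have "(h has_real_derivative 0) (at s)" by (subst DERIV_cong_ev[OF refl _ refl]) auto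
      then show ?thesis by (intro exI[of _ 0]) auto
    qed
    then obtain h' where h': "\<And>s. s \<in> {0<..<1} - F \<Longrightarrow> (h has_real_derivative h' s) (at s) \<and> \<bar>h' s\<bar> \<le> max 0 (speed M \<gamma> s)"
      by metis
    have "ennreal \<bar>h 1 - h 0\<bar> \<le> (\<integral>\<^sup>+ s\<in>{0..1}. ennreal (max 0 (speed M \<gamma> s)) \<partial>lborel)"
      by (rule ftc_le_nn_integral[OF hc F, of h']) (use h' in auto)
    also have "\<dots> = curve_length M \<gamma>" unfolding curve_length_def by (simp add: ennreal_max_0)
    finally show "ennreal \<bar>u x - u y\<bar> \<le> curve_length M \<gamma>" using g01 by (simp add: h_def abs_minus_commute)
  qed
  show ?thesis using u1 lip unfolding lip_class_def u_def[abs_def] by blast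
qed

end

section \<open>Null sets and bi-Lipschitz charts\<close>

context riem
begin

text \<open>The square root of the determinant has a positive minimum on a nonempty compact set, so
  volume 0 forces Lebesgue measure 0 in coordinates. Compactness of \<open>E\<close> also makes its
  image closed, hence measurable.\<close>

lemma null_pullback:
  assumes c: "(U, \<phi>) \<in> rm_atlas M" and E: "compact E" "E \<subseteq> \<phi> ` U"
    and \<mu>: "riemannian_volume M \<mu>" and Z: "Z \<in> null_sets \<mu>" "inv_into U \<phi> ` E \<subseteq> Z"
  shows "emeasure (Euclidean_lebesgue n) E = 0"
proof (cases "E = {}")
  case False
  let ?psi = "inv_into U \<phi>"
  let ?g = "\<lambda>z. nat_det n (rm_metric M (U, \<phi>) (?psi z))"
  have \<mu>s: "space \<mu> = X" "sets \<mu> = sigma_sets X {U. openin T U}"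
    and \<mu>c: "\<And>B. B \<in> sets \<mu> \<Longrightarrow> B \<subseteq> U \<Longrightarrow> emeasure \<mu> B = (\<integral>\<^sup>+ p\<in>\<phi> ` B. ennreal (sqrt (nat_det n (rm_metric M (U, \<phi>) (inv_into U \<phi> p)))) \<partial>Euclidean_lebesgue n)"
    using \<mu> c unfolding riemannian_volume_def by auto
  have cl: "closedin T (?psi ` E)" by (rule closedin_chart_image[OF c E])
  have BU: "?psi ` E \<subseteq> U" using E by (auto intro: inv_into_into)
  have B: "?psi ` E \<in> sets \<mu>"
  proof -
    have "X - ?psi ` E \<in> sigma_sets X {U. openin T U}" using cl by (intro sigma_sets.Basic) auto
    then have "X - (X - ?psi ` E) \<in> sigma_sets X {U. openin T U}" by (rule sigma_sets.Compl)
    moreover have "X - (X - ?psi ` E) = ?psi ` E" using closedin_subset[OF cl] by blast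
    ultimately show ?thesis by (simp add: \<mu>s)
  qed
  have "emeasure \<mu> (?psi ` E) = 0"
    using null_sets_subset[OF Z(1) B Z(2)] by (rule null_setsD1)
  moreover have "\<phi> ` ?psi ` E = E" using E(2) by (force simp: image_iff f_inv_into_f subset_iff)
  ultimately have int0: "(\<integral>\<^sup>+ z\<in>E. ennreal (sqrt (?g z)) \<partial>Euclidean_lebesgue n) = 0"
    using \<mu>c[OF B BU] by simp
  have cont: "continuous_on E ?g"
    unfolding nat_det_def
  proof (intro continuous_on_sum continuous_on_mult continuous_on_const continuous_on_prod)
    fix \<sigma> i assume "\<sigma> \<in> {\<sigma>. \<sigma> permutes {..<n}}" and i: "i \<in> {..<n}"
    then have "\<sigma> i < n" using permutes_in_image[of \<sigma> "{..<n}" i] by simp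
    then show "continuous_on E (\<lambda>z. rm_metric M (U, \<phi>) (?psi z) i (\<sigma> i))"
      using metric_facts(1)[OF c] i continuous_on_subset[OF _ E(2)] by blast
  qed
  obtain z0 where z0: "z0 \<in> E" "\<And>z. z \<in> E \<Longrightarrow> ?g z0 \<le> ?g z"
    using continuous_attains_inf[OF E(1) False cont] by blast
  have pos: "?g z0 > 0"
  proof (rule nat_det_pos)
    fix v :: "nat \<Rightarrow> real" assume "\<exists>i<n. v i \<noteq> 0"
    then show "0 < (\<Sum>i<n. \<Sum>j<n. rm_metric M (U, \<phi>) (?psi z0) i j * v i * v j)"
      using metric_facts(2)[OF c, of "?psi z0" v] z0(1) BU unfolding qform_def by blast
  qed
  have "ennreal (sqrt (?g z0)) * emeasure (Euclidean_lebesgue n) E =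
      (\<integral>\<^sup>+ z\<in>E. ennreal (sqrt (?g z0)) \<partial>Euclidean_lebesgue n)"
    using compact_imp_closed[OF E(1)] by (intro nn_integral_cmult_indicator[symmetric]) auto
  also have "\<dots> \<le> (\<integral>\<^sup>+ z\<in>E. ennreal (sqrt (?g z)) \<partial>Euclidean_lebesgue n)"
    using z0(2) by (intro nn_integral_mono) (auto simp: indicator_def intro!: ennreal_leI)
  finally show ?thesis using int0 pos by simp
qed simp

text \<open>The upper bound is \<open>dist_le_in_chart\<close>. For the lower bound each coordinate
  has a test function that grows linearly in it. Capturing nearby points uses a bump that is bounded
  below on the inner ball and vanishes outside the double ball. The clause on null sets is
  \<open>null_pullback\<close>.\<close>

lemma local_chart:
  assumes x: "x \<in> X"
  shows "\<exists>q \<rho> L \<psi> O'. 0 < \<rho> \<and> 1 \<le> L \<and> (\<forall>i\<ge>n. q i = 0) \<and> openin T O' \<and> x \<in> O' \<and> O' \<subseteq> \<psi> ` coord_ball n q \<rho> \<and>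
    (\<forall>v\<in>coord_ball n q (2 * \<rho>). \<psi> v \<in> X) \<and>
    (\<forall>u\<in>coord_ball n q (2 * \<rho>). \<forall>v\<in>coord_ball n q (2 * \<rho>). d (\<psi> u) (\<psi> v) \<le> ennreal (L * cdist n u v) \<and>
       cdist n u v \<le> L * lip_dist X d (\<psi> u) (\<psi> v)) \<and>
    (\<forall>u\<in>coord_ball n q \<rho>. \<forall>y\<in>X. L * lip_dist X d (\<psi> u) y < \<rho> \<longrightarrow> (\<exists>v\<in>coord_ball n q (2 * \<rho>). y = \<psi> v)) \<and>
    (\<forall>\<mu> Z E. riemannian_volume M \<mu> \<longrightarrow> Z \<in> null_sets \<mu> \<longrightarrow> compact E \<longrightarrow> E \<subseteq> coord_ball n q (2 * \<rho>) \<longrightarrow>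
       \<psi> ` E \<subseteq> Z \<longrightarrow> emeasure (Euclidean_lebesgue n) E = 0)"
proof -
  have "x \<in> (\<Union>(U, \<phi>)\<in>rm_atlas M. U)" using x atlas_cover by simp
  then obtain U \<phi> where c: "(U, \<phi>) \<in> rm_atlas M" and xU: "x \<in> U" by blast
  define q where "q = \<phi> x"
  have q0: "q i = 0" if "i \<ge> n" for i using chart_facts(2)[OF c] xU that by (auto simp: q_def)
  obtain R where R: "R > 0" "coord_ball n q R \<subseteq> \<phi> ` U"
    using openin_Euclidean_ball[OF chart(2)[OF c], of q] xU by (auto simp: q_def)
  \<comment> \<open>Three concentric balls: the inner one for covering, the double one for the
    estimates, and the one of radius \<open>R\<close> as support of the coordinate test functions,
    so that their bump stays bounded below on the double ball.\<close>
  define \<rho> where "\<rho> = R / 3"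
  have \<rho>: "\<rho> > 0" "R = 3 * \<rho>" using R by (auto simp: \<rho>_def)
  have balls: "coord_ball n q \<rho> \<subseteq> coord_ball n q (2 * \<rho>)" "coord_ball n q (2 * \<rho>) \<subseteq> coord_ball n q R"
    using \<rho> by (auto simp: coord_ball_def)
  have b2U: "coord_ball n q (2 * \<rho>) \<subseteq> \<phi> ` U" using balls R by blast
  obtain a b where ab: "a > 0" "b > 0"
    and lb: "\<And>z v. z \<in> coord_ball n q R \<Longrightarrow> a * L2_set v {..<n} \<le> sqrt (qform (U, \<phi>) (inv_into U \<phi> z) v)"
    and ub: "\<And>z v. z \<in> coord_ball n q R \<Longrightarrow> sqrt (qform (U, \<phi>) (inv_into U \<phi> z) v) \<le> b * L2_set v {..<n}"
    using metric_bounds[OF c R(2)] by blast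
  let ?psi = "inv_into U \<phi>"
  let ?D = "lip_dist X d"
  have psiU: "?psi z \<in> U" "\<phi> (?psi z) = z" if "z \<in> coord_ball n q R" for z
    using that R(2) by (auto intro: inv_into_into f_inv_into_f)
  have psiX: "?psi z \<in> X" if "z \<in> coord_ball n q R" for z
    using psiU[OF that] chart_facts(1)[OF c] by blast
  have inE: "z i = 0" if "z \<in> \<phi> ` U" "i \<ge> n" for z i using chart_facts(2)[OF c] that by auto
  \<comment> \<open>Normalizes the test function: \<open>9 * R ^ 4\<close> is the coefficient in
    \<open>bump_deriv\<close> for \<open>e = 0\<close> and \<open>f = 1\<close>, and
    \<open>2 * R ^ 5\<close> bounds the function before scaling.\<close>
  define k where "k = min (a / (9 * R ^ 4)) (1 / (2 * R ^ 5))"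
  have k: "k > 0" "k * (9 * R ^ 4) \<le> a" "k * (R ^ 4 * (2 * R)) \<le> 1"
  proof -
    show "k > 0" using ab R by (auto simp: k_def)
    have "k \<le> a / (9 * R ^ 4)" "k \<le> 1 / (2 * R ^ 5)" by (auto simp: k_def)
    then show "k * (9 * R ^ 4) \<le> a" "k * (R ^ 4 * (2 * R)) \<le> 1"
      using R by (auto simp: field_simps eval_nat_numeral)
  qed
  \<comment> \<open>\<open>25 * \<rho> ^ 4\<close> is \<open>(R^2 - (2 * \<rho>)^2)^2\<close>, the
    lower bound of the bump on the double ball.\<close>
  define \<kappa> where "\<kappa> = k * (25 * \<rho> ^ 4)"
  have \<kappa>: "\<kappa> > 0" using k \<rho> by (simp add: \<kappa>_def)
  have coordwise: "\<kappa> * \<bar>v j - w j\<bar> \<le> ?D (?psi v) (?psi w)"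
    if v: "v \<in> coord_ball n q (2 * \<rho>)" and w: "w \<in> coord_ball n q (2 * \<rho>)" and j: "j < n" for v w j
  proof -
    \<comment> \<open>Vanishes at \<open>w\<close>, so that the difference of its values at
      \<open>v\<close> and \<open>w\<close> is its value at \<open>v\<close>.\<close>
    define B where "B z = k * (bump n q R z * (0 + 1 * (z j - w j)))" for z
    have wR: "cdist n q w \<le> R" using w balls by (auto simp: coord_ball_def)
    have "(\<lambda>y. if y \<in> U then B (\<phi> y) else 0) \<in> lip_class X d"
    proof (rule test_function_lip[OF c R(2) lb])
      show "continuous_on UNIV B"
        unfolding B_def by (intro continuous_intros continuous_on_bump continuous_on_product_coordinates)
      show "B z = 0" if "z \<in> \<phi> ` U" "z \<notin> coord_ball n q R" for z
        using bump_outside[of R n q z] that inE R by (auto simp: B_def coord_ball_def)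
      show "\<bar>B z\<bar> \<le> 1" if z: "z \<in> coord_ball n q R" for z
      proof -
        have "cdist n q z \<le> R" using z by (simp add: coord_ball_def)
        then have "\<bar>z j - w j\<bar> \<le> 2 * R"
          using cdist_coord[OF j, of q z] cdist_coord[OF j, of q w] wR by linarith
        then have "bump n q R z * \<bar>z j - w j\<bar> \<le> R ^ 4 * (2 * R)"
          using bump_le[of n q R z] by (intro mult_mono) auto
        from mult_left_mono[OF this, of k] have "k * (bump n q R z * \<bar>z j - w j\<bar>) \<le> 1"
          using k by linarith
        then show ?thesis using k bump_le(2)[of n q R z] by (simp add: B_def abs_mult)
      qed
      fix z v s assume z: "z s \<in> coord_ball n q R" and dz: "\<And>i. i < n \<Longrightarrow> ((\<lambda>r. z r i) has_real_derivative v i) (at s)"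
      obtain D where D: "((\<lambda>r. bump n q R (z r) * (0 + 1 * (z r j - w j))) has_real_derivative D) (at s)"
        "\<bar>D\<bar> \<le> (4 * R ^ 3 * (\<bar>0\<bar> + 2 * R * \<bar>1\<bar>) + R ^ 4 * \<bar>1\<bar>) * L2_set v {..<n}"
        using bump_deriv[of R n q z s v w j 1 0] R(1) z dz wR j by (auto simp: coord_ball_def)
      have "\<bar>k * D\<bar> \<le> a * L2_set v {..<n}"
      proof -
        have "4 * R ^ 3 * (\<bar>0\<bar> + 2 * R * \<bar>1\<bar>) + R ^ 4 * \<bar>1\<bar> = 9 * R ^ 4" by (simp add: eval_nat_numeral)
        then have "\<bar>D\<bar> \<le> 9 * R ^ 4 * L2_set v {..<n}" using D(2) by simp
        then have "k * \<bar>D\<bar> \<le> k * (9 * R ^ 4) * L2_set v {..<n}"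
          using mult_left_mono[of "\<bar>D\<bar>" "9 * R ^ 4 * L2_set v {..<n}" k] k by (simp add: mult.assoc)
        also have "\<dots> \<le> a * L2_set v {..<n}" using k by (intro mult_right_mono L2_set_nonneg)
        finally show ?thesis using k by (simp add: abs_mult)
      qed
      moreover have "((\<lambda>r. B (z r)) has_real_derivative k * D) (at s)"
        unfolding B_def by (rule DERIV_cmult[OF D(1)])
      ultimately show "\<exists>D. ((\<lambda>r. B (z r)) has_real_derivative D) (at s) \<and> \<bar>D\<bar> \<le> a * L2_set v {..<n}" by blast
    qed
    from lip_dist_ge[OF psiX psiX this, of v w]
    have "\<bar>B v - B w\<bar> \<le> ?D (?psi v) (?psi w)"
      using v w balls psiU[of v] psiU[of w] by (auto simp: subset_iff)
    moreover have "\<kappa> * \<bar>v j - w j\<bar> \<le> \<bar>B v - B w\<bar>"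
    proof -
      have "25 * \<rho> ^ 4 = (R\<^sup>2 - (2 * \<rho>)\<^sup>2)\<^sup>2" unfolding \<rho>(2) by (simp add: power2_eq_square eval_nat_numeral)
      also have "\<dots> \<le> bump n q R v" using v \<rho> by (intro bump_ge) (auto simp: coord_ball_def)
      finally have "\<kappa> * \<bar>v j - w j\<bar> \<le> k * bump n q R v * \<bar>v j - w j\<bar>"
        unfolding \<kappa>_def using k by (intro mult_right_mono mult_left_mono) auto
      also have "\<dots> = \<bar>B v - B w\<bar>" using k bump_le(2)[of n q R v] by (simp add: B_def abs_mult)
      finally show ?thesis .
    qed
    ultimately show ?thesis by linarith
  qed
  \<comment> \<open>The bounds for the bump of radius \<open>2 * \<rho>\<close>: for its derivative,
    from \<open>bump_deriv\<close> with \<open>e = 1\<close> and \<open>f = 0\<close>, and for its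
    values.\<close>
  define k2 where "k2 = min (a / (4 * (2 * \<rho>) ^ 3)) (1 / (2 * \<rho>) ^ 4)"
  have k2: "k2 > 0" "k2 * (4 * (2 * \<rho>) ^ 3) \<le> a" "k2 * (2 * \<rho>) ^ 4 \<le> 1"
  proof -
    have p: "0 < 4 * (2 * \<rho>) ^ 3" "0 < (2 * \<rho>) ^ 4" using \<rho> by auto
    show "k2 > 0" using ab p by (simp add: k2_def)
    have "k2 \<le> a / (4 * (2 * \<rho>) ^ 3)" "k2 \<le> 1 / (2 * \<rho>) ^ 4" by (auto simp: k2_def)
    then show "k2 * (4 * (2 * \<rho>) ^ 3) \<le> a" "k2 * (2 * \<rho>) ^ 4 \<le> 1"
      using p by (auto simp only: pos_le_divide_eq)
  qed
  \<comment> \<open>\<open>9 * \<rho> ^ 4\<close> is \<open>((2 * \<rho>)^2 - \<rho>^2)^2\<close>,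
    the lower bound of this bump on the inner ball.\<close>
  define \<kappa>2 where "\<kappa>2 = k2 * (9 * \<rho> ^ 4)"
  have \<kappa>2: "\<kappa>2 > 0" using k2 \<rho> by (simp add: \<kappa>2_def)
  have far: "\<kappa>2 \<le> ?D (?psi u) y"
    if u: "u \<in> coord_ball n q \<rho>" and y: "y \<in> X" and ny: "\<not> (\<exists>v\<in>coord_ball n q (2 * \<rho>). y = ?psi v)" for u y
  proof -
    \<comment> \<open>Written with a zero term to match the form in
      \<open>bump_deriv\<close>.\<close>
    define B where "B z = k2 * (bump n q (2 * \<rho>) z * (1 + 0 * (z 0 - q 0)))" for z
    let ?f = "\<lambda>y. if y \<in> U then B (\<phi> y) else 0"
    have out: "B z = 0" if "z \<in> \<phi> ` U" "z \<notin> coord_ball n q (2 * \<rho>)" for z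
      using bump_outside[of "2 * \<rho>" n q z] that inE \<rho> by (auto simp: B_def coord_ball_def)
    have "?f \<in> lip_class X d"
    proof (rule test_function_lip[OF c b2U])
      show "a * L2_set v {..<n} \<le> sqrt (qform (U, \<phi>) (inv_into U \<phi> z) v)" if "z \<in> coord_ball n q (2 * \<rho>)" for z v
        using lb balls that by blast
      show "continuous_on UNIV B"
        unfolding B_def by (intro continuous_intros continuous_on_bump continuous_on_product_coordinates)
      show "\<bar>B z\<bar> \<le> 1" for z
      proof -
        have "k2 * bump n q (2 * \<rho>) z \<le> 1"
          using mult_left_mono[OF bump_le(1)[of n q "2 * \<rho>" z], of k2] k2 by linarith
        then show ?thesis using bump_le(2)[of n q "2 * \<rho>" z] k2 by (simp add: B_def abs_mult)
      qed
      show "B z = 0" if "z \<in> \<phi> ` U" "z \<notin> coord_ball n q (2 * \<rho>)" for z using out that by blast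
      fix z v s assume z: "z s \<in> coord_ball n q (2 * \<rho>)" and dz: "\<And>i. i < n \<Longrightarrow> ((\<lambda>r. z r i) has_real_derivative v i) (at s)"
      obtain D where D: "((\<lambda>r. bump n q (2 * \<rho>) (z r) * (1 + 0 * (z r 0 - q 0))) has_real_derivative D) (at s)"
        "\<bar>D\<bar> \<le> (4 * (2 * \<rho>) ^ 3 * (\<bar>1\<bar> + 2 * (2 * \<rho>) * \<bar>0\<bar>) + (2 * \<rho>) ^ 4 * \<bar>0\<bar>) * L2_set v {..<n}"
        using bump_deriv[of "2 * \<rho>" n q z s v q 0 0 1] \<rho>(1) z dz by (auto simp: coord_ball_def)
      have "\<bar>k2 * D\<bar> \<le> a * L2_set v {..<n}"
      proof -
        have "\<bar>D\<bar> \<le> 4 * (2 * \<rho>) ^ 3 * L2_set v {..<n}" using D(2) by simp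
        then have "k2 * \<bar>D\<bar> \<le> k2 * (4 * (2 * \<rho>) ^ 3) * L2_set v {..<n}"
          using mult_left_mono[of "\<bar>D\<bar>" "4 * (2 * \<rho>) ^ 3 * L2_set v {..<n}" k2] k2 by (simp add: mult.assoc)
        also have "\<dots> \<le> a * L2_set v {..<n}" using k2 by (intro mult_right_mono L2_set_nonneg)
        finally show ?thesis using k2 by (simp add: abs_mult)
      qed
      moreover have "((\<lambda>r. B (z r)) has_real_derivative k2 * D) (at s)"
        unfolding B_def by (rule DERIV_cmult[OF D(1)])
      ultimately show "\<exists>D. ((\<lambda>r. B (z r)) has_real_derivative D) (at s) \<and> \<bar>D\<bar> \<le> a * L2_set v {..<n}" by blast
    qed
    from lip_dist_ge[OF psiX y this, of u] have "\<bar>?f (?psi u) - ?f y\<bar> \<le> ?D (?psi u) y"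
      using u balls by blast
    moreover have "?f y = 0"
    proof (cases "y \<in> U")
      case True
      have "\<phi> y \<notin> coord_ball n q (2 * \<rho>)" using ny True chart_facts(3)[OF c] by (metis inv_into_f_f)
      then show ?thesis using out[of "\<phi> y"] True by simp
    qed simp
    moreover have "\<kappa>2 \<le> ?f (?psi u)"
    proof -
      have "9 * \<rho> ^ 4 = ((2 * \<rho>)\<^sup>2 - \<rho>\<^sup>2)\<^sup>2" by (simp add: power2_eq_square eval_nat_numeral)
      also have "\<dots> \<le> bump n q (2 * \<rho>) u" using u \<rho> by (intro bump_ge) (auto simp: coord_ball_def)
      finally have "\<kappa>2 \<le> B u" unfolding \<kappa>2_def B_def using k2 by simp
      moreover have "?f (?psi u) = B u" using psiU[of u] u balls by (auto simp: subset_iff)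
      ultimately show ?thesis by simp
    qed
    ultimately show ?thesis by linarith
  qed
  \<comment> \<open>\<open>n / \<kappa>\<close> sums the \<open>n\<close> coordinate bounds;
    \<open>\<rho> / \<kappa>2\<close> makes \<open>L * ?D (?psi u) y < \<rho>\<close> incompatible
    with the conclusion of \<open>far\<close>.\<close>
  define L where "L = Max {1, b, n / \<kappa>, \<rho> / \<kappa>2}"
  have L: "1 \<le> L" "b \<le> L" "n / \<kappa> \<le> L" "\<rho> / \<kappa>2 \<le> L" by (simp_all add: L_def)
  have up: "d (?psi u) (?psi v) \<le> ennreal (L * cdist n u v)"
    if "u \<in> coord_ball n q (2 * \<rho>)" "v \<in> coord_ball n q (2 * \<rho>)" for u v
  proof -
    have "d (?psi u) (?psi v) \<le> ennreal (b * cdist n u v)"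
      using balls that by (intro dist_le_in_chart[OF c R(2) ab(2) ub]) auto
    also have "\<dots> \<le> ennreal (L * cdist n u v)" using L by (intro ennreal_leI mult_right_mono) auto
    finally show ?thesis .
  qed
  have lo: "cdist n u v \<le> L * ?D (?psi u) (?psi v)"
    if u: "u \<in> coord_ball n q (2 * \<rho>)" and v: "v \<in> coord_ball n q (2 * \<rho>)" for u v
  proof -
    have D0: "0 \<le> ?D (?psi u) (?psi v)" using psiX u v balls by (intro lip_dist_nonneg) auto
    have "cdist n u v \<le> (\<Sum>i<n. \<bar>u i - v i\<bar>)" by (rule cdist_le_sum)
    also have "\<dots> \<le> of_nat (card {..<n}) * (?D (?psi u) (?psi v) / \<kappa>)"
      using coordwise[OF u v] \<kappa> by (intro sum_bounded_above) (simp add: pos_le_divide_eq mult.commute)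
    also have "\<dots> = n / \<kappa> * ?D (?psi u) (?psi v)" by simp
    also have "\<dots> \<le> L * ?D (?psi u) (?psi v)" using L D0 by (intro mult_right_mono)
    finally show ?thesis .
  qed
  have cap: "\<exists>v\<in>coord_ball n q (2 * \<rho>). y = ?psi v"
    if u: "u \<in> coord_ball n q \<rho>" and y: "y \<in> X" and lt: "L * ?D (?psi u) y < \<rho>" for u y
  proof (rule ccontr)
    assume "\<not> ?thesis"
    then have "\<kappa>2 \<le> ?D (?psi u) y" by (rule far[OF u y])
    then have "\<rho> / \<kappa>2 * \<kappa>2 \<le> L * ?D (?psi u) y" using L \<kappa>2 \<rho> by (intro mult_mono) auto
    then show False using lt \<kappa>2 by simp
  qed
  \<comment> \<open>The open ball, since compactness will be applied to a cover by sets of this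
    kind.\<close>
  define O' where "O' = {y \<in> U. \<phi> y \<in> {z. cdist n q z < \<rho>}}"
  have "open {z. cdist n q z < \<rho>}"
    by (intro open_Collect_less continuous_on_cdist continuous_on_const)
  then have "openin (subtopology T U) {y \<in> topspace (subtopology T U). \<phi> y \<in> {z. cdist n q z < \<rho>}}"
    by (intro openin_continuous_map_preimage[OF chart_facts(4)[OF c]]) auto
  moreover have "topspace (subtopology T U) = U" using chart_facts(1)[OF c] by (simp add: Int_absorb1)
  ultimately have "openin (subtopology T U) O'" by (simp only: O'_def)
  then have O1: "openin T O'" by (rule openin_trans_full[OF _ chart(1)[OF c]])
  have O2: "x \<in> O'" using xU \<rho> by (simp add: O'_def q_def)
  have O3: "O' \<subseteq> ?psi ` coord_ball n q \<rho>"
  proof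
    fix y assume y: "y \<in> O'"
    then have "\<phi> y \<in> coord_ball n q \<rho>" using inE[of "\<phi> y"] by (auto simp: O'_def coord_ball_def)
    moreover have "y = ?psi (\<phi> y)" using y chart_facts(3)[OF c] by (simp add: O'_def)
    ultimately show "y \<in> ?psi ` coord_ball n q \<rho>" by blast
  qed
  have nul: "emeasure (Euclidean_lebesgue n) E = 0"
    if "riemannian_volume M \<mu>" "Z \<in> null_sets \<mu>" "compact E" "E \<subseteq> coord_ball n q (2 * \<rho>)" "?psi ` E \<subseteq> Z" for \<mu> Z E
    using null_pullback[OF c that(3) _ that(1,2,5)] that(4) b2U by blast
  show ?thesis
  proof (rule exI[of _ q], rule exI[of _ \<rho>], rule exI[of _ L], rule exI[of _ ?psi], rule exI[of _ O'], intro conjI)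
    show "0 < \<rho>" "1 \<le> L" by fact+
    show "\<forall>i\<ge>n. q i = 0" using q0 by blast
    show "openin T O'" "x \<in> O'" "O' \<subseteq> ?psi ` coord_ball n q \<rho>" by fact+
    show "\<forall>v\<in>coord_ball n q (2 * \<rho>). ?psi v \<in> X" using psiX balls by blast
    show "\<forall>u\<in>coord_ball n q (2 * \<rho>). \<forall>v\<in>coord_ball n q (2 * \<rho>). d (?psi u) (?psi v) \<le> ennreal (L * cdist n u v) \<and>
       cdist n u v \<le> L * lip_dist X d (?psi u) (?psi v)"
      by (intro ballI conjI up lo)
    show "\<forall>u\<in>coord_ball n q \<rho>. \<forall>y\<in>X. L * lip_dist X d (?psi u) y < \<rho> \<longrightarrow> (\<exists>v\<in>coord_ball n q (2 * \<rho>). y = ?psi v)"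
      by (intro ballI impI cap)
    show "\<forall>\<mu> Z E. riemannian_volume M \<mu> \<longrightarrow> Z \<in> null_sets \<mu> \<longrightarrow> compact E \<longrightarrow> E \<subseteq> coord_ball n q (2 * \<rho>) \<longrightarrow>
       ?psi ` E \<subseteq> Z \<longrightarrow> emeasure (Euclidean_lebesgue n) E = 0"
      by (intro allI impI nul)
  qed
qed

end

section \<open>Bi-Lipschitz atlases of compact Riemannian manifolds\<close>

context riem
begin

text \<open>Compactness leaves finitely many of the charts from \<open>local_chart\<close>, indexed
  by their centres; the largest of their constants serves for all of them.\<close>

lemma finite_bilip_atlas:
  "\<exists>(J :: 'a set) q r \<psi> L. bilip_atlas X d n J q r \<psi> L \<and>
    (\<forall>j\<in>J. \<forall>\<mu> Z E. riemannian_volume M \<mu> \<longrightarrow> Z \<in> null_sets \<mu> \<longrightarrow> compact E \<longrightarrow>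
       E \<subseteq> coord_ball n (q j) (2 * r j) \<longrightarrow> \<psi> j ` E \<subseteq> Z \<longrightarrow> emeasure (Euclidean_lebesgue n) E = 0)"
proof -
  define P where "P x q \<rho> L \<psi> O' \<longleftrightarrow> 0 < \<rho> \<and> 1 \<le> L \<and> (\<forall>i\<ge>n. q i = 0) \<and> openin T O' \<and> x \<in> O' \<and> O' \<subseteq> \<psi> ` coord_ball n q \<rho> \<and>
    (\<forall>v\<in>coord_ball n q (2 * \<rho>). \<psi> v \<in> X) \<and>
    (\<forall>u\<in>coord_ball n q (2 * \<rho>). \<forall>v\<in>coord_ball n q (2 * \<rho>). d (\<psi> u) (\<psi> v) \<le> ennreal (L * cdist n u v) \<and>
       cdist n u v \<le> L * lip_dist X d (\<psi> u) (\<psi> v)) \<and>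
    (\<forall>u\<in>coord_ball n q \<rho>. \<forall>y\<in>X. L * lip_dist X d (\<psi> u) y < \<rho> \<longrightarrow> (\<exists>v\<in>coord_ball n q (2 * \<rho>). y = \<psi> v)) \<and>
    (\<forall>\<mu> Z E. riemannian_volume M \<mu> \<longrightarrow> Z \<in> null_sets \<mu> \<longrightarrow> compact E \<longrightarrow> E \<subseteq> coord_ball n q (2 * \<rho>) \<longrightarrow>
       \<psi> ` E \<subseteq> Z \<longrightarrow> emeasure (Euclidean_lebesgue n) E = 0)"
    for x and q :: "nat \<Rightarrow> real" and \<rho> L :: real and \<psi> :: "(nat \<Rightarrow> real) \<Rightarrow> 'a" and O'
  have "\<forall>x\<in>X. \<exists>q \<rho> L \<psi> O'. P x q \<rho> L \<psi> O'"
  proof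
    fix x assume "x \<in> X"
    from local_chart[OF this] show "\<exists>q \<rho> L \<psi> O'. P x q \<rho> L \<psi> O'" unfolding P_def .
  qed
  then obtain q \<rho> L \<psi> O' where P: "\<And>x. x \<in> X \<Longrightarrow> P x (q x) (\<rho> x) (L x) (\<psi> x) (O' x)" by metis
  have PD: "0 < \<rho> x" "1 \<le> L x" "\<And>i. i \<ge> n \<Longrightarrow> q x i = 0" "openin T (O' x)" "x \<in> O' x" "O' x \<subseteq> \<psi> x ` coord_ball n (q x) (\<rho> x)"
    "\<And>v. v \<in> coord_ball n (q x) (2 * \<rho> x) \<Longrightarrow> \<psi> x v \<in> X"
    "\<And>u v. u \<in> coord_ball n (q x) (2 * \<rho> x) \<Longrightarrow> v \<in> coord_ball n (q x) (2 * \<rho> x) \<Longrightarrow> d (\<psi> x u) (\<psi> x v) \<le> ennreal (L x * cdist n u v)"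
    "\<And>u v. u \<in> coord_ball n (q x) (2 * \<rho> x) \<Longrightarrow> v \<in> coord_ball n (q x) (2 * \<rho> x) \<Longrightarrow> cdist n u v \<le> L x * lip_dist X d (\<psi> x u) (\<psi> x v)"
    "\<And>u y. u \<in> coord_ball n (q x) (\<rho> x) \<Longrightarrow> y \<in> X \<Longrightarrow> L x * lip_dist X d (\<psi> x u) y < \<rho> x \<Longrightarrow> \<exists>v\<in>coord_ball n (q x) (2 * \<rho> x). y = \<psi> x v"
    "\<And>\<mu> Z E. riemannian_volume M \<mu> \<Longrightarrow> Z \<in> null_sets \<mu> \<Longrightarrow> compact E \<Longrightarrow> E \<subseteq> coord_ball n (q x) (2 * \<rho> x) \<Longrightarrow>
       \<psi> x ` E \<subseteq> Z \<Longrightarrow> emeasure (Euclidean_lebesgue n) E = 0" if "x \<in> X" for x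
  proof -
    note c = P[OF that, unfolded P_def]
    note c2 = c[THEN conjunct2] note c3 = c2[THEN conjunct2] note c4 = c3[THEN conjunct2]
    note c5 = c4[THEN conjunct2] note c6 = c5[THEN conjunct2] note c7 = c6[THEN conjunct2]
    note c8 = c7[THEN conjunct2] note c9 = c8[THEN conjunct2] note c10 = c9[THEN conjunct2]
    show "0 < \<rho> x" by (rule c[THEN conjunct1])
    show "1 \<le> L x" by (rule c2[THEN conjunct1])
    show "q x i = 0" if "i \<ge> n" for i using c3[THEN conjunct1] that by blast
    show "openin T (O' x)" by (rule c4[THEN conjunct1])
    show "x \<in> O' x" by (rule c5[THEN conjunct1])
    show "O' x \<subseteq> \<psi> x ` coord_ball n (q x) (\<rho> x)" by (rule c6[THEN conjunct1])
    show "\<psi> x v \<in> X" if "v \<in> coord_ball n (q x) (2 * \<rho> x)" for v using c7[THEN conjunct1] that by blast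
    show "d (\<psi> x u) (\<psi> x v) \<le> ennreal (L x * cdist n u v)" "cdist n u v \<le> L x * lip_dist X d (\<psi> x u) (\<psi> x v)"
      if "u \<in> coord_ball n (q x) (2 * \<rho> x)" "v \<in> coord_ball n (q x) (2 * \<rho> x)" for u v
      using bspec[OF bspec[OF c8[THEN conjunct1] that(1)] that(2)] by simp_all
    show "\<exists>v\<in>coord_ball n (q x) (2 * \<rho> x). y = \<psi> x v"
      if "u \<in> coord_ball n (q x) (\<rho> x)" "y \<in> X" "L x * lip_dist X d (\<psi> x u) y < \<rho> x" for u y
      using bspec[OF bspec[OF c9[THEN conjunct1] that(1)] that(2)] that(3) by (rule mp)
    show "emeasure (Euclidean_lebesgue n) E = 0"
      if "riemannian_volume M \<mu>" "Z \<in> null_sets \<mu>" "compact E" "E \<subseteq> coord_ball n (q x) (2 * \<rho> x)" "\<psi> x ` E \<subseteq> Z"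
      for \<mu> Z E
      using c10 that by simp
  qed
  have "compactin T X" using compact by (simp add: compact_space_def)
  moreover have "openin T U" if "U \<in> O' ` X" for U using PD(4) that by blast
  moreover have "X \<subseteq> \<Union>(O' ` X)" using PD(5) by blast
  ultimately obtain \<F> where \<F>: "finite \<F>" "\<F> \<subseteq> O' ` X" "X \<subseteq> \<Union>\<F>"
    using compactinD[of T X "O' ` X"] by blast
  from finite_subset_image[OF \<F>(1,2)] obtain J where "J \<subseteq> X" "finite J" "\<F> = O' ` J" by blast
  then have J: "finite J" "J \<subseteq> X" "X \<subseteq> \<Union>(O' ` J)" using \<F>(3) by auto
  define L0 where "L0 = Max (insert 1 (L ` J))"
  have L0: "1 \<le> L0" "\<And>j. j \<in> J \<Longrightarrow> L j \<le> L0" using J(1) by (auto simp: L0_def)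
  have "bilip_atlas X d n J q \<rho> \<psi> L0"
  proof
    show "X \<noteq> {}" by (rule nonempty)
    show "finite J" "L0 \<ge> 1" using J L0 by auto
    fix j assume j: "j \<in> J"
    then have jX: "j \<in> X" using J by blast
    note PDj = PD[OF jX]
    show "\<rho> j > 0" by (rule PDj(1))
    show "q j i = 0" if "i \<ge> n" for i using PDj(3) that .
    show "\<psi> j v \<in> X" if "v \<in> coord_ball n (q j) (2 * \<rho> j)" for v using PDj(7) that .
    fix u v
    show "d (\<psi> j u) (\<psi> j v) \<le> ennreal (L0 * cdist n u v)"
      if "u \<in> coord_ball n (q j) (2 * \<rho> j)" "v \<in> coord_ball n (q j) (2 * \<rho> j)"
      by (rule order_trans[OF PDj(8)[OF that] ennreal_leI[OF mult_right_mono[OF L0(2)[OF j] cdist_nonneg]]])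
    show "cdist n u v \<le> L0 * lip_dist X d (\<psi> j u) (\<psi> j v)"
      if "u \<in> coord_ball n (q j) (2 * \<rho> j)" "v \<in> coord_ball n (q j) (2 * \<rho> j)"
      using PDj(9)[OF that] mult_right_mono[OF L0(2)[OF j] lip_dist_nonneg[OF PDj(7)[OF that(1)] PDj(7)[OF that(2)], of d]]
      by linarith
    show "\<exists>v\<in>coord_ball n (q j) (2 * \<rho> j). y = \<psi> j v"
      if u: "u \<in> coord_ball n (q j) (\<rho> j)" and y: "y \<in> X" and lt: "L0 * lip_dist X d (\<psi> j u) y < \<rho> j" for y
    proof -
      have "u \<in> coord_ball n (q j) (2 * \<rho> j)" using u PDj(1) by (simp add: coord_ball_def)
      then have "L j * lip_dist X d (\<psi> j u) y \<le> L0 * lip_dist X d (\<psi> j u) y"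
        using PDj(7) y by (intro mult_right_mono L0(2)[OF j] lip_dist_nonneg) auto
      then show ?thesis using PDj(10)[OF u y] lt by linarith
    qed
  next
    fix x assume "x \<in> X"
    then obtain j where j: "j \<in> J" "x \<in> O' j" using J by blast
    then have "x \<in> \<psi> j ` coord_ball n (q j) (\<rho> j)" using PD(6)[of j] J by blast
    then show "\<exists>j\<in>J. \<exists>v\<in>coord_ball n (q j) (\<rho> j). x = \<psi> j v" using j by blast
  qed
  moreover have "emeasure (Euclidean_lebesgue n) E = 0"
    if "j \<in> J" "riemannian_volume M \<mu>" "Z \<in> null_sets \<mu>" "compact E" "E \<subseteq> coord_ball n (q j) (2 * \<rho> j)" "\<psi> j ` E \<subseteq> Z"
    for j \<mu> Z E
    using PD(11)[of j \<mu> Z E] that J(2) by blast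
  ultimately have "bilip_atlas X d n J q \<rho> \<psi> L0 \<and>
    (\<forall>j\<in>J. \<forall>\<mu> Z E. riemannian_volume M \<mu> \<longrightarrow> Z \<in> null_sets \<mu> \<longrightarrow> compact E \<longrightarrow>
       E \<subseteq> coord_ball n (q j) (2 * \<rho> j) \<longrightarrow> \<psi> j ` E \<subseteq> Z \<longrightarrow> emeasure (Euclidean_lebesgue n) E = 0)"
    by (intro conjI ballI allI impI; simp)
  then show ?thesis by (intro exI)
qed

end

text \<open>In coordinates the fixed points of \<open>g\<close> form a closed subset of a compact
  ball, by continuity of the displacement, and they are mapped to points with nontrivial stabilizer.
  The clause on null sets of the atlas then applies.\<close>

lemma essentially_free_bilip:
  fixes M :: "'a riem_mfd" and \<alpha> :: "'g \<Rightarrow> 'a \<Rightarrow> 'a"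
  assumes G: "group G" "finite_generating_set G S" "symmetric_set G S"
    and M: "compact_riemannian_manifold M" and act: "isometric_action G \<alpha> M" and ef: "essentially_free G \<alpha> M"
  obtains J :: "'a set" and q r \<psi> L
  where "bilip_ess_free (rm_points M) (riemannian_dist M) (rm_dim M) J q r \<psi> L G S \<alpha>"
proof -
  interpret riem M by (rule riem.intro[OF M])
  from finite_bilip_atlas obtain J :: "'a set" and q r \<psi> L where atlas: "bilip_atlas X d n J q r \<psi> L" and
    nul': "\<forall>j\<in>J. \<forall>\<mu> Z E. riemannian_volume M \<mu> \<longrightarrow> Z \<in> null_sets \<mu> \<longrightarrow> compact E \<longrightarrow>
       E \<subseteq> coord_ball n (q j) (2 * r j) \<longrightarrow> \<psi> j ` E \<subseteq> Z \<longrightarrow> emeasure (Euclidean_lebesgue n) E = 0"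
    by (elim exE conjE) (rule that)
  have nul: "emeasure (Euclidean_lebesgue n) E = 0"
    if "j \<in> J" "riemannian_volume M \<mu>" "Z \<in> null_sets \<mu>" "compact E"
       "E \<subseteq> coord_ball n (q j) (2 * r j)" "\<psi> j ` E \<subseteq> Z" for j \<mu> Z E
    using nul' that by blast
  have ba: "bilip_action X d n J q r \<psi> L G S \<alpha>"
    using atlas G act
    by (intro bilip_action.intro fg_group.intro fg_group_axioms.intro bilip_action_axioms.intro)
      (auto simp: isometric_action_def)
  interpret bilip_action X d n J q r \<psi> L G S \<alpha> by (rule ba)
  obtain \<mu> Z where \<mu>: "riemannian_volume M \<mu>" and Z: "Z \<in> null_sets \<mu>" "{x \<in> X. stabilizer G \<alpha> x \<noteq> {\<one>\<^bsub>G\<^esub>}} \<subseteq> Z"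
    using ef unfolding essentially_free_def by blast
  have "bilip_ess_free X d n J q r \<psi> L G S \<alpha>"
  proof (intro bilip_ess_free.intro ba bilip_ess_free_axioms.intro)
    fix j g assume j: "j \<in> J" and g: "g \<in> carrier G" "g \<noteq> \<one>\<^bsub>G\<^esub>"
    let ?E = "{v \<in> coord_ball n (q j) (2 * r j). \<alpha> g (\<psi> j v) = \<psi> j v}"
    have "closed ?E" using closed_slow[OF j g(1), of 0] slow_0[OF j g(1)] by simp
    then have "compact (coord_ball n (q j) (2 * r j) \<inter> ?E)" by (intro compact_Int_closed compact_coord_ball)
    moreover have "coord_ball n (q j) (2 * r j) \<inter> ?E = ?E" by blast
    ultimately have "compact ?E" by simp
    moreover have "\<psi> j ` ?E \<subseteq> Z"
    proof
      fix x assume "x \<in> \<psi> j ` ?E"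
      then obtain v where v: "v \<in> coord_ball n (q j) (2 * r j)" "\<alpha> g (\<psi> j v) = \<psi> j v" "x = \<psi> j v" by blast
      then have "g \<in> stabilizer G \<alpha> x" using g by (simp add: stabilizer_def)
      then show "x \<in> Z" using Z(2) g psi_X[OF j v(1)] v(3) by auto
    qed
    ultimately show "emeasure (Euclidean_lebesgue n) ?E = 0" using nul[OF j \<mu> Z(1), of ?E] by blast
  qed
  then show ?thesis by (rule that)
qed

section \<open>Good points that are mapped to good points\<close>

lemma control_functionD:
  assumes "control_function \<rho>"
  shows "\<And>r. 0 \<le> r \<Longrightarrow> 0 \<le> \<rho> r" "\<And>r s. 0 \<le> r \<Longrightarrow> r \<le> s \<Longrightarrow> \<rho> r \<le> \<rho> s"
    "\<And>c. \<exists>b\<ge>0. \<forall>r\<ge>0. \<rho> r \<le> c \<longrightarrow> r \<le> b"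
proof -
  show "\<And>r. 0 \<le> r \<Longrightarrow> 0 \<le> \<rho> r" "\<And>r s. 0 \<le> r \<Longrightarrow> r \<le> s \<Longrightarrow> \<rho> r \<le> \<rho> s"
    using assms by (auto simp: control_function_def mono_on_def)
  fix c
  obtain b where b: "b \<ge> 0" "\<rho> b > c"
    using assms unfolding control_function_def bdd_above_def by (auto simp: not_le)
  have "r \<le> b" if "r \<ge> 0" "\<rho> r \<le> c" for r
  proof (rule ccontr)
    assume "\<not> r \<le> b"
    then have "\<rho> b \<le> \<rho> r" using assms b that by (auto simp: control_function_def mono_on_def)
    then show False using b that by linarith
  qed
  then show "\<exists>b\<ge>0. \<forall>r\<ge>0. \<rho> r \<le> c \<longrightarrow> r \<le> b" using b by blast
qed

locale bilip_pair = A: bilip_ess_free X d n J p r \<psi> L G S \<alpha> + B: bilip_ess_free X' d' n' J' p' r' \<psi>' L' G' S' \<alpha>'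
  for X :: "'x set" and d n and J :: "'j set" and p r \<psi> L and G :: "('g, 'c) monoid_scheme" and S
    and \<alpha> :: "'g \<Rightarrow> 'x \<Rightarrow> 'x"
    and X' :: "'y set" and d' n' and J' :: "'k set" and p' r' \<psi>' L' and G' :: "('h, 'e) monoid_scheme" and S'
    and \<alpha>' :: "'h \<Rightarrow> 'y \<Rightarrow> 'y"
begin

text \<open>
  Up to constants, coarse surjectivity bounds \<open>s k ^ n'\<close> by \<open>t k ^ n\<close>. If all points of a good ball were
  mapped to bad points, then \<open>t k ^ n\<close> would in turn be bounded by the number of bad cells, which is
  \<open>o(s k ^ n')\<close> because the bad points shrink to a null set.
\<close>

lemma common_good_point:
  fixes t s :: "nat \<Rightarrow> real" and \<delta> \<delta>' f and R :: real
  assumes t: "filterlim t at_top sequentially" and s: "filterlim s at_top sequentially"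
    and w: "\<And>k. A.warped (t k) (\<delta> k)" and w': "\<And>k. B.warped (s k) (\<delta>' k)"
    and f: "\<And>k x. x \<in> X \<Longrightarrow> f k x \<in> X'"
    and ctl: "control_function \<rho>l" "control_function \<rho>u"
    and fl: "\<And>k x y. x \<in> X \<Longrightarrow> y \<in> X \<Longrightarrow> \<rho>l (\<delta> k x y) \<le> \<delta>' k (f k x) (f k y)"
    and fu: "\<And>k x y. x \<in> X \<Longrightarrow> y \<in> X \<Longrightarrow> \<delta>' k (f k x) (f k y) \<le> \<rho>u (\<delta> k x y)"
    and onto: "\<And>k y. y \<in> X' \<Longrightarrow> \<exists>x\<in>X. \<delta>' k y (f k x) \<le> C"
  shows "\<exists>k x. x \<in> X \<and> R \<le> t k \<and> R \<le> s k \<and> A.good (t k) R x \<and> B.good (s k) R (f k x)"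
proof (rule ccontr)
  assume neg: "\<not> ?thesis"
  \<comment> \<open>Two points whose images share a cell are at distance at most \<open>B1\<close>,
    by \<open>key_close\<close> and the lower control.\<close>
  obtain B1 where B1: "B1 \<ge> 0" "\<And>a. a \<ge> 0 \<Longrightarrow> \<rho>l a \<le> L' * n' \<Longrightarrow> a \<le> B1"
    using control_functionD(3)[OF ctl(1)] by metis
  \<comment> \<open>Two points whose chosen preimages share a cell are at distance at most
    \<open>B2\<close>: \<open>C\<close> for each replacement of a point by an image, and
    \<open>\<rho>u (L * n)\<close> between the images.\<close>
  define B2 where "B2 = 2 * \<bar>C\<bar> + \<rho>u (L * n)"
  have Ln: "0 \<le> L * n" using A.L1 by simp
  have B2: "B2 \<ge> 0" unfolding B2_def using control_functionD(1)[OF ctl(2) Ln] by simp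
  \<comment> \<open>Bounds for the multiplicities of the two counts; the 1 keeps them positive for
    the division in \<open>\<eta>\<close>.\<close>
  define N1 where "N1 = real (card {g \<in> carrier G. real (A.wl g) \<le> B1 + 1}) + 1"
  define N2 where "N2 = real (card {g \<in> carrier G'. real (B.wl g) \<le> B2 + 1}) + 1"
  have N: "N1 > 0" "N2 > 0" by (auto simp: N1_def N2_def add_nonneg_pos)
  obtain C1 t1 :: real where C1: "C1 > 0" and "t1 > 0"
    and keys: "\<And>t. t \<ge> t1 \<Longrightarrow> finite (A.key t ` X) \<and> real (card (A.key t ` X)) \<le> C1 * t ^ n"
    by (rule A.keys_all, rule that)
  obtain j v0 \<rho> t2 where j: "j \<in> J" "\<rho> > 0" "v0 \<in> coord_ball n (p j) (2 * r j)" "coord_ball n v0 \<rho> \<subseteq> coord_ball n (p j) (2 * r j)"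
    and "t2 > 0" and good: "\<And>t x. t \<ge> t2 \<Longrightarrow> x \<in> \<psi> j ` coord_ball n v0 \<rho> \<Longrightarrow> A.good t R x"
    by (rule A.good_ball[where R = R], rule that)
  obtain j' v0' \<rho>' where j': "j' \<in> J'" "\<rho>' > 0" "v0' \<in> coord_ball n' (p' j') (2 * r' j')" "coord_ball n' v0' \<rho>' \<subseteq> coord_ball n' (p' j') (2 * r' j')"
    by (rule B.good_ball[where R = R], rule that)
  define b1 b2 where "b1 = 2 * (B1 + 1)" and "b2 = 2 * (B2 + 1)"
  have b: "b1 \<ge> 0" "b2 \<ge> 0" using B1 B2 by (auto simp: b1_def b2_def)
  \<comment> \<open>\<open>c1\<close> and \<open>c2\<close> are the densities that
    \<open>packing\<close> yields for the separations \<open>b1\<close> and \<open>b2\<close>, which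
    \<open>multiplicity\<close> requires for \<open>B1\<close> and \<open>B2\<close>.\<close>
  define c1 where "c1 = \<rho> / ((L * b1 + 1) * (real n + 1))"
  define c2 where "c2 = \<rho>' / ((L' * b2 + 1) * (real n' + 1))"
  have c: "c1 > 0" "c2 > 0"
    unfolding c1_def c2_def using j j' b A.L1 B.L1 by (auto intro!: divide_pos_pos mult_pos_pos add_nonneg_pos mult_nonneg_nonneg)
  \<comment> \<open>Chosen so that \<open>upper\<close> and \<open>lower\<close> together bound
    \<open>c1 ^ n * c2 ^ n' * t k ^ n\<close> by half of itself.\<close>
  define \<eta> where "\<eta> = c1 ^ n * c2 ^ n' / (2 * N1 * N2 * C1)"
  have \<eta>: "\<eta> > 0" using c N C1 by (simp add: \<eta>_def)
  obtain t3 :: real where "t3 > 0" and bad: "\<And>t. t \<ge> t3 \<Longrightarrow> finite (B.key t ` {x \<in> X'. \<not> B.good t R x}) \<and>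
     real (card (B.key t ` {x \<in> X'. \<not> B.good t R x})) \<le> \<eta> * t ^ n'"
    by (rule B.bad_keys[OF \<eta>, where R = R], rule that)
  have "\<forall>\<^sub>F k in sequentially. t k \<ge> max (max t1 t2) (max R 1)" using t unfolding filterlim_at_top by blast
  moreover have "\<forall>\<^sub>F k in sequentially. s k \<ge> max t3 (max R 1)" using s unfolding filterlim_at_top by blast
  ultimately have "\<forall>\<^sub>F k in sequentially. t k \<ge> max (max t1 t2) (max R 1) \<and> s k \<ge> max t3 (max R 1)"
    by (rule eventually_conj)
  then obtain k where k: "t k \<ge> max (max t1 t2) (max R 1)" "s k \<ge> max t3 (max R 1)"
    using eventually_happens by fastforce
  then have t0: "t k > 0" "s k > 0" by auto
  interpret MA: Metric_space X "\<delta> k" using A.warped_metric[OF w] .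
  interpret MB: Metric_space X' "\<delta>' k" using B.warped_metric[OF w'] .
  \<comment> \<open>A packing of the target is pulled back by approximate preimages; each cell of
    the source receives at most \<open>N2\<close> of its points.\<close>
  have upper: "c2 ^ n' * s k ^ n' \<le> N2 * (C1 * t k ^ n)"
  proof -
    obtain Q where Q: "finite Q" "Q \<subseteq> \<psi>' j' ` coord_ball n' v0' \<rho>'" "(c2 * s k) ^ n' \<le> real (card Q)"
      "\<And>x y. x \<in> Q \<Longrightarrow> y \<in> Q \<Longrightarrow> x \<noteq> y \<Longrightarrow> B.D x y > b2 / s k"
      using B.packing[OF j'(1,3,2,4) b(2) t0(2)] unfolding c2_def by blast
    have QX: "Q \<subseteq> X'" using Q(2) B.psi_X[OF j'(1)] j'(4) by blast
    have "\<forall>y\<in>Q. \<exists>x. x \<in> X \<and> \<delta>' k y (f k x) \<le> C"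
    proof
      fix y assume "y \<in> Q"
      then have "y \<in> X'" using QX by blast
      from onto[OF this, of k] show "\<exists>x. x \<in> X \<and> \<delta>' k y (f k x) \<le> C" by blast
    qed
    from bchoice[OF this] obtain g where g: "\<And>y. y \<in> Q \<Longrightarrow> g y \<in> X \<and> \<delta>' k y (f k (g y)) \<le> C" by blast
    have "card Q \<le> card {g \<in> carrier G'. real (B.wl g) \<le> B2 + 1} * card (A.key (t k) ` X)"
    proof (rule card_le_fibres[where f = "\<lambda>y. A.key (t k) (g y)"])
      fix z
      show "card {y \<in> Q. A.key (t k) (g y) = z} \<le> card {g \<in> carrier G'. real (B.wl g) \<le> B2 + 1}"
      proof (rule B.multiplicity[OF w' t0(2) Q(1) QX])
        fix y y' assume y: "y \<in> {y \<in> Q. A.key (t k) (g y) = z}" "y' \<in> {y \<in> Q. A.key (t k) (g y) = z}"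
        then have gg: "g y \<in> X" "g y' \<in> X" "y \<in> X'" "y' \<in> X'" using g QX by auto
        have "\<delta> k (g y) (g y') \<le> L * n" using y gg by (intro A.key_close[OF w t0(1)]) auto
        then have 1: "\<delta>' k (f k (g y)) (f k (g y')) \<le> \<rho>u (L * n)"
          using fu[OF gg(1,2), of k] control_functionD(2)[OF ctl(2), of "\<delta> k (g y) (g y')" "L * n"] by simp
        have "\<delta>' k y y' \<le> \<delta>' k y (f k (g y)) + \<delta>' k (f k (g y)) y'"
          using gg f by (intro MB.triangle) auto
        also have "\<dots> \<le> \<delta>' k y (f k (g y)) + (\<delta>' k (f k (g y)) (f k (g y')) + \<delta>' k (f k (g y')) y')"
          using gg f by (intro add_left_mono MB.triangle) auto
        also have "\<dots> \<le> B2"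
        proof -
          have "\<delta>' k y (f k (g y)) \<le> \<bar>C\<bar>" "\<delta>' k (f k (g y')) y' \<le> \<bar>C\<bar>"
            using g[of y] g[of y'] y MB.commute[of y' "f k (g y')"] by auto
          then show ?thesis using 1 unfolding B2_def by linarith
        qed
        finally show "\<delta>' k y y' \<le> B2" .
      qed (use Q(4) in \<open>auto simp: b2_def\<close>)
    qed (use keys[of "t k"] k g Q(1) in auto)
    then have "real (card Q) \<le> N2 * card (A.key (t k) ` X)"
      unfolding N2_def using of_nat_mono[of "card Q" _, where 'a = real] by (fastforce simp: algebra_simps)
    also have "\<dots> \<le> N2 * (C1 * t k ^ n)" using keys[of "t k"] k N by (intro mult_left_mono) auto
    finally show ?thesis using Q(3) by (simp add: power_mult_distrib)
  qed
  \<comment> \<open>A packing of the good ball is pushed forward by \<open>f\<close>. By the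
    assumption to be refuted it lands in bad points, whose cells are few.\<close>
  have lower: "c1 ^ n * t k ^ n \<le> N1 * (\<eta> * s k ^ n')"
  proof -
    obtain Q where Q: "finite Q" "Q \<subseteq> \<psi> j ` coord_ball n v0 \<rho>" "(c1 * t k) ^ n \<le> real (card Q)"
      "\<And>x y. x \<in> Q \<Longrightarrow> y \<in> Q \<Longrightarrow> x \<noteq> y \<Longrightarrow> A.D x y > b1 / t k"
      using A.packing[OF j(1,3,2,4) b(1) t0(1)] unfolding c1_def by blast
    have QX: "Q \<subseteq> X" using Q(2) A.psi_X[OF j(1)] j(4) by blast
    let ?bad = "{x \<in> X'. \<not> B.good (s k) R x}"
    have "card Q \<le> card {g \<in> carrier G. real (A.wl g) \<le> B1 + 1} * card (B.key (s k) ` ?bad)"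
    proof (rule card_le_fibres[where f = "\<lambda>x. B.key (s k) (f k x)"])
      show "(\<lambda>x. B.key (s k) (f k x)) ` Q \<subseteq> B.key (s k) ` ?bad"
      proof (rule image_subsetI, rule imageI)
        fix x assume x: "x \<in> Q"
        then have "A.good (t k) R x" using good[of "t k" x] Q(2) k by auto
        then show "f k x \<in> ?bad" using neg f[of x k] QX x k by auto
      qed
      fix z
      show "card {x \<in> Q. B.key (s k) (f k x) = z} \<le> card {g \<in> carrier G. real (A.wl g) \<le> B1 + 1}"
      proof (rule A.multiplicity[OF w t0(1) Q(1) QX])
        fix x y assume xy: "x \<in> {x \<in> Q. B.key (s k) (f k x) = z}" "y \<in> {x \<in> Q. B.key (s k) (f k x) = z}"
        then have X: "x \<in> X" "y \<in> X" using QX by auto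
        have "\<delta>' k (f k x) (f k y) \<le> L' * n'" using xy X f by (intro B.key_close[OF w' t0(2)]) auto
        then show "\<delta> k x y \<le> B1" using fl[OF X, of k] by (intro B1(2)) auto
      qed (use Q(4) in \<open>auto simp: b1_def\<close>)
    qed (use bad[of "s k"] k Q(1) in auto)
    then have "real (card Q) \<le> N1 * card (B.key (s k) ` ?bad)"
      unfolding N1_def using of_nat_mono[of "card Q" _, where 'a = real] by (fastforce simp: algebra_simps)
    also have "\<dots> \<le> N1 * (\<eta> * s k ^ n')" using bad[of "s k"] k N by (intro mult_left_mono) auto
    finally show ?thesis using Q(3) by (simp add: power_mult_distrib)
  qed
  have "c2 ^ n' * (c1 ^ n * t k ^ n) \<le> c2 ^ n' * (N1 * (\<eta> * s k ^ n'))"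
    using lower c by (intro mult_left_mono) auto
  also have "\<dots> = N1 * \<eta> * (c2 ^ n' * s k ^ n')" by simp
  also have "\<dots> \<le> N1 * \<eta> * (N2 * (C1 * t k ^ n))" using upper N \<eta> by (intro mult_left_mono) auto
  also have "\<dots> = (N1 * N2 * C1 * \<eta>) * t k ^ n" by simp
  also have "N1 * N2 * C1 * \<eta> = c1 ^ n * c2 ^ n' / 2" using N C1 by (simp add: \<eta>_def)
  finally have "(c1 ^ n * c2 ^ n') * t k ^ n \<le> (c1 ^ n * c2 ^ n' / 2) * t k ^ n" by (simp add: mult_ac)
  moreover have "(c1 ^ n * c2 ^ n' / 2) * t k ^ n < (c1 ^ n * c2 ^ n') * t k ^ n"
    using c t0 by (intro mult_strict_right_mono) auto
  ultimately show False by linarith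
qed

end

section \<open>Cayley graphs of quotient groups\<close>

text \<open>By the triangle inequality a shift of the centre by \<open>C\<close> only enlarges the
  constant: \<open>A * (1 + C)\<close> pays for the covering clause and \<open>A + C\<close> for the
  image of the unit.\<close>

lemma local_model_recentre:
  assumes lm: "local_model G S A r X d p \<psi>" and m: "Metric_space X d" and p: "p \<in> X" "p' \<in> X" "d p p' \<le> C"
    and A: "A \<ge> 1" and r: "r \<ge> 0" and one: "\<psi> \<one>\<^bsub>G\<^esub> \<in> X"
    and A': "A' \<ge> A * (1 + C)" "A' \<ge> A + C" "C \<ge> 0"
  shows "local_model G S A' r X d p' \<psi>"
proof -
  interpret Metric_space X d by fact
  note D = local_modelD[OF lm]
  have AC: "A \<le> A * (1 + C)" using A A' by (simp add: distrib_left)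
  then have AA: "A \<le> A'" using A' by linarith
  have up: "A * a + A \<le> A' * a + A'" if "a \<ge> 0" for a
    using mult_right_mono[OF AA that] AA by linarith
  show ?thesis
    unfolding local_model_def
  proof (intro conjI ballI impI)
    show "\<psi> g \<in> X" if "g \<in> carrier G" "real (word_length G S g) \<le> r" for g using D(1) that .
    have "d p' (\<psi> \<one>\<^bsub>G\<^esub>) \<le> d p' p + d p (\<psi> \<one>\<^bsub>G\<^esub>)" using p one by (intro triangle)
    then show "d p' (\<psi> \<one>\<^bsub>G\<^esub>) \<le> A'" using D(2) p(3) A' commute[of p p'] by linarith
    fix g h assume *: "g \<in> carrier G" "h \<in> carrier G" "real (word_length G S g) \<le> r" "real (word_length G S h) \<le> r"
    show "d (\<psi> g) (\<psi> h) \<le> A' * word_metric G S g h + A'"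
      using D(3)[OF *] up[of "word_metric G S g h"] by (simp add: word_metric_def)
    show "word_metric G S g h \<le> A' * d (\<psi> g) (\<psi> h) + A'"
      using D(4)[OF *] up[of "d (\<psi> g) (\<psi> h)"] by simp
  next
    fix x assume x: "x \<in> X" "A' * d p' x + A' \<le> r"
    have "d p x \<le> C + d p' x" using triangle[of p p' x] p x by linarith
    then have "A * d p x + A \<le> A * (C + d p' x) + A" using A by (intro add_right_mono mult_left_mono) auto
    also have "\<dots> = A * (1 + C) + A * d p' x" by (simp add: algebra_simps)
    also have "\<dots> \<le> A' * d p' x + A'" using A' mult_right_mono[OF AA, of "d p' x"] by simp
    also have "\<dots> \<le> r" by (rule x(2))
    finally obtain g where "g \<in> carrier G" "real (word_length G S g) \<le> r" "d x (\<psi> g) \<le> A" using D(5)[OF x(1)] by blast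
    then show "\<exists>g\<in>carrier G. real (word_length G S g) \<le> r \<and> d x (\<psi> g) \<le> A'" using AA by force
  qed
qed

text \<open>Allows the two models to be used with a common constant.\<close>

lemma local_model_mono:
  assumes lm: "local_model G S A r X d p \<psi>" and m: "Metric_space X d" and AA: "A \<le> A'"
  shows "local_model G S A' r X d p \<psi>"
proof -
  interpret Metric_space X d by fact
  note D = local_modelD[OF lm]
  have up: "A * a + A \<le> A' * a + A'" if "a \<ge> 0" for a
    using mult_right_mono[OF AA that] AA by linarith
  show ?thesis
    unfolding local_model_def
  proof (intro conjI ballI impI)
    show "\<psi> g \<in> X" if "g \<in> carrier G" "real (word_length G S g) \<le> r" for g using D(1) that .
    show "d p (\<psi> \<one>\<^bsub>G\<^esub>) \<le> A'" using D(2) AA by linarith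
    fix g h assume *: "g \<in> carrier G" "h \<in> carrier G" "real (word_length G S g) \<le> r" "real (word_length G S h) \<le> r"
    show "d (\<psi> g) (\<psi> h) \<le> A' * word_metric G S g h + A'"
      using D(3)[OF *] up[of "word_metric G S g h"] by (simp add: word_metric_def)
    show "word_metric G S g h \<le> A' * d (\<psi> g) (\<psi> h) + A'"
      using D(4)[OF *] up[of "d (\<psi> g) (\<psi> h)"] by simp
  next
    fix x assume x: "x \<in> X" "A' * d p x + A' \<le> r"
    have "A * d p x + A \<le> r" using x up[of "d p x"] by simp
    then obtain g where "g \<in> carrier G" "real (word_length G S g) \<le> r" "d x (\<psi> g) \<le> A" using D(5)[OF x(1)] by blast
    then show "\<exists>g\<in>carrier G. real (word_length G S g) \<le> r \<and> d x (\<psi> g) \<le> A'" using AA by force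
  qed
qed

context fg_group
begin

lemma wl_change_gens:
  assumes "finite_generating_set G T"
  obtains C :: real where "C \<ge> 1" "\<And>g. g \<in> carrier G \<Longrightarrow> real (word_length G T g) \<le> C * real (wl g)"
proof -
  interpret T: fg_group G T by unfold_locales fact
  define C where "C = Max (insert 1 ((\<lambda>g. real (T.wl g)) ` symmetrization G S))"
  have "real (T.wl g) \<le> C * wl g" if "g \<in> carrier G" for g
    by (rule wl_bound[of "\<lambda>g. real (T.wl g)"])
      (use that T.wl_mult finite_sym in \<open>auto simp: C_def simp flip: of_nat_add intro!: Max_ge\<close>)
  moreover have "C \<ge> 1" using finite_sym by (auto simp: C_def)
  ultimately show ?thesis using that by blast
qed

end

section \<open>Lifting paths from quotient graphs to the group\<close>

locale cayley_quotient = fg_group +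
  fixes N
  assumes normal: "N \<lhd> G"
begin

definition E where "E = cayley_edges (G Mod N) ((\<lambda>g. N #> g) ` S)"

lemma coset_mult: "a \<in> carrier G \<Longrightarrow> b \<in> carrier G \<Longrightarrow> (N #> a) \<otimes>\<^bsub>G Mod N\<^esub> (N #> b) = N #> (a \<otimes> b)"
  using normal.rcos_sum[OF normal] by (simp add: FactGroup_def)

lemma carrier_Mod: "carrier (G Mod N) = (\<lambda>g. N #> g) ` carrier G"
  by (auto simp: FactGroup_def RCOSETS_def)

lemma coset_eq_iff:
  assumes "a \<in> carrier G" "b \<in> carrier G"
  shows "N #> a = N #> b \<longleftrightarrow> a \<otimes> inv b \<in> N"
proof -
  have sub: "subgroup N G" using normal by (simp add: normal_def)
  show ?thesis
  proof
    assume "N #> a = N #> b"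
    then have "a \<in> N #> b" using rcos_self[OF assms(1) sub] by simp
    then obtain h where h: "h \<in> N" "a = h \<otimes> b" by (auto simp: r_coset_def)
    then have "a \<otimes> inv b = h" using assms subgroup.mem_carrier[OF sub h(1)] by (simp add: m_assoc)
    then show "a \<otimes> inv b \<in> N" using h by simp
  next
    assume h: "a \<otimes> inv b \<in> N"
    have "a = (a \<otimes> inv b) \<otimes> b" using assms by (simp add: m_assoc)
    then have "a \<in> N #> b" using h unfolding r_coset_def by blast
    then show "N #> a = N #> b" using repr_independence[OF _ assms(2) sub] by metis
  qed
qed

lemma path_of_word:
  assumes "g \<in> carrier G" "set w \<subseteq> symmetrization G S"
  shows "(N #> g, N #> (g \<otimes> word_prod G w)) \<in> E ^^ length w"
  using assms
proof (induction w arbitrary: g)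
  case Nil then show ?case by simp
next
  case (Cons a w)
  have a: "a \<in> carrier G" "word_prod G w \<in> carrier G"
    using Cons.prems sym_carrier word_prod_closed[OF is_group, of w] by auto
  have "(N #> g, N #> (g \<otimes> a)) \<in> E"
  proof (cases "a \<in> S")
    case True
    then show ?thesis using Cons.prems(1) a coset_mult[of g a]
      by (auto simp: E_def cayley_edges_def carrier_Mod)
  next
    case False
    then obtain s where s: "s \<in> S" "a = inv s" using Cons.prems(2) by (auto simp: symmetrization_def)
    then have sc: "s \<in> carrier G" using S_carrier by blast
    have "N #> g = (N #> (g \<otimes> a)) \<otimes>\<^bsub>G Mod N\<^esub> (N #> s)"
      using Cons.prems(1) a sc s(2) by (subst coset_mult) (auto simp: m_assoc)
    then show ?thesis using Cons.prems(1) a s(1) by (auto simp: E_def cayley_edges_def carrier_Mod)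
  qed
  moreover have "(N #> (g \<otimes> a), N #> ((g \<otimes> a) \<otimes> word_prod G w)) \<in> E ^^ length w"
    using Cons.prems a by (intro Cons.IH) auto
  ultimately have "(N #> g, N #> ((g \<otimes> a) \<otimes> word_prod G w)) \<in> E ^^ Suc (length w)"
    by (rule relpow_Suc_I2)
  then show ?case using Cons.prems(1) a by (simp add: m_assoc)
qed

text \<open>An edge of the quotient graph is right multiplication by the coset of a generator or of
  its inverse, so a path lifts letter by letter from any representative of its start.\<close>

lemma word_of_path:
  assumes "g \<in> carrier G" "(N #> g, y) \<in> E ^^ m"
  shows "\<exists>h\<in>carrier G. wl h \<le> m \<and> y = N #> (g \<otimes> h)"
  using assms(2)
proof (induction m arbitrary: y)
  case 0
  then show ?case using assms(1) by (intro bexI[of _ \<one>]) auto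
next
  case (Suc m)
  then obtain z where z: "(N #> g, z) \<in> E ^^ m" "(z, y) \<in> E" by auto
  then obtain h where h: "h \<in> carrier G" "wl h \<le> m" "z = N #> (g \<otimes> h)" using Suc.IH by blast
  obtain s where s: "s \<in> S" "y = z \<otimes>\<^bsub>G Mod N\<^esub> (N #> s) \<or> z = y \<otimes>\<^bsub>G Mod N\<^esub> (N #> s)" and yc: "y \<in> carrier (G Mod N)"
    using z(2) by (auto simp: E_def cayley_edges_def)
  have sc: "s \<in> carrier G" using s S_carrier by blast
  have "\<exists>a\<in>symmetrization G S. y = N #> ((g \<otimes> h) \<otimes> a)"
    using s(2)
  proof
    assume "y = z \<otimes>\<^bsub>G Mod N\<^esub> (N #> s)"
    then have "y = N #> ((g \<otimes> h) \<otimes> s)" using coset_mult[of "g \<otimes> h" s] h sc assms(1) by simp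
    then show ?thesis using s(1) by (auto simp: symmetrization_def)
  next
    assume zy: "z = y \<otimes>\<^bsub>G Mod N\<^esub> (N #> s)"
    obtain b where b: "b \<in> carrier G" "y = N #> b" using yc by (auto simp: carrier_Mod)
    then have "N #> (g \<otimes> h) = N #> (b \<otimes> s)" using zy h coset_mult[OF b(1) sc] by simp
    then have "(N #> (g \<otimes> h)) \<otimes>\<^bsub>G Mod N\<^esub> (N #> inv s) = (N #> (b \<otimes> s)) \<otimes>\<^bsub>G Mod N\<^esub> (N #> inv s)" by simp
    then have "N #> ((g \<otimes> h) \<otimes> inv s) = N #> b"
      using assms(1) h b sc coset_mult[of "g \<otimes> h" "inv s"] coset_mult[of "b \<otimes> s" "inv s"] by (simp add: m_assoc)
    then show ?thesis using s(1) b by (auto simp: symmetrization_def)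
  qed
  then obtain a where a: "a \<in> symmetrization G S" "y = N #> ((g \<otimes> h) \<otimes> a)" by blast
  have ac: "a \<in> carrier G" using a sym_carrier by blast
  have "wl (h \<otimes> a) \<le> Suc m" using wl_mult[OF h(1) ac] wl_gen[OF a(1)] h(2) by simp
  then show ?case using a h ac assms(1) by (intro bexI[of _ "h \<otimes> a"]) (auto simp: m_assoc)
qed

lemma graph_dist_le:
  assumes "g \<in> carrier G" "h \<in> carrier G"
  shows "graph_dist E (N #> g) (N #> (g \<otimes> h)) \<le> wl h"
proof -
  obtain w where w: "length w = wl h" "set w \<subseteq> symmetrization G S" "word_prod G w = h" by (rule wl_word[OF assms(2)])
  then have "(N #> g, N #> (g \<otimes> h)) \<in> E ^^ wl h" using path_of_word[OF assms(1) w(2)] by simp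
  then show ?thesis unfolding graph_dist_def by (simp add: Least_le)
qed

lemma connected:
  assumes "x \<in> carrier (G Mod N)" "y \<in> carrier (G Mod N)"
  shows "(x, y) \<in> E ^^ (LEAST n. (x, y) \<in> E ^^ n)"
proof -
  obtain a b where ab: "a \<in> carrier G" "b \<in> carrier G" "x = N #> a" "y = N #> b" using assms by (auto simp: carrier_Mod)
  obtain w where w: "length w = wl (inv a \<otimes> b)" "set w \<subseteq> symmetrization G S" "word_prod G w = inv a \<otimes> b"
    using wl_word[of "inv a \<otimes> b"] ab by blast
  have "a \<otimes> (inv a \<otimes> b) = b" using ab by (simp flip: m_assoc)
  then have "(x, y) \<in> E ^^ length w" using path_of_word[OF ab(1) w(2)] w(3) ab by simp
  then show ?thesis by (rule LeastI)
qed

lemma graph_dist_word: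
  assumes "g \<in> carrier G" "y \<in> carrier (G Mod N)"
  shows "\<exists>h\<in>carrier G. wl h \<le> graph_dist E (N #> g) y \<and> y = N #> (g \<otimes> h)"
  using word_of_path[OF assms(1) connected[of "N #> g" y]] assms by (auto simp: graph_dist_def carrier_Mod)

lemma Metric_cayley: "Metric_space (carrier (G Mod N)) (graph_dist E)"
proof
  have sE: "(y, x) \<in> E" if "(x, y) \<in> E" for x y
    using that by (auto simp: E_def cayley_edges_def)
  have "(y, x) \<in> E ^^ m" if "(x, y) \<in> E ^^ m" for x y m
    using that
  proof (induction m arbitrary: y)
    case (Suc m)
    then obtain z where "(x, z) \<in> E ^^ m" "(z, y) \<in> E" by auto
    then show ?case using Suc.IH sE relpow_Suc_I2 by metis
  qed simp
  then have symE: "(x, y) \<in> E ^^ m \<longleftrightarrow> (y, x) \<in> E ^^ m" for x y m by blast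
  show "graph_dist E x y = graph_dist E y x" for x y
    unfolding graph_dist_def using symE[of x y] by simp
  show "graph_dist E x y = 0 \<longleftrightarrow> x = y" if "x \<in> carrier (G Mod N)" "y \<in> carrier (G Mod N)" for x y
  proof
    assume "graph_dist E x y = 0"
    then show "x = y" using connected[OF that] by (simp add: graph_dist_def)
  next
    assume "x = y"
    then have "(LEAST n. (x, y) \<in> E ^^ n) \<le> 0" by (intro Least_le) simp
    then show "graph_dist E x y = 0" by (simp add: graph_dist_def)
  qed
  show "graph_dist E x z \<le> graph_dist E x y + graph_dist E y z"
    if "x \<in> carrier (G Mod N)" "y \<in> carrier (G Mod N)" "z \<in> carrier (G Mod N)" for x y z
  proof -
    have "(x, z) \<in> E ^^ ((LEAST n. (x, y) \<in> E ^^ n) + (LEAST n. (y, z) \<in> E ^^ n))"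
      using connected[OF that(1,2)] connected[OF that(2,3)] by (auto simp: relpow_add)
    then show ?thesis unfolding graph_dist_def by (simp add: Least_le flip: of_nat_add)
  qed
qed (simp add: graph_dist_def)

text \<open>If a shortest path from the coset of \<open>g\<close> to that of \<open>h\<close> lifts
  to \<open>w\<close>, then \<open>h\<close> and \<open>g \<otimes> w\<close> differ by an element
  of \<open>N\<close>, which is short and hence trivial; so the quotient map does not shorten
  distances on the ball. The bound \<open>4 * (C * r)\<close> consists of \<open>C * r\<close> for
  each of \<open>g\<close> and \<open>h\<close> and \<open>2 * (C * r)\<close> for
  \<open>w\<close>.\<close>

lemma cayley_local_model:
  assumes T: "C \<ge> 1" "\<And>g. g \<in> carrier G \<Longrightarrow> real (word_length G T g) \<le> C * real (wl g)"
      "\<And>g. g \<in> carrier G \<Longrightarrow> real (wl g) \<le> C * real (word_length G T g)"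
    and inj: "\<And>g. g \<in> N \<Longrightarrow> real (wl g) \<le> 4 * (C * r) \<Longrightarrow> g = \<one>" and g0: "g0 \<in> carrier G"
  shows "local_model G T C r (carrier (G Mod N)) (graph_dist E) (N #> g0) (\<lambda>h. N #> (g0 \<otimes> h))"
  unfolding local_model_def
proof (intro conjI ballI impI)
  interpret Metric_space "carrier (G Mod N)" "graph_dist E" by (rule Metric_cayley)
  have sub: "subgroup N G" using normal by (simp add: normal_def)
  show c: "N #> (g0 \<otimes> g) \<in> carrier (G Mod N)" if "g \<in> carrier G" for g using that g0 by (auto simp: carrier_Mod)
  have "graph_dist E (N #> g0) (N #> (g0 \<otimes> \<one>)) = 0" using c[of \<one>] g0 zero[of "N #> g0" "N #> g0"] by simp
  then show "graph_dist E (N #> g0) (N #> (g0 \<otimes> \<one>)) \<le> C" using T by simp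
  fix g h assume g: "g \<in> carrier G" and h: "h \<in> carrier G" and gr: "real (word_length G T g) \<le> r" and hr: "real (word_length G T h) \<le> r"
  have gh: "(g0 \<otimes> g) \<otimes> (inv g \<otimes> h) = g0 \<otimes> h" using g h g0 by (metis inv_closed inv_solve_left m_assoc m_closed)
  have "graph_dist E (N #> (g0 \<otimes> g)) (N #> ((g0 \<otimes> g) \<otimes> (inv g \<otimes> h))) \<le> wl (inv g \<otimes> h)"
    using g h g0 by (intro graph_dist_le) auto
  then have up: "graph_dist E (N #> (g0 \<otimes> g)) (N #> (g0 \<otimes> h)) \<le> wl (inv g \<otimes> h)" unfolding gh .
  also have "\<dots> \<le> C * word_metric G T g h" unfolding word_metric_def using g h by (intro T) auto
  finally show "graph_dist E (N #> (g0 \<otimes> g)) (N #> (g0 \<otimes> h)) \<le> C * word_metric G T g h + C" using T by simp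
  obtain w where w: "w \<in> carrier G" "real (wl w) \<le> graph_dist E (N #> (g0 \<otimes> g)) (N #> (g0 \<otimes> h))"
    "N #> (g0 \<otimes> h) = N #> ((g0 \<otimes> g) \<otimes> w)"
    using graph_dist_word[of "g0 \<otimes> g" "N #> (g0 \<otimes> h)"] c[OF h] g g0 by auto
  have Cr: "real (wl g) \<le> C * r" "real (wl h) \<le> C * r"
    using T(3)[OF g] T(3)[OF h] mult_left_mono[OF gr, of C] mult_left_mono[OF hr, of C] T(1) by linarith+
  let ?k = "h \<otimes> inv (g \<otimes> w)"
  have "(g0 \<otimes> h) \<otimes> inv ((g0 \<otimes> g) \<otimes> w) \<in> N"
    using w(3) coset_eq_iff[of "g0 \<otimes> h" "(g0 \<otimes> g) \<otimes> w"] g h g0 w(1) by simp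
  moreover have "(g0 \<otimes> h) \<otimes> inv ((g0 \<otimes> g) \<otimes> w) = g0 \<otimes> ?k \<otimes> inv g0"
    using g h g0 w(1) by (simp add: inv_mult_group m_assoc)
  ultimately have "g0 \<otimes> ?k \<otimes> inv g0 \<in> N" by simp
  \<comment> \<open>\<open>N\<close> is normal, so the translation by \<open>g0\<close> is removed
    by conjugation.\<close>
  then have "inv g0 \<otimes> (g0 \<otimes> ?k \<otimes> inv g0) \<otimes> inv (inv g0) \<in> N"
    using normal.inv_op_closed2[OF normal inv_closed[OF g0]] by blast
  moreover have "inv g0 \<otimes> (g0 \<otimes> ?k \<otimes> inv g0) \<otimes> inv (inv g0) = ?k"
  proof -
    have "?k \<in> carrier G" using g h w by simp
    then show ?thesis using g0 by (metis inv_closed inv_inv l_inv l_one m_assoc m_closed r_one)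
  qed
  ultimately have kN: "?k \<in> N" by simp
  have "wl ?k \<le> wl h + wl (inv (g \<otimes> w))" using g h w by (intro wl_mult) auto
  also have "\<dots> \<le> wl h + (wl g + wl w)" using g w wl_mult[OF g w(1)] by simp
  finally have "real (wl ?k) \<le> real (wl h) + (real (wl g) + real (wl w))" by (simp flip: of_nat_add)
  moreover have "real (wl w) \<le> 2 * (C * r)"
  proof -
    have "wl (inv g \<otimes> h) \<le> wl g + wl h" using wl_mult[of "inv g" h] g h by simp
    then have "real (wl (inv g \<otimes> h)) \<le> real (wl g) + real (wl h)" by (simp flip: of_nat_add)
    then show ?thesis using w(2) up Cr by linarith
  qed
  ultimately have "real (wl ?k) \<le> 4 * (C * r)" using Cr by linarith
  then have k1: "?k = \<one>" using inj[OF kN] by simp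
  have "h = ?k \<otimes> (g \<otimes> w)" using g h w by (simp add: m_assoc)
  then have "h = g \<otimes> w" using k1 g w by simp
  then have "inv g \<otimes> h = w" using g w by (simp flip: m_assoc)
  then have "word_metric G T g h \<le> C * real (wl w)" unfolding word_metric_def using T(2)[OF w(1)] by simp
  also have "\<dots> \<le> C * graph_dist E (N #> (g0 \<otimes> g)) (N #> (g0 \<otimes> h))" using w(2) T(1) by (intro mult_left_mono) auto
  finally show "word_metric G T g h \<le> C * graph_dist E (N #> (g0 \<otimes> g)) (N #> (g0 \<otimes> h)) + C" using T by simp
next
  interpret Metric_space "carrier (G Mod N)" "graph_dist E" by (rule Metric_cayley)
  fix y assume y: "y \<in> carrier (G Mod N)" and le: "C * graph_dist E (N #> g0) y + C \<le> r"
  obtain h where h: "h \<in> carrier G" "real (wl h) \<le> graph_dist E (N #> g0) y" "y = N #> (g0 \<otimes> h)"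
    using graph_dist_word[OF g0 y] by blast
  have "real (word_length G T h) \<le> C * real (wl h)" by (rule T(2)[OF h(1)])
  also have "\<dots> \<le> C * graph_dist E (N #> g0) y" using h T by (intro mult_left_mono) auto
  also have "\<dots> \<le> r" using le T by linarith
  finally show "\<exists>g\<in>carrier G. real (word_length G T g) \<le> r \<and> graph_dist E y (N #> (g0 \<otimes> g)) \<le> C"
    using h y T zero[OF y y] by (intro bexI[of _ h]) auto
qed

end

section \<open>Conclusion\<close>

lemma symmetrization_generates:
  assumes "group G" "finite_generating_set G S"
  shows "finite_generating_set G (symmetrization G S)" "symmetric_set G (symmetrization G S)"
proof -
  interpret fg_group G S by (intro fg_group.intro fg_group_axioms.intro assms)
  have "generate G S \<subseteq> generate G (symmetrization G S)"
    by (rule mono_generate) (auto simp: symmetrization_def)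
  then show "finite_generating_set G (symmetrization G S)"
    using fgs sym_carrier finite_sym generate_incl[OF sym_carrier] by (auto simp: finite_generating_set_def)
  show "symmetric_set G (symmetrization G S)"
    using symmetrization_inv[OF is_group S_carrier] by (simp add: symmetric_set_def)
qed

theorem theorem5p8:
  fixes \<Gamma> :: "('g, 'c) monoid_scheme" and S :: "'g set"
    and M :: "'a riem_mfd" and \<alpha> :: "'g \<Rightarrow> 'a \<Rightarrow> 'a"
    and t :: "nat \<Rightarrow> real" and \<delta>\<Gamma> :: "nat \<Rightarrow> 'a \<Rightarrow> 'a \<Rightarrow> real"
    and \<Lambda> :: "('h, 'd) monoid_scheme" and S' :: "'h set"
  assumes "group \<Gamma>"
    and "finite_generating_set \<Gamma> S" and "symmetric_set \<Gamma> S"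
    and "compact_riemannian_manifold M"
    and "isometric_action \<Gamma> \<alpha> M" and "essentially_free \<Gamma> \<alpha> M"
    and "mono t" and "filterlim t at_top sequentially" and "\<forall>k. t k \<ge> 1"
    and "\<forall>k. warped_level_metric S \<alpha> M (t k) (\<delta>\<Gamma> k)"
    and "group \<Lambda>" and "finite_generating_set \<Lambda> S'"
  shows
    "(\<forall>(N :: 'b riem_mfd) \<beta> (s :: nat \<Rightarrow> real) \<delta>\<Lambda>.
        compact_riemannian_manifold N \<longrightarrow>
        isometric_action \<Lambda> \<beta> N \<longrightarrow> essentially_free \<Lambda> \<beta> N \<longrightarrow>
        mono s \<longrightarrow> filterlim s at_top sequentially \<longrightarrow> (\<forall>k. s k \<ge> 1) \<longrightarrow>
        (\<forall>k. warped_level_metric (symmetrization \<Lambda> S') \<beta> N (s k) (\<delta>\<Lambda> k)) \<longrightarrow>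
        uniformly_coarsely_equivalent
          (\<lambda>_. rm_points M) \<delta>\<Gamma> (\<lambda>_. rm_points N) \<delta>\<Lambda> \<longrightarrow>
        quasi_isometric_groups (\<Lambda> \<times>\<times> Zn (rm_dim N)) (\<Gamma> \<times>\<times> Zn (rm_dim M)))
     \<and>
     (\<forall>L :: nat \<Rightarrow> 'h set.
        (\<forall>k. L k \<lhd> \<Lambda> \<and> finite (carrier (\<Lambda> Mod L k))) \<longrightarrow>
        (\<forall>k. L (Suc k) \<subseteq> L k) \<longrightarrow>
        (\<Inter>k. L k) = {\<one>\<^bsub>\<Lambda>\<^esub>} \<longrightarrow>
        uniformly_coarsely_equivalent
          (\<lambda>k. carrier (\<Lambda> Mod L k))
          (\<lambda>k. graph_dist (cayley_edges (\<Lambda> Mod L k) ((\<lambda>g. L k #>\<^bsub>\<Lambda>\<^esub> g) ` S')))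
          (\<lambda>_. rm_points M) \<delta>\<Gamma> \<longrightarrow>
        quasi_isometric_groups \<Lambda> (\<Gamma> \<times>\<times> Zn (rm_dim M)))"
proof -
  let ?n = "rm_dim M"
  obtain J :: "'a set" and p r \<psi> L where
    A: "bilip_ess_free (rm_points M) (riemannian_dist M) ?n J p r \<psi> L \<Gamma> S \<alpha>"
    using essentially_free_bilip[OF assms(1-6)] .
  interpret A: bilip_ess_free "rm_points M" "riemannian_dist M" ?n J p r \<psi> L \<Gamma> S \<alpha> by (rule A)
  have wA: "A.warped (t k) (\<delta>\<Gamma> k)" for k
    using assms(10) by (simp add: A.warped_def A.admissible_def warped_level_metric_def warped_admissible_def)
  have fgA: "fg_group (\<Gamma> \<times>\<times> Zn ?n) T" if "finite_generating_set (\<Gamma> \<times>\<times> Zn ?n) T" for T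
    using that by (intro fg_group.intro fg_group_axioms.intro A.group_GZ)
  interpret \<Lambda>: fg_group \<Lambda> S' by (intro fg_group.intro fg_group_axioms.intro assms)
  show ?thesis
  proof (intro conjI allI impI)

    \<comment> \<open>Two warped cones\<close>
    fix N :: "'b riem_mfd" and \<beta> and s :: "nat \<Rightarrow> real" and \<delta>\<Lambda>
    assume N: "compact_riemannian_manifold N" "isometric_action \<Lambda> \<beta> N" "essentially_free \<Lambda> \<beta> N"
      and s: "filterlim s at_top sequentially"
      and wN: "\<forall>k. warped_level_metric (symmetrization \<Lambda> S') \<beta> N (s k) (\<delta>\<Lambda> k)"
      and ce: "uniformly_coarsely_equivalent (\<lambda>_. rm_points M) \<delta>\<Gamma> (\<lambda>_. rm_points N) \<delta>\<Lambda>"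
    let ?m = "rm_dim N" and ?S = "symmetrization \<Lambda> S'"
    \<comment> \<open>\<open>S'\<close> need not be symmetric, whereas the locales for actions ask
      for a symmetric generating set.\<close>
    note gens = symmetrization_generates[OF assms(11,12)]
    obtain J' :: "'b set" and p' r' \<psi>' L' where
      B: "bilip_ess_free (rm_points N) (riemannian_dist N) ?m J' p' r' \<psi>' L' \<Lambda> ?S \<beta>"
      using essentially_free_bilip[OF assms(11) gens N] .
    interpret P: bilip_pair "rm_points M" "riemannian_dist M" ?n J p r \<psi> L \<Gamma> S \<alpha>
      "rm_points N" "riemannian_dist N" ?m J' p' r' \<psi>' L' \<Lambda> ?S \<beta>
      by (intro bilip_pair.intro A B)
    have wB: "P.B.warped (s k) (\<delta>\<Lambda> k)" for k
      using wN by (simp add: P.B.warped_def P.B.admissible_def warped_level_metric_def warped_admissible_def)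
    have fgB: "fg_group (\<Lambda> \<times>\<times> Zn ?m) T" if "finite_generating_set (\<Lambda> \<times>\<times> Zn ?m) T" for T
      using that by (intro fg_group.intro fg_group_axioms.intro P.B.group_GZ)
    obtain \<rho>l \<rho>u C f where ctl: "control_function \<rho>l" "control_function \<rho>u" and C: "C > 0"
      and f: "\<forall>k. f k \<in> rm_points M \<rightarrow> rm_points N \<and>
           (\<forall>x\<in>rm_points M. \<forall>x'\<in>rm_points M.
              \<rho>l (\<delta>\<Gamma> k x x') \<le> \<delta>\<Lambda> k (f k x) (f k x') \<and> \<delta>\<Lambda> k (f k x) (f k x') \<le> \<rho>u (\<delta>\<Gamma> k x x')) \<and>
           (\<forall>y\<in>rm_points N. \<exists>x\<in>rm_points M. \<delta>\<Lambda> k y (f k x) \<le> C)"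
      using ce unfolding uniformly_coarsely_equivalent_def by (elim exE conjE) (rule that)
    show "quasi_isometric_groups (\<Lambda> \<times>\<times> Zn ?m) (\<Gamma> \<times>\<times> Zn ?n)"
      unfolding quasi_isometric_groups_def
    proof (intro conjI allI impI)
      show "\<exists>T. finite_generating_set (\<Lambda> \<times>\<times> Zn ?m) T" using P.B.prod_gens_generate by blast
      show "\<exists>T. finite_generating_set (\<Gamma> \<times>\<times> Zn ?n) T" using A.prod_gens_generate by blast
      fix T1 T2 assume T1: "finite_generating_set (\<Lambda> \<times>\<times> Zn ?m) T1" and T2: "finite_generating_set (\<Gamma> \<times>\<times> Zn ?n) T2"
      obtain A1 :: real where A1: "A1 \<ge> 1" and lm1: "\<And>s::real. \<exists>R::real. \<forall>t::real. t \<ge> R \<longrightarrow>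
          (\<forall>\<delta> x. x \<in> rm_points M \<longrightarrow> A.warped t \<delta> \<longrightarrow> A.good t R x \<longrightarrow>
            (\<exists>\<phi>. local_model (\<Gamma> \<times>\<times> Zn ?n) T2 A1 s (rm_points M) \<delta> x \<phi>))"
        using A.local_model_good[OF T2] by blast
      obtain A2 :: real where A2: "A2 \<ge> 1" and lm2: "\<And>s::real. \<exists>R::real. \<forall>t::real. t \<ge> R \<longrightarrow>
          (\<forall>\<delta> x. x \<in> rm_points N \<longrightarrow> P.B.warped t \<delta> \<longrightarrow> P.B.good t R x \<longrightarrow>
            (\<exists>\<phi>. local_model (\<Lambda> \<times>\<times> Zn ?m) T1 A2 s (rm_points N) \<delta> x \<phi>))"
        using P.B.local_model_good[OF T1] by blast
      \<comment> \<open>One constant for both models and for coarse surjectivity.\<close>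
      define A0 where "A0 = max (max A1 A2) C"
      show "quasi_isometric (carrier (\<Lambda> \<times>\<times> Zn ?m)) (word_metric (\<Lambda> \<times>\<times> Zn ?m) T1)
          (carrier (\<Gamma> \<times>\<times> Zn ?n)) (word_metric (\<Gamma> \<times>\<times> Zn ?n) T2)"
      \<comment> \<open>The coarse equivalence runs from \<open>M\<close> to \<open>N\<close>, the
        claim from the product with \<open>\<Lambda>\<close> to the product with
        \<open>\<Gamma>\<close>; hence the second conclusion.\<close>
      proof (rule quasi_isometric_of_local_models(2)[OF fgA[OF T2] fgB[OF T1], of A0 \<rho>l \<rho>u])
        show "A0 \<ge> 1" using A1 by (simp add: A0_def)
        show "control_function \<rho>l" "control_function \<rho>u" by fact+
        fix \<sigma> :: real
        obtain R1 where R1: "\<And>t \<delta> x. t \<ge> R1 \<Longrightarrow> x \<in> rm_points M \<Longrightarrow> A.warped t \<delta> \<Longrightarrow> A.good t R1 x \<Longrightarrow>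
            \<exists>\<phi>. local_model (\<Gamma> \<times>\<times> Zn ?n) T2 A1 \<sigma> (rm_points M) \<delta> x \<phi>" using lm1[of \<sigma>] by blast
        obtain R2 where R2: "\<And>t \<delta> x. t \<ge> R2 \<Longrightarrow> x \<in> rm_points N \<Longrightarrow> P.B.warped t \<delta> \<Longrightarrow> P.B.good t R2 x \<Longrightarrow>
            \<exists>\<phi>. local_model (\<Lambda> \<times>\<times> Zn ?m) T1 A2 \<sigma> (rm_points N) \<delta> x \<phi>" using lm2[of \<sigma>] by blast
        \<comment> \<open>Goodness for the larger threshold gives it for both.\<close>
        have "\<exists>k x. x \<in> rm_points M \<and> max R1 R2 \<le> t k \<and> max R1 R2 \<le> s k \<and>
            A.good (t k) (max R1 R2) x \<and> P.B.good (s k) (max R1 R2) (f k x)"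
          by (rule P.common_good_point[where C = C, OF assms(8) s wA wB _ ctl]) (use f in auto)
        then obtain k x where x: "x \<in> rm_points M" and Rk: "R1 \<le> t k" "R2 \<le> s k"
          and g: "A.good (t k) R1 x" "P.B.good (s k) R2 (f k x)"
          using A.good_mono[of _ "max R1 R2" _ R1] P.B.good_mono[of _ "max R1 R2" _ R2] by auto
        have fx: "f k x \<in> rm_points N" using f x by blast
        obtain \<phi>1 where "local_model (\<Gamma> \<times>\<times> Zn ?n) T2 A1 \<sigma> (rm_points M) (\<delta>\<Gamma> k) x \<phi>1"
          using R1[OF Rk(1) x wA g(1)] by blast
        then have \<phi>1: "local_model (\<Gamma> \<times>\<times> Zn ?n) T2 A0 \<sigma> (rm_points M) (\<delta>\<Gamma> k) x \<phi>1"
          by (rule local_model_mono[OF _ A.warped_metric[OF wA]]) (simp add: A0_def)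
        obtain \<phi>2 where "local_model (\<Lambda> \<times>\<times> Zn ?m) T1 A2 \<sigma> (rm_points N) (\<delta>\<Lambda> k) (f k x) \<phi>2"
          using R2[OF Rk(2) fx wB g(2)] by blast
        then have \<phi>2: "local_model (\<Lambda> \<times>\<times> Zn ?m) T1 A0 \<sigma> (rm_points N) (\<delta>\<Lambda> k) (f k x) \<phi>2"
          by (rule local_model_mono[OF _ P.B.warped_metric[OF wB]]) (simp add: A0_def)
        have onto: "\<forall>y\<in>rm_points N. \<exists>x\<in>rm_points M. \<delta>\<Lambda> k y (f k x) \<le> A0"
          using f unfolding A0_def by (meson max.coboundedI2)
        show "\<exists>(X :: 'a set) dX (Y :: 'b set) dY f p \<psi> \<phi>. Metric_space X dX \<and> Metric_space Y dY \<and> f \<in> X \<rightarrow> Y \<and> p \<in> X \<and>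
           local_model (\<Gamma> \<times>\<times> Zn ?n) T2 A0 \<sigma> X dX p \<psi> \<and> local_model (\<Lambda> \<times>\<times> Zn ?m) T1 A0 \<sigma> Y dY (f p) \<phi> \<and>
           (\<forall>x\<in>X. \<forall>x'\<in>X. \<rho>l (dX x x') \<le> dY (f x) (f x') \<and> dY (f x) (f x') \<le> \<rho>u (dX x x')) \<and>
           (\<forall>y\<in>Y. \<exists>x\<in>X. dY y (f x) \<le> A0)"
          by (rule exI[of _ "rm_points M"], rule exI[of _ "\<delta>\<Gamma> k"], rule exI[of _ "rm_points N"], rule exI[of _ "\<delta>\<Lambda> k"],
              rule exI[of _ "f k"], rule exI[of _ x], rule exI[of _ \<phi>1], rule exI[of _ \<phi>2])
            (use A.warped_metric[OF wA[of k]] P.B.warped_metric[OF wB[of k]] f x \<phi>1 \<phi>2 onto in simp)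
      qed
    qed
  next

    \<comment> \<open>A warped cone and finite quotients\<close>
    fix K :: "nat \<Rightarrow> 'h set"
    assume K: "\<forall>k. K k \<lhd> \<Lambda> \<and> finite (carrier (\<Lambda> Mod K k))" and dec: "\<forall>k. K (Suc k) \<subseteq> K k"
      and int: "(\<Inter>k. K k) = {\<one>\<^bsub>\<Lambda>\<^esub>}"
      and ce: "uniformly_coarsely_equivalent (\<lambda>k. carrier (\<Lambda> Mod K k))
          (\<lambda>k. graph_dist (cayley_edges (\<Lambda> Mod K k) ((\<lambda>g. K k #>\<^bsub>\<Lambda>\<^esub> g) ` S'))) (\<lambda>_. rm_points M) \<delta>\<Gamma>"
    have cq: "cayley_quotient \<Lambda> S' (K k)" for k
      using K by (intro cayley_quotient.intro cayley_quotient_axioms.intro \<Lambda>.fg_group_axioms) auto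
    let ?d = "\<lambda>k. graph_dist (cayley_edges (\<Lambda> Mod K k) ((\<lambda>g. K k #>\<^bsub>\<Lambda>\<^esub> g) ` S'))"
    have dE: "?d k = graph_dist (cayley_quotient.E \<Lambda> S' (K k))" for k
      by (simp add: cayley_quotient.E_def[OF cq])
    obtain \<rho>l \<rho>u C f where ctl: "control_function \<rho>l" "control_function \<rho>u" and C: "C > 0"
      and f: "\<forall>k. f k \<in> carrier (\<Lambda> Mod K k) \<rightarrow> rm_points M \<and>
           (\<forall>x\<in>carrier (\<Lambda> Mod K k). \<forall>x'\<in>carrier (\<Lambda> Mod K k).
              \<rho>l (?d k x x') \<le> \<delta>\<Gamma> k (f k x) (f k x') \<and> \<delta>\<Gamma> k (f k x) (f k x') \<le> \<rho>u (?d k x x')) \<and>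
           (\<forall>y\<in>rm_points M. \<exists>x\<in>carrier (\<Lambda> Mod K k). \<delta>\<Gamma> k y (f k x) \<le> C)"
      using ce unfolding uniformly_coarsely_equivalent_def by (elim exE conjE) (rule that)
    show "quasi_isometric_groups \<Lambda> (\<Gamma> \<times>\<times> Zn ?n)"
      unfolding quasi_isometric_groups_def
    proof (intro conjI allI impI)
      show "\<exists>T. finite_generating_set \<Lambda> T" using assms(12) by blast
      show "\<exists>T. finite_generating_set (\<Gamma> \<times>\<times> Zn ?n) T" using A.prod_gens_generate by blast
      fix T1 T2 assume T1: "finite_generating_set \<Lambda> T1" and T2: "finite_generating_set (\<Gamma> \<times>\<times> Zn ?n) T2"
      have fg1: "fg_group \<Lambda> T1" by (intro fg_group.intro fg_group_axioms.intro assms T1)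
      obtain C1 :: real where C1: "C1 \<ge> 1" "\<And>g. g \<in> carrier \<Lambda> \<Longrightarrow> real (word_length \<Lambda> T1 g) \<le> C1 * real (\<Lambda>.wl g)"
        using \<Lambda>.wl_change_gens[OF T1] by blast
      obtain C2 :: real where C2: "C2 \<ge> 1" "\<And>g. g \<in> carrier \<Lambda> \<Longrightarrow> real (\<Lambda>.wl g) \<le> C2 * real (word_length \<Lambda> T1 g)"
        using fg_group.wl_change_gens[OF fg1 assms(12)] by blast
      define C3 where "C3 = max C1 C2"
      have C3: "C3 \<ge> 1" "\<And>g. g \<in> carrier \<Lambda> \<Longrightarrow> real (word_length \<Lambda> T1 g) \<le> C3 * real (\<Lambda>.wl g)"
        "\<And>g. g \<in> carrier \<Lambda> \<Longrightarrow> real (\<Lambda>.wl g) \<le> C3 * real (word_length \<Lambda> T1 g)"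
      proof -
        show "C3 \<ge> 1" using C1 by (simp add: C3_def)
        show "real (word_length \<Lambda> T1 g) \<le> C3 * real (\<Lambda>.wl g)" if "g \<in> carrier \<Lambda>" for g
          using C1(2)[OF that] mult_right_mono[of C1 C3 "real (\<Lambda>.wl g)"] by (simp add: C3_def)
        show "real (\<Lambda>.wl g) \<le> C3 * real (word_length \<Lambda> T1 g)" if "g \<in> carrier \<Lambda>" for g
          using C2(2)[OF that] mult_right_mono[of C2 C3 "real (word_length \<Lambda> T1 g)"] by (simp add: C3_def)
      qed
      obtain A1 :: real where A1: "A1 \<ge> 1" and lm1: "\<And>s::real. \<exists>R::real. \<forall>t::real. t \<ge> R \<longrightarrow>
          (\<forall>\<delta> x. x \<in> rm_points M \<longrightarrow> A.warped t \<delta> \<longrightarrow> A.good t R x \<longrightarrow>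
            (\<exists>\<phi>. local_model (\<Gamma> \<times>\<times> Zn ?n) T2 A1 s (rm_points M) \<delta> x \<phi>))"
        using A.local_model_good[OF T2] by blast
      \<comment> \<open>The second and third entries are the requirements of
        \<open>local_model_recentre\<close> for a shift by \<open>C\<close>.\<close>
      define A0 where "A0 = Max {C3, A1 * (1 + C), A1 + C, C}"
      have A0: "C3 \<le> A0" "A1 * (1 + C) \<le> A0" "A1 + C \<le> A0" "C \<le> A0" by (simp_all add: A0_def)
      show "quasi_isometric (carrier \<Lambda>) (word_metric \<Lambda> T1) (carrier (\<Gamma> \<times>\<times> Zn ?n)) (word_metric (\<Gamma> \<times>\<times> Zn ?n) T2)"
      proof (rule quasi_isometric_of_local_models(1)[OF fg1 fgA[OF T2], of A0 \<rho>l \<rho>u])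
        show "A0 \<ge> 1" using A0(1) C3(1) by linarith
        show "control_function \<rho>l" "control_function \<rho>u" by fact+
        fix \<sigma> :: real assume \<sigma>: "0 \<le> \<sigma>"
        obtain R1 where R1: "\<And>t \<delta> x. t \<ge> R1 \<Longrightarrow> x \<in> rm_points M \<Longrightarrow> A.warped t \<delta> \<Longrightarrow> A.good t R1 x \<Longrightarrow>
            \<exists>\<phi>. local_model (\<Gamma> \<times>\<times> Zn ?n) T2 A1 \<sigma> (rm_points M) \<delta> x \<phi>" using lm1[of \<sigma>] by blast
        obtain j v0 and \<rho> t2 :: real where j: "j \<in> J" "\<rho> > 0" "v0 \<in> coord_ball ?n (p j) (2 * r j)"
          "coord_ball ?n v0 \<rho> \<subseteq> coord_ball ?n (p j) (2 * r j)" "t2 > 0"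
          and good: "\<And>t x. t \<ge> t2 \<Longrightarrow> x \<in> \<psi> j ` coord_ball ?n v0 \<rho> \<Longrightarrow> A.good t R1 x"
          by (rule A.good_ball[where R = R1], rule that)
        \<comment> \<open>Good at all large levels, so it can be fixed before the level is
          chosen.\<close>
        define x0 where "x0 = \<psi> j v0"
        have x0: "x0 \<in> rm_points M" unfolding x0_def by (rule A.psi_X[OF j(1,3)])
        have x0b: "x0 \<in> \<psi> j ` coord_ball ?n v0 \<rho>" unfolding x0_def using j(2,3) by (auto simp: coord_ball_def)
        \<comment> \<open>The short elements that \<open>cayley_local_model\<close> with radius
          \<open>\<sigma>\<close> wants outside \<open>K k\<close>, apart from the unit. There are
          finitely many of them, so a single level excludes them all.\<close>
        let ?F = "{g \<in> carrier \<Lambda>. \<Lambda>.wl g \<le> nat \<lfloor>4 * (C3 * \<sigma>)\<rfloor>}"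
        have "\<forall>\<^sub>F k in sequentially. g \<in> K k \<longrightarrow> g = \<one>\<^bsub>\<Lambda>\<^esub>" for g
        proof (cases "g = \<one>\<^bsub>\<Lambda>\<^esub>")
          case False
          then obtain k0 where k0: "g \<notin> K k0" using int by blast
          have "K k \<subseteq> K k0" if "k \<ge> k0" for k using that lift_Suc_antimono_le[of K] dec by blast
          then show ?thesis using k0 by (intro eventually_sequentiallyI[of k0]) blast
        qed simp
        then have "\<forall>\<^sub>F k in sequentially. \<forall>g\<in>?F. g \<in> K k \<longrightarrow> g = \<one>\<^bsub>\<Lambda>\<^esub>"
          by (intro eventually_ball_finite \<Lambda>.finite_wl_ball) auto
        moreover have "\<forall>\<^sub>F k in sequentially. max R1 t2 \<le> t k" using assms(8) unfolding filterlim_at_top by blast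
        ultimately have "\<forall>\<^sub>F k in sequentially. (\<forall>g\<in>?F. g \<in> K k \<longrightarrow> g = \<one>\<^bsub>\<Lambda>\<^esub>) \<and> max R1 t2 \<le> t k"
          by (rule eventually_conj)
        then obtain k where k: "\<And>g. g \<in> ?F \<Longrightarrow> g \<in> K k \<Longrightarrow> g = \<one>\<^bsub>\<Lambda>\<^esub>" "R1 \<le> t k" "t2 \<le> t k"
          using eventually_happens by fastforce
        interpret Q: cayley_quotient \<Lambda> S' "K k" by (rule cq)
        interpret MM: Metric_space "rm_points M" "\<delta>\<Gamma> k" using A.warped_metric[OF wA] .
        \<comment> \<open>Coarse surjectivity provides a vertex whose image is within
          \<open>C\<close> of the good point. The model of the quotient works around every vertex,
          and the model of \<open>M\<close> is recentred at \<open>f k q\<close>.\<close>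
        obtain q where q: "q \<in> carrier (\<Lambda> Mod K k)" "\<delta>\<Gamma> k x0 (f k q) \<le> C" using f x0 by blast
        obtain g0 where g0: "g0 \<in> carrier \<Lambda>" "q = K k #>\<^bsub>\<Lambda>\<^esub> g0" using q(1) by (auto simp: Q.carrier_Mod)
        have inj: "g = \<one>\<^bsub>\<Lambda>\<^esub>" if "g \<in> K k" "real (\<Lambda>.wl g) \<le> 4 * (C3 * \<sigma>)" for g
        proof -
          have "g \<in> carrier \<Lambda>" using that K normal_imp_subgroup subgroup.mem_carrier by metis
          then show ?thesis using k(1)[of g] that by (auto simp: le_nat_floor)
        qed
        have "local_model \<Lambda> T1 C3 \<sigma> (carrier (\<Lambda> Mod K k)) (?d k) q (\<lambda>h. K k #>\<^bsub>\<Lambda>\<^esub> (g0 \<otimes>\<^bsub>\<Lambda>\<^esub> h))"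
          unfolding g0(2) dE by (rule Q.cayley_local_model[OF C3 inj g0(1)])
        then have \<phi>1: "local_model \<Lambda> T1 A0 \<sigma> (carrier (\<Lambda> Mod K k)) (?d k) q (\<lambda>h. K k #>\<^bsub>\<Lambda>\<^esub> (g0 \<otimes>\<^bsub>\<Lambda>\<^esub> h))"
          using Q.Metric_cayley A0(1) unfolding dE by (rule local_model_mono)
        have fq: "f k q \<in> rm_points M" using f q(1) by blast
        obtain \<phi>2 where \<phi>2: "local_model (\<Gamma> \<times>\<times> Zn ?n) T2 A1 \<sigma> (rm_points M) (\<delta>\<Gamma> k) x0 \<phi>2"
          using R1[OF k(2) x0 wA good[OF k(3) x0b]] by blast
        interpret PT: fg_group "\<Gamma> \<times>\<times> Zn ?n" T2 by (rule fgA[OF T2])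
        have one: "\<phi>2 \<one>\<^bsub>\<Gamma> \<times>\<times> Zn ?n\<^esub> \<in> rm_points M"
          by (rule local_modelD(1)[OF \<phi>2 PT.one_closed]) (use \<sigma> in \<open>simp only: PT.wl_one of_nat_0\<close>)
        have \<phi>2': "local_model (\<Gamma> \<times>\<times> Zn ?n) T2 A0 \<sigma> (rm_points M) (\<delta>\<Gamma> k) (f k q) \<phi>2"
          by (rule local_model_recentre[OF \<phi>2 A.warped_metric[OF wA] x0 fq q(2) A1 \<sigma> one A0(2,3)]) (use C in simp)
        have onto: "\<forall>y\<in>rm_points M. \<exists>x\<in>carrier (\<Lambda> Mod K k). \<delta>\<Gamma> k y (f k x) \<le> A0"
          using f A0(4) by (meson order_trans)
        have mc: "Metric_space (carrier (\<Lambda> Mod K k)) (?d k)" unfolding dE by (rule Q.Metric_cayley)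
        show "\<exists>(X :: 'h set set) dX (Y :: 'a set) dY f p \<psi> \<phi>. Metric_space X dX \<and> Metric_space Y dY \<and> f \<in> X \<rightarrow> Y \<and> p \<in> X \<and>
           local_model \<Lambda> T1 A0 \<sigma> X dX p \<psi> \<and> local_model (\<Gamma> \<times>\<times> Zn ?n) T2 A0 \<sigma> Y dY (f p) \<phi> \<and>
           (\<forall>x\<in>X. \<forall>x'\<in>X. \<rho>l (dX x x') \<le> dY (f x) (f x') \<and> dY (f x) (f x') \<le> \<rho>u (dX x x')) \<and>
           (\<forall>y\<in>Y. \<exists>x\<in>X. dY y (f x) \<le> A0)"
          by (rule exI[of _ "carrier (\<Lambda> Mod K k)"], rule exI[of _ "?d k"], rule exI[of _ "rm_points M"], rule exI[of _ "\<delta>\<Gamma> k"],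
              rule exI[of _ "f k"], rule exI[of _ q], rule exI[of _ "\<lambda>h. K k #>\<^bsub>\<Lambda>\<^esub> (g0 \<otimes>\<^bsub>\<Lambda>\<^esub> h)"], rule exI[of _ \<phi>2])
            (intro conjI mc A.warped_metric[OF wA] \<phi>1 \<phi>2' onto q(1); use f in blast)
      qed
    qed
  qed
qed

end
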